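(* Let $\varphi$ be a diffeomorphism of $[0,1]$ onto itself such that $\varphi(0)=0$, and let $w$ be an invertible element of the algebra $C^{(1)}[0,1]$. Let $F\subseteq[0,1]$ be the set of all fixed points of $\varphi$ and let $I$ be the subset of $F$ consisting of the points isolated in $F$. Let $T$ be the weighted composition operator on $C^{(1)}[0,1]$ defined by $$(Tf)(x)=w(x)f(\varphi(x)),\quad f\in C^{(1)}[0,1],\ x\in[0,1],$$ and let $A$ be the weighted composition operator on $C[0,1]$ defined by $$(Ag)(x)=w(x)\varphi'(x)g(\varphi(x)),\quad g\in C[0,1],\ x\in[0,1].$$ Then: (I) $\sigma_i(T)=\sigma_i(A)$ for $i=1,\ldots,5$. (II) $\sigma_i(T)=\sigma(A)$ for $i=3,4,5$. (III) $\sigma(A)\subseteq\sigma(T)$ and $\sigma(T)\setminus\sigma(A)=w(I)\setminus\sigma(A)$. Moreover, if $\lambda\in\sigma(T)\setminus\sigma(A)$, then $\lambda$ is an isolated eigenvalue of $T$ of finite multiplicity.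
   Context: All spaces are over $\mathbb{C}$. $C^{(1)}[0,1]$ is the space of continuously differentiable functions on $[0,1]$ with norm $\|f\|=|f(0)|+\|f'\|_\infty$; $C[0,1]$ has the sup norm. A diffeomorphism of $[0,1]$ is a homeomorphism $\varphi$ of $[0,1]$ onto itself with $\varphi,\varphi^{-1}\in C^{(1)}[0,1]$. For a bounded linear operator $T$ on a Banach space, $\sigma(T)$ is its spectrum. An operator is semi-Fredholm if it has closed range and at least one of its nullity and deficiency is finite. The essential spectra are: $\sigma_1(T)=\{\lambda\in\mathbb{C}:\lambda I-T\text{ is not semi-Fredholm}\}$; $\sigma_2(T)=\sigma_1(T)\cup\{\lambda\in\sigma(T):\lambda I-T\text{ is semi-Fredholm and }\dim\ker(\lambda I-T)=\infty\}$; $\sigma_3(T)=\{\lambda\in\mathbb{C}:\lambda I-T\text{ is not Fredholm}\}$; $\sigma_4(T)=\sigma_3(T)\cup\{\lambda\in\mathbb{C}:\lambda I-T\text{ is Fredholm but }\mathrm{ind}(\lambda I-T)\neq0\}$; $\sigma_5(T)=\sigma(T)\setminus\{\zeta\in\mathbb{C}:$ there is a component $C$ of $\mathbb{C}\setminus\sigma_1(T)$ such that $\zeta\in C$ and $C$ intersects the resolvent set of $T\}$. *)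

theory Defs
  imports "HOL-Analysis.Analysis"
begin

section \<open>Complex normed and Banach spaces\<close>

text \<open>HOL-Analysis only has real normed spaces as type classes. Here they are equipped with a
  compatible multiplication by complex scalars.\<close>

class complex_normed_vector = real_normed_vector +
  fixes scaleC :: "complex \<Rightarrow> 'a \<Rightarrow> 'a" (infixr \<open>*\<^sub>C\<close> 75)
  assumes scaleC_add_right: "c *\<^sub>C (x + y) = c *\<^sub>C x + c *\<^sub>C y"
    and scaleC_add_left: "(c + d) *\<^sub>C x = c *\<^sub>C x + d *\<^sub>C x"
    and scaleC_scaleC: "c *\<^sub>C d *\<^sub>C x = (c * d) *\<^sub>C x"
    and scaleC_one: "1 *\<^sub>C x = x"
    and scaleC_of_real: "complex_of_real r *\<^sub>C x = r *\<^sub>R x"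
    and norm_scaleC: "norm (c *\<^sub>C x) = cmod c * norm x"

class complex_banach = complex_normed_vector + banach

global_interpretation complex_vector: vector_space "scaleC :: complex \<Rightarrow> 'a \<Rightarrow> 'a::complex_normed_vector"
  defines csubspace = complex_vector.subspace
    and cspan = complex_vector.span
    and cdependent = complex_vector.dependent
    and crepresentation = complex_vector.representation
    and cextend_basis = complex_vector.extend_basis
    and cdim = complex_vector.dim
  by unfold_locales (simp_all add: scaleC_add_right scaleC_add_left scaleC_scaleC scaleC_one)

text \<open>The library dimension of an infinite-dimensional space is 0, so nullity and deficiency are
  taken in \<open>enat\<close>.\<close>

definition cdim_enat :: "'a::complex_normed_vector set \<Rightarrow> enat" where
  "cdim_enat S = (if \<exists>B. finite B \<and> S \<subseteq> cspan B then enat (cdim S) else \<infinity>)"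

text \<open>For a subspace \<open>S\<close>, this is the dimension of the quotient of the whole space by \<open>S\<close>:
  \<open>cspan (S \<union> B) = UNIV\<close> says that the cosets of the elements of \<open>B\<close> span that quotient.\<close>

definition ccodim_enat :: "'a::complex_normed_vector set \<Rightarrow> enat" where
  "ccodim_enat S =
    (if \<exists>B. finite B \<and> cspan (S \<union> B) = UNIV
     then enat (LEAST n. \<exists>B. finite B \<and> card B = n \<and> cspan (S \<union> B) = UNIV)
     else \<infinity>)"

lemma ccodim_enat_complement:
  fixes S N :: "'a::complex_normed_vector set"
  assumes S: "csubspace S" and N: "csubspace N"
    and disj: "S \<inter> N = {0}" and sum: "\<And>x. \<exists>s\<in>S. \<exists>n\<in>N. x = s + n"
  shows "ccodim_enat S = cdim_enat N"
proof -
  have spanS: "cspan S = S" and spanN: "cspan N = N"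
    using S N complex_vector.span_eq_iff by blast+
  have key: "\<exists>B'. finite B' \<and> card B' \<le> card B \<and> N \<subseteq> cspan B'"
    if B: "finite B" "cspan (S \<union> B) = UNIV" for B
  proof -
    have "\<forall>b. \<exists>n\<in>N. \<exists>s\<in>S. b = s + n" using sum by blast
    then obtain p where p: "\<And>b. p b \<in> N" "\<And>b. \<exists>s\<in>S. b = s + p b" by metis
    have "N \<subseteq> cspan (p ` B)"
    proof
      fix x assume x: "x \<in> N"
      have "b \<in> cspan (S \<union> p ` B)" if "b \<in> B" for b
        using p(2)[of b] that
        by (metis UnI1 UnI2 complex_vector.span_add complex_vector.span_base imageI)
      moreover have "S \<subseteq> cspan (S \<union> p ` B)"
        using complex_vector.span_superset by blast
      ultimately have "S \<union> B \<subseteq> cspan (S \<union> p ` B)"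
        by blast
      then have "cspan (S \<union> p ` B) = UNIV"
        using B(2) complex_vector.span_minimal[OF _ complex_vector.subspace_span] by blast
      then have "x \<in> cspan (S \<union> p ` B)" by simp
      then obtain s q where sq: "x = s + q" "s \<in> S" "q \<in> cspan (p ` B)"
        unfolding complex_vector.span_Un spanS by blast
      have "q \<in> N"
        using sq(3) complex_vector.span_minimal[OF _ N, of "p ` B"] p(1) by blast
      then have "s \<in> N"
        using x sq(1) complex_vector.subspace_diff[OF N x] by force
      then have "s = 0" using disj sq(2) by blast
      then show "x \<in> cspan (p ` B)" using sq by simp
    qed
    then show ?thesis using B(1) card_image_le by blast
  qed
  have conv: "cspan (S \<union> B) = UNIV" if "cspan B = N" for B
    unfolding complex_vector.span_Un spanS that using sum by blast
  show ?thesis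
  proof (cases "\<exists>B. finite B \<and> N \<subseteq> cspan B")
    case False
    then have "\<not> (\<exists>B. finite B \<and> cspan (S \<union> B) = UNIV)" using key by blast
    then show ?thesis using False by (simp add: ccodim_enat_def cdim_enat_def)
  next
    case True
    then obtain C where C: "finite C" "N \<subseteq> cspan C" by blast
    obtain B where B: "B \<subseteq> N" "\<not> cdependent B" "N \<subseteq> cspan B" "card B = cdim N"
      using complex_vector.basis_exists[of N] by blast
    have finB: "finite B"
      using complex_vector.independent_span_bound[OF C(1) B(2)] B(1) C(2) by blast
    have "cspan B = N"
      using B complex_vector.span_minimal[OF _ N, of B] by blast
    then have B2: "cspan (S \<union> B) = UNIV" by (rule conv)
    have "(LEAST n. \<exists>B. finite B \<and> card B = n \<and> cspan (S \<union> B) = UNIV) = cdim N"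
    proof (rule Least_equality)
      show "\<exists>B. finite B \<and> card B = cdim N \<and> cspan (S \<union> B) = UNIV"
        using finB B(4) B2 by blast
    next
      fix n assume "\<exists>B. finite B \<and> card B = n \<and> cspan (S \<union> B) = UNIV"
      then obtain D where "finite D" "card D = n" "cspan (S \<union> D) = UNIV" by blast
      then obtain D' where D': "finite D'" "card D' \<le> n" "N \<subseteq> cspan D'" using key by blast
      then have "cdim N \<le> card D'" using complex_vector.dim_le_card by blast
      then show "cdim N \<le> n" using D'(2) by simp
    qed
    then show ?thesis using True finB B2 by (auto simp: ccodim_enat_def cdim_enat_def)
  qed
qed


section \<open>Bounded operators, spectrum and essential spectra\<close>

definition bounded_clinear ::
    "('a::complex_normed_vector \<Rightarrow> 'b::complex_normed_vector) \<Rightarrow> bool" where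
  "bounded_clinear T \<longleftrightarrow> bounded_linear T \<and> (\<forall>c x. T (c *\<^sub>C x) = c *\<^sub>C T x)"

definition op_kernel :: "('a::complex_normed_vector \<Rightarrow> 'b::complex_normed_vector) \<Rightarrow> 'a set" where
  "op_kernel T = {x. T x = 0}"

definition nullity :: "('a::complex_normed_vector \<Rightarrow> 'b::complex_normed_vector) \<Rightarrow> enat" where
  "nullity T = cdim_enat (op_kernel T)"

definition deficiency :: "('a::complex_normed_vector \<Rightarrow> 'b::complex_normed_vector) \<Rightarrow> enat" where
  "deficiency T = ccodim_enat (range T)"

definition semi_Fredholm :: "('a::complex_banach \<Rightarrow> 'b::complex_banach) \<Rightarrow> bool" where
  "semi_Fredholm T \<longleftrightarrow>
     bounded_clinear T \<and> closed (range T) \<and> (nullity T < \<infinity> \<or> deficiency T < \<infinity>)"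

definition Fredholm :: "('a::complex_banach \<Rightarrow> 'b::complex_banach) \<Rightarrow> bool" where
  "Fredholm T \<longleftrightarrow>
     bounded_clinear T \<and> closed (range T) \<and> nullity T < \<infinity> \<and> deficiency T < \<infinity>"

text \<open>Only meaningful for Fredholm operators.\<close>

definition Fredholm_index :: "('a::complex_banach \<Rightarrow> 'b::complex_banach) \<Rightarrow> int" where
  "Fredholm_index T = int (the_enat (nullity T)) - int (the_enat (deficiency T))"

text \<open>\<open>shifted \<mu> T\<close> is \<open>\<mu>I - T\<close>.\<close>

definition shifted :: "complex \<Rightarrow> ('a \<Rightarrow> 'a) \<Rightarrow> 'a \<Rightarrow> 'a::complex_normed_vector" where
  "shifted \<mu> T = (\<lambda>x. \<mu> *\<^sub>C x - T x)"

definition resolvent_set :: "('a::complex_banach \<Rightarrow> 'a) \<Rightarrow> complex set" where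
  "resolvent_set T =
     {\<mu>. \<exists>R. bounded_clinear R \<and> R \<circ> shifted \<mu> T = id \<and> shifted \<mu> T \<circ> R = id}"

definition op_spectrum :: "('a::complex_banach \<Rightarrow> 'a) \<Rightarrow> complex set" where
  "op_spectrum T = - resolvent_set T"

definition ess_spectrum1 :: "('a::complex_banach \<Rightarrow> 'a) \<Rightarrow> complex set" where
  "ess_spectrum1 T = {\<mu>. \<not> semi_Fredholm (shifted \<mu> T)}"

definition ess_spectrum2 :: "('a::complex_banach \<Rightarrow> 'a) \<Rightarrow> complex set" where
  "ess_spectrum2 T = ess_spectrum1 T \<union>
     {\<mu> \<in> op_spectrum T. semi_Fredholm (shifted \<mu> T) \<and> nullity (shifted \<mu> T) = \<infinity>}"

definition ess_spectrum3 :: "('a::complex_banach \<Rightarrow> 'a) \<Rightarrow> complex set" where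
  "ess_spectrum3 T = {\<mu>. \<not> Fredholm (shifted \<mu> T)}"

definition ess_spectrum4 :: "('a::complex_banach \<Rightarrow> 'a) \<Rightarrow> complex set" where
  "ess_spectrum4 T = ess_spectrum3 T \<union>
     {\<mu>. Fredholm (shifted \<mu> T) \<and> Fredholm_index (shifted \<mu> T) \<noteq> 0}"

definition ess_spectrum5 :: "('a::complex_banach \<Rightarrow> 'a) \<Rightarrow> complex set" where
  "ess_spectrum5 T = op_spectrum T -
     {\<zeta>. \<exists>C \<in> components (- ess_spectrum1 T). \<zeta> \<in> C \<and> C \<inter> resolvent_set T \<noteq> {}}"

definition eigenvalue :: "('a::complex_normed_vector \<Rightarrow> 'a) \<Rightarrow> complex \<Rightarrow> bool" where
  "eigenvalue T \<mu> \<longleftrightarrow> op_kernel (shifted \<mu> T) \<noteq> {0}"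

text \<open>Algebraic multiplicity: the dimension of the generalized eigenspace. It is at least the
  geometric multiplicity \<open>nullity (shifted \<mu> T)\<close>.\<close>

definition multiplicity_eigenvalue :: "('a::complex_normed_vector \<Rightarrow> 'a) \<Rightarrow> complex \<Rightarrow> enat" where
  "multiplicity_eigenvalue T \<mu> = cdim_enat (\<Union>n. op_kernel (shifted \<mu> T ^^ n))"

text \<open>Isolated means isolated as a point of the spectrum.\<close>

definition isolated_eigenvalue_finite_mult :: "('a::complex_banach \<Rightarrow> 'a) \<Rightarrow> complex \<Rightarrow> bool" where
  "isolated_eigenvalue_finite_mult T \<mu> \<longleftrightarrow>
     \<mu> isolated_in op_spectrum T \<and> eigenvalue T \<mu> \<and> multiplicity_eigenvalue T \<mu> < \<infinity>"


section \<open>The space \<open>C[0,1]\<close>\<close>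

text \<open>A function on \<open>[0,1]\<close> is represented by its extension by 0 to the real line.\<close>

lemma continuous_on_if_Icc:
  "continuous_on {0..1} (\<lambda>x. if x \<in> {0..1} then f x else c) = continuous_on {0..1::real} f"
  by (rule continuous_on_cong) auto

typedef C0_Icc = "{f :: real \<Rightarrow> complex. continuous_on {0..1} f \<and> (\<forall>x. x \<notin> {0..1} \<longrightarrow> f x = 0)}"
  morphisms C0_fun Abs_C0
  by (rule exI[of _ "\<lambda>_. 0"]) simp

setup_lifting type_definition_C0_Icc

lemma continuous_on_C0_fun: "continuous_on {0..1} (C0_fun f)"
  and C0_fun_outside: "x \<notin> {0..1} \<Longrightarrow> C0_fun f x = 0"
  using C0_fun[of f] by auto

lemma C0_eqI: "(\<And>x. x \<in> {0..1} \<Longrightarrow> C0_fun f x = C0_fun g x) \<Longrightarrow> f = g"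
  by (metis C0_fun_inject C0_fun_outside ext)

instantiation C0_Icc :: real_vector
begin
lift_definition zero_C0_Icc :: C0_Icc is "\<lambda>_. 0" by simp
lift_definition plus_C0_Icc :: "C0_Icc \<Rightarrow> C0_Icc \<Rightarrow> C0_Icc" is "\<lambda>f g x. f x + g x"
  by (auto intro!: continuous_intros)
lift_definition minus_C0_Icc :: "C0_Icc \<Rightarrow> C0_Icc \<Rightarrow> C0_Icc" is "\<lambda>f g x. f x - g x"
  by (auto intro!: continuous_intros)
lift_definition uminus_C0_Icc :: "C0_Icc \<Rightarrow> C0_Icc" is "\<lambda>f x. - f x"
  by (auto intro!: continuous_intros)
lift_definition scaleR_C0_Icc :: "real \<Rightarrow> C0_Icc \<Rightarrow> C0_Icc" is "\<lambda>r f x. r *\<^sub>R f x"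
  by (auto intro!: continuous_intros)
instance
  by standard (transfer; auto simp: algebra_simps fun_eq_iff)+
end

lemmas C0_fun_simps [simp] = zero_C0_Icc.rep_eq plus_C0_Icc.rep_eq minus_C0_Icc.rep_eq
  uminus_C0_Icc.rep_eq scaleR_C0_Icc.rep_eq

lemma bdd_above_C0_fun: "bdd_above ((\<lambda>x. cmod (C0_fun f x)) ` {0..1})"
  by (intro bounded_imp_bdd_above compact_imp_bounded compact_continuous_image
      continuous_intros continuous_on_C0_fun) simp

instantiation C0_Icc :: real_normed_vector
begin

definition norm_C0_Icc :: "C0_Icc \<Rightarrow> real" where
  "norm_C0_Icc f = (SUP x\<in>{0..1}. cmod (C0_fun f x))"

definition "dist_C0_Icc f g = norm (f - g)" for f g :: C0_Icc
definition "sgn_C0_Icc f = f /\<^sub>R norm f" for f :: C0_Icc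
definition "uniformity_C0_Icc =
  (INF e\<in>{0<..}. principal {(f, g :: C0_Icc). dist f g < e})"
definition "open_C0_Icc U =
  (\<forall>f\<in>U. eventually (\<lambda>(f', g). f' = f \<longrightarrow> g \<in> U) uniformity)" for U :: "C0_Icc set"

lemma C0_norm_bound: "cmod (C0_fun f x) \<le> norm f"
proof (cases "x \<in> {0..1}")
  case True
  then show ?thesis
    unfolding norm_C0_Icc_def by (intro cSUP_upper bdd_above_C0_fun)
next
  case False
  have "cmod (C0_fun f 0) \<le> norm f"
    unfolding norm_C0_Icc_def by (intro cSUP_upper bdd_above_C0_fun) simp
  with False show ?thesis
    using norm_ge_zero[of "C0_fun f 0"] C0_fun_outside[OF False]
    by (metis norm_zero order_trans)
qed

lemma C0_norm_least: "(\<And>x. x \<in> {0..1} \<Longrightarrow> cmod (C0_fun f x) \<le> b) \<Longrightarrow> norm f \<le> b"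
  unfolding norm_C0_Icc_def by (rule cSUP_least) auto

lemma C0_norm_scale:
  assumes "\<And>x. cmod (C0_fun g x) = a * cmod (C0_fun f x)" "a \<ge> 0"
  shows "norm g = a * norm f"
proof (rule antisym)
  show "norm g \<le> a * norm f"
    by (rule C0_norm_least) (simp add: assms mult_left_mono C0_norm_bound)
  show "a * norm f \<le> norm g"
  proof (cases "a = 0")
    case True
    then show ?thesis
      using C0_norm_bound[of g 0] assms(1)[of 0] by simp
  next
    case False
    have "norm f \<le> norm g / a"
      by (rule C0_norm_least)
        (use False assms C0_norm_bound[of g] in \<open>simp add: field_simps\<close>)
    then show ?thesis using False assms(2) by (simp add: field_simps)
  qed
qed

instance
proof
  fix f g :: C0_Icc and r :: real
  show "(norm f = 0) = (f = 0)"
  proof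
    assume "norm f = 0"
    then have "C0_fun f x = 0" for x using C0_norm_bound[of f x] by simp
    then show "f = 0" by (intro C0_eqI) simp
  next
    assume "f = 0"
    then show "norm f = 0" by (simp add: norm_C0_Icc_def)
  qed
  show "norm (f + g) \<le> norm f + norm g"
    by (rule C0_norm_least)
      (auto intro!: norm_triangle_le add_mono C0_norm_bound)
  show "norm (r *\<^sub>R f) = \<bar>r\<bar> * norm f"
    by (rule C0_norm_scale) auto
qed (simp_all add: dist_C0_Icc_def sgn_C0_Icc_def uniformity_C0_Icc_def open_C0_Icc_def)

end

instantiation C0_Icc :: complex_banach
begin

lift_definition scaleC_C0_Icc :: "complex \<Rightarrow> C0_Icc \<Rightarrow> C0_Icc" is "\<lambda>c f x. c * f x"
  by (auto intro!: continuous_intros)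

instance
proof
  fix f g :: C0_Icc and c d :: complex and r :: real
  show "c *\<^sub>C (f + g) = c *\<^sub>C f + c *\<^sub>C g" "(c + d) *\<^sub>C f = c *\<^sub>C f + d *\<^sub>C f"
    "c *\<^sub>C d *\<^sub>C f = (c * d) *\<^sub>C f" "1 *\<^sub>C f = f" "complex_of_real r *\<^sub>C f = r *\<^sub>R f"
    by (transfer; simp add: algebra_simps scaleR_conv_of_real)+
  show "norm (c *\<^sub>C f) = cmod c * norm f"
    by (rule C0_norm_scale) (auto simp: scaleC_C0_Icc.rep_eq norm_mult)
next
  fix X :: "nat \<Rightarrow> C0_Icc"
  assume "Cauchy X"
  have "uniformly_Cauchy_on {0..1} (\<lambda>n. C0_fun (X n))"
    unfolding uniformly_Cauchy_on_def
  proof (intro allI impI)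
    fix e :: real assume "e > 0"
    then obtain M where M: "\<forall>m\<ge>M. \<forall>n\<ge>M. dist (X m) (X n) < e"
      using \<open>Cauchy X\<close> unfolding Cauchy_def by blast
    have "dist (C0_fun (X m) x) (C0_fun (X n) x) \<le> dist (X m) (X n)" for m n x
      using C0_norm_bound[of "X m - X n" x] by (simp add: dist_norm)
    then show "\<exists>M. \<forall>x\<in>{0..1}. \<forall>m\<ge>M. \<forall>n\<ge>M. dist (C0_fun (X m) x) (C0_fun (X n) x) < e"
      using M by (meson le_less_trans)
  qed
  then obtain l where l: "uniform_limit {0..1} (\<lambda>n. C0_fun (X n)) l sequentially"
    using Cauchy_uniformly_convergent uniformly_convergent_on_def by blast
  have contl: "continuous_on {0..1} l"
    by (rule uniform_limit_theorem[OF _ l]) (auto simp: continuous_on_C0_fun)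
  define L where "L = Abs_C0 (\<lambda>x. if x \<in> {0..1} then l x else 0)"
  have "continuous_on {0..1} (\<lambda>x. if x \<in> {0..1} then l x else 0)"
    using contl by (simp only: continuous_on_if_Icc)
  then have L: "C0_fun L = (\<lambda>x. if x \<in> {0..1} then l x else 0)"
    unfolding L_def by (intro Abs_C0_inverse) auto
  have "X \<longlonglongrightarrow> L"
  proof (rule tendstoI)
    fix e :: real assume "e > 0"
    then have "\<forall>\<^sub>F n in sequentially. \<forall>x\<in>{0..1}. dist (C0_fun (X n) x) (l x) < e / 2"
      using l by (intro uniform_limitD) auto
    then show "\<forall>\<^sub>F n in sequentially. dist (X n) L < e"
    proof eventually_elim
      case (elim n)
      have "norm (X n - L) \<le> e / 2"
        by (rule C0_norm_least) (use elim in \<open>auto simp: L dist_norm intro: less_imp_le\<close>)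
      then show ?case using \<open>e > 0\<close> by (simp add: dist_norm)
    qed
  qed
  then show "convergent X" by (rule convergentI)
qed

end


section \<open>The space \<open>C\<^sup>(\<^sup>1\<^sup>)[0,1]\<close>\<close>

text \<open>The derivative on \<open>[0,1]\<close> (one-sided at the endpoints).\<close>

definition deriv_Icc :: "(real \<Rightarrow> 'a::real_normed_vector) \<Rightarrow> real \<Rightarrow> 'a" where
  "deriv_Icc f x = vector_derivative f (at x within {0..1})"

definition C1_on_Icc :: "(real \<Rightarrow> 'a::real_normed_vector) \<Rightarrow> bool" where
  "C1_on_Icc f \<longleftrightarrow>
     (\<forall>x\<in>{0..1}. f differentiable (at x within {0..1})) \<and> continuous_on {0..1} (deriv_Icc f)"

lemma has_vector_derivative_deriv_Icc:
  "C1_on_Icc f \<Longrightarrow> x \<in> {0..1} \<Longrightarrow> (f has_vector_derivative deriv_Icc f x) (at x within {0..1})"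
  unfolding C1_on_Icc_def deriv_Icc_def using vector_derivative_works by blast

lemma deriv_Icc_eqI:
  "(f has_vector_derivative f') (at x within {0..1}) \<Longrightarrow> x \<in> {0..1} \<Longrightarrow> deriv_Icc f x = f'"
  unfolding deriv_Icc_def using vector_derivative_within_cbox[of 0 1 x f f'] by simp

lemma C1_on_IccI:
  assumes "\<And>x. x \<in> {0..1} \<Longrightarrow> (f has_vector_derivative f' x) (at x within {0..1})"
    and "continuous_on {0..1} f'"
  shows "C1_on_Icc f"
proof -
  have "continuous_on {0..1} (deriv_Icc f)"
    using assms(2) by (rule continuous_on_eq) (metis deriv_Icc_eqI assms(1))
  then show ?thesis
    unfolding C1_on_Icc_def using assms(1) differentiableI_vector by blast
qed

lemma C1_on_Icc_continuous: "C1_on_Icc f \<Longrightarrow> continuous_on {0..1} f"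
  using has_vector_derivative_deriv_Icc has_vector_derivative_continuous
    continuous_on_eq_continuous_within by blast

lemma C1_on_Icc_deriv_continuous: "C1_on_Icc f \<Longrightarrow> continuous_on {0..1} (deriv_Icc f)"
  by (simp add: C1_on_Icc_def)

typedef C1_Icc = "{f :: real \<Rightarrow> complex. C1_on_Icc f \<and> (\<forall>x. x \<notin> {0..1} \<longrightarrow> f x = 0)}"
  morphisms C1_fun Abs_C1
  by (rule exI[of _ "\<lambda>_. 0"]) (auto intro!: C1_on_IccI[where f' = "\<lambda>_. 0"])

setup_lifting type_definition_C1_Icc

lemma C1_on_C1_fun: "C1_on_Icc (C1_fun f)"
  and C1_fun_outside: "x \<notin> {0..1} \<Longrightarrow> C1_fun f x = 0"
  using C1_fun[of f] by auto

lemma C1_eqI: "(\<And>x. x \<in> {0..1} \<Longrightarrow> C1_fun f x = C1_fun g x) \<Longrightarrow> f = g"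
  by (metis C1_fun_inject C1_fun_outside ext)

lemma C1_on_Icc_add:
  fixes f g :: "real \<Rightarrow> complex"
  assumes "C1_on_Icc f" "C1_on_Icc g"
  shows "C1_on_Icc (\<lambda>x. f x + g x)"
proof (rule C1_on_IccI)
  show "((\<lambda>x. f x + g x) has_vector_derivative deriv_Icc f x + deriv_Icc g x)
      (at x within {0..1})" if "x \<in> {0..1}" for x
    by (intro has_vector_derivative_add has_vector_derivative_deriv_Icc assms that)
  show "continuous_on {0..1} (\<lambda>x. deriv_Icc f x + deriv_Icc g x)"
    by (intro continuous_intros C1_on_Icc_deriv_continuous assms)
qed

lemma C1_on_Icc_mult:
  fixes f g :: "real \<Rightarrow> complex"
  assumes "C1_on_Icc f" "C1_on_Icc g"
  shows "C1_on_Icc (\<lambda>x. f x * g x)"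
proof (rule C1_on_IccI)
  show "((\<lambda>x. f x * g x) has_vector_derivative f x * deriv_Icc g x + deriv_Icc f x * g x)
      (at x within {0..1})" if "x \<in> {0..1}" for x
    by (intro has_vector_derivative_mult has_vector_derivative_deriv_Icc assms that)
  show "continuous_on {0..1} (\<lambda>x. f x * deriv_Icc g x + deriv_Icc f x * g x)"
    by (intro continuous_intros C1_on_Icc_deriv_continuous C1_on_Icc_continuous assms)
qed

lemma C1_on_Icc_const: "C1_on_Icc (\<lambda>_. c :: complex)"
  by (rule C1_on_IccI[where f' = "\<lambda>_. 0"]) auto

lemma C1_on_Icc_cong:
  assumes "C1_on_Icc f" "\<And>x. x \<in> {0..1} \<Longrightarrow> g x = f x"
  shows "C1_on_Icc g"
  by (rule C1_on_IccI[OF _ C1_on_Icc_deriv_continuous[OF assms(1)]])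
    (rule has_vector_derivative_transform[OF _ assms(2) has_vector_derivative_deriv_Icc[OF assms(1)]])

text \<open>\<open>C\<^sup>(\<^sup>1\<^sup>)[0,1]\<close> as an algebra, with pointwise operations.\<close>

instantiation C1_Icc :: comm_ring_1
begin
lift_definition zero_C1_Icc :: C1_Icc is "\<lambda>_. 0" by (simp add: C1_on_Icc_const)
lift_definition one_C1_Icc :: C1_Icc is "\<lambda>x. if x \<in> {0..1} then 1 else 0"
  by (auto intro: C1_on_Icc_cong[OF C1_on_Icc_const])
lift_definition plus_C1_Icc :: "C1_Icc \<Rightarrow> C1_Icc \<Rightarrow> C1_Icc" is "\<lambda>f g x. f x + g x"
  by (simp add: C1_on_Icc_add)
lift_definition times_C1_Icc :: "C1_Icc \<Rightarrow> C1_Icc \<Rightarrow> C1_Icc" is "\<lambda>f g x. f x * g x"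
  by (simp add: C1_on_Icc_mult)
lift_definition uminus_C1_Icc :: "C1_Icc \<Rightarrow> C1_Icc" is "\<lambda>f x. - f x"
  using C1_on_Icc_mult[OF C1_on_Icc_const[of "-1"]] by simp
lift_definition minus_C1_Icc :: "C1_Icc \<Rightarrow> C1_Icc \<Rightarrow> C1_Icc" is "\<lambda>f g x. f x - g x"
  using C1_on_Icc_add[OF _ C1_on_Icc_mult[OF C1_on_Icc_const[of "-1"]]] by simp
instance
proof
  show "(0 :: C1_Icc) \<noteq> 1"
    by transfer (auto simp: fun_eq_iff intro: exI[of _ 0])
qed (transfer; auto simp: algebra_simps fun_eq_iff)+
end

instantiation C1_Icc :: real_vector
begin
lift_definition scaleR_C1_Icc :: "real \<Rightarrow> C1_Icc \<Rightarrow> C1_Icc" is "\<lambda>r f x. r *\<^sub>R f x"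
  using C1_on_Icc_mult[OF C1_on_Icc_const] by (simp add: scaleR_conv_of_real)
instance
  by standard (transfer; auto simp: algebra_simps fun_eq_iff)+
end

lift_definition deriv_C1 :: "C1_Icc \<Rightarrow> C0_Icc" is
  "\<lambda>f x. if x \<in> {0..1} then deriv_Icc f x else 0"
  by (auto simp: C1_on_Icc_def continuous_on_if_Icc simp del: atLeastAtMost_iff)

lemmas C1_fun_simps [simp] = zero_C1_Icc.rep_eq plus_C1_Icc.rep_eq minus_C1_Icc.rep_eq
  uminus_C1_Icc.rep_eq scaleR_C1_Icc.rep_eq times_C1_Icc.rep_eq one_C1_Icc.rep_eq

lemma C1_fun_has_deriv:
  "x \<in> {0..1} \<Longrightarrow> (C1_fun f has_vector_derivative C0_fun (deriv_C1 f) x) (at x within {0..1})"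
  by (simp add: deriv_C1.rep_eq has_vector_derivative_deriv_Icc C1_on_C1_fun del: atLeastAtMost_iff)

lemma deriv_C1_eqI:
  assumes "\<And>x. x \<in> {0..1} \<Longrightarrow> (C1_fun f has_vector_derivative C0_fun g x) (at x within {0..1})"
  shows "deriv_C1 f = g"
  by (rule C0_eqI) (simp add: deriv_C1.rep_eq deriv_Icc_eqI assms del: atLeastAtMost_iff)

lemma deriv_C1_add: "deriv_C1 (f + g) = deriv_C1 f + deriv_C1 g"
  by (rule deriv_C1_eqI) (simp only: C1_fun_simps C0_fun_simps has_vector_derivative_add C1_fun_has_deriv)

lemma deriv_C1_diff: "deriv_C1 (f - g) = deriv_C1 f - deriv_C1 g"
  by (rule deriv_C1_eqI) (simp only: C1_fun_simps C0_fun_simps has_vector_derivative_diff C1_fun_has_deriv)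

lemma deriv_C1_scaleR: "deriv_C1 (r *\<^sub>R f) = r *\<^sub>R deriv_C1 f"
  by (rule deriv_C1_eqI)
    (auto intro!: bounded_linear.has_vector_derivative[OF bounded_linear_scaleR_right]
      C1_fun_has_deriv simp del: atLeastAtMost_iff)

instantiation C1_Icc :: real_normed_vector
begin

definition norm_C1_Icc :: "C1_Icc \<Rightarrow> real" where
  "norm_C1_Icc f = cmod (C1_fun f 0) + (SUP x\<in>{0..1}. cmod (deriv_Icc (C1_fun f) x))"

definition "dist_C1_Icc f g = norm (f - g)" for f g :: C1_Icc
definition "sgn_C1_Icc f = f /\<^sub>R norm f" for f :: C1_Icc
definition "uniformity_C1_Icc =
  (INF e\<in>{0<..}. principal {(f, g :: C1_Icc). dist f g < e})"
definition "open_C1_Icc U =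
  (\<forall>f\<in>U. eventually (\<lambda>(f', g). f' = f \<longrightarrow> g \<in> U) uniformity)" for U :: "C1_Icc set"

lemma norm_C1_eq: "norm f = cmod (C1_fun f 0) + norm (deriv_C1 f)"
  unfolding norm_C1_Icc_def norm_C0_Icc_def
  by (auto simp: deriv_C1.rep_eq intro!: SUP_cong)

instance
proof
  fix f g :: C1_Icc and r :: real
  show "(norm f = 0) = (f = 0)"
  proof
    assume "norm f = 0"
    then have "cmod (C1_fun f 0) + norm (deriv_C1 f) = 0" by (simp add: norm_C1_eq)
    then have 0: "C1_fun f 0 = 0" and d: "deriv_C1 f = 0"
      by (simp_all add: add_nonneg_eq_0_iff)
    have "(C1_fun f has_vector_derivative 0) (at x within {0..1})" if "x \<in> {0..1}" for x
      using C1_fun_has_deriv[OF that, of f] by (simp add: d)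
    then obtain c where c: "\<And>x. x \<in> {0..1} \<Longrightarrow> C1_fun f x = c"
      using has_vector_derivative_zero_constant[of "{0..1}" "C1_fun f"] by auto
    have "c = 0" using c[of 0] 0 by simp
    then show "f = 0" using c by (intro C1_eqI) simp
  next
    assume "f = 0"
    moreover have "deriv_C1 0 = 0" by (rule deriv_C1_eqI) simp
    ultimately show "norm f = 0" by (simp add: norm_C1_eq)
  qed
  show "norm (f + g) \<le> norm f + norm g"
    unfolding norm_C1_eq deriv_C1_add
    using norm_triangle_ineq[of "C1_fun f 0" "C1_fun g 0"]
      norm_triangle_ineq[of "deriv_C1 f" "deriv_C1 g"] by simp
  show "norm (r *\<^sub>R f) = \<bar>r\<bar> * norm f"
    by (simp add: norm_C1_eq deriv_C1_scaleR algebra_simps)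
qed (simp_all add: dist_C1_Icc_def sgn_C1_Icc_def uniformity_C1_Icc_def open_C1_Icc_def)

end

instantiation C1_Icc :: complex_banach
begin

lift_definition scaleC_C1_Icc :: "complex \<Rightarrow> C1_Icc \<Rightarrow> C1_Icc" is "\<lambda>c f x. c * f x"
  using C1_on_Icc_mult[OF C1_on_Icc_const] by simp

lemma deriv_C1_scaleC: "deriv_C1 (c *\<^sub>C f) = c *\<^sub>C deriv_C1 f"
  by (rule deriv_C1_eqI)
    (auto intro!: bounded_linear.has_vector_derivative[OF bounded_linear_mult_right]
      C1_fun_has_deriv simp: scaleC_C1_Icc.rep_eq scaleC_C0_Icc.rep_eq simp del: atLeastAtMost_iff)

instance
proof
  fix f g :: C1_Icc and c d :: complex and r :: real
  show "c *\<^sub>C (f + g) = c *\<^sub>C f + c *\<^sub>C g" "(c + d) *\<^sub>C f = c *\<^sub>C f + d *\<^sub>C f"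
    "c *\<^sub>C d *\<^sub>C f = (c * d) *\<^sub>C f" "1 *\<^sub>C f = f" "complex_of_real r *\<^sub>C f = r *\<^sub>R f"
    by (transfer; simp add: algebra_simps scaleR_conv_of_real)+
  show "norm (c *\<^sub>C f) = cmod c * norm f"
    by (simp add: norm_C1_eq deriv_C1_scaleC norm_scaleC scaleC_C1_Icc.rep_eq norm_mult
        algebra_simps)
next
  fix X :: "nat \<Rightarrow> C1_Icc"
  assume X: "Cauchy X"
  have eq: "dist f g = dist (C1_fun f 0) (C1_fun g 0) + dist (deriv_C1 f) (deriv_C1 g)"
    for f g :: C1_Icc
    by (simp add: dist_norm norm_C1_eq deriv_C1_diff)
  have "dist (C1_fun f 0) (C1_fun g 0) \<le> dist f g" "dist (deriv_C1 f) (deriv_C1 g) \<le> dist f g"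
    for f g :: C1_Icc
    by (simp_all add: eq)
  then have "Cauchy (\<lambda>n. C1_fun (X n) 0)" "Cauchy (\<lambda>n. deriv_C1 (X n))"
    using X unfolding Cauchy_def by (meson le_less_trans)+
  then obtain a g where a: "(\<lambda>n. C1_fun (X n) 0) \<longlonglongrightarrow> a" and g: "(\<lambda>n. deriv_C1 (X n)) \<longlonglongrightarrow> g"
    using Cauchy_convergent convergent_def by metis
  define l where "l = (\<lambda>x. a + integral {0..x} (C0_fun g))"
  have l: "(l has_vector_derivative C0_fun g x) (at x within {0..1})" if "x \<in> {0..1}" for x
    unfolding l_def using integral_has_vector_derivative[OF continuous_on_C0_fun that]
    by (auto intro!: derivative_eq_intros)
  have C1l: "C1_on_Icc l"
    by (rule C1_on_IccI[OF l continuous_on_C0_fun])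
  define L where "L = Abs_C1 (\<lambda>x. if x \<in> {0..1} then l x else 0)"
  have L: "C1_fun L = (\<lambda>x. if x \<in> {0..1} then l x else 0)"
    unfolding L_def by (intro Abs_C1_inverse) (auto intro: C1_on_Icc_cong[OF C1l])
  have "deriv_C1 L = g"
    by (rule deriv_C1_eqI) (rule has_vector_derivative_transform[OF _ _ l], auto simp: L)
  moreover have "C1_fun L 0 = a" by (simp add: L l_def)
  ultimately have "(\<lambda>n. dist (X n) L) \<longlonglongrightarrow> 0 + 0"
    using tendsto_add[OF iffD1[OF tendsto_dist_iff a] iffD1[OF tendsto_dist_iff g]]
    by (simp only: eq)
  then have "(\<lambda>n. dist (X n) L) \<longlonglongrightarrow> 0" by (simp only: add_0)
  then have "X \<longlonglongrightarrow> L" by (rule iffD2[OF tendsto_dist_iff])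
  then show "convergent X" by (rule convergentI)
qed

end

definition diffeo_Icc :: "(real \<Rightarrow> real) \<Rightarrow> bool" where
  "diffeo_Icc \<phi> \<longleftrightarrow>
     (\<exists>\<psi>. homeomorphism {0..1} {0..1} \<phi> \<psi> \<and> C1_on_Icc \<phi> \<and> C1_on_Icc \<psi>)"

end

theory Submission
  imports Defs
begin

text \<open>The isomorphism \<open>f \<mapsto> (f(0), f')\<close> turns \<open>\<mu> - T\<close> into \<open>(\<mu> - A) \<oplus> 1\<close> plus an operator that Bernstein
  polynomials approximate by operators of finite rank, so that one-sided inverses of \<open>\<mu> - A\<close> control
  \<open>\<mu> - T\<close>. What happens at \<open>\<mu>\<close> is decided by the weight \<open>a = w \<phi>'\<close> at the fixed points of \<open>\<phi>\<close>.
  If \<open>a p = \<mu>\<close> at some fixed point, or \<open>cmod (a p) = cmod \<mu>\<close> at a boundary point of the fixed point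
  set, there are approximate eigenvectors and almost annihilating functionals with disjoint supports,
  and neither operator is semi-Fredholm. Otherwise consider the gaps of the fixed point set: one whose
  orbits run from \<open>cmod a < cmod \<mu>\<close> to \<open>cmod a > cmod \<mu>\<close> makes both nullities infinite, one with the
  reverse behaviour makes both deficiencies infinite, and in the absence of the one or the other kind
  geometric series along orbits, split by a cutoff function, give a left or a right inverse of
  \<open>\<mu> - A\<close>. If there are no such gaps at all, \<open>\<mu> - A\<close> is invertible and \<open>\<mu> - T\<close> is Fredholm of
  index \<open>0\<close>; a function in its kernel is determined by its values at the fixed points, which satisfy
  \<open>(\<mu> - w p) f p = 0\<close>, and \<open>w p = \<mu>\<close> forces the fixed point \<open>p\<close> to be isolated.\<close>

section \<open>Bounded complex-linear operators\<close>

text \<open>The hypothesis \<phi> 0 = 0 makes \<phi> increasing, so orbits are monotone and end at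
  fixed points in both time directions; products of \<open>a\<close> along an orbit are governed by
  the two limit values. Scaling \<open>w\<close> by \<open>1 / \<mu>\<close> reduces \<mu> \<noteq>
  0 to \<mu> = 1, and at \<mu> = 0 both operators are invertible. Exchanging \<phi> with its inverse
  \<psi> and passing to reciprocal weights turns statements on forward orbits into statements on
  backward orbits. The obstacle for \<open>T\<close> is the lower-order term of the product rule:
  the derivative of \<open>T f\<close> is \<open>A\<close> applied to the derivative of
  \<open>f\<close>, plus the derivative of \<open>w\<close> times f o \<phi>. This term is
  approximable, but it also disturbs the convergence of orbit sums; there it is absorbed because the
  functions involved vanish at the limiting fixed point and are small near it. At a fixed point
  \<open>p\<close> the operator \<open>T\<close> multiplies values by \<open>w p\<close>, whereas
  \<open>A\<close> has the additional factor \<phi>' p. This factor is 1 where fixed points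
  accumulate, so the two can disagree only at isolated fixed points, which is the source of the
  additional eigenvalues.\<close>

lemma bounded_clinearI:
  assumes "\<And>x y. T (x + y) = T x + T y" "\<And>c x. T (c *\<^sub>C x) = c *\<^sub>C T x"
    "\<And>x. norm (T x) \<le> K * norm x"
  shows "bounded_clinear T"
  unfolding bounded_clinear_def
proof (intro conjI allI)
  show "bounded_linear T"
    by (rule bounded_linear_intro[where K = K])
      (auto simp: assms(1) scaleC_of_real[symmetric] assms(2) assms(3) mult.commute)
qed (rule assms(2))

lemma bounded_clinear_bl: "bounded_clinear T \<Longrightarrow> bounded_linear T"
  by (simp add: bounded_clinear_def)

lemma bounded_clinear_scaleC: "bounded_clinear T \<Longrightarrow> T (c *\<^sub>C x) = c *\<^sub>C T x"
  by (simp add: bounded_clinear_def)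

lemma bounded_clinear_add: "bounded_clinear T \<Longrightarrow> T (x + y) = T x + T y"
  by (simp add: bounded_clinear_def linear_simps)

lemma bounded_clinear_diff: "bounded_clinear T \<Longrightarrow> T (x - y) = T x - T y"
  by (simp add: bounded_clinear_def linear_simps)

lemma bounded_clinear_minus: "bounded_clinear T \<Longrightarrow> T (- x) = - T x"
  by (simp add: bounded_clinear_def linear_simps)

lemma bounded_clinear_zero: "bounded_clinear T \<Longrightarrow> T 0 = 0"
  by (simp add: bounded_clinear_def linear_simps)

lemma bounded_clinear_sum: "bounded_clinear T \<Longrightarrow> T (sum f I) = (\<Sum>i\<in>I. T (f i))"
  by (simp add: bounded_clinear_def bounded_linear.linear linear_sum)

lemma bounded_clinear_bound: "bounded_clinear T \<Longrightarrow> \<exists>K>0. \<forall>x. norm (T x) \<le> K * norm x"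
  by (metis bounded_clinear_def bounded_linear.pos_bounded mult.commute)

lemma bounded_clinear_tendsto:
  "bounded_clinear T \<Longrightarrow> (f \<longlongrightarrow> l) F \<Longrightarrow> ((\<lambda>x. T (f x)) \<longlongrightarrow> T l) F"
  by (simp add: bounded_clinear_def bounded_linear.tendsto)

lemma bounded_clinear_continuous: "bounded_clinear T \<Longrightarrow> continuous_on UNIV T"
  by (simp add: bounded_clinear_def linear_continuous_on)

lemmas bounded_clinear_rules = bounded_clinear_scaleC bounded_clinear_add bounded_clinear_diff
  bounded_clinear_minus bounded_clinear_zero bounded_clinear_sum

lemma bounded_clinear_linear: "bounded_clinear T \<Longrightarrow> Vector_Spaces.linear scaleC scaleC T"
  by unfold_locales (simp_all add: bounded_clinear_rules)

lemma bounded_clinear_span_image: "bounded_clinear T \<Longrightarrow> cspan (T ` E) = T ` cspan E"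
  unfolding cspan_def
  by (rule module_hom.span_image, rule Vector_Spaces.linear.axioms(3), rule bounded_clinear_linear)

lemma bounded_clinear_compose:
  "bounded_clinear S \<Longrightarrow> bounded_clinear T \<Longrightarrow> bounded_clinear (\<lambda>x. S (T x))"
  by (simp add: bounded_clinear_def bounded_linear_compose)

lemma bounded_clinear_plus:
  "bounded_clinear S \<Longrightarrow> bounded_clinear T \<Longrightarrow> bounded_clinear (\<lambda>x. S x + T x)"
  by (simp add: bounded_clinear_def bounded_linear_add scaleC_add_right)

lemma scaleC_diff_right: "c *\<^sub>C (x - y) = c *\<^sub>C x - c *\<^sub>C (y::'a::complex_normed_vector)"
  by (rule complex_vector.scale_right_diff_distrib)

lemma bounded_clinear_uminus: "bounded_clinear S \<Longrightarrow> bounded_clinear (\<lambda>x. - S x)"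
  by (simp add: bounded_clinear_def bounded_linear_minus)

lemma bounded_clinear_minus_fun:
  "bounded_clinear S \<Longrightarrow> bounded_clinear T \<Longrightarrow> bounded_clinear (\<lambda>x. S x - T x)"
  by (simp add: bounded_clinear_def bounded_linear_sub scaleC_diff_right)

lemma bounded_clinear_ident: "bounded_clinear (\<lambda>x. x)"
  by (simp add: bounded_clinear_def)

lemma bounded_clinear_scaleC_fun: "bounded_clinear S \<Longrightarrow> bounded_clinear (\<lambda>x. c *\<^sub>C S x)"
proof -
  assume S: "bounded_clinear S"
  obtain K where "\<And>x. norm (S x) \<le> K * norm x" using bounded_clinear_bound[OF S] by blast
  then show ?thesis
    by (intro bounded_clinearI[where K = "cmod c * K"])
      (auto simp: bounded_clinear_rules[OF S] scaleC_add_right scaleC_scaleC norm_scaleC mult.assoc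
        mult.commute[of c] intro!: mult_left_mono)
qed

lemma bounded_clinear_sum_fun:
  "(\<And>i. i \<in> I \<Longrightarrow> bounded_clinear (f i)) \<Longrightarrow> bounded_clinear (\<lambda>x. \<Sum>i\<in>I. f i x)"
  by (induction I rule: infinite_finite_induct)
    (auto simp: bounded_clinear_plus intro: bounded_clinearI[where K = 0])

lemmas bounded_clinear_intros = bounded_clinear_plus
  bounded_clinear_uminus bounded_clinear_minus_fun bounded_clinear_ident
  bounded_clinear_scaleC_fun bounded_clinear_sum_fun

lemma bounded_clinear_range_subspace: "bounded_clinear S \<Longrightarrow> csubspace (range S)"
proof (rule complex_vector.subspaceI)
  assume S: "bounded_clinear S"
  show "0 \<in> range S" using bounded_clinear_zero[OF S] by (metis rangeI)
  show "x + y \<in> range S" if "x \<in> range S" "y \<in> range S" for x y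
    using that by (auto simp: bounded_clinear_add[OF S, symmetric])
  show "c *\<^sub>C x \<in> range S" if "x \<in> range S" for c x
    using that by (auto simp: bounded_clinear_scaleC[OF S, symmetric])
qed

lemma bounded_clinear_kernel_subspace: "bounded_clinear S \<Longrightarrow> csubspace (op_kernel S)"
  by (intro complex_vector.subspaceI) (auto simp: op_kernel_def bounded_clinear_rules)

text \<open>Continuity is not built in: statements that depend on a bound carry it separately, with
  an explicit constant.\<close>

definition cfunctional :: "('a::complex_normed_vector \<Rightarrow> complex) \<Rightarrow> bool" where
  "cfunctional e \<longleftrightarrow> (\<forall>x y. e (x + y) = e x + e y) \<and> (\<forall>c x. e (c *\<^sub>C x) = c * e x)"

lemma cfunctional_zero: "cfunctional e \<Longrightarrow> e 0 = 0"
  unfolding cfunctional_def by (metis complex_vector.scale_zero_left mult_zero_left)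

lemma cfunctional_sum:
  "cfunctional e \<Longrightarrow> e (\<Sum>i\<in>I. c i *\<^sub>C x i) = (\<Sum>i\<in>I. c i * e (x i))"
  by (induction I rule: infinite_finite_induct) (auto simp: cfunctional_zero cfunctional_def)

lemma cfunctional_diff: "cfunctional e \<Longrightarrow> e (x - y) = e x - e y"
  unfolding cfunctional_def by (metis add_diff_cancel diff_add_cancel)

section \<open>Nullity, deficiency and singular systems\<close>

text \<open>An indexed family rather than a set: equal members would merge in a set and hide their
  dependence, so the non-injective case supplies the coefficients 1 and -1 by hand.\<close>

lemma cspan_finite_family_dependent:
  fixes b :: "nat \<Rightarrow> 'a::complex_normed_vector"
  assumes "finite B" "\<And>j. j < n \<Longrightarrow> b j \<in> cspan B" "card B < n"
  obtains c where "\<exists>j<n. c j \<noteq> 0" "(\<Sum>j<n. c j *\<^sub>C b j) = 0"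
proof (cases "inj_on b {..<n}")
  case False
  then obtain i j where ij: "i < n" "j < n" "i \<noteq> j" "b i = b j" by (auto simp: inj_on_def)
  let ?c = "\<lambda>k. (if k = i then 1 else if k = j then -1 else 0) :: complex"
  have "(\<Sum>k<n. ?c k *\<^sub>C b k) = (\<Sum>k\<in>{i,j}. ?c k *\<^sub>C b k)"
    using ij by (intro sum.mono_neutral_right) auto
  also have "\<dots> = 0" using ij by (simp add: scaleC_one)
  finally show ?thesis using ij by (intro that[of ?c]) auto
next
  case True
  have "cdependent (b ` {..<n})"
  proof (rule ccontr)
    assume "\<not> cdependent (b ` {..<n})"
    then have "card (b ` {..<n}) \<le> card B"
      using complex_vector.independent_span_bound[OF assms(1)] assms(2) by auto
    then show False using assms(3) card_image[OF True] by simp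
  qed
  then obtain u where u: "\<exists>v\<in>b ` {..<n}. u v \<noteq> 0" "(\<Sum>v\<in>b ` {..<n}. u v *\<^sub>C v) = 0"
    using complex_vector.dependent_finite[of "b ` {..<n}"] by auto
  then show ?thesis using sum.reindex[OF True, of "\<lambda>v. u v *\<^sub>C v"]
    by (intro that[of "\<lambda>j. u (b j)"]) auto
qed

lemma exists_argmax:
  fixes f :: "nat \<Rightarrow> real"
  assumes "n > 0"
  shows "\<exists>i<n. \<forall>j<n. f j \<le> f i"
proof -
  have "Max (f ` {..<n}) \<in> f ` {..<n}" using assms by (intro Max_in) auto
  then obtain i where "i < n" "Max (f ` {..<n}) = f i" by auto
  then show ?thesis using Max_ge[of "f ` {..<n}"] by (metis finite_imageI finite_lessThan imageI lessThan_iff)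
qed

lemma nullity_finiteD:
  "nullity S < \<infinity> \<Longrightarrow> \<exists>B. finite B \<and> op_kernel S \<subseteq> cspan B"
  by (auto simp: nullity_def cdim_enat_def split: if_splits)

lemma nullity_finiteI: "finite B \<Longrightarrow> op_kernel S \<subseteq> cspan B \<Longrightarrow> nullity S < \<infinity>"
  by (auto simp: nullity_def cdim_enat_def)

lemma deficiency_finiteD:
  "deficiency S < \<infinity> \<Longrightarrow> \<exists>B. finite B \<and> cspan (range S \<union> B) = UNIV"
  by (auto simp: deficiency_def ccodim_enat_def split: if_splits)

lemma deficiency_finiteI: "finite B \<Longrightarrow> cspan (range S \<union> B) = UNIV \<Longrightarrow> deficiency S < \<infinity>"
  by (auto simp: deficiency_def ccodim_enat_def)

lemma deficiency_decompose:
  assumes S: "bounded_clinear S" and B: "cspan (range S \<union> B) = UNIV"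
  obtains x b where "b \<in> cspan B" "y = S x + b"
proof -
  have "cspan (range S) = range S"
    using complex_vector.span_eq_iff bounded_clinear_range_subspace[OF S] by blast
  moreover have "y \<in> cspan (range S \<union> B)" using B by simp
  ultimately obtain s b where "y = s + b" "s \<in> range S" "b \<in> cspan B"
    unfolding complex_vector.span_Un by (simp del: complex_vector.span_eq_iff) blast
  then show ?thesis using that[of b] by auto
qed

text \<open>Kernel vectors with a biorthogonal system of functionals are independent, because the
  i-th functional reads off the i-th coefficient of a relation. So no finite set can span the
  kernel.\<close>

lemma nullity_infiniteI:
  assumes "\<And>n::nat. \<exists>k e. \<forall>i<n. S (k i) = 0 \<and> cfunctional (e i) \<and>
    (\<forall>j<n. e i (k j) = (if i = j then 1 else 0))"
  shows "nullity S = \<infinity>"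
proof (rule ccontr)
  assume "nullity S \<noteq> \<infinity>"
  then obtain B where B: "finite B" "op_kernel S \<subseteq> cspan B"
    using nullity_finiteD[of S] by auto
  define n where "n = Suc (card B)"
  have card: "card B < n" by (simp add: n_def)
  obtain k e where ke: "\<And>i. i < n \<Longrightarrow> S (k i) = 0" "\<And>i. i < n \<Longrightarrow> cfunctional (e i)"
    "\<And>i j. i < n \<Longrightarrow> j < n \<Longrightarrow> e i (k j) = (if i = j then 1 else 0)"
    using assms[of n] by blast
  have "k j \<in> cspan B" if "j < n" for j using ke(1)[OF that] B(2) by (auto simp: op_kernel_def)
  then obtain c where c: "\<exists>j<n. c j \<noteq> 0" "(\<Sum>j<n. c j *\<^sub>C k j) = 0"
    by (rule cspan_finite_family_dependent[OF B(1) _ card])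
  have "c i = 0" if "i < n" for i
  proof -
    have "0 = e i (\<Sum>j<n. c j *\<^sub>C k j)" using c ke(2)[OF that] by (simp add: cfunctional_zero)
    also have "\<dots> = (\<Sum>j<n. c j * e i (k j))" by (rule cfunctional_sum[OF ke(2)[OF that]])
    also have "\<dots> = (\<Sum>j<n. if i = j then c j else 0)"
      by (rule sum.cong) (auto simp: ke(3) that)
    finally show ?thesis using that by simp
  qed
  then show False using c by blast
qed

text \<open>The functionals have to kill only the image of \<open>X0\<close>: the images of
  \<open>E\<close> join the finite set \<open>B\<close>, and with more than that many
  \<open>y j\<close> some combination lies in \<open>S X0\<close>. Linearity of \<open>e\<close> is
  replaced by its values on combinations, since later \<open>e\<close> is an orbit sum whose
  convergence is known only on \<open>X0\<close>.\<close>

lemma deficiency_infiniteI: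
  assumes S: "bounded_clinear S" and X0: "csubspace X0" and E: "finite E"
    and dec: "\<And>x. \<exists>x0\<in>X0. \<exists>z\<in>cspan E. x = x0 + z"
    and ex: "\<And>n::nat. \<exists>y e. \<forall>i<n. (\<forall>x\<in>X0. e i (S x) = (0::complex)) \<and>
      (\<forall>c. e i (\<Sum>j<n. c j *\<^sub>C y j) = c i)"
  shows "deficiency S = \<infinity>"
proof (rule ccontr)
  assume "deficiency S \<noteq> \<infinity>"
  then obtain B where B: "finite B" "cspan (range S \<union> B) = UNIV"
    using deficiency_finiteD[of S] by auto
  define n where "n = Suc (card (S ` E \<union> B))"
  have card: "card (S ` E \<union> B) < n" by (simp add: n_def)
  obtain y and e :: "nat \<Rightarrow> 'b \<Rightarrow> complex"
    where e0: "\<And>i x. i < n \<Longrightarrow> x \<in> X0 \<Longrightarrow> e i (S x) = 0"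
    and ec: "\<And>i c. i < n \<Longrightarrow> e i (\<Sum>j<n. c j *\<^sub>C y j) = c i"
    using ex[of n] by blast
  have "\<exists>x0\<in>X0. \<exists>z\<in>cspan (S ` E \<union> B). y j = S x0 + z" for j
  proof -
    obtain x b where xb: "b \<in> cspan B" "y j = S x + b" by (rule deficiency_decompose[OF S B(2)])
    obtain x0 z where z: "x0 \<in> X0" "z \<in> cspan E" "x = x0 + z" using dec by blast
    have "S z \<in> cspan (S ` E)"
      using z(2) bounded_clinear_span_image[OF S, of E] by blast
    then have "S z + b \<in> cspan (S ` E \<union> B)"
      using xb(1) complex_vector.span_mono[of "S ` E" "S ` E \<union> B"]
        complex_vector.span_mono[of B "S ` E \<union> B"] complex_vector.span_add by blast
    then show ?thesis using z xb by (metis S add.assoc bounded_clinear_add)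
  qed
  then obtain x0 z where z: "\<And>j. x0 j \<in> X0" "\<And>j. z j \<in> cspan (S ` E \<union> B)"
    "\<And>j. y j = S (x0 j) + z j" by metis
  have "finite (S ` E \<union> B)" using E B(1) by simp
  then obtain c where c: "\<exists>j<n. c j \<noteq> 0" "(\<Sum>j<n. c j *\<^sub>C z j) = 0"
    using z(2) by (rule cspan_finite_family_dependent[OF _ _ card])
  have "(\<Sum>j<n. c j *\<^sub>C y j) = S (\<Sum>j<n. c j *\<^sub>C x0 j)"
    by (simp add: z(3) scaleC_add_right sum.distrib c(2) bounded_clinear_rules[OF S])
  moreover have "(\<Sum>j<n. c j *\<^sub>C x0 j) \<in> X0"
    using X0 z(1) by (simp add: complex_vector.subspace_scale complex_vector.subspace_sum)
  ultimately have "c i = 0" if "i < n" for i using ec[OF that, of c] e0[OF that] by simp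
  then show False using c by blast
qed

section \<open>Open mapping theorem and singular systems\<close>

text \<open>The open mapping theorem for \<open>S\<close> onto its closed range, which is complete;
  Baire's theorem is applied to the closures of the images of balls.\<close>

lemma closed_range_bounded_preimage:
  fixes S :: "'a::banach \<Rightarrow> 'b::banach"
  assumes S: "bounded_linear S" and W: "closed (range S)"
  obtains C where "C > 0" "\<And>x. \<exists>x'. S x' = S x \<and> norm x' \<le> C * norm (S x)"
proof -
  interpret S: bounded_linear S by fact
  let ?W = "range S"
  define D where "D n = closure (S ` cball 0 (real n))" for n :: nat
  have DW: "D n \<subseteq> ?W" for n unfolding D_def by (rule closure_minimal[OF _ W]) auto
  have cov: "(\<Union>n. D n) = ?W"
  proof (intro equalityI subsetI)
    fix y assume "y \<in> ?W"
    then obtain x where x: "y = S x" by blast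
    obtain n where "norm x \<le> real n" using real_arch_simple by blast
    then have "y \<in> D n" unfolding D_def x by (intro subsetD[OF closure_subset]) auto
    then show "y \<in> (\<Union>n. D n)" by blast
  qed (use DW in blast)
  have "\<exists>n. top_of_set ?W interior_of D n \<noteq> {}"
  proof (rule ccontr)
    assume neg: "\<not> ?thesis"
    have "top_of_set ?W interior_of \<Union>(range D) = {}"
    proof (rule Baire_category_alt)
      show "completely_metrizable_space (top_of_set ?W) \<or>
          locally_compact_space (top_of_set ?W) \<and> regular_space (top_of_set ?W)"
        using completely_metrizable_space_closedin[OF completely_metrizable_space_euclidean] W
        by (metis closed_closedin)
    next
      fix T assume "T \<in> range D"
      then obtain n where n: "T = D n" by blast
      have "closedin (top_of_set ?W) T"
        using DW[of n] unfolding n by (intro closed_subset) (auto simp: D_def)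
      then show "closedin (top_of_set ?W) T \<and> top_of_set ?W interior_of T = {}" using neg n by blast
    qed simp
    then show False using cov interior_of_topspace[of "top_of_set ?W"] by auto
  qed
  then obtain n y0 where y0: "y0 \<in> top_of_set ?W interior_of D n" by blast
  then obtain U where U: "openin (top_of_set ?W) U" "y0 \<in> U" "U \<subseteq> D n"
    by (auto simp: interior_of_def)
  then obtain r where r: "r > 0" "ball y0 r \<inter> ?W \<subseteq> D n" "y0 \<in> ?W"
    unfolding openin_contains_ball by blast
  define c where "c = 2 * (real n + 1) / r"
  have c: "c > 0" using r(1) by (simp add: c_def)
  have step: "\<exists>x. norm x \<le> c * norm y \<and> norm (y - S x) \<le> norm y / 2" if y: "y \<in> ?W" for y
  proof (cases "y = 0")
    case True
    then show ?thesis by (intro exI[of _ 0]) (simp add: S.zero)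
  next
    case False
    \<comment> \<open>Scales \<open>y\<close> to norm \<open>r / 2\<close>, so that both
      \<open>y0 + t y\<close> and \<open>y0 - t y\<close> remain in the ball about
      \<open>y0\<close>.\<close>
    define t where "t = r / (2 * norm y)"
    have t: "t > 0" using False r(1) by (simp add: t_def)
    have tn: "norm (t *\<^sub>R y) < r" using False r(1) by (simp add: t_def)
    obtain u0 v0 where "y0 = S u0" "y = S v0" using r(3) y by blast
    then have "y0 + t *\<^sub>R y = S (u0 + t *\<^sub>R v0)" "y0 - t *\<^sub>R y = S (u0 - t *\<^sub>R v0)"
      by (simp_all add: S.add S.diff S.scaleR)
    then have "y0 + t *\<^sub>R y \<in> ?W" "y0 - t *\<^sub>R y \<in> ?W" by blast+
    moreover have "y0 + t *\<^sub>R y \<in> ball y0 r" "y0 - t *\<^sub>R y \<in> ball y0 r"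
      using tn by (simp_all add: dist_norm)
    ultimately have "y0 + t *\<^sub>R y \<in> D n" "y0 - t *\<^sub>R y \<in> D n"
      using r(2) by blast+
    then obtain u v where uv: "norm u \<le> n" "norm v \<le> n"
      "dist (S u) (y0 + t *\<^sub>R y) < t * norm y / 2" "dist (S v) (y0 - t *\<^sub>R y) < t * norm y / 2"
    proof -
      have "t * norm y / 2 > 0" using t False by simp
      then obtain a b where "a \<in> S ` cball 0 n" "b \<in> S ` cball 0 n"
        "dist a (y0 + t *\<^sub>R y) < t * norm y / 2" "dist b (y0 - t *\<^sub>R y) < t * norm y / 2"
        using \<open>y0 + t *\<^sub>R y \<in> D n\<close> \<open>y0 - t *\<^sub>R y \<in> D n\<close> unfolding D_def closure_approachable by meson
      then show ?thesis using that by auto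
    qed
    \<comment> \<open>Taking the difference of the two approximations eliminates the unknown centre
      \<open>y0\<close>.\<close>
    let ?x = "(1 / (2 * t)) *\<^sub>R (u - v)"
    have "(2 * t) *\<^sub>R y - S (u - v) = (y0 + t *\<^sub>R y - S u) - (y0 - t *\<^sub>R y - S v)"
      by (simp add: S.diff mult.commute[of 2] flip: scaleR_scaleR) (simp add: scaleR_2 scaleR_add_right)
    also have "norm \<dots> \<le> t * norm y"
      using uv(3,4) norm_triangle_ineq4[of "y0 + t *\<^sub>R y - S u" "y0 - t *\<^sub>R y - S v"]
      by (simp add: dist_norm norm_minus_commute)
    finally have 1: "norm ((2 * t) *\<^sub>R y - S (u - v)) \<le> t * norm y" by simp
    have "y - S ?x = (1 / (2 * t)) *\<^sub>R ((2 * t) *\<^sub>R y - S (u - v))"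
      unfolding S.scaleR using t by (simp add: scaleR_diff_right)
    then have "norm (y - S ?x) = norm ((2 * t) *\<^sub>R y - S (u - v)) / (2 * t)" using t by simp
    also have "\<dots> \<le> norm y / 2" using 1 t by (simp add: field_simps)
    finally have 2: "norm (y - S ?x) \<le> norm y / 2" .
    have "norm (u - v) \<le> 2 * n" using uv(1,2) norm_triangle_ineq4[of u v] by simp
    then have "norm (u - v) / (2 * t) \<le> (2 * n) / (2 * t)" using t by (intro divide_right_mono) auto
    then have "norm ?x \<le> (2 * n) / (2 * t)" using t by simp
    also have "\<dots> \<le> c * norm y" using r(1) False by (simp add: t_def c_def field_simps)
    finally show ?thesis using 2 by blast
  qed
  then obtain G where G: "\<And>y. y \<in> ?W \<Longrightarrow> norm (G y) \<le> c * norm y"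
    "\<And>y. y \<in> ?W \<Longrightarrow> norm (y - S (G y)) \<le> norm y / 2" by metis
  have "\<exists>x'. S x' = S x \<and> norm x' \<le> 2 * c * norm (S x)" for x
  proof -
    \<comment> \<open>Residuals of a successive approximation: each correction \<open>G\<close>
      halves the residual, so the corrections are dominated by a geometric series and sum to an
      exact preimage. The factor 2 in the bound is the sum of the powers of 1/2.\<close>
    define y where "y = rec_nat (S x) (\<lambda>_ y. y - S (G y))"
    have ySuc: "y (Suc k) = y k - S (G (y k))" for k by (simp add: y_def)
    have yW: "y k \<in> ?W" for k
    proof (induction k)
      case (Suc k)
      then obtain z where "y k = S z" by blast
      then have "y (Suc k) = S (z - G (y k))" by (simp add: ySuc S.diff)
      then show ?case by blast
    qed (simp add: y_def)
    have yn: "norm (y k) \<le> norm (S x) * (1/2) ^ k" for k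
    proof (induction k)
      case (Suc k)
      then show ?case using G(2)[OF yW, of k] by (simp add: ySuc)
    qed (simp add: y_def)
    have Gn: "norm (G (y k)) \<le> c * norm (S x) * (1/2) ^ k" for k
    proof -
      have "c * norm (y k) \<le> c * (norm (S x) * (1/2) ^ k)" using yn[of k] c by simp
      then show ?thesis using G(1)[OF yW, of k] by (simp add: mult.assoc)
    qed
    have sm: "summable (\<lambda>k. c * norm (S x) * (1/2) ^ k)" by (intro summable_mult summable_geometric) simp
    have sn: "summable (\<lambda>k. norm (G (y k)))"
      by (rule summable_comparison_test'[OF sm]) (use Gn in auto)
    have sG: "summable (\<lambda>k. G (y k))" by (rule summable_norm_cancel[OF sn])
    have "y \<longlonglongrightarrow> 0"
    proof (rule Lim_null_comparison[OF always_eventually])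
      show "(\<lambda>k. norm (S x) * (1/2) ^ k) \<longlonglongrightarrow> 0"
        using tendsto_mult_right_zero[OF LIMSEQ_realpow_zero[of "1/2::real"]] by simp
    qed (use yn in auto)
    then have "(\<lambda>k. y k - y (Suc k)) sums (y 0 - 0)" by (rule telescope_sums')
    then have "(\<lambda>k. S (G (y k))) sums S x" by (simp add: ySuc y_def)
    moreover have "(\<lambda>k. S (G (y k))) sums S (\<Sum>k. G (y k))"
      by (rule S.sums[OF summable_sums[OF sG]])
    ultimately have "S (\<Sum>k. G (y k)) = S x" using sums_unique2 by blast
    moreover have "norm (\<Sum>k. G (y k)) \<le> (\<Sum>k. c * norm (S x) * (1/2) ^ k)"
      using summable_norm[OF sn] suminf_le[OF Gn sn sm] by linarith
    moreover have "(\<Sum>k. c * norm (S x) * (1/2::real) ^ k) = 2 * c * norm (S x)"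
      by (subst suminf_mult) (auto simp: suminf_geometric intro: summable_geometric)
    ultimately show ?thesis by auto
  qed
  then show ?thesis using c by (intro that[of "2 * c"]) auto
qed

text \<open>Closed range turns almost-kernel vectors into genuine ones: \<open>g i\<close> differs
  from a kernel vector by some \<open>g' i\<close> of norm at most \<open>C * \<epsilon>\<close>. A
  finite-dimensional kernel would force a relation among the \<open>g i - g' i\<close>, and testing
  it at the largest coefficient leaves too small an error.\<close>

lemma singular_system_nullity:
  fixes S :: "'a::complex_banach \<Rightarrow> 'b::complex_banach"
  assumes S: "bounded_clinear S" and cl: "closed (range S)"
    and sing: "\<And>(n::nat) \<epsilon>. \<epsilon> > 0 \<Longrightarrow> \<exists>g e. \<forall>i<n. norm (S (g i)) \<le> \<epsilon> \<and> cfunctional (e i) \<and>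
      (\<forall>x. cmod (e i x) \<le> norm x) \<and> (\<forall>j<n. e i (g j) = (if i = j then 1 else 0))"
  shows "nullity S = \<infinity>"
proof (rule ccontr)
  assume "nullity S \<noteq> \<infinity>"
  then obtain B where B: "finite B" "op_kernel S \<subseteq> cspan B"
    using nullity_finiteD[of S] by auto
  define n where "n = Suc (card B)"
  have card: "card B < n" by (simp add: n_def)
  obtain C where C: "C > 0" "\<And>x. \<exists>x'. S x' = S x \<and> norm x' \<le> C * norm (S x)"
    using closed_range_bounded_preimage[OF bounded_clinear_bl[OF S] cl] by blast
  \<comment> \<open>With this choice the n error terms add up to at most half of the largest
    coefficient.\<close>
  define \<epsilon> where "\<epsilon> = 1 / (2 * n * C)"
  have "real n > 0" by (simp add: n_def)
  then have \<epsilon>: "\<epsilon> > 0" "n * (C * \<epsilon>) = 1/2"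
    using C(1) unfolding \<epsilon>_def by (simp_all del: of_nat_0_less_iff)
  obtain g e where g: "\<And>i. i < n \<Longrightarrow> norm (S (g i)) \<le> \<epsilon>" "\<And>i. i < n \<Longrightarrow> cfunctional (e i)"
    "\<And>i x. i < n \<Longrightarrow> cmod (e i x) \<le> norm x"
    "\<And>i j. i < n \<Longrightarrow> j < n \<Longrightarrow> e i (g j) = (if i = j then 1 else 0)"
    using sing[OF \<epsilon>(1), of n] by blast
  have "\<forall>i. \<exists>x'. S x' = S (g i) \<and> norm x' \<le> C * norm (S (g i))" using C(2) by blast
  then obtain g' where g': "\<And>i. S (g' i) = S (g i)" "\<And>i. norm (g' i) \<le> C * norm (S (g i))"
    unfolding choice_iff by blast
  have "g i - g' i \<in> cspan B" for i
    using B(2) g'(1) by (auto simp: op_kernel_def bounded_clinear_rules[OF S])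
  then obtain c where c: "\<exists>j<n. c j \<noteq> 0" "(\<Sum>j<n. c j *\<^sub>C (g j - g' j)) = 0"
    by (rule cspan_finite_family_dependent[OF B(1) _ card])
  obtain i where i: "i < n" "\<And>j. j < n \<Longrightarrow> cmod (c j) \<le> cmod (c i)"
    using exists_argmax[of n "\<lambda>j. cmod (c j)"] by (auto simp: n_def)
  obtain j where "j < n" "c j \<noteq> 0" using c(1) by blast
  then have pos: "cmod (c i) > 0" using i(2)[of j] zero_less_norm_iff[of "c j"] by linarith
  have e: "cfunctional (e i)" by (rule g(2)[OF i(1)])
  have "0 = e i (\<Sum>j<n. c j *\<^sub>C (g j - g' j))" by (simp add: c(2) cfunctional_zero[OF e])
  also have "\<dots> = (\<Sum>j<n. c j * e i (g j)) - (\<Sum>j<n. c j * e i (g' j))"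
    by (simp add: cfunctional_sum[OF e] cfunctional_diff[OF e] algebra_simps sum_subtractf)
  also have "(\<Sum>j<n. c j * e i (g j)) = (\<Sum>j<n. if i = j then c j else 0)"
    by (rule sum.cong) (auto simp: g(4) i(1))
  also have "\<dots> = c i" using i(1) by simp
  finally have "cmod (c i) = cmod (\<Sum>j<n. c j * e i (g' j))" by simp
  also have "\<dots> \<le> (\<Sum>j<n. cmod (c i) * (C * \<epsilon>))"
  proof (rule order_trans[OF norm_sum], rule sum_mono)
    fix j assume j: "j \<in> {..<n}"
    have "cmod (e i (g' j)) \<le> C * \<epsilon>"
    proof -
      have "C * norm (S (g j)) \<le> C * \<epsilon>" using g(1)[of j] j C(1) by simp
      then show ?thesis using g(3)[OF i(1), of "g' j"] g'(2)[of j] by linarith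
    qed
    then show "norm (c j * e i (g' j)) \<le> cmod (c i) * (C * \<epsilon>)"
      using i(2)[of j] j by (simp add: norm_mult mult_mono)
  qed
  also have "\<dots> = cmod (c i) * (n * (C * \<epsilon>))" by simp
  also have "\<dots> = cmod (c i) / 2" by (simp add: \<epsilon>(2))
  finally show False using pos by simp
qed

text \<open>Dual to the previous lemma: with finite deficiency a nontrivial combination of the
  \<open>y i\<close> lies in the range and has a preimage of controlled norm. The functionals are
  almost zero on its image, although one of them reads off the largest coefficient.\<close>

lemma singular_system_deficiency:
  fixes S :: "'a::complex_banach \<Rightarrow> 'b::complex_banach"
  assumes S: "bounded_clinear S" and cl: "closed (range S)"
    and sing: "\<And>(n::nat) \<epsilon>. \<epsilon> > 0 \<Longrightarrow> \<exists>y e. \<forall>i<n. norm (y i) \<le> b \<and> cfunctional (e i) \<and>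
      (\<forall>x. cmod (e i (S x)) \<le> \<epsilon> * norm x) \<and> (\<forall>j<n. e i (y j) = (if i = j then 1 else 0))"
  shows "deficiency S = \<infinity>"
proof (rule ccontr)
  assume "deficiency S \<noteq> \<infinity>"
  then obtain B where B: "finite B" "cspan (range S \<union> B) = UNIV"
    using deficiency_finiteD[of S] by auto
  define n where "n = Suc (card B)"
  have card: "card B < n" by (simp add: n_def)
  obtain C where C: "C > 0" "\<And>x. \<exists>x'. S x' = S x \<and> norm x' \<le> C * norm (S x)"
    using closed_range_bounded_preimage[OF bounded_clinear_bl[OF S] cl] by blast
  \<comment> \<open>\<open>b\<close> itself may fail to be positive, and \<open>b'\<close> is
    divided by.\<close>
  define b' where "b' = max b 1"
  define \<epsilon> where "\<epsilon> = 1 / (2 * n * C * b')"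
  have b': "b' > 0" "b \<le> b'" by (auto simp: b'_def)
  have "real n > 0" by (simp add: n_def)
  then have \<epsilon>: "\<epsilon> > 0" "\<epsilon> * (C * (n * b')) = 1/2"
    using C(1) b' unfolding \<epsilon>_def by (simp_all del: of_nat_0_less_iff)
  obtain y e where y: "\<And>i. i < n \<Longrightarrow> norm (y i) \<le> b" "\<And>i. i < n \<Longrightarrow> cfunctional (e i)"
    "\<And>i x. i < n \<Longrightarrow> cmod (e i (S x)) \<le> \<epsilon> * norm x"
    "\<And>i j. i < n \<Longrightarrow> j < n \<Longrightarrow> e i (y j) = (if i = j then 1 else 0)"
    using sing[OF \<epsilon>(1), of n] by blast
  have "\<exists>x z. z \<in> cspan B \<and> y j = S x + z" for j
    by (rule deficiency_decompose[OF S B(2)]) blast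
  then obtain x z where z: "\<And>j. z j \<in> cspan B" "\<And>j. y j = S (x j) + z j" by metis
  obtain c where c: "\<exists>j<n. c j \<noteq> 0" "(\<Sum>j<n. c j *\<^sub>C z j) = 0"
    by (rule cspan_finite_family_dependent[OF B(1) z(1) card])
  obtain i where i: "i < n" "\<And>j. j < n \<Longrightarrow> cmod (c j) \<le> cmod (c i)"
    using exists_argmax[of n "\<lambda>j. cmod (c j)"] by (auto simp: n_def)
  obtain j where "j < n" "c j \<noteq> 0" using c(1) by blast
  then have pos: "cmod (c i) > 0" using i(2)[of j] zero_less_norm_iff[of "c j"] by linarith
  have e: "cfunctional (e i)" by (rule y(2)[OF i(1)])
  let ?y = "\<Sum>j<n. c j *\<^sub>C y j"
  have "?y = S (\<Sum>j<n. c j *\<^sub>C x j)"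
    by (simp add: z(2) scaleC_add_right sum.distrib c(2) bounded_clinear_rules[OF S])
  then obtain g where g: "S g = ?y" "norm g \<le> C * norm ?y" using C(2) by metis
  have "norm ?y \<le> (\<Sum>j<n. cmod (c i) * b')"
  proof (rule order_trans[OF norm_sum], rule sum_mono)
    fix j assume "j \<in> {..<n}"
    then show "norm (c j *\<^sub>C y j) \<le> cmod (c i) * b'"
      unfolding norm_scaleC using i(2)[of j] y(1)[of j] b' by (intro mult_mono) auto
  qed
  then have ny: "norm ?y \<le> cmod (c i) * (n * b')" by (simp add: algebra_simps)
  have "e i ?y = (\<Sum>j<n. if i = j then c j else 0)"
    unfolding cfunctional_sum[OF e] by (rule sum.cong) (auto simp: y(4) i(1))
  then have "cmod (c i) = cmod (e i (S g))" using i(1) by (simp add: g(1))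
  also have "\<dots> \<le> \<epsilon> * (C * (cmod (c i) * (n * b')))"
    using y(3)[OF i(1), of g] g(2) ny \<epsilon>(1) C(1)
    by (meson mult_left_mono order_trans less_imp_le)
  also have "\<dots> = cmod (c i) * (\<epsilon> * (C * (n * b')))" by simp
  also have "\<dots> = cmod (c i) / 2" by (simp only: \<epsilon>(2))
  finally show False using pos by simp
qed

section \<open>Approximable perturbations\<close>

text \<open>The inverse comes from the Banach fixed point theorem for the contraction
  \<open>x \<mapsto> y - Q x\<close>; uniqueness of the solution gives additivity and homogeneity at
  once.\<close>

lemma neumann_inverse:
  fixes Q :: "'a::complex_banach \<Rightarrow> 'a"
  assumes Q: "bounded_clinear Q" "\<And>x. norm (Q x) \<le> q * norm x" and q: "0 \<le> q" "q < 1"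
  shows "\<exists>N. bounded_clinear N \<and> (\<forall>x. N (x + Q x) = x) \<and> (\<forall>x. N x + Q (N x) = x)"
proof -
  have "\<exists>!x. y - Q x = x" for y
  proof (rule banach_fix_type[OF q])
    show "\<forall>u v. dist (y - Q u) (y - Q v) \<le> q * dist u v"
    proof (intro allI)
      fix u v
      have "dist (y - Q u) (y - Q v) = norm (Q (v - u))"
        by (simp add: dist_norm bounded_clinear_rules[OF Q(1)])
      then show "dist (y - Q u) (y - Q v) \<le> q * dist u v"
        using Q(2)[of "v - u"] by (simp add: dist_norm norm_minus_commute)
    qed
  qed
  then have ex: "\<exists>!x. x + Q x = y" for y
    by (simp add: algebra_simps eq_commute[of y]) (metis add.commute add_diff_cancel_right' diff_add_cancel)
  define N where "N y = (THE x. x + Q x = y)" for y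
  have N: "N y + Q (N y) = y" for y
    unfolding N_def by (rule theI'[OF ex])
  have Nu: "x = N y" if "x + Q x = y" for x y using ex[of y] that N by blast
  have "bounded_clinear N"
  proof (rule bounded_clinearI[where K = "1 / (1 - q)"])
    fix x y :: 'a and c :: complex
    have "(N x + N y) + Q (N x + N y) = (N x + Q (N x)) + (N y + Q (N y))"
      by (simp add: bounded_clinear_rules[OF Q(1)])
    then show "N (x + y) = N x + N y" using N by (intro Nu[symmetric]) simp
    have "c *\<^sub>C N x + Q (c *\<^sub>C N x) = c *\<^sub>C (N x + Q (N x))"
      by (simp add: bounded_clinear_rules[OF Q(1)] scaleC_add_right)
    then show "N (c *\<^sub>C x) = c *\<^sub>C N x" using N by (intro Nu[symmetric]) simp
    have "norm (N x) \<le> norm x + norm (Q (N x))"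
      using norm_triangle_ineq4[of x "Q (N x)"] N[of x] by (metis add_diff_cancel_right')
    then show "norm (N x) \<le> 1 / (1 - q) * norm x" using Q(2)[of "N x"] q by (simp add: field_simps)
  qed
  moreover have "N (x + Q x) = x" for x using Nu by simp
  ultimately show ?thesis using N by blast
qed

section \<open>Closed subspaces of finite codimension and operators of finite rank\<close>

text \<open>The distance \<open>d\<close> from \<open>x\<close> to \<open>M\<close> controls the
  coefficient of \<open>x\<close>: \<open>cmod k * d\<close> is at most the norm of
  \<open>m + k x\<close>. Hence the coefficients of a convergent sequence are Cauchy, and the parts
  in \<open>M\<close> converge as well.\<close>

lemma closed_cspan_insert:
  fixes M :: "'a::complex_banach set"
  assumes M: "csubspace M" "closed M"
  shows "closed (cspan (insert x M))"
proof (cases "x \<in> M")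
  case True
  then have "cspan (insert x M) = M"
    using complex_vector.span_eq_iff M(1) by (metis insert_absorb)
  then show ?thesis using M by simp
next
  case False
  have spanM: "cspan M = M" using M(1) complex_vector.span_eq_iff by blast
  have "M \<noteq> {}" using M(1) complex_vector.subspace_0 by blast
  define d where "d = infdist x M"
  have d: "d > 0" unfolding d_def
    using False M \<open>M \<noteq> {}\<close> by (simp add: infdist_pos_not_in_closed)
  have est: "cmod k * d \<le> norm (m + k *\<^sub>C x)" if "m \<in> M" for m k
  proof (cases "k = 0")
    case k: False
    have "- (1/k) *\<^sub>C m \<in> M" using M(1) that complex_vector.subspace_scale by blast
    then have "d \<le> dist x (- (1/k) *\<^sub>C m)" unfolding d_def by (rule infdist_le)
    also have "\<dots> = norm ((1/k) *\<^sub>C (m + k *\<^sub>C x))"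
      using k by (simp add: dist_norm scaleC_add_right scaleC_scaleC scaleC_one add.commute)
    also have "\<dots> = norm (m + k *\<^sub>C x) / cmod k" by (simp add: norm_scaleC norm_divide)
    finally show ?thesis using k by (simp add: field_simps)
  qed simp
  show ?thesis
  proof (rule closed_sequential_limits[THEN iffD2], intro allI impI, elim conjE)
    fix y l assume "\<forall>n. y n \<in> cspan (insert x M)" and l: "y \<longlonglongrightarrow> l"
    then have "\<forall>n. \<exists>k. y n - k *\<^sub>C x \<in> M"
      unfolding complex_vector.span_insert spanM by blast
    then obtain k where k: "\<And>n. y n - k n *\<^sub>C x \<in> M" by metis
    have kd: "cmod (k m - k n) * d \<le> norm (y m - y n)" for m n
    proof -
      have "(y m - k m *\<^sub>C x) - (y n - k n *\<^sub>C x) \<in> M"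
        using k M(1) complex_vector.subspace_diff by blast
      from est[OF this, of "k m - k n"] show ?thesis
        by (simp add: complex_vector.scale_left_diff_distrib)
    qed
    have "Cauchy k"
    proof (rule metric_CauchyI)
      fix e :: real assume e: "e > 0"
      obtain N where N: "\<forall>m\<ge>N. \<forall>n\<ge>N. dist (y m) (y n) < e * d"
        using LIMSEQ_imp_Cauchy[OF l] d e unfolding Cauchy_def by (metis mult_pos_pos)
      have "dist (k m) (k n) < e" if "m \<ge> N" "n \<ge> N" for m n
      proof -
        have "cmod (k m - k n) * d < e * d"
          using kd[of m n] N that by (metis dist_norm le_less_trans)
        then show ?thesis using d by (simp add: dist_norm)
      qed
      then show "\<exists>N. \<forall>m\<ge>N. \<forall>n\<ge>N. dist (k m) (k n) < e" by blast
    qed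
    then obtain c where c: "k \<longlonglongrightarrow> c" using Cauchy_convergent convergent_def by metis
    have bl: "bounded_linear (\<lambda>z. z *\<^sub>C x)"
      by (rule bounded_linear_intro[where K = "norm x"])
        (auto simp: scaleC_add_left norm_scaleC scaleC_of_real[symmetric] scaleC_scaleC scaleR_conv_of_real)
    have "(\<lambda>n. y n - k n *\<^sub>C x) \<longlonglongrightarrow> l - c *\<^sub>C x"
      by (intro tendsto_diff l bounded_linear.tendsto[OF bl] c)
    from closed_sequentially[OF M(2) k this] have "l - c *\<^sub>C x \<in> M" .
    then show "l \<in> cspan (insert x M)"
      unfolding complex_vector.span_insert spanM by (intro CollectI exI)
  qed
qed

text \<open>Induction on \<open>E\<close>: if \<open>e\<close> cannot be dropped, some
  \<open>v\<close> in \<open>W\<close> takes its place by exchange, and \<open>M\<close> extended by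
  \<open>v\<close> is still closed and contained in \<open>W\<close>.\<close>

lemma closed_subspace_finite_codim:
  fixes M :: "'a::complex_banach set"
  assumes "finite E" "csubspace M" "closed M" "M \<subseteq> W" "csubspace W" "W \<subseteq> cspan (M \<union> E)"
  shows "closed W"
  using assms
proof (induction E arbitrary: M rule: finite_induct)
  case empty
  have "cspan M = M" using empty(1) complex_vector.span_eq_iff by blast
  then have "W = M" using empty by (simp del: complex_vector.span_eq_iff)
  then show ?case using empty by simp
next
  case (insert e E)
  show ?case
  proof (cases "W \<subseteq> cspan (M \<union> E)")
    case True
    then show ?thesis using insert.IH[OF insert.prems(1-4)] by blast
  next
    case False
    then obtain v where v: "v \<in> W" "v \<notin> cspan (M \<union> E)" by blast
    define M' where "M' = cspan (insert v M)"
    have "v \<in> cspan (insert e (M \<union> E))" using v(1) insert.prems(5) by auto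
    then have e: "e \<in> cspan (insert v (M \<union> E))"
      using v(2) complex_vector.in_span_insert by blast
    have 1: "insert v (M \<union> E) \<subseteq> cspan (M' \<union> E)"
      unfolding M'_def using complex_vector.span_superset
      by (auto intro: complex_vector.span_base)
    then have "cspan (insert v (M \<union> E)) \<subseteq> cspan (M' \<union> E)"
      by (intro complex_vector.span_minimal complex_vector.subspace_span)
    then have "M \<union> insert e E \<subseteq> cspan (M' \<union> E)" using e 1 by auto
    then have "cspan (M \<union> insert e E) \<subseteq> cspan (M' \<union> E)"
      by (intro complex_vector.span_minimal complex_vector.subspace_span)
    moreover have "M' \<subseteq> W" unfolding M'_def
      using insert.prems(3,4) v(1) by (intro complex_vector.span_minimal) auto
    moreover have "closed M'" unfolding M'_def by (rule closed_cspan_insert[OF insert.prems(1,2)])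
    moreover have "csubspace M'" unfolding M'_def by (rule complex_vector.subspace_span)
    ultimately show ?thesis using insert.IH[of M'] insert.prems(4,5) by blast
  qed
qed

lemma closed_op_kernel: "bounded_clinear G \<Longrightarrow> closed (op_kernel G)"
  unfolding op_kernel_def
  by (intro closed_Collect_eq bounded_clinear_continuous continuous_on_const)

definition finite_rank :: "('a::complex_normed_vector \<Rightarrow> 'b::complex_normed_vector) \<Rightarrow> bool" where
  "finite_rank G \<longleftrightarrow> bounded_clinear G \<and> (\<exists>E. finite E \<and> range G \<subseteq> cspan E)"

lemma finite_rankD: "finite_rank G \<Longrightarrow> bounded_clinear G"
  unfolding finite_rank_def by (rule conjunct1)

lemma finite_rank_plus:
  assumes "finite_rank G" "finite_rank H"
  shows "finite_rank (\<lambda>x. G x + H x)"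
proof -
  obtain E E' where E: "finite E" "range G \<subseteq> cspan E" "finite E'" "range H \<subseteq> cspan E'"
    using assms unfolding finite_rank_def by blast
  have "range (\<lambda>x. G x + H x) \<subseteq> cspan (E \<union> E')"
    using E(2,4) complex_vector.span_mono[of E "E \<union> E'"] complex_vector.span_mono[of E' "E \<union> E'"]
    by (auto intro!: complex_vector.span_add)
  then show ?thesis
    using assms E unfolding finite_rank_def by (auto intro: bounded_clinear_plus exI[of _ "E \<union> E'"])
qed

lemma finite_rank_sum:
  assumes "finite I" "\<And>i. i \<in> I \<Longrightarrow> finite_rank (G i)"
  shows "finite_rank (\<lambda>x. \<Sum>i\<in>I. G i x)"
  using assms
proof (induction I rule: finite_induct)
  case empty
  show ?case by (auto simp: finite_rank_def intro!: exI[of _ "{}"] bounded_clinearI[where K = 0])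
qed (auto intro: finite_rank_plus)

lemma finite_rank_compose_right:
  "finite_rank G \<Longrightarrow> bounded_clinear T \<Longrightarrow> finite_rank (\<lambda>x. G (T x))"
  unfolding finite_rank_def by (auto intro: bounded_clinear_compose)

lemma finite_rank_compose_left:
  assumes "finite_rank G" "bounded_clinear T"
  shows "finite_rank (\<lambda>x. T (G x))"
proof -
  obtain E where E: "finite E" "range G \<subseteq> cspan E" using assms unfolding finite_rank_def by blast
  then have "range (\<lambda>x. T (G x)) \<subseteq> cspan (T ` E)"
    unfolding bounded_clinear_span_image[OF assms(2)] by blast
  then show ?thesis
    using assms E(1) unfolding finite_rank_def by (auto intro: bounded_clinear_compose)
qed

lemma finite_rank_cfunctional:
  assumes "cfunctional e" "\<And>x. cmod (e x) \<le> K * norm x"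
  shows "finite_rank (\<lambda>x. e x *\<^sub>C v)"
  unfolding finite_rank_def
proof (intro conjI exI)
  show "bounded_clinear (\<lambda>x. e x *\<^sub>C v)"
  proof (rule bounded_clinearI[where K = "K * norm v"])
    show "norm (e x *\<^sub>C v) \<le> K * norm v * norm x" for x
      using mult_right_mono[OF assms(2)[of x], of "norm v"] by (simp add: norm_scaleC algebra_simps)
  qed (use assms(1) in \<open>auto simp: cfunctional_def scaleC_add_left scaleC_scaleC\<close>)
  show "range (\<lambda>x. e x *\<^sub>C v) \<subseteq> cspan {v}"
    by (auto intro: complex_vector.span_scale complex_vector.span_base)
qed simp

text \<open>The finite set consists of preimages of a basis of the range.\<close>

lemma finite_rank_kernel_complement:
  assumes "finite_rank G"
  obtains E where "finite E" "\<And>x. \<exists>z\<in>cspan E. G (x - z) = 0"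
proof -
  have G: "bounded_clinear G" by (rule finite_rankD[OF assms])
  obtain E0 where E0: "finite E0" "range G \<subseteq> cspan E0" using assms unfolding finite_rank_def by blast
  obtain B where B: "B \<subseteq> range G" "\<not> cdependent B" "range G \<subseteq> cspan B"
    by (rule complex_vector.basis_exists[of "range G"])
  have "B \<subseteq> cspan E0" using B(1) E0(2) by (rule subset_trans)
  then have "finite B"
    using complex_vector.independent_span_bound[OF E0(1) B(2)] by simp
  moreover have "\<forall>b\<in>B. \<exists>x. G x = b" using B(1) by blast
  then obtain g where g: "\<And>b. b \<in> B \<Longrightarrow> G (g b) = b" by metis
  have "\<exists>z\<in>cspan (g ` B). G (x - z) = 0" for x
  proof -
    have "G ` g ` B = B" using g by force
    then have "G x \<in> G ` cspan (g ` B)"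
      using B(3) unfolding bounded_clinear_span_image[OF G, symmetric] by auto
    then show ?thesis by (auto simp: bounded_clinear_rules[OF G])
  qed
  ultimately show ?thesis using that[of "g ` B"] by blast
qed

text \<open>On the kernel of \<open>G\<close> the map \<open>R\<close> is an exact right inverse, so
  the range of \<open>S\<close> contains this closed subspace of finite codimension.\<close>

lemma right_inverse_mod_finite_rank:
  fixes S :: "'a::complex_banach \<Rightarrow> 'b::complex_banach"
  assumes S: "bounded_clinear S" and G: "finite_rank G" and R: "\<And>y. S (R y) = y + G y"
  shows "closed (range S)" "deficiency S < \<infinity>"
proof -
  have Gc: "bounded_clinear G" by (rule finite_rankD[OF G])
  obtain E where E: "finite E" "\<And>x. \<exists>z\<in>cspan E. G (x - z) = 0"
    using finite_rank_kernel_complement[OF G] by blast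
  have KS: "op_kernel G \<subseteq> range S"
  proof
    fix y assume "y \<in> op_kernel G"
    then have "S (R y) = y" by (simp add: R op_kernel_def)
    then show "y \<in> range S" by (metis rangeI)
  qed
  have U: "cspan (op_kernel G \<union> E) = UNIV"
  proof -
    have "x \<in> cspan (op_kernel G \<union> E)" for x
    proof -
      obtain z where z: "z \<in> cspan E" "G (x - z) = 0" using E(2) by blast
      have "(x - z) + z \<in> cspan (op_kernel G \<union> E)"
        using z complex_vector.span_mono[of E "op_kernel G \<union> E"]
        by (intro complex_vector.span_add) (auto simp: op_kernel_def intro: complex_vector.span_base)
      then show ?thesis by simp
    qed
    then show ?thesis by blast
  qed
  show "closed (range S)"
    by (rule closed_subspace_finite_codim[OF E(1) bounded_clinear_kernel_subspace[OF Gc]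
          closed_op_kernel[OF Gc] KS bounded_clinear_range_subspace[OF S]]) (simp add: U)
  have "cspan (range S \<union> E) = UNIV"
    using U complex_vector.span_mono[of "op_kernel G \<union> E" "range S \<union> E"] KS by auto
  then show "deficiency S < \<infinity>" by (rule deficiency_finiteI[OF E(1)])
qed

text \<open>On the kernel of \<open>G\<close>, \<open>L\<close> inverts \<open>S\<close> exactly, so
  the image of that kernel is closed, and the range exceeds it by finitely many dimensions. A vector
  killed by \<open>S\<close> satisfies \<open>x = G (- x)\<close> and hence lies in the range of
  \<open>G\<close>.\<close>

lemma left_inverse_mod_finite_rank:
  fixes S :: "'a::complex_banach \<Rightarrow> 'b::complex_banach"
  assumes S: "bounded_clinear S" and G: "finite_rank G" and L: "bounded_clinear L"
    and LS: "\<And>x. L (S x) = x + G x"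
  shows "closed (range S)" "nullity S < \<infinity>"
proof -
  have Gc: "bounded_clinear G" by (rule finite_rankD[OF G])
  obtain E where E: "finite E" "\<And>x. \<exists>z\<in>cspan E. G (x - z) = 0"
    using finite_rank_kernel_complement[OF G] by blast
  let ?M = "S ` op_kernel G"
  have "closed ?M"
  proof (rule closed_sequential_limits[THEN iffD2], intro allI impI, elim conjE)
    fix y l assume y: "\<forall>n. y n \<in> ?M" and l: "y \<longlonglongrightarrow> l"
    have Ly: "L (y n) \<in> op_kernel G" "S (L (y n)) = y n" for n
      using y[rule_format, of n] by (auto simp: LS op_kernel_def)
    have 1: "(\<lambda>n. L (y n)) \<longlonglongrightarrow> L l" by (rule bounded_clinear_tendsto[OF L l])
    from closed_sequentially[OF closed_op_kernel[OF Gc] Ly(1) this] have "L l \<in> op_kernel G" .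
    moreover have "y \<longlonglongrightarrow> S (L l)" using bounded_clinear_tendsto[OF S 1] Ly(2) by simp
    then have "S (L l) = l" using l LIMSEQ_unique by blast
    ultimately show "l \<in> ?M" by (metis imageI)
  qed
  moreover have "csubspace ?M"
  proof -
    have "cspan ?M = S ` cspan (op_kernel G)" by (rule bounded_clinear_span_image[OF S])
    also have "cspan (op_kernel G) = op_kernel G"
      using bounded_clinear_kernel_subspace[OF Gc] complex_vector.span_eq_iff by blast
    finally show ?thesis using complex_vector.subspace_span[of ?M] by simp
  qed
  moreover have "range S \<subseteq> cspan (?M \<union> S ` E)"
  proof
    fix y assume "y \<in> range S"
    then obtain x where x: "y = S x" by blast
    obtain z where z: "z \<in> cspan E" "G (x - z) = 0" using E(2) by blast
    have "y = S (x - z) + S z" by (simp add: x bounded_clinear_rules[OF S])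
    moreover have "S (x - z) \<in> cspan ?M" using z(2)
      by (auto simp: op_kernel_def intro: complex_vector.span_base)
    moreover have "S z \<in> cspan (S ` E)" unfolding bounded_clinear_span_image[OF S] using z(1) by blast
    ultimately show "y \<in> cspan (?M \<union> S ` E)" unfolding complex_vector.span_Un by blast
  qed
  ultimately show "closed (range S)"
    using closed_subspace_finite_codim[of "S ` E" ?M "range S"] E(1)
      bounded_clinear_range_subspace[OF S] by blast
  obtain E0 where E0: "finite E0" "range G \<subseteq> cspan E0" using G unfolding finite_rank_def by blast
  have "op_kernel S \<subseteq> cspan E0"
  proof
    fix x assume "x \<in> op_kernel S"
    then have "x + G x = 0" using LS[of x] by (simp add: op_kernel_def bounded_clinear_zero[OF L])
    then have "x = G (- x)" by (simp add: bounded_clinear_rules[OF Gc] eq_neg_iff_add_eq_0)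
    then show "x \<in> cspan E0" using E0(2) by (metis rangeI subsetD)
  qed
  then show "nullity S < \<infinity>" by (rule nullity_finiteI[OF E0(1)])
qed

section \<open>Index zero for finite rank perturbations of an invertible operator\<close>

lemma cspan_Int_independent:
  assumes "\<not> cdependent (A \<union> B)" "A \<inter> B = {}" "x \<in> cspan A" "x \<in> cspan B"
  shows "x = 0"
proof -
  have A: "crepresentation (A \<union> B) x = crepresentation A x"
    by (rule complex_vector.representation_extend[OF assms(1,3)]) simp
  have B: "crepresentation (A \<union> B) x = crepresentation B x"
    by (rule complex_vector.representation_extend[OF assms(1,4)]) simp
  have "crepresentation A x b = 0" for b
    using A B assms(2) complex_vector.representation_ne_zero by (metis disjoint_iff)
  then have "(\<Sum>b | crepresentation A x b \<noteq> 0. crepresentation A x b *\<^sub>C b) = 0" by simp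
  moreover have "\<not> cdependent A" using assms(1) complex_vector.independent_mono by blast
  ultimately show ?thesis
    using complex_vector.sum_nonzero_representation_eq[of A x] assms(3) by simp
qed

lemma inj_on_cspanI:
  assumes S: "bounded_clinear S" and "\<And>x. x \<in> cspan A \<Longrightarrow> S x = 0 \<Longrightarrow> x = 0"
  shows "inj_on S (cspan A)"
proof (rule inj_onI)
  fix x y assume "x \<in> cspan A" "y \<in> cspan A" "S x = S y"
  then have "x - y = 0"
    by (intro assms(2) complex_vector.span_diff) (auto simp: bounded_clinear_rules[OF S])
  then show "x = y" by simp
qed

text \<open>Apart from the invertible factor \<open>C\<close> the operator is
  \<open>T = id + G\<close>, and everything happens in the finite-dimensional span \<open>?U\<close>
  of \<open>E\<close>: it is invariant under \<open>T\<close>, contains the kernel, and contains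
  every vector that \<open>T\<close> maps into it. Counting two bases of \<open>?U\<close> gives
  rank-nullity there.\<close>

lemma index_zero_invertible_mod_finite_rank:
  fixes S :: "'a::complex_banach \<Rightarrow> 'b::complex_banach"
  assumes S: "bounded_clinear S" and G: "finite_rank G"
    and C: "bounded_clinear C" and D: "bounded_clinear D" "\<And>x. D (C x) = x" "\<And>y. C (D y) = y"
    and SG: "\<And>x. S x = C (x + G x)"
  shows "Fredholm S" "Fredholm_index S = 0"
proof -
  define T where "T = (\<lambda>x. x + G x)"
  have Gc: "bounded_clinear G" by (rule finite_rankD[OF G])
  have T: "bounded_clinear T" unfolding T_def by (intro bounded_clinear_intros Gc)
  have ST: "S x = C (T x)" for x by (simp add: SG T_def)
  obtain E where E: "finite E" "range G \<subseteq> cspan E" using G unfolding finite_rank_def by blast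
  let ?U = "cspan E"
  have TU: "T x \<in> ?U" if "x \<in> ?U" for x
    unfolding T_def using E(2) that by (auto intro: complex_vector.span_add)
  have UT: "x \<in> ?U" if "T x \<in> ?U" for x
  proof -
    have "T x - G x \<in> ?U" using E(2) that by (auto intro: complex_vector.span_diff)
    then show ?thesis by (simp add: T_def)
  qed
  have kerU: "op_kernel T \<subseteq> ?U"
    using UT complex_vector.span_zero[of E] by (auto simp: op_kernel_def)
  have fin: "finite B" if "\<not> cdependent B" "B \<subseteq> ?U" for B
    using complex_vector.independent_span_bound[OF E(1) that] by simp
  obtain K where K: "K \<subseteq> op_kernel T" "\<not> cdependent K" "op_kernel T \<subseteq> cspan K"
    "card K = cdim (op_kernel T)"
    by (rule complex_vector.basis_exists[of "op_kernel T"])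
  have spK: "cspan K = op_kernel T"
    using K(1,3) complex_vector.span_minimal[OF K(1) bounded_clinear_kernel_subspace[OF T]] by blast
  obtain B where B: "K \<subseteq> B" "B \<subseteq> ?U" "\<not> cdependent B" "?U \<subseteq> cspan B"
    by (rule complex_vector.maximal_independent_subset_extend[OF subset_trans[OF K(1) kerU] K(2)])
  define K' where "K' = B - K"
  have BK: "B = K \<union> K'" "K \<inter> K' = {}" using B(1) by (auto simp: K'_def)
  have spB: "cspan B = ?U"
    using B(2,4) complex_vector.span_minimal[OF B(2) complex_vector.subspace_span] by blast
  have injK': "inj_on T (cspan K')"
  proof (rule inj_on_cspanI[OF T])
    fix x assume "x \<in> cspan K'" "T x = 0"
    then show "x = 0"
      using cspan_Int_independent[of K K' x] BK B(3) spK by (auto simp: op_kernel_def)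
  qed
  have indK': "\<not> cdependent K'" using B(3) BK(1) complex_vector.independent_mono by blast
  have indT: "\<not> cdependent (T ` K')"
    using module_hom.independent_injective_image[OF Vector_Spaces.linear.axioms(3)[OF
      bounded_clinear_linear[OF T]]]
      indK' injK' unfolding cdependent_def cspan_def by blast
  have TK'U: "T ` K' \<subseteq> ?U" using B(2) TU BK(1) by blast
  obtain B' where B': "T ` K' \<subseteq> B'" "B' \<subseteq> ?U" "\<not> cdependent B'" "?U \<subseteq> cspan B'"
    by (rule complex_vector.maximal_independent_subset_extend[OF TK'U indT])
  \<comment> \<open>\<open>N\<close> will span a complement of the range. Both bases of
    \<open>?U\<close> have the same size and \<open>T\<close> is injective on the span of
    \<open>K'\<close>, so \<open>N\<close> has as many elements as the kernel basis
    \<open>K\<close>.\<close>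
  define N where "N = B' - T ` K'"
  have BN: "B' = T ` K' \<union> N" "T ` K' \<inter> N = {}" using B'(1) by (auto simp: N_def)
  have spB': "cspan B' = ?U"
    using B'(2,4) complex_vector.span_minimal[OF B'(2) complex_vector.subspace_span] by blast
  have finB: "finite B" "finite B'" using fin B B' by blast+
  have "card B = card B'"
    using complex_vector.independent_span_bound[OF finB(2) B(3)] complex_vector.independent_span_bound[OF
      finB(1) B'(3)]
      complex_vector.span_superset[of B] complex_vector.span_superset[of B'] spB spB' by fastforce
  moreover have "card (T ` K') = card K'"
    using injK' complex_vector.span_superset[of K'] by (intro card_image) (rule inj_on_subset)
  moreover have "card B = card K + card K'"
    using finB(1) BK by (simp add: card_Un_disjoint)
  moreover have "card B' = card (T ` K') + card N"
    using finB(2) BN by (simp add: card_Un_disjoint)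
  ultimately have cardN: "card N = card K" by simp
  have NU: "cspan N \<subseteq> ?U"
    using B'(2) BN(1) by (intro complex_vector.span_minimal complex_vector.subspace_span) auto
  have spTK': "T u \<in> cspan (T ` K')" if "u \<in> ?U" for u
  proof -
    have "u \<in> cspan (K \<union> K')" using that spB BK(1) by simp
    then obtain a b where "u = a + b" "a \<in> cspan K" "b \<in> cspan K'"
      unfolding complex_vector.span_Un by blast
    then have "T u = T b" using spK by (simp add: op_kernel_def bounded_clinear_rules[OF T])
    then show ?thesis unfolding bounded_clinear_span_image[OF T] using \<open>b \<in> cspan K'\<close> by blast
  qed
  \<comment> \<open>A range element lying in \<open>?U\<close> comes from a vector of
    \<open>?U\<close>, which reduces the intersection to independence inside
    \<open>?U\<close>.\<close>
  have disj: "x = 0" if "x \<in> range T" "x \<in> cspan N" for x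
  proof -
    from that(1) obtain u where u: "x = T u" by blast
    then have "u \<in> ?U" using UT NU that(2) by blast
    then have "x \<in> cspan (T ` K')" using spTK' u by simp
    then show ?thesis using cspan_Int_independent[of "T ` K'" N x] BN B'(3) that(2) by auto
  qed
  have sum: "\<exists>u. \<exists>n\<in>cspan N. x = T u + n" for x
  proof -
    have "- G x \<in> ?U" using E(2) by (auto intro: complex_vector.span_neg)
    then have "- G x \<in> cspan (T ` K' \<union> N)" using spB' BN(1) by simp
    then obtain a n where an: "- G x = a + n" "a \<in> cspan (T ` K')" "n \<in> cspan N"
      unfolding complex_vector.span_Un by blast
    then obtain u where u: "a = T u" unfolding bounded_clinear_span_image[OF T] by blast
    have "x = T x + - G x" by (simp add: T_def)
    then have "x = T (x + u) + n" using an u by (simp add: bounded_clinear_rules[OF T] add.assoc)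
    then show ?thesis using an(3) by blast
  qed
  have kerS: "op_kernel S = op_kernel T"
    using D(2) bounded_clinear_zero[OF C] bounded_clinear_zero[OF D(1)]
    by (auto simp: op_kernel_def ST) metis
  have finK: "finite K" "finite N" using finB BK BN by auto
  have nullS: "nullity S = enat (card K)"
    using finK K by (auto simp: nullity_def kerS cdim_enat_def)
  let ?N = "C ` cspan N"
  have spN: "cspan (C ` N) = ?N" by (rule bounded_clinear_span_image[OF C])
  have injC: "inj_on C A" for A by (metis D(2) inj_on_inverseI)
  have defS: "deficiency S = cdim_enat ?N" unfolding deficiency_def
  proof (rule ccodim_enat_complement)
    show "csubspace (range S)" by (rule bounded_clinear_range_subspace[OF S])
    show "csubspace ?N" unfolding spN[symmetric] by (rule complex_vector.subspace_span)
    show "range S \<inter> ?N = {0}"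
    proof (intro equalityI subsetI)
      fix x assume "x \<in> range S \<inter> ?N"
      then obtain u n where "x = C (T u)" "x = C n" "n \<in> cspan N" unfolding ST by blast
      then have "n = T u" by (metis D(2))
      then have "n = 0" using disj[of n] \<open>n \<in> cspan N\<close> by blast
      then show "x \<in> {0}" using \<open>x = C n\<close> by (simp add: bounded_clinear_zero[OF C])
    next
      fix x :: 'b assume "x \<in> {0}"
      then have "x = S 0" "x = C 0"
        by (simp_all add: bounded_clinear_zero[OF S] bounded_clinear_zero[OF C])
      then show "x \<in> range S \<inter> ?N" using complex_vector.span_zero[of N] by blast
    qed
    fix x
    obtain u n where "n \<in> cspan N" "D x = T u + n" using sum by blast
    then have "x = S u + C n" by (metis D(3) ST bounded_clinear_add[OF C])
    then show "\<exists>s\<in>range S. \<exists>n\<in>?N. x = s + n" using \<open>n \<in> cspan N\<close> by blast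
  qed
  have indN: "\<not> cdependent N" using B'(3) BN(1) complex_vector.independent_mono by blast
  have indCN: "\<not> cdependent (C ` N)"
    using module_hom.independent_injective_image[OF Vector_Spaces.linear.axioms(3)[OF
      bounded_clinear_linear[OF C]]]
      indN injC unfolding cdependent_def cspan_def by blast
  have "cdim ?N = card N"
    using complex_vector.dim_span_eq_card_independent[OF indCN] card_image[OF injC] spN by metis
  then have defS2: "deficiency S = enat (card K)"
    using finK cardN spN unfolding defS cdim_enat_def by (auto intro!: exI[of _ "C ` N"])
  show "Fredholm_index S = 0" by (simp add: Fredholm_index_def nullS defS2)
  have "S (D y) = y + C (G (D y))" for y by (simp add: SG bounded_clinear_rules[OF C] D)
  moreover have "finite_rank (\<lambda>y. C (G (D y)))"
    by (intro finite_rank_compose_left[OF _ C] finite_rank_compose_right[OF G D(1)])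
  ultimately have "closed (range S)" using right_inverse_mod_finite_rank(1)[OF S] by blast
  then show "Fredholm S" using S by (simp add: Fredholm_def nullS defS2)
qed

section \<open>Perturbation by norm limits of finite rank operators\<close>

text \<open>The norm closure of the finite rank operators. It takes the place of compactness and
  reduces perturbation theory to a Neumann series and linear algebra.\<close>

definition approximable :: "('a::complex_normed_vector \<Rightarrow> 'b::complex_normed_vector) \<Rightarrow> bool" where
  "approximable K \<longleftrightarrow> bounded_clinear K \<and>
    (\<forall>\<epsilon>>0. \<exists>G. finite_rank G \<and> (\<forall>x. norm (K x - G x) \<le> \<epsilon> * norm x))"

lemma approximableD: "approximable K \<Longrightarrow> bounded_clinear K"
  unfolding approximable_def by (rule conjunct1)

text \<open>With \<open>H\<close> a one-sided inverse, the factor 1/2 on either side of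
  \<open>H\<close> makes \<open>neumann_inverse\<close> applicable to the part of \<open>K\<close>
  left after removing \<open>G\<close>.\<close>

lemma approximable_split:
  assumes K: "approximable K" and H: "bounded_clinear H"
  obtains G where "finite_rank G" "\<And>x. norm (K (H x) - G (H x)) \<le> 1/2 * norm x"
    "\<And>x. norm (H (K x - G x)) \<le> 1/2 * norm x"
proof -
  obtain M where M: "M > 0" "\<And>x. norm (H x) \<le> M * norm x" using bounded_clinear_bound[OF H] by blast
  then obtain G where G: "finite_rank G" "\<And>x. norm (K x - G x) \<le> 1/(2*M) * norm x"
    using K unfolding approximable_def
    by (metis divide_pos_pos mult_pos_pos zero_less_numeral zero_less_one)
  have "norm (K (H x) - G (H x)) \<le> 1/2 * norm x" for x
    using order_trans[OF G(2)[of "H x"] mult_left_mono[OF M(2)[of x], of "1/(2*M)"]] M(1) by simp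
  moreover have "norm (H (K x - G x)) \<le> 1/2 * norm x" for x
    using order_trans[OF M(2)[of "K x - G x"] mult_left_mono[OF G(2)[of x], of M]] M(1) by simp
  ultimately show ?thesis using that[OF G(1)] by blast
qed

text \<open>After splitting off the finite rank part \<open>G\<close>, composition with
  \<open>R\<close> turns \<open>B + (K - G)\<close> into the identity plus a contraction. If
  \<open>N\<close> inverts that, \<open>R N\<close> is a right inverse of \<open>B + K\<close> up to
  finite rank.\<close>

lemma right_invertible_perturbation:
  fixes B :: "'a::complex_banach \<Rightarrow> 'b::complex_banach"
  assumes B: "bounded_clinear B" and R: "bounded_clinear R" "\<And>y. B (R y) = y" and K: "approximable K"
  shows "closed (range (\<lambda>x. B x + K x))" "deficiency (\<lambda>x. B x + K x) < \<infinity>"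
proof -
  obtain G where G: "finite_rank G" "\<And>x. norm (K (R x) - G (R x)) \<le> 1/2 * norm x"
    by (rule approximable_split[OF K R(1)], rule that)
  have Kc: "bounded_clinear K" and Gc: "bounded_clinear G"
    by (rule approximableD[OF K], rule finite_rankD[OF G(1)])
  have "bounded_clinear (\<lambda>x. K (R x) - G (R x))"
    by (rule bounded_clinear_minus_fun[OF bounded_clinear_compose[OF Kc R(1)] bounded_clinear_compose[OF Gc
      R(1)]])
  then obtain N where N: "bounded_clinear N" "\<And>x. N x + (K (R (N x)) - G (R (N x))) = x"
    using neumann_inverse[OF _ G(2)] by auto
  have S: "bounded_clinear (\<lambda>x. B x + K x)" by (intro bounded_clinear_plus B Kc)
  have GR: "finite_rank (\<lambda>x. G (R (N x)))"
    by (rule finite_rank_compose_right[OF G(1) bounded_clinear_compose[OF R(1) N(1)]])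
  have "B (R (N y)) + K (R (N y)) = y + G (R (N y))" for y
    using N(2)[of y] by (simp add: R algebra_simps)
  from right_inverse_mod_finite_rank[OF S GR, of "\<lambda>y. R (N y)", OF this]
  show "closed (range (\<lambda>x. B x + K x))" "deficiency (\<lambda>x. B x + K x) < \<infinity>" by blast+
qed

text \<open>Here the contraction arises by composing with \<open>L\<close> on the left, and
  \<open>N L\<close> inverts \<open>B + K\<close> from the left up to finite rank.\<close>

lemma left_invertible_perturbation:
  fixes B :: "'a::complex_banach \<Rightarrow> 'b::complex_banach"
  assumes B: "bounded_clinear B" and L: "bounded_clinear L" "\<And>x. L (B x) = x" and K: "approximable K"
  shows "closed (range (\<lambda>x. B x + K x))" "nullity (\<lambda>x. B x + K x) < \<infinity>"
proof -
  obtain G where G: "finite_rank G" "\<And>x. norm (L (K x - G x)) \<le> 1/2 * norm x"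
    by (rule approximable_split[OF K L(1)], rule that)
  have Kc: "bounded_clinear K" and Gc: "bounded_clinear G"
    by (rule approximableD[OF K], rule finite_rankD[OF G(1)])
  have "bounded_clinear (\<lambda>x. L (K x - G x))"
    by (rule bounded_clinear_compose[OF L(1) bounded_clinear_minus_fun[OF Kc Gc]])
  then obtain N where N: "bounded_clinear N" "\<And>x. N (x + L (K x - G x)) = x"
    using neumann_inverse[OF _ G(2)] by auto
  have S: "bounded_clinear (\<lambda>x. B x + K x)" by (intro bounded_clinear_plus B Kc)
  have NL: "bounded_clinear (\<lambda>x. N (L x))" by (rule bounded_clinear_compose[OF N(1) L(1)])
  have "N (L (B x + K x)) = x + N (L (G x))" for x
  proof -
    have "L (B x + K x) = (x + L (K x - G x)) + L (G x)"
      by (simp add: bounded_clinear_rules[OF L(1)] L(2))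
    then show ?thesis by (simp only: bounded_clinear_add[OF N(1), of "x + L (K x - G x)"] N(2))
  qed
  from left_inverse_mod_finite_rank[OF S finite_rank_compose_left[OF G(1) NL] NL this]
  show "closed (range (\<lambda>x. B x + K x))" "nullity (\<lambda>x. B x + K x) < \<infinity>" by blast+
qed

text \<open>The operator \<open>C = B + (K - G)\<close> is \<open>B\<close> times the identity plus
  a contraction, hence invertible; factoring it out of \<open>B + K\<close> leaves the identity plus
  finite rank.\<close>

lemma invertible_perturbation:
  fixes B :: "'a::complex_banach \<Rightarrow> 'b::complex_banach"
  assumes B: "bounded_clinear B" and L: "bounded_clinear L" "\<And>x. L (B x) = x" "\<And>y. B (L y) = y"
    and K: "approximable K"
  shows "Fredholm (\<lambda>x. B x + K x)" "Fredholm_index (\<lambda>x. B x + K x) = 0"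
proof -
  obtain G where G: "finite_rank G" "\<And>x. norm (L (K x - G x)) \<le> 1/2 * norm x"
    by (rule approximable_split[OF K L(1)], rule that)
  have Kc: "bounded_clinear K" and Gc: "bounded_clinear G"
    by (rule approximableD[OF K], rule finite_rankD[OF G(1)])
  have "bounded_clinear (\<lambda>x. L (K x - G x))"
    by (rule bounded_clinear_compose[OF L(1) bounded_clinear_minus_fun[OF Kc Gc]])
  then obtain N where N: "bounded_clinear N" "\<And>x. N (x + L (K x - G x)) = x"
    "\<And>x. N x + L (K (N x) - G (N x)) = x"
    using neumann_inverse[OF _ G(2)] by auto
  define C where "C = (\<lambda>x. B x + (K x - G x))"
  have C: "bounded_clinear C" unfolding C_def by (intro bounded_clinear_intros B Kc Gc)
  have Cx: "C x = B (x + L (K x - G x))" for x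
    by (simp add: C_def bounded_clinear_add[OF B] L(3))
  have S: "bounded_clinear (\<lambda>x. B x + K x)" by (intro bounded_clinear_plus B Kc)
  have NL: "bounded_clinear (\<lambda>x. N (L x))" by (rule bounded_clinear_compose[OF N(1) L(1)])
  have DC: "N (L (C x)) = x" "C (N (L y)) = y" for x y
    unfolding Cx by (simp_all add: L N)
  have "B x + K x = C (x + N (L (G x)))" for x
    by (simp add: bounded_clinear_add[OF C] DC) (simp add: C_def)
  from index_zero_invertible_mod_finite_rank[OF S finite_rank_compose_left[OF G(1) NL] C NL DC this]
  show "Fredholm (\<lambda>x. B x + K x)" "Fredholm_index (\<lambda>x. B x + K x) = 0" by blast+
qed

lemma open_resolvent_set:
  fixes T :: "'a::complex_banach \<Rightarrow> 'a"
  shows "open (resolvent_set T)"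
proof (rule openI)
  fix \<mu> assume "\<mu> \<in> resolvent_set T"
  then obtain R where R: "bounded_clinear R" "\<And>x. R (\<mu> *\<^sub>C x - T x) = x" "\<And>x. \<mu> *\<^sub>C R x - T (R x) = x"
    by (auto simp: resolvent_set_def shifted_def o_def fun_eq_iff)
  obtain M where M: "M > 0" "\<And>x. norm (R x) \<le> M * norm x" using bounded_clinear_bound[OF R(1)] by blast
  have "\<nu> \<in> resolvent_set T" if "dist \<mu> \<nu> < 1 / (2 * M)" for \<nu>
  proof -
    define \<delta> where "\<delta> = \<nu> - \<mu>"
    have "norm (\<delta> *\<^sub>C R x) \<le> 1/2 * norm x" for x
    proof -
      have "cmod \<delta> * norm (R x) \<le> 1/(2*M) * (M * norm x)"
        using that M by (intro mult_mono) (auto simp: \<delta>_def dist_norm norm_minus_commute)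
      then show ?thesis using M(1) by (simp add: norm_scaleC)
    qed
    then obtain N where N: "bounded_clinear N" "\<And>x. N (x + \<delta> *\<^sub>C R x) = x" "\<And>x. N x + \<delta> *\<^sub>C R (N x) = x"
      using neumann_inverse[OF bounded_clinear_scaleC_fun[OF R(1)], of \<delta> "1/2"] by auto
    have 1: "\<nu> *\<^sub>C R x - T (R x) = x + \<delta> *\<^sub>C R x" for x
      using R(3)[of x] by (simp add: \<delta>_def complex_vector.scale_left_diff_distrib algebra_simps)
    \<comment> \<open>\<open>R\<close> commutes with \<open>1 + \<delta> R\<close> and hence with
      its inverse, so a single operator serves on both sides.\<close>
    have RN: "R (N x) = N (R x)" for x
    proof -
      have "R x = R (N x) + \<delta> *\<^sub>C R (R (N x))"
        using N(3)[of x] by (metis R(1) bounded_clinear_add bounded_clinear_scaleC)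
      then show ?thesis by (metis N(2))
    qed
    have 2: "R (\<nu> *\<^sub>C x - T x) = x + \<delta> *\<^sub>C R x" for x
    proof -
      have "\<nu> *\<^sub>C x - T x = (\<mu> *\<^sub>C x - T x) + \<delta> *\<^sub>C x"
        by (simp add: \<delta>_def complex_vector.scale_left_diff_distrib)
      then show ?thesis by (simp only: bounded_clinear_add[OF R(1)] R(2) bounded_clinear_scaleC[OF R(1)])
    qed
    have "bounded_clinear (\<lambda>x. R (N x))" by (rule bounded_clinear_compose[OF R(1) N(1)])
    moreover have "(\<lambda>x. R (N x)) \<circ> shifted \<nu> T = id" by (auto simp: shifted_def RN 2 N)
    moreover have "shifted \<nu> T \<circ> (\<lambda>x. R (N x)) = id" by (auto simp: shifted_def 1 N)
    ultimately show ?thesis unfolding resolvent_set_def by blast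
  qed
  then show "\<exists>e>0. ball \<mu> e \<subseteq> resolvent_set T"
    using M(1) by (intro exI[of _ "1/(2*M)"]) auto
qed

section \<open>Functions on the unit interval\<close>

declare scaleC_C0_Icc.rep_eq [simp] scaleC_C1_Icc.rep_eq [simp]

definition mk_C0 :: "(real \<Rightarrow> complex) \<Rightarrow> C0_Icc" where
  "mk_C0 f = Abs_C0 (\<lambda>x. if x \<in> {0..1} then f x else 0)"

lemma C0_fun_mk_C0:
  assumes "continuous_on {0..1} f" "x \<in> {0..1}"
  shows "C0_fun (mk_C0 f) x = f x"
  using assms(2) Abs_C0_inverse[of "\<lambda>x. if x \<in> {0..1} then f x else 0"] assms(1)
  by (simp add: mk_C0_def continuous_on_if_Icc del: atLeastAtMost_iff)

definition mk_C1 :: "(real \<Rightarrow> complex) \<Rightarrow> C1_Icc" where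
  "mk_C1 f = Abs_C1 (\<lambda>x. if x \<in> {0..1} then f x else 0)"

lemma C1_fun_mk_C1:
  assumes "C1_on_Icc f" "x \<in> {0..1}"
  shows "C1_fun (mk_C1 f) x = f x"
proof -
  have "C1_on_Icc (\<lambda>x. if x \<in> {0..1} then f x else 0)"
    by (rule C1_on_Icc_cong[OF assms(1)]) simp
  then show ?thesis using assms(2) Abs_C1_inverse[of "\<lambda>x. if x \<in> {0..1} then f x else 0"]
    by (simp add: mk_C1_def del: atLeastAtMost_iff)
qed

lemma deriv_mk_C1:
  assumes "\<And>x. x \<in> {0..1} \<Longrightarrow> (f has_vector_derivative f' x) (at x within {0..1})"
    and "continuous_on {0..1} f'" "x \<in> {0..1}"
  shows "C0_fun (deriv_C1 (mk_C1 f)) x = f' x"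
proof -
  have C1: "C1_on_Icc f" by (rule C1_on_IccI[OF assms(1,2)])
  have "deriv_Icc (C1_fun (mk_C1 f)) x = f' x"
    by (rule deriv_Icc_eqI[OF has_vector_derivative_transform[OF assms(3) C1_fun_mk_C1[OF C1] assms(1)]])
      (use assms(3) in auto)
  then show ?thesis using assms(3) by (simp add: deriv_C1.rep_eq)
qed

lemma continuous_on_C1_fun: "continuous_on {0..1} (C1_fun f)"
  by (rule C1_on_Icc_continuous[OF C1_on_C1_fun])

lemma C0_fun_sum: "C0_fun (\<Sum>i\<in>I. f i) x = (\<Sum>i\<in>I. C0_fun (f i) x)"
  by (induction I rule: infinite_finite_induct) auto

lemma C0_functional: "cfunctional (\<lambda>f. C0_fun f x)"
  by (simp add: cfunctional_def)

lemma C1_functional: "cfunctional (\<lambda>f. C1_fun f x)"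
  by (simp add: cfunctional_def)

lemma C1_lipschitz:
  assumes "x \<in> {0..1}" "y \<in> {0..1}"
  shows "cmod (C1_fun f x - C1_fun f y) \<le> norm (deriv_C1 f) * \<bar>x - y\<bar>"
proof -
  have "norm (C1_fun f x - C1_fun f y) \<le> norm (deriv_C1 f) * norm (x - y)"
  proof (rule differentiable_bound[of "{0..1}"])
    fix z :: real assume z: "z \<in> {0..1}"
    show "(C1_fun f has_derivative (\<lambda>h. h *\<^sub>R C0_fun (deriv_C1 f) z)) (at z within {0..1})"
      using C1_fun_has_deriv[OF z, of f] by (simp add: has_vector_derivative_def)
    show "onorm (\<lambda>h. h *\<^sub>R C0_fun (deriv_C1 f) z) \<le> norm (deriv_C1 f)"
      by (rule onorm_bound) (auto simp: mult.commute intro!: mult_left_mono C0_norm_bound)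
  qed (use assms in auto)
  then show ?thesis by simp
qed

lemma C1_norm_bound: "cmod (C1_fun f x) \<le> norm f"
proof (cases "x \<in> {0..1}")
  case True
  have "cmod (C1_fun f x) \<le> cmod (C1_fun f 0) + cmod (C1_fun f x - C1_fun f 0)"
    by (metis norm_triangle_sub)
  also have "\<dots> \<le> cmod (C1_fun f 0) + norm (deriv_C1 f) * \<bar>x - 0\<bar>"
    using C1_lipschitz[OF True, of 0 f] by simp
  also have "\<dots> \<le> norm f"
    unfolding norm_C1_eq using True mult_left_le[of x "norm (deriv_C1 f)"] by simp
  finally show ?thesis .
next
  case False
  then show ?thesis by (simp add: C1_fun_outside)
qed

lemma norm_deriv_C1: "norm (deriv_C1 f) \<le> norm f"
  by (simp add: norm_C1_eq)

lemma bounded_clinear_deriv_C1: "bounded_clinear deriv_C1"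
  by (rule bounded_clinearI[where K = 1]) (auto simp: deriv_C1_add deriv_C1_scaleC norm_deriv_C1)

definition primitive_C0 :: "C0_Icc \<Rightarrow> C1_Icc" where
  "primitive_C0 g = mk_C1 (\<lambda>x. integral {0..x} (C0_fun g))"

lemma primitive_has_derivative:
  "x \<in> {0..1} \<Longrightarrow>
    ((\<lambda>x. integral {0..x} (C0_fun g)) has_vector_derivative C0_fun g x) (at x within {0..1})"
  by (rule integral_has_vector_derivative[OF continuous_on_C0_fun])

lemma C1_fun_primitive: "x \<in> {0..1} \<Longrightarrow> C1_fun (primitive_C0 g) x = integral {0..x} (C0_fun g)"
  unfolding primitive_C0_def
  by (rule C1_fun_mk_C1[OF C1_on_IccI[OF primitive_has_derivative continuous_on_C0_fun]])

lemma deriv_primitive: "deriv_C1 (primitive_C0 g) = g"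
  unfolding primitive_C0_def
  by (rule C0_eqI, rule deriv_mk_C1[OF primitive_has_derivative continuous_on_C0_fun])

lemma primitive_at_0: "C1_fun (primitive_C0 g) 0 = 0"
  by (simp add: C1_fun_primitive)

lemma C1_eq_iff_deriv:
  assumes "C1_fun f 0 = C1_fun g 0" "deriv_C1 f = deriv_C1 g"
  shows "f = g"
proof -
  have "norm (f - g) = 0" unfolding norm_C1_eq by (simp add: assms deriv_C1_diff)
  then show ?thesis by simp
qed

lemma deriv_C1_one: "deriv_C1 1 = 0"
proof (rule C0_eqI)
  fix x :: real assume x: "x \<in> {0..1}"
  have "(C1_fun 1 has_vector_derivative 0) (at x within {0..1})"
    by (rule has_vector_derivative_transform[OF x _ has_vector_derivative_const[of 1]]) simp
  then show "C0_fun (deriv_C1 1) x = C0_fun 0 x"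
    using x by (simp add: deriv_C1.rep_eq deriv_Icc_eqI)
qed

lemma norm_primitive: "norm (primitive_C0 g) = norm g"
  by (simp add: norm_C1_eq primitive_at_0 deriv_primitive)

lemma bounded_clinear_primitive: "bounded_clinear primitive_C0"
proof (rule bounded_clinearI[where K = 1])
  fix g h :: C0_Icc and c
  show "primitive_C0 (g + h) = primitive_C0 g + primitive_C0 h"
    by (rule C1_eq_iff_deriv) (simp_all add: primitive_at_0 deriv_C1_add deriv_primitive)
  show "primitive_C0 (c *\<^sub>C g) = c *\<^sub>C primitive_C0 g"
    by (rule C1_eq_iff_deriv) (simp_all add: primitive_at_0 deriv_C1_scaleC deriv_primitive)
qed (simp add: norm_primitive)

lemma finite_rank_eval_C1: "finite_rank (\<lambda>f. C1_fun f x *\<^sub>C v)"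
  by (rule finite_rank_cfunctional[OF C1_functional, where K = 1]) (simp add: C1_norm_bound)

definition mult_C0 :: "C0_Icc \<Rightarrow> C0_Icc \<Rightarrow> C0_Icc" where
  "mult_C0 h g = mk_C0 (\<lambda>x. C0_fun h x * C0_fun g x)"

lemma C0_fun_mult: "C0_fun (mult_C0 h g) x = C0_fun h x * C0_fun g x"
proof (cases "x \<in> {0..1}")
  case True
  show ?thesis unfolding mult_C0_def
    by (rule C0_fun_mk_C0[OF _ True]) (intro continuous_intros continuous_on_C0_fun)
qed (simp add: C0_fun_outside)

lemma bounded_clinear_mult_C0: "bounded_clinear (mult_C0 h)"
proof (rule bounded_clinearI[where K = "norm h"])
  fix f g :: C0_Icc and c
  show "mult_C0 h (f + g) = mult_C0 h f + mult_C0 h g" "mult_C0 h (c *\<^sub>C f) = c *\<^sub>C mult_C0 h f"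
    by (rule C0_eqI; simp add: C0_fun_mult algebra_simps)+
  show "norm (mult_C0 h f) \<le> norm h * norm f"
    by (rule C0_norm_least) (simp add: C0_fun_mult norm_mult mult_mono C0_norm_bound)
qed

definition embed_C1 :: "C1_Icc \<Rightarrow> C0_Icc" where
  "embed_C1 f = mk_C0 (C1_fun f)"

lemma C0_fun_embed: "C0_fun (embed_C1 f) x = C1_fun f x"
proof (cases "x \<in> {0..1}")
  case True
  show ?thesis unfolding embed_C1_def by (rule C0_fun_mk_C0[OF continuous_on_C1_fun True])
qed (simp add: C0_fun_outside C1_fun_outside)

section \<open>Bump functions\<close>

text \<open>Squaring the positive part removes its kink at 0, which gives an elementary building
  block for continuously differentiable bumps.\<close>

lemma has_derivative_square_pos_part:
  "((\<lambda>s::real. (max 0 s)\<^sup>2) has_real_derivative 2 * max 0 s) (at s)"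
proof -
  consider "s > 0" | "s < 0" | "s = 0" by linarith
  then show ?thesis
  proof cases
    case 1
    have "((\<lambda>s::real. s\<^sup>2) has_real_derivative 2 * max 0 s) (at s)"
      using 1 by (auto intro!: derivative_eq_intros)
    then show ?thesis
      by (rule has_field_derivative_transform_within_open[of _ _ _ "{0<..}"]) (use 1 in auto)
  next
    case 2
    have "((\<lambda>s::real. 0) has_real_derivative 2 * max 0 s) (at s)"
      using 2 by (auto intro!: derivative_eq_intros)
    then show ?thesis
      by (rule has_field_derivative_transform_within_open[of _ _ _ "{..<0}"]) (use 2 in auto)
  next
    case 3
    have "(\<lambda>h. ((max 0 (0 + h))\<^sup>2 - (max 0 0)\<^sup>2) / h) \<midarrow>0\<rightarrow> (0::real)"
    proof (rule Lim_null_comparison)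
      show "\<forall>\<^sub>F h in at 0. norm (((max 0 (0 + h))\<^sup>2 - (max 0 0)\<^sup>2) / h) \<le> \<bar>h::real\<bar>"
        by (auto simp: eventually_at_filter max_def power2_eq_square)
      show "(\<lambda>h::real. \<bar>h\<bar>) \<midarrow>0\<rightarrow> 0" by (intro tendsto_rabs_zero tendsto_ident_at)
    qed
    then show ?thesis using 3 by (simp add: DERIV_def)
  qed
qed

text \<open>A biorthogonal system of points and bumps inside a prescribed interval, the raw material
  for the finite families of vectors and functionals that the nullity and deficiency criteria ask
  for.\<close>

lemma exists_bumps:
  fixes u v :: real and n :: nat
  assumes uv: "0 \<le> u" "u < v" "v \<le> 1"
  shows "\<exists>(x :: nat \<Rightarrow> real) (\<beta> :: nat \<Rightarrow> C1_Icc). (\<forall>i<n. u < x i \<and> x i < v) \<and>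
    (\<forall>i<n. \<forall>j<n. C1_fun (\<beta> i) (x j) = (if i = j then 1 else 0)) \<and>
    (\<forall>i<n. \<forall>y. \<not> (u < y \<and> y < v) \<longrightarrow> C1_fun (\<beta> i) y = 0) \<and>
    (\<forall>i<n. \<forall>y. cmod (C1_fun (\<beta> i) y) \<le> 1)"
proof (cases "n = 0")
  case True
  then show ?thesis by simp
next
  case False
  \<comment> \<open>The interval is cut into n pieces of length 2 r with midpoints
    \<open>x i\<close>; a bump of radius r stays in its own piece.\<close>
  define r where "r = (v - u) / (2 * real n)"
  have r: "r > 0" using False uv by (simp add: r_def)
  have nr: "2 * real n * r = v - u" using False by (simp add: r_def)
  define x where "x i = u + (2 * real i + 1) * r" for i :: nat
  define h where "h i y = (max 0 (1 - ((y - x i) / r)\<^sup>2))\<^sup>2" for i y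
  define h' where "h' i y = 2 * max 0 (1 - ((y - x i) / r)\<^sup>2) * (- (2 * ((y - x i) / r)) / r)" for i y
  have hd: "(h i has_real_derivative h' i y) (at y)" for i y
  proof -
    have "((\<lambda>y. 1 - ((y - x i) / r)\<^sup>2) has_real_derivative (- (2 * ((y - x i) / r)) / r)) (at y)"
      using r by (auto intro!: derivative_eq_intros simp: power2_eq_square field_simps)
    from DERIV_chain2[OF has_derivative_square_pos_part this] show ?thesis
      unfolding h_def h'_def .
  qed
  define \<beta> where "\<beta> i = mk_C1 (\<lambda>y. complex_of_real (h i y))" for i
  have C1: "C1_on_Icc (\<lambda>y. complex_of_real (h i y))" for i
  proof (rule C1_on_IccI[where f' = "\<lambda>y. complex_of_real (h' i y)"])
    show "((\<lambda>y. complex_of_real (h i y)) has_vector_derivative complex_of_real (h' i y)) (at y within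
      {0..1})" for y
      by (rule has_vector_derivative_of_real)
        (rule has_field_derivative_at_within[OF hd])
    show "continuous_on {0..1} (\<lambda>y. complex_of_real (h' i y))"
      unfolding h'_def using r by (intro continuous_intros) auto
  qed
  have \<beta>: "C1_fun (\<beta> i) y = (if y \<in> {0..1} then complex_of_real (h i y) else 0)" for i y
    unfolding \<beta>_def using C1_fun_mk_C1[OF C1] C1_fun_outside by auto
  have h0: "h i y = 0" if "\<bar>y - x i\<bar> \<ge> r" for i y
  proof -
    have "1 \<le> (\<bar>y - x i\<bar> / r)\<^sup>2" using that r by (intro one_le_power) simp
    then show ?thesis by (simp add: h_def power_divide)
  qed
  have xin: "u + r \<le> x i" "x i \<le> v - r" if "i < n" for i
  proof -
    show "u + r \<le> x i" using r by (simp add: x_def algebra_simps)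
    have "(2 * real i + 1) * r \<le> (2 * real n - 1) * r" using that r by (intro mult_right_mono) auto
    then show "x i \<le> v - r" using nr by (simp add: x_def algebra_simps)
  qed
  have sep: "\<bar>x j - x i\<bar> \<ge> r" if "i \<noteq> j" for i j
  proof -
    have "\<bar>real j - real i\<bar> \<ge> 1" using that by linarith
    then have "2 * \<bar>real j - real i\<bar> * r \<ge> 1 * r" using r by (intro mult_right_mono) auto
    moreover have "x j - x i = 2 * (real j - real i) * r" by (simp add: x_def algebra_simps)
    moreover have "\<bar>2 * (real j - real i) * r\<bar> = 2 * \<bar>real j - real i\<bar> * r"
      unfolding abs_mult using r by simp
    ultimately show ?thesis by simp
  qed
  show ?thesis
  proof (intro exI[of _ x] exI[of _ \<beta>] conjI allI impI)
    fix i assume i: "i < n"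
    show "u < x i" "x i < v" using xin[OF i] r by linarith+
    show "C1_fun (\<beta> i) (x j) = (if i = j then 1 else 0)" if "j < n" for j
    proof -
      have "x j \<in> {0..1}" using xin[OF that] uv r by auto
      then show ?thesis using h0[of "x j" i] sep[of i j] by (simp add: \<beta>) (simp add: h_def)
    qed
    show "C1_fun (\<beta> i) y = 0" if "\<not> (u < y \<and> y < v)" for y
    proof -
      have "\<bar>y - x i\<bar> \<ge> r" using xin[OF i] that by linarith
      then show ?thesis by (simp add: \<beta> h0)
    qed
    show "cmod (C1_fun (\<beta> i) y) \<le> 1" for y
    proof -
      have "0 \<le> h i y" "h i y \<le> 1" unfolding h_def by (auto intro: power_le_one)
      then show ?thesis by (simp add: \<beta>)
    qed
  qed
qed

section \<open>Approximation of composition operators by operators of finite rank\<close>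

text \<open>The variance of the mean of n Bernoulli trials, computed from the first two factorial
  moments of the Bernstein weights.\<close>

lemma sum_Bernstein_square:
  assumes "n > 0"
  shows "(\<Sum>k\<le>n. (x - k / n)\<^sup>2 * Bernstein n k x) = x * (1 - x) / n"
proof -
  have "(\<Sum>k\<le>n. (x - k / n)\<^sup>2 * Bernstein n k x) =
      (\<Sum>k\<le>n. x\<^sup>2 * Bernstein n k x + ((1 - 2 * n * x) / n\<^sup>2) * (k * Bernstein n k x)
        + (1 / n\<^sup>2) * (real k * (real k - 1) * Bernstein n k x))"
    using assms by (intro sum.cong) (auto simp: power2_eq_square field_simps)
  also have "\<dots> = x\<^sup>2 + ((1 - 2 * n * x) / n\<^sup>2) * (n * x) + (1 / n\<^sup>2) * (real n * (real n - 1) * x\<^sup>2)"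
    unfolding sum.distrib sum_distrib_left[symmetric] by simp
  also have "\<dots> = x * (1 - x) / n"
    using assms by (simp add: power2_eq_square field_simps)
  finally show ?thesis .
qed

text \<open>The Lipschitz bound and \<open>\<bar>t\<bar> \<le> e/2 + t^2/(2 e)\<close> reduce the
  error to the variance. The function enters only through the norm of its derivative, so one n
  serves the whole unit ball; this makes it an approximation in operator norm.\<close>

lemma Bernstein_approximation_C1:
  assumes e: "e > 0" and n: "real n * e\<^sup>2 \<ge> 1" and x: "x \<in> {0..1}"
  shows "cmod (C1_fun f x - (\<Sum>k\<le>n. C1_fun f (k / n) * complex_of_real (Bernstein n k x)))
    \<le> e * norm (deriv_C1 f)"
proof -
  have n0: "n > 0" using n by (cases n) auto
  have b0: "Bernstein n k x \<ge> 0" for k using x by (intro Bernstein_nonneg) auto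
  have "C1_fun f x = (\<Sum>k\<le>n. C1_fun f x * complex_of_real (Bernstein n k x))"
    by (simp add: sum_distrib_left[symmetric] of_real_sum[symmetric])
  then have "C1_fun f x - (\<Sum>k\<le>n. C1_fun f (k / n) * complex_of_real (Bernstein n k x)) =
      (\<Sum>k\<le>n. (C1_fun f x - C1_fun f (k / n)) * complex_of_real (Bernstein n k x))"
    by (simp add: sum_subtractf left_diff_distrib)
  also have "cmod \<dots> \<le> (\<Sum>k\<le>n. norm (deriv_C1 f) * ((e / 2 + (x - k / n)\<^sup>2 / (2 * e)) * Bernstein n k x))"
  proof (rule order_trans[OF norm_sum], rule sum_mono)
    fix k assume k: "k \<in> {..n}"
    have amgm: "\<bar>x - k / n\<bar> \<le> e / 2 + (x - k / n)\<^sup>2 / (2 * e)"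
    proof -
      have "0 \<le> (e - \<bar>x - k / n\<bar>)\<^sup>2" by simp
      then have "2 * e * \<bar>x - k / n\<bar> \<le> e\<^sup>2 + (x - k / n)\<^sup>2"
        by (simp only: power2_diff power2_abs)
      then show ?thesis using e by (simp add: field_simps power2_eq_square)
    qed
    have "real k / real n \<in> {0..1}" using k n0 by auto
    then have "cmod (C1_fun f x - C1_fun f (k / n)) \<le> norm (deriv_C1 f) * \<bar>x - k / n\<bar>"
      by (rule C1_lipschitz[OF x])
    also have "\<dots> \<le> norm (deriv_C1 f) * (e / 2 + (x - k / n)\<^sup>2 / (2 * e))"
      by (rule mult_left_mono[OF amgm]) simp
    finally have c: "cmod (C1_fun f x - C1_fun f (k / n)) \<le>
      norm (deriv_C1 f) * (e / 2 + (x - k / n)\<^sup>2 / (2 * e))" .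
    show "norm ((C1_fun f x - C1_fun f (k / n)) * complex_of_real (Bernstein n k x))
        \<le> norm (deriv_C1 f) * ((e / 2 + (x - k / n)\<^sup>2 / (2 * e)) * Bernstein n k x)"
      using mult_right_mono[OF c b0[of k]] b0[of k] by (simp add: norm_mult mult.assoc)
  qed
  also have "\<dots> = norm (deriv_C1 f) * (e / 2 + x * (1 - x) / n / (2 * e))"
  proof -
    have "(\<Sum>k\<le>n. (e / 2 + (x - k / n)\<^sup>2 / (2 * e)) * Bernstein n k x) =
        e / 2 * (\<Sum>k\<le>n. Bernstein n k x) + 1 / (2 * e) * (\<Sum>k\<le>n. (x - k / n)\<^sup>2 * Bernstein n k x)"
      unfolding sum_distrib_left sum.distrib[symmetric] by (rule sum.cong) (auto simp: algebra_simps)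
    then show ?thesis
      unfolding sum_distrib_left[symmetric] by (simp add: sum_Bernstein_square[OF n0])
  qed
  also have "\<dots> \<le> norm (deriv_C1 f) * e"
  proof (rule mult_left_mono)
    have "x * (1 - x) \<le> 1" using x by (intro mult_le_one) auto
    then have "x * (1 - x) / n / (2 * e) \<le> 1 / n / (2 * e)"
      using e n0 by (intro divide_right_mono) auto
    also have "\<dots> \<le> e / 2" using n e n0 by (simp add: field_simps power2_eq_square)
    finally have "x * (1 - x) / n / (2 * e) \<le> e / 2" .
    then show "e / 2 + x * (1 - x) / n / (2 * e) \<le> e" by linarith
  qed simp
  finally show ?thesis by (simp add: mult.commute)
qed

definition mult_comp :: "C0_Icc \<Rightarrow> (real \<Rightarrow> real) \<Rightarrow> C1_Icc \<Rightarrow> C0_Icc" where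
  "mult_comp h \<theta> f = mk_C0 (\<lambda>x. C0_fun h x * C1_fun f (\<theta> x))"

lemma C0_fun_mult_comp:
  assumes "continuous_on {0..1} \<theta>" "\<theta> ` {0..1} \<subseteq> {0..1}" "x \<in> {0..1}"
  shows "C0_fun (mult_comp h \<theta> f) x = C0_fun h x * C1_fun f (\<theta> x)"
  unfolding mult_comp_def
  by (rule C0_fun_mk_C0[OF _ assms(3)])
    (intro continuous_intros continuous_on_C0_fun continuous_on_compose2[OF continuous_on_C1_fun assms(1,2)])

text \<open>Measuring only the sup norm of the result leaves a derivative to spare. Replacing
  \<open>f\<close> by its Bernstein polynomial uses n + 1 point values of \<open>f\<close>, hence an
  operator of finite rank.\<close>

lemma approximable_mult_comp:
  assumes \<theta>: "continuous_on {0..1} \<theta>" "\<theta> ` {0..1} \<subseteq> {0..1}"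
  shows "approximable (mult_comp h \<theta>)"
  unfolding approximable_def
proof (intro conjI allI impI)
  note mc = C0_fun_mult_comp[OF \<theta>]
  show "bounded_clinear (mult_comp h \<theta>)"
  proof (rule bounded_clinearI[where K = "norm h"])
    fix f g :: C1_Icc and c
    show "mult_comp h \<theta> (f + g) = mult_comp h \<theta> f + mult_comp h \<theta> g"
      "mult_comp h \<theta> (c *\<^sub>C f) = c *\<^sub>C mult_comp h \<theta> f"
      by (rule C0_eqI; simp add: mc algebra_simps)+
    show "norm (mult_comp h \<theta> f) \<le> norm h * norm f"
      by (rule C0_norm_least) (simp add: mc norm_mult mult_mono C0_norm_bound C1_norm_bound)
  qed
  fix \<epsilon> :: real assume \<epsilon>: "\<epsilon> > 0"
  \<comment> \<open>Adding 1 avoids a division by zero when \<open>h = 0\<close>.\<close>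
  define e where "e = \<epsilon> / (norm h + 1)"
  have hp: "norm h + 1 > 0" by (simp add: add_nonneg_pos)
  have e: "e > 0" using \<epsilon> hp by (simp add: e_def)
  obtain n :: nat where "1 / e\<^sup>2 \<le> real n" using real_arch_simple by blast
  then have n: "real n * e\<^sup>2 \<ge> 1" using e by (simp add: field_simps)
  define b where "b k = mk_C0 (\<lambda>x. C0_fun h x * complex_of_real (Bernstein n k (\<theta> x)))" for k
  have b: "C0_fun (b k) x = C0_fun h x * complex_of_real (Bernstein n k (\<theta> x))" if "x \<in> {0..1}" for k x
    unfolding b_def
    by (rule C0_fun_mk_C0[OF _ that]) (unfold Bernstein_def, intro continuous_intros continuous_on_C0_fun \<theta>)
  define G where "G f = (\<Sum>k\<le>n. C1_fun f (k / n) *\<^sub>C b k)" for f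
  have "finite_rank G" unfolding G_def by (intro finite_rank_sum finite_rank_eval_C1) simp
  moreover have "norm (mult_comp h \<theta> f - G f) \<le> \<epsilon> * norm f" for f
  proof (rule C0_norm_least)
    fix x :: real assume x: "x \<in> {0..1}"
    then have \<theta>x: "\<theta> x \<in> {0..1}" using \<theta>(2) by blast
    have "C0_fun (mult_comp h \<theta> f - G f) x =
        C0_fun h x * (C1_fun f (\<theta> x) - (\<Sum>k\<le>n. C1_fun f (k / n) * complex_of_real (Bernstein n k (\<theta> x))))"
      using x by (simp add: mc G_def C0_fun_sum b right_diff_distrib sum_distrib_left mult_ac)
    also have "cmod \<dots> \<le> norm h * (e * norm (deriv_C1 f))"
      unfolding norm_mult
      by (intro mult_mono C0_norm_bound Bernstein_approximation_C1[OF e n \<theta>x]) auto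
    also have "\<dots> \<le> (norm h + 1) * (e * norm f)"
      using e by (intro mult_mono mult_left_mono norm_deriv_C1) auto
    also have "\<dots> = \<epsilon> * norm f" using hp by (simp add: e_def)
    finally show "cmod (C0_fun (mult_comp h \<theta> f - G f) x) \<le> \<epsilon> * norm f" .
  qed
  ultimately show "\<exists>G. finite_rank G \<and> (\<forall>f. norm (mult_comp h \<theta> f - G f) \<le> \<epsilon> * norm f)" by blast
qed

lemma approximable_compose_left:
  fixes K :: "'a::complex_normed_vector \<Rightarrow> 'b::complex_normed_vector"
  assumes K: "approximable K" and H: "bounded_clinear H"
  shows "approximable (\<lambda>x. H (K x))"
  unfolding approximable_def
proof (intro conjI allI impI)
  show "bounded_clinear (\<lambda>x. H (K x))" by (rule bounded_clinear_compose[OF H approximableD[OF K]])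
  fix \<epsilon> :: real assume \<epsilon>: "\<epsilon> > 0"
  obtain M where M: "M > 0" "\<And>x. norm (H x) \<le> M * norm x" using bounded_clinear_bound[OF H] by blast
  then have "\<epsilon> / M > 0" using \<epsilon> by simp
  then obtain G where G: "finite_rank G" "\<And>x. norm (K x - G x) \<le> \<epsilon> / M * norm x"
    using K unfolding approximable_def by blast
  have "norm (H (K x) - H (G x)) \<le> \<epsilon> * norm x" for x
    using order_trans[OF M(2)[of "K x - G x"] mult_left_mono[OF G(2)[of x], of M]] M(1)
    by (simp add: bounded_clinear_diff[OF H])
  then show "\<exists>G. finite_rank G \<and> (\<forall>x. norm (H (K x) - G x) \<le> \<epsilon> * norm x)"
    using finite_rank_compose_left[OF G(1) H] by blast
qed

lemma approximable_add_finite_rank: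
  assumes K: "approximable K" and H: "finite_rank H"
  shows "approximable (\<lambda>x. K x + H x)"
  unfolding approximable_def
proof (intro conjI allI impI)
  show "bounded_clinear (\<lambda>x. K x + H x)"
    by (rule bounded_clinear_plus[OF approximableD[OF K] finite_rankD[OF H]])
  fix \<epsilon> :: real assume "\<epsilon> > 0"
  then obtain G where G: "finite_rank G" "\<And>x. norm (K x - G x) \<le> \<epsilon> * norm x"
    using K unfolding approximable_def by blast
  have "norm (K x + H x - (G x + H x)) \<le> \<epsilon> * norm x" for x using G(2)[of x] by simp
  then show "\<exists>G. finite_rank G \<and> (\<forall>x. norm (K x + H x - G x) \<le> \<epsilon> * norm x)"
    using finite_rank_plus[OF G(1) H] by blast
qed

section \<open>Increasing homeomorphisms of the unit interval\<close>

lemma summable_ratio_limit: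
  fixes s :: "nat \<Rightarrow> 'a::banach"
  assumes "b \<longlonglongrightarrow> L" "L < 1" "\<And>n. norm (s (Suc n)) \<le> b n * norm (s n)"
  shows "summable (\<lambda>n. norm (s n))"
proof -
  obtain c where c: "L < c" "c < 1" using assms(2) dense by blast
  then obtain N where N: "\<And>n. n \<ge> N \<Longrightarrow> b n < c"
    using order_tendstoD(2)[OF assms(1)] unfolding eventually_sequentially by blast
  show ?thesis
  proof (rule summable_ratio_test[OF c(2)])
    show "norm (norm (s (Suc n))) \<le> c * norm (norm (s n))" if "n \<ge> N" for n
      using order_trans[OF assms(3)[of n] mult_right_mono[of "b n" c "norm (s n)"]] N[OF that] by simp
  qed
qed

lemma prod_tendsto_zero:
  fixes b :: "nat \<Rightarrow> real"
  assumes "b \<longlonglongrightarrow> L" "L < 1" "\<And>n. b n \<ge> 0"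
  shows "(\<lambda>n. \<Prod>k<n. b k) \<longlonglongrightarrow> 0"
proof -
  have "summable (\<lambda>n. norm (\<Prod>k<n. b k))"
    by (rule summable_ratio_limit[OF assms(1,2)]) (simp add: abs_mult assms(3) mult.commute)
  then show ?thesis using summable_LIMSEQ_zero tendsto_norm_zero_iff by blast
qed

text \<open>Products along orbits that tend to 0 pointwise on a compact invariant set decay
  exponentially and uniformly: compactness bounds the time needed to drop below 1/2, and such blocks
  can be concatenated.\<close>

lemma uniform_exponential_decay:
  fixes f :: "real \<Rightarrow> real" and b :: "real \<Rightarrow> real"
  assumes E: "compact E" and f: "continuous_on E f" "f ` E \<subseteq> E"
    and b: "continuous_on E b" "\<And>y. y \<in> E \<Longrightarrow> b y \<ge> 0"
    and lim: "\<And>y. y \<in> E \<Longrightarrow> (\<lambda>n. \<Prod>k<n. b ((f ^^ k) y)) \<longlonglongrightarrow> 0"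
  obtains C \<theta> where "0 \<le> \<theta>" "\<theta> < 1" "\<And>n y. y \<in> E \<Longrightarrow> (\<Prod>k<n. b ((f ^^ k) y)) \<le> C * \<theta> ^ n"
proof -
  define P where "P n y = (\<Prod>k<n. b ((f ^^ k) y))" for n y
  have fk: "(f ^^ k) y \<in> E" if "y \<in> E" for k y using that f(2) by (induction k) auto
  have P0: "P n y \<ge> 0" if "y \<in> E" for n y
    unfolding P_def by (intro prod_nonneg) (use b(2) fk that in auto)
  have contf: "continuous_on E (f ^^ k)" for k
  proof (induction k)
    case (Suc k)
    have "continuous_on E (\<lambda>y. f ((f ^^ k) y))"
      by (rule continuous_on_compose2[OF f(1) Suc]) (use fk in auto)
    then show ?case by (simp add: o_def)
  qed (simp add: id_def)
  have contP: "continuous_on E (P n)" for n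
    unfolding P_def
    by (intro continuous_on_prod continuous_on_compose2[OF b(1) contf]) (use fk in auto)
  \<comment> \<open>Otherwise points staying above 1/2 for longer and longer times accumulate at
    some \<open>l\<close> in \<open>E\<close>, whose products would all stay at or above
    1/2.\<close>
  have "\<exists>N. \<forall>y\<in>E. \<exists>n. 1 \<le> n \<and> n \<le> N \<and> P n y < 1/2"
  proof (rule ccontr)
    assume "\<not> ?thesis"
    then have "\<forall>N. \<exists>y\<in>E. \<forall>n. 1 \<le> n \<and> n \<le> N \<longrightarrow> 1/2 \<le> P n y" by (meson not_less)
    then obtain y where y: "\<And>N. y N \<in> E" "\<And>N n. 1 \<le> n \<Longrightarrow> n \<le> N \<Longrightarrow> 1/2 \<le> P n (y N)" by metis
    obtain l r where l: "l \<in> E" "strict_mono r" "(y \<circ> r) \<longlonglongrightarrow> l"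
      using E y(1) unfolding compact_def by metis
    have "1/2 \<le> P n l" if "n \<ge> 1" for n
    proof (rule LIMSEQ_le_const)
      show "(\<lambda>i. P n ((y \<circ> r) i)) \<longlonglongrightarrow> P n l"
        using continuous_on_tendsto_compose[OF contP l(3) l(1)] y(1) by simp
      have "1/2 \<le> P n ((y \<circ> r) i)" if "i \<ge> n" for i
        using y(2)[OF \<open>n \<ge> 1\<close>, of "r i"] seq_suble[OF l(2), of i] that by simp
      then show "\<exists>N. \<forall>i\<ge>N. 1/2 \<le> P n ((y \<circ> r) i)" by blast
    qed
    moreover have "\<exists>N. \<forall>n\<ge>N. P n l < 1/2"
      using order_tendstoD(2)[OF lim[OF l(1)], of "1/2"] unfolding P_def eventually_sequentially by simp
    ultimately show False by (metis max.cobounded1 max.cobounded2 not_less)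
  qed
  then obtain N0 where N0: "\<And>y. y \<in> E \<Longrightarrow> \<exists>n. 1 \<le> n \<and> n \<le> N0 \<and> P n y < 1/2" by blast
  define N where "N = max N0 1"
  have N: "N > 0" "\<And>y. y \<in> E \<Longrightarrow> \<exists>n. 1 \<le> n \<and> n \<le> N \<and> P n y < 1/2"
    using N0 by (auto simp: N_def) (meson le_max_iff_disj)
  \<comment> \<open>With this root every block of length \<open>n1 \<le> N\<close> whose product is
    below 1/2 is also below \<open>\<theta> ^ n1\<close>.\<close>
  define \<theta> where "\<theta> = root N (1/2)"
  have \<theta>: "\<theta> > 0" "\<theta> < 1" "\<theta> ^ N = 1/2" using N(1) by (auto simp: \<theta>_def)
  have "\<forall>n. \<exists>K. \<forall>y\<in>E. P n y \<le> K"
  proof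
    fix n
    have "bdd_above (P n ` E)"
      by (intro bounded_imp_bdd_above compact_imp_bounded compact_continuous_image contP E)
    then show "\<exists>K. \<forall>y\<in>E. P n y \<le> K" unfolding bdd_above_def by blast
  qed
  then obtain K where K: "\<And>n y. y \<in> E \<Longrightarrow> P n y \<le> K n" by metis
  \<comment> \<open>Covers the products of length at most \<open>N\<close>; the factor 2 compensates
    \<open>\<theta> ^ N = 1/2\<close>.\<close>
  define C where "C = 2 * (\<Sum>n\<le>N. \<bar>K n\<bar>)"
  have C0: "C \<ge> 0" unfolding C_def by (simp add: sum_nonneg)
  have Pn: "P n y \<le> C * \<theta> ^ n" if "y \<in> E" for n y
    using that
  proof (induction n arbitrary: y rule: less_induct)
    case (less n)
    show ?case
    proof (cases "n \<le> N")
      case True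
      have "P n y \<le> \<bar>K n\<bar>" using K[OF less.prems, of n] by simp
      also have "\<dots> \<le> (\<Sum>n\<le>N. \<bar>K n\<bar>)" using True by (intro member_le_sum) auto
      also have "\<dots> = C * \<theta> ^ N" by (simp add: C_def \<theta>)
      also have "\<dots> \<le> C * \<theta> ^ n"
        using True \<theta> C0 by (intro mult_left_mono power_decreasing) auto
      finally show ?thesis .
    next
      case False
      obtain n1 where n1: "1 \<le> n1" "n1 \<le> N" "P n1 y < 1/2" using N(2)[OF less.prems] by blast
      obtain n2 where n2: "n = n1 + n2" using False n1(2) by (metis le_add_diff_inverse le_trans nat_le_linear)
      have "P n y = P n1 y * P n2 ((f ^^ n1) y)"
      proof -
        have "P n y = (\<Prod>k\<in>{..<n1} \<union> {n1..<n1+n2}. b ((f ^^ k) y))"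
          unfolding P_def n2 by (rule prod.cong) auto
        also have "\<dots> = P n1 y * (\<Prod>k\<in>{n1..<n1+n2}. b ((f ^^ k) y))"
          unfolding P_def by (rule prod.union_disjoint) auto
        also have "(\<Prod>k\<in>{n1..<n1+n2}. b ((f ^^ k) y)) = (\<Prod>k<n2. b ((f ^^ (k + n1)) y))"
          using prod.shift_bounds_nat_ivl[of "\<lambda>k. b ((f ^^ k) y)" 0 n1 n2]
          by (simp add: atLeast0LessThan add.commute)
        finally show ?thesis by (simp add: P_def funpow_add)
      qed
      also have "\<dots> \<le> \<theta> ^ n1 * (C * \<theta> ^ n2)"
      proof (rule mult_mono)
        have "(1/2::real) \<le> \<theta> ^ n1"
          using power_decreasing[OF n1(2), of \<theta>] \<theta> by simp
        then show "P n1 y \<le> \<theta> ^ n1" using n1(3) by simp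
        show "P n2 ((f ^^ n1) y) \<le> C * \<theta> ^ n2"
          using n1(1) n2 by (intro less.IH fk less.prems) auto
      qed (use P0 fk less.prems \<theta> in auto)
      also have "\<dots> = C * \<theta> ^ n" by (simp add: n2 power_add)
      finally show ?thesis .
    qed
  qed
  show ?thesis
    by (rule that[of \<theta> C]) (use \<theta> Pn in \<open>auto simp: P_def\<close>)
qed

section \<open>Orbits of an increasing homeomorphism and their limits\<close>

text \<open>The forward limit of the orbit; with \<psi> in place of \<phi> it is the backward
  limit.\<close>

definition omega :: "(real \<Rightarrow> real) \<Rightarrow> real \<Rightarrow> real" where
  "omega f x = lim (\<lambda>n. (f ^^ n) x)"

locale icc_map =
  fixes \<phi> \<psi> :: "real \<Rightarrow> real"
  assumes cont: "continuous_on {0..1} \<phi>" and cont_inv: "continuous_on {0..1} \<psi>"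
    and into: "x \<in> {0..1} \<Longrightarrow> \<phi> x \<in> {0..1}" and into_inv: "x \<in> {0..1} \<Longrightarrow> \<psi> x \<in> {0..1}"
    and left_inv: "x \<in> {0..1} \<Longrightarrow> \<psi> (\<phi> x) = x" and right_inv: "x \<in> {0..1} \<Longrightarrow> \<phi> (\<psi> x) = x"
    and mono: "x \<in> {0..1} \<Longrightarrow> y \<in> {0..1} \<Longrightarrow> x < y \<Longrightarrow> \<phi> x < \<phi> y"
begin

lemma mono_le: "x \<in> {0..1} \<Longrightarrow> y \<in> {0..1} \<Longrightarrow> x \<le> y \<Longrightarrow> \<phi> x \<le> \<phi> y"
  using mono[of x y] by (cases "x = y") auto

text \<open>Interpreting the locale with the two maps exchanged makes every result on forward orbits
  available for backward orbits.\<close>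

lemma inverse_map: "icc_map \<psi> \<phi>"
proof
  fix x y :: real assume xy: "x \<in> {0..1}" "y \<in> {0..1}" "x < y"
  show "\<psi> x < \<psi> y"
  proof (rule ccontr)
    assume "\<not> ?thesis"
    then have "\<phi> (\<psi> y) \<le> \<phi> (\<psi> x)" by (intro mono_le into_inv xy) simp
    then show False using xy by (simp add: right_inv)
  qed
qed (use cont cont_inv into into_inv left_inv right_inv in auto)

lemma fix_0: "\<phi> 0 = 0"
proof -
  have "\<phi> 0 \<le> \<phi> (\<psi> 0)" using into_inv[of 0] by (intro mono_le) auto
  then show ?thesis using into[of 0] right_inv[of 0] by auto
qed

lemma fix_1: "\<phi> 1 = 1"
proof -
  have "\<phi> (\<psi> 1) \<le> \<phi> 1" using into_inv[of 1] by (intro mono_le) auto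
  then show ?thesis using into[of 1] right_inv[of 1] by auto
qed

definition Fix :: "real set" where "Fix = {x \<in> {0..1}. \<phi> x = x}"

text \<open>The boundary of the fixed point set relative to the unit interval: 0 and 1 belong to it
  only as limits of non-fixed points.\<close>

definition bdFix :: "real set" where
  "bdFix = {p \<in> Fix. \<forall>d>0. \<exists>x\<in>{0..1}. x \<notin> Fix \<and> \<bar>x - p\<bar> < d}"

lemma Fix_inverse: "icc_map.Fix \<psi> = Fix"
proof -
  interpret i: icc_map \<psi> \<phi> by (rule inverse_map)
  show ?thesis unfolding Fix_def i.Fix_def by (metis left_inv right_inv)
qed

lemma bdFix_inverse: "icc_map.bdFix \<psi> = bdFix"
proof -
  interpret i: icc_map \<psi> \<phi> by (rule inverse_map)
  show ?thesis unfolding bdFix_def i.bdFix_def Fix_inverse by simp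
qed

lemma Fix_Icc: "x \<in> Fix \<Longrightarrow> x \<in> {0..1}" and Fix_eq: "x \<in> Fix \<Longrightarrow> \<phi> x = x"
  by (auto simp: Fix_def)

lemma Fix_eq_inv: "x \<in> Fix \<Longrightarrow> \<psi> x = x"
  by (metis Fix_Icc Fix_eq left_inv)

lemma Fix_01: "0 \<in> Fix" "1 \<in> Fix"
  by (auto simp: Fix_def fix_0 fix_1)

lemma closed_Fix: "closed Fix"
  unfolding Fix_def
  by (intro continuous_closed_preimage_constant[where f = "\<lambda>x. \<phi> x - x" and a = 0, simplified]
      continuous_intros cont)

lemma image_Fix_iff: "x \<in> {0..1} \<Longrightarrow> \<phi> x \<in> Fix \<longleftrightarrow> x \<in> Fix"
proof -
  assume x: "x \<in> {0..1}"
  have "\<phi> x = x" if "\<phi> (\<phi> x) = \<phi> x"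
    using left_inv[OF into[OF x]] left_inv[OF x] that by simp
  then show ?thesis using x into[OF x] by (auto simp: Fix_def)
qed

lemma iter_Icc: "x \<in> {0..1} \<Longrightarrow> (\<phi> ^^ n) x \<in> {0..1}"
  by (induction n) (auto simp: into simp del: atLeastAtMost_iff)

lemma iter_Fix: "x \<in> Fix \<Longrightarrow> (\<phi> ^^ n) x = x"
  by (induction n) (auto simp: Fix_eq)

lemma iter_Fix_iff: "x \<in> {0..1} \<Longrightarrow> (\<phi> ^^ n) x \<in> Fix \<longleftrightarrow> x \<in> Fix"
  by (induction n) (auto simp: image_Fix_iff iter_Icc simp del: atLeastAtMost_iff)

lemma iter_mono: "x \<in> {0..1} \<Longrightarrow> y \<in> {0..1} \<Longrightarrow> x \<le> y \<Longrightarrow> (\<phi> ^^ n) x \<le> (\<phi> ^^ n) y"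
  by (induction n) (auto intro!: mono_le iter_Icc simp del: atLeastAtMost_iff)

lemma iter_continuous: "continuous_on {0..1} (\<phi> ^^ n)"
proof (induction n)
  case (Suc n)
  have "continuous_on {0..1} (\<lambda>x. \<phi> ((\<phi> ^^ n) x))"
    by (rule continuous_on_compose2[OF cont Suc]) (use iter_Icc in blast)
  then show ?case by (simp add: o_def)
qed (simp add: id_def)

lemma iter_left_inv: "x \<in> {0..1} \<Longrightarrow> (\<psi> ^^ n) ((\<phi> ^^ n) x) = x"
proof (induction n)
  case (Suc n)
  have "(\<psi> ^^ Suc n) ((\<phi> ^^ Suc n) x) = (\<psi> ^^ n) (\<psi> (\<phi> ((\<phi> ^^ n) x)))"
    by (simp add: funpow_swap1)
  then show ?case using Suc by (simp only: left_inv iter_Icc)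
qed simp

lemma orbit_increasing:
  assumes "x \<in> {0..1}" "x \<le> \<phi> x"
  shows "incseq (\<lambda>n. (\<phi> ^^ n) x)"
proof (rule incseq_SucI)
  show "(\<phi> ^^ n) x \<le> (\<phi> ^^ Suc n) x" for n
    using iter_mono[OF assms(1) into[OF assms(1)] assms(2), of n] by (simp add: funpow_swap1)
qed

lemma orbit_decreasing:
  assumes "x \<in> {0..1}" "\<phi> x \<le> x"
  shows "decseq (\<lambda>n. (\<phi> ^^ n) x)"
proof (rule decseq_SucI)
  show "(\<phi> ^^ Suc n) x \<le> (\<phi> ^^ n) x" for n
    using iter_mono[OF into[OF assms(1)] assms(1) assms(2), of n] by (simp add: funpow_swap1)
qed

lemma orbit_tendsto_omega:
  assumes x: "x \<in> {0..1}"
  shows "(\<lambda>n. (\<phi> ^^ n) x) \<longlonglongrightarrow> omega \<phi> x"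
proof -
  have b: "Bseq (\<lambda>n. (\<phi> ^^ n) x)"
    by (rule BseqI'[where K = 1]) (use iter_Icc[OF x] in auto)
  have "monoseq (\<lambda>n. (\<phi> ^^ n) x)"
    using orbit_increasing[OF x] orbit_decreasing[OF x] by (cases "x \<le> \<phi> x") (auto simp: monoseq_iff)
  then show ?thesis
    unfolding omega_def using Bseq_monoseq_convergent[OF b] convergent_LIMSEQ_iff by blast
qed

lemma omega_Icc: "x \<in> {0..1} \<Longrightarrow> omega \<phi> x \<in> {0..1}"
  using orbit_tendsto_omega iter_Icc by (meson closed_atLeastAtMost closed_sequentially)

lemma omega_Fix: assumes x: "x \<in> {0..1}" shows "omega \<phi> x \<in> Fix"
proof -
  have "(\<lambda>n. \<phi> ((\<phi> ^^ n) x)) \<longlonglongrightarrow> \<phi> (omega \<phi> x)"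
    by (rule continuous_on_tendsto_compose[OF cont orbit_tendsto_omega[OF x] omega_Icc[OF x]])
      (use iter_Icc[OF x] in auto)
  moreover have "(\<lambda>n. \<phi> ((\<phi> ^^ n) x)) \<longlonglongrightarrow> omega \<phi> x"
    using LIMSEQ_Suc[OF orbit_tendsto_omega[OF x]] by simp
  ultimately have "\<phi> (omega \<phi> x) = omega \<phi> x" by (rule LIMSEQ_unique)
  then show ?thesis using omega_Icc[OF x] by (simp add: Fix_def)
qed

lemma omega_of_Fix: "x \<in> Fix \<Longrightarrow> omega \<phi> x = x"
  by (simp add: omega_def iter_Fix)

text \<open>The orbit of a non-fixed point approaches its limit through points that are not
  fixed.\<close>

lemma omega_bdFix: assumes x: "x \<in> {0..1}" "x \<notin> Fix" shows "omega \<phi> x \<in> bdFix"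
  unfolding bdFix_def
proof (intro CollectI conjI omega_Fix x(1) allI impI)
  fix d :: real assume "d > 0"
  then obtain n where "dist ((\<phi> ^^ n) x) (omega \<phi> x) < d"
    using metric_LIMSEQ_D[OF orbit_tendsto_omega[OF x(1)]] by blast
  then show "\<exists>y\<in>{0..1}. y \<notin> Fix \<and> \<bar>y - omega \<phi> x\<bar> < d"
    using iter_Icc[OF x(1)] iter_Fix_iff[OF x(1)] x(2) by (metis dist_real_def)
qed

lemma omega_step: "x \<in> {0..1} \<Longrightarrow> omega \<phi> (\<phi> x) = omega \<phi> x"
proof -
  assume x: "x \<in> {0..1}"
  have "(\<lambda>n. (\<phi> ^^ n) (\<phi> x)) \<longlonglongrightarrow> omega \<phi> x"
    using LIMSEQ_Suc[OF orbit_tendsto_omega[OF x]] by (simp add: funpow_swap1)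
  then show ?thesis using orbit_tendsto_omega[OF into[OF x]] LIMSEQ_unique by blast
qed

text \<open>The iterates of \<open>x\<close> are squeezed between those of \<open>y\<close> and
  those of \<open>\<phi> y\<close>, which have the same limit.\<close>

lemma omega_between:
  assumes y: "y \<in> {0..1}" and x: "min y (\<phi> y) \<le> x" "x \<le> max y (\<phi> y)"
  shows "omega \<phi> x = omega \<phi> y"
proof -
  have xI: "x \<in> {0..1}" using x y into[OF y] by (auto simp: min_def max_def split: if_splits)
  have lo: "(\<lambda>n. (\<phi> ^^ n) (\<phi> y)) \<longlonglongrightarrow> omega \<phi> y"
    using orbit_tendsto_omega[OF into[OF y]] omega_step[OF y] by simp
  note hi = orbit_tendsto_omega[OF y]
  have "(\<lambda>n. (\<phi> ^^ n) x) \<longlonglongrightarrow> omega \<phi> y"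
  proof (cases "y \<le> \<phi> y")
    case True
    then have "y \<le> x" "x \<le> \<phi> y" using x by auto
    then show ?thesis
      by (intro tendsto_sandwich[OF always_eventually always_eventually hi lo] allI iter_mono xI y into)
  next
    case False
    then have "\<phi> y \<le> x" "x \<le> y" using x by auto
    then show ?thesis
      by (intro tendsto_sandwich[OF always_eventually always_eventually lo hi] allI iter_mono xI y into)
  qed
  then show ?thesis using orbit_tendsto_omega[OF xI] LIMSEQ_unique by blast
qed

section \<open>Gaps of the fixed point set and interpolation across them\<close>

text \<open>For a non-fixed \<open>x\<close> this and \<open>uppF x\<close> are the end points of
  the gap around \<open>x\<close>; both are attained because the fixed point set is closed and
  contains 0 and 1.\<close>

definition lowF :: "real \<Rightarrow> real" where "lowF x = Sup (Fix \<inter> {..x})"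
definition uppF :: "real \<Rightarrow> real" where "uppF x = Inf (Fix \<inter> {x..})"

lemma lowF:
  assumes "x \<in> {0..1}"
  shows "lowF x \<in> Fix" "lowF x \<le> x" "\<And>p. p \<in> Fix \<Longrightarrow> p \<le> x \<Longrightarrow> p \<le> lowF x"
proof -
  have ne: "Fix \<inter> {..x} \<noteq> {}" using Fix_01(1) assms by auto
  have bdd: "bdd_above (Fix \<inter> {..x})" by (rule bdd_aboveI[of _ x]) auto
  have "closed (Fix \<inter> {..x})" by (intro closed_Int closed_Fix closed_atMost)
  then have "lowF x \<in> Fix \<inter> {..x}" unfolding lowF_def by (rule closed_contains_Sup[OF ne bdd])
  then show "lowF x \<in> Fix" "lowF x \<le> x" by auto
  show "p \<le> lowF x" if "p \<in> Fix" "p \<le> x" for p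
    unfolding lowF_def using that by (intro cSup_upper bdd) auto
qed

lemma uppF:
  assumes "x \<in> {0..1}"
  shows "uppF x \<in> Fix" "x \<le> uppF x" "\<And>p. p \<in> Fix \<Longrightarrow> x \<le> p \<Longrightarrow> uppF x \<le> p"
proof -
  have ne: "Fix \<inter> {x..} \<noteq> {}" using Fix_01(2) assms by auto
  have bdd: "bdd_below (Fix \<inter> {x..})" by (rule bdd_belowI[of _ x]) auto
  have "closed (Fix \<inter> {x..})" by (intro closed_Int closed_Fix closed_atLeast)
  then have "uppF x \<in> Fix \<inter> {x..}" unfolding uppF_def by (rule closed_contains_Inf[OF ne bdd])
  then show "uppF x \<in> Fix" "x \<le> uppF x" by auto
  show "uppF x \<le> p" if "p \<in> Fix" "x \<le> p" for p
    unfolding uppF_def using that by (intro cInf_lower bdd) auto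
qed

lemma gap_strict:
  assumes "x \<in> {0..1}" "x \<notin> Fix"
  shows "lowF x < x" "x < uppF x"
  using lowF(1,2)[OF assms(1)] uppF(1,2)[OF assms(1)] assms(2) by (metis order_le_less)+

lemma gap_eq:
  assumes "x \<in> {0..1}" "x \<notin> Fix" "lowF x < y" "y < uppF x"
  shows "y \<in> {0..1}" "y \<notin> Fix" "lowF y = lowF x" "uppF y = uppF x"
proof -
  note L = lowF[OF assms(1)] and U = uppF[OF assms(1)]
  show y: "y \<in> {0..1}" using Fix_Icc[OF L(1)] Fix_Icc[OF U(1)] assms by auto
  show "y \<notin> Fix" using L(3)[of y] U(3)[of y] assms(3,4) by force
  show "lowF y = lowF x"
  proof (rule antisym)
    have "lowF y < uppF x" using lowF(2)[OF y] assms(4) by simp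
    then have "lowF y \<le> x" using U(3)[OF lowF(1)[OF y]] by force
    then show "lowF y \<le> lowF x" by (rule L(3)[OF lowF(1)[OF y]])
    show "lowF x \<le> lowF y" using assms(3) by (intro lowF(3)[OF y] L(1)) simp
  qed
  show "uppF y = uppF x"
  proof (rule antisym)
    have "lowF x < uppF y" using uppF(2)[OF y] assms(3) by simp
    then have "x \<le> uppF y" using L(3)[OF uppF(1)[OF y]] by force
    then show "uppF x \<le> uppF y" by (rule U(3)[OF uppF(1)[OF y]])
    show "uppF y \<le> uppF x" using assms(4) by (intro uppF(3)[OF y] U(1)) simp
  qed
qed

lemma gap_step:
  assumes "x \<in> {0..1}" "x \<notin> Fix"
  shows "lowF (\<phi> x) = lowF x" "uppF (\<phi> x) = uppF x"
proof -
  note L = lowF[OF assms(1)] and U = uppF[OF assms(1)] and g = gap_strict[OF assms]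
  have "\<phi> (lowF x) < \<phi> x" "\<phi> x < \<phi> (uppF x)"
    by (intro mono Fix_Icc L U assms g)+
  then have "lowF x < \<phi> x" "\<phi> x < uppF x" using Fix_eq[OF L(1)] Fix_eq[OF U(1)] by auto
  then show "lowF (\<phi> x) = lowF x" "uppF (\<phi> x) = uppF x" using gap_eq[OF assms] by blast+
qed

text \<open>The orbit moves to the right, cannot pass the fixed point \<open>uppF x\<close>, and has
  a fixed point as its limit.\<close>

lemma omega_up:
  assumes x: "x \<in> {0..1}" "x < \<phi> x"
  shows "omega \<phi> x = uppF x"
proof (rule antisym)
  have "x \<le> (\<phi> ^^ n) x" for n
    using incseqD[OF orbit_increasing[OF x(1)], of 0 n] x(2) by simp
  then have "x \<le> omega \<phi> x" by (intro LIMSEQ_le_const[OF orbit_tendsto_omega[OF x(1)]]) auto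
  then show "uppF x \<le> omega \<phi> x" by (rule uppF(3)[OF x(1) omega_Fix[OF x(1)]])
  have "(\<phi> ^^ n) x \<le> uppF x" for n
    using iter_mono[OF x(1) Fix_Icc uppF(2)[OF x(1)], of n] uppF(1)[OF x(1)] by (simp add: iter_Fix)
  then show "omega \<phi> x \<le> uppF x" by (intro LIMSEQ_le_const2[OF orbit_tendsto_omega[OF x(1)]]) auto
qed

lemma omega_down:
  assumes x: "x \<in> {0..1}" "\<phi> x < x"
  shows "omega \<phi> x = lowF x"
proof (rule antisym)
  have "(\<phi> ^^ n) x \<le> x" for n
    using decseqD[OF orbit_decreasing[OF x(1)], of 0 n] x(2) by simp
  then have "omega \<phi> x \<le> x" by (intro LIMSEQ_le_const2[OF orbit_tendsto_omega[OF x(1)]]) auto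
  then show "omega \<phi> x \<le> lowF x" by (rule lowF(3)[OF x(1) omega_Fix[OF x(1)]])
  have "lowF x \<le> (\<phi> ^^ n) x" for n
    using iter_mono[OF Fix_Icc x(1) lowF(2)[OF x(1)], of n] lowF(1)[OF x(1)] by (simp add: iter_Fix)
  then show "lowF x \<le> omega \<phi> x" by (intro LIMSEQ_le_const[OF orbit_tendsto_omega[OF x(1)]]) auto
qed

lemma lowF_Fix: "x \<in> Fix \<Longrightarrow> lowF x = x" and uppF_Fix: "x \<in> Fix \<Longrightarrow> uppF x = x"
  using lowF(2,3)[OF Fix_Icc] uppF(2,3)[OF Fix_Icc] by (metis antisym order_refl)+

text \<open>Interpolating linearly between the values of \<open>M\<close> at the two end points of each gap of the fixed
  point set gives a continuous function that is monotone along orbits. At a fixed point the quotient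
  is \<open>0/0 = 0\<close>, so the value is \<open>M x\<close>.\<close>

definition interp :: "(real \<Rightarrow> real) \<Rightarrow> real \<Rightarrow> real" where
  "interp M x = M (lowF x) + (M (uppF x) - M (lowF x)) * ((x - lowF x) / (uppF x - lowF x))"

lemma interp_Fix: "x \<in> Fix \<Longrightarrow> interp M x = M x"
  by (simp add: interp_def lowF_Fix uppF_Fix)

lemma convex_dist_bound:
  fixes a b c t e :: real
  assumes "0 \<le> t" "t \<le> 1" "\<bar>a - c\<bar> \<le> e" "\<bar>b - c\<bar> \<le> e"
  shows "\<bar>a + (b - a) * t - c\<bar> \<le> e"
proof -
  have "a + (b - a) * t - c = (1 - t) * (a - c) + t * (b - c)" by (simp add: algebra_simps)
  also have "\<bar>\<dots>\<bar> \<le> (1 - t) * \<bar>a - c\<bar> + t * \<bar>b - c\<bar>"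
    using assms(1,2) by (intro order_trans[OF abs_triangle_ineq]) (simp add: abs_mult)
  also have "\<dots> \<le> (1 - t) * e + t * e" using assms by (intro add_mono mult_left_mono) auto
  finally show ?thesis by (simp add: algebra_simps)
qed

text \<open>The delicate case is a fixed point \<open>x0\<close>. A short gap near \<open>x0\<close>
  has both ends near \<open>x0\<close>. A long gap comes near \<open>x0\<close> only at one end, and
  there the linear interpolation has bounded slope.\<close>

lemma interp_continuous:
  assumes M: "continuous_on {0..1} M"
  shows "continuous_on {0..1} (interp M)"
  unfolding continuous_on_eq_continuous_within
proof
  fix x0 :: real assume x0: "x0 \<in> {0..1}"
  show "continuous (at x0 within {0..1}) (interp M)"
  proof (cases "x0 \<in> Fix")
    case False
    let ?l = "lowF x0" and ?u = "uppF x0"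
    have "continuous (at x0 within {0..1}) (\<lambda>x. M ?l + (M ?u - M ?l) * ((x - ?l) / (?u - ?l)))"
      using gap_strict[OF x0 False] by (intro continuous_intros) auto
    then show ?thesis
    proof (rule continuous_transform_within[where \<delta> = "min (x0 - ?l) (?u - x0)"])
      fix y assume "y \<in> {0..1}" "dist y x0 < min (x0 - ?l) (?u - x0)"
      then have "?l < y" "y < ?u" by (auto simp: dist_real_def)
      from gap_eq(3,4)[OF x0 False this]
      show "M ?l + (M ?u - M ?l) * ((y - ?l) / (?u - ?l)) = interp M y" by (simp add: interp_def)
    qed (use gap_strict[OF x0 False] x0 in auto)
  next
    case True
    have "bounded (M ` {0..1})" by (intro compact_imp_bounded compact_continuous_image M) simp
    then obtain B where B: "B > 0" "\<And>x. x \<in> {0..1} \<Longrightarrow> \<bar>M x\<bar> \<le> B"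
      unfolding bounded_pos by auto
    show ?thesis unfolding continuous_within_eps_delta
    proof (intro allI impI)
      fix \<epsilon> :: real assume "\<epsilon> > 0"
      define e where "e = \<epsilon> / 3"
      have e: "e > 0" using \<open>\<epsilon> > 0\<close> by (simp add: e_def)
      obtain \<eta> where \<eta>: "\<eta> > 0" "\<And>y. y \<in> {0..1} \<Longrightarrow> \<bar>y - x0\<bar> < \<eta> \<Longrightarrow> \<bar>M y - M x0\<bar> < e"
        using M x0 e unfolding continuous_on_iff dist_real_def by metis
      \<comment> \<open>The first bound keeps both ends of a gap shorter than
        \<open>\<eta> / 2\<close> within \<eta> of \<open>x0\<close>; the second lets the
        interpolation on a longer gap vary by at most \<open>e\<close> over a distance
        \<open>d\<close>.\<close>
      define d where "d = min (\<eta> / 2) (e * \<eta> / (4 * B))"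
      have d: "d > 0" "d \<le> \<eta> / 2" "2 * B * d \<le> e * (\<eta> / 2)"
      proof -
        show "d > 0" "d \<le> \<eta> / 2" using \<eta>(1) e B(1) by (auto simp: d_def)
        have "2 * B * d \<le> 2 * B * (e * \<eta> / (4 * B))" using B(1) by (intro mult_left_mono) (auto simp: d_def)
        then show "2 * B * d \<le> e * (\<eta> / 2)" using B(1) by (simp add: mult.commute[of e])
      qed
      have main: "\<bar>interp M x - M x0\<bar> \<le> 2 * e" if x: "x \<in> {0..1}" "\<bar>x - x0\<bar> < d" for x
      proof (cases "x \<in> Fix")
        case True
        then show ?thesis using \<eta>(2)[OF x(1)] x(2) d(2) \<eta>(1) e by (simp add: interp_Fix)
      next
        case xF: False
        define l where "l = lowF x"
        define u where "u = uppF x"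
        note L = lowF[OF x(1), folded l_def] and U = uppF[OF x(1), folded u_def]
        have lu: "l < x" "x < u" using gap_strict[OF x(1) xF] by (auto simp: l_def u_def)
        have lI: "l \<in> {0..1}" and uI: "u \<in> {0..1}" using Fix_Icc L(1) U(1) by auto
        have side: "x0 \<le> l \<or> u \<le> x0" using L(3)[OF True] U(3)[OF True] by linarith
        define t where "t = (x - l) / (u - l)"
        have t: "0 \<le> t" "t \<le> 1" using lu by (auto simp: t_def)
        have im: "interp M x = M l + (M u - M l) * t" by (simp add: interp_def l_def u_def t_def)
        have Mul: "\<bar>M u - M l\<bar> \<le> 2 * B" using B(2)[OF lI] B(2)[OF uI] by linarith
        show ?thesis
        proof (cases "u - l < \<eta> / 2")
          case True
          have "\<bar>l - x0\<bar> < \<eta>" "\<bar>u - x0\<bar> < \<eta>" using True lu x(2) d(2) by linarith+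
          then have "\<bar>M l - M x0\<bar> \<le> e" "\<bar>M u - M x0\<bar> \<le> e"
            using \<eta>(2)[OF lI] \<eta>(2)[OF uI] by (auto intro: less_imp_le)
          then show ?thesis unfolding im using convex_dist_bound[OF t, of "M l" "M x0" e "M u"] e by simp
        next
          case False
          have small: "2 * B * (s / (u - l)) \<le> e" if "0 \<le> s" "s \<le> d" for s
          proof -
            have "2 * B * s \<le> 2 * B * d" using that B(1) by simp
            also have "\<dots> \<le> e * (u - l)" using d(3) False e by (intro order_trans[OF d(3)] mult_left_mono) auto
            finally show ?thesis using lu by (simp add: field_simps)
          qed
          from side show ?thesis
          proof
            assume s: "x0 \<le> l"
            have "\<bar>l - x0\<bar> < \<eta>" using s lu x(2) d(2) \<eta>(1) by linarith
            then have 1: "\<bar>M l - M x0\<bar> < e" using \<eta>(2)[OF lI] by blast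
            have "\<bar>(M u - M l) * t\<bar> \<le> 2 * B * t" using Mul t by (simp add: abs_mult mult_right_mono)
            also have "\<dots> \<le> e" unfolding t_def using s lu x(2) by (intro small) auto
            finally show ?thesis unfolding im using 1 by linarith
          next
            assume s: "u \<le> x0"
            have "\<bar>u - x0\<bar> < \<eta>" using s lu x(2) d(2) \<eta>(1) by linarith
            then have 1: "\<bar>M u - M x0\<bar> < e" using \<eta>(2)[OF uI] by blast
            have t1: "1 - t = (u - x) / (u - l)" using lu by (simp add: t_def field_simps)
            have "\<bar>(M u - M l) * (1 - t)\<bar> \<le> 2 * B * (1 - t)" using Mul t by (simp add: abs_mult mult_right_mono)
            also have "\<dots> \<le> e" unfolding t1 using s lu x(2) by (intro small) auto
            finally have "\<bar>(M u - M l) * (1 - t)\<bar> \<le> e" .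
            moreover have "interp M x = M u - (M u - M l) * (1 - t)" unfolding im by (simp add: algebra_simps)
            ultimately show ?thesis using 1 by linarith
          qed
        qed
      qed
      have "2 * e < \<epsilon>" using \<open>\<epsilon> > 0\<close> by (simp add: e_def)
      then have "dist (interp M x) (interp M x0) < \<epsilon>" if "x \<in> {0..1}" "dist x x0 < d" for x
        using main[of x] that True by (simp add: dist_real_def interp_Fix)
      then show "\<exists>d>0. \<forall>x\<in>{0..1}. dist x x0 < d \<longrightarrow> dist (interp M x) (interp M x0) < \<epsilon>"
        using d(1) by blast
    qed
  qed
qed

text \<open>The two branches are glued along closed sets, the fixed points and the closure of the
  rest, which meet only in \<open>bdFix\<close>, where both are zero.\<close>

lemma continuous_on_extend_Fix:
  fixes k :: "real \<Rightarrow> 'b::real_normed_vector"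
  assumes k: "continuous_on Fix k" and bd: "\<And>p. p \<in> bdFix \<Longrightarrow> k p = 0"
  shows "continuous_on {0..1} (\<lambda>x. if x \<in> Fix then k x else 0)"
proof -
  let ?G = "closure ({0..1} - Fix)"
  have G: "?G \<subseteq> {0..1}" by (rule closure_minimal) auto
  have "continuous_on (Fix \<union> ?G) (\<lambda>x. if x \<in> Fix then k x else 0)"
  proof (rule continuous_on_cases[OF closed_Fix closed_closure k continuous_on_const])
    show "\<forall>x. x \<in> Fix \<and> x \<notin> Fix \<or> x \<in> ?G \<and> x \<in> Fix \<longrightarrow> k x = 0"
    proof (intro allI impI)
      fix x assume "x \<in> Fix \<and> x \<notin> Fix \<or> x \<in> ?G \<and> x \<in> Fix"
      then have x: "x \<in> ?G" "x \<in> Fix" by auto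
      have "x \<in> bdFix" unfolding bdFix_def
        using x(2) x(1)[unfolded closure_approachable] by (auto simp: dist_real_def)
      then show "k x = 0" by (rule bd)
    qed
  qed
  then show ?thesis
    by (rule continuous_on_subset) (use closure_subset[of "{0..1} - Fix"] in auto)
qed

lemma compact_bdFix: "compact bdFix"
proof -
  have "bdFix = Fix \<inter> closure ({0..1} - Fix)"
    unfolding bdFix_def by (auto simp: closure_approachable dist_real_def Bex_def conj_assoc)
  moreover have "compact Fix"
    using closed_Fix Fix_Icc by (meson bounded_closed_interval bounded_subset compact_eq_bounded_closed subsetI)
  ultimately show ?thesis by (simp add: compact_Int_closed)
qed

lemma omega_inv_step: "y \<in> {0..1} \<Longrightarrow> omega \<psi> (\<phi> y) = omega \<psi> y"
proof -
  assume y: "y \<in> {0..1}"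
  interpret i: icc_map \<psi> \<phi> by (rule inverse_map)
  show ?thesis using i.omega_step[OF into[OF y]] left_inv[OF y] by simp
qed

text \<open>The orbit runs from one end of its gap to the other, so its two limits are
  \<open>lowF x\<close> and \<open>uppF x\<close> in an order given by the direction of motion.
  Moving towards the end with the smaller value of \<open>M\<close> lowers the
  interpolation.\<close>

lemma interp_between:
  assumes x: "x \<in> {0..1}" "x \<notin> Fix"
  shows "interp M x \<le> max (M (omega \<phi> x)) (M (omega \<psi> x))"
    and "min (M (omega \<phi> x)) (M (omega \<psi> x)) \<le> interp M x"
    and "M (omega \<phi> x) \<le> M (omega \<psi> x) \<Longrightarrow> interp M (\<phi> x) \<le> interp M x"
    and "M (omega \<phi> x) \<le> M (omega \<psi> x) \<Longrightarrow> interp M x \<le> interp M (\<psi> x)"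
proof -
  interpret i: icc_map \<psi> \<phi> by (rule inverse_map)
  have lowF_i: "i.lowF = lowF" and uppF_i: "i.uppF = uppF"
    unfolding i.lowF_def lowF_def i.uppF_def uppF_def Fix_inverse by auto
  let ?l = "lowF x" and ?u = "uppF x"
  note g = gap_strict[OF x]
  have xi: "x \<notin> i.Fix" using x(2) by (simp add: Fix_inverse)
  define t where "t = (x - ?l) / (?u - ?l)"
  have t: "0 \<le> t" "t \<le> 1" using g by (auto simp: t_def)
  have im: "interp M x = M ?l + (M ?u - M ?l) * t" by (simp add: interp_def t_def)
  have "M ?l + (M ?u - M ?l) * t = (1 - t) * M ?l + t * M ?u" by (simp add: algebra_simps)
  moreover have "(1 - t) * M ?l + t * M ?u \<le> (1 - t) * max (M ?l) (M ?u) + t * max (M ?l) (M ?u)"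
    using t by (intro add_mono mult_left_mono) auto
  moreover have "(1 - t) * min (M ?l) (M ?u) + t * min (M ?l) (M ?u) \<le> (1 - t) * M ?l + t * M ?u"
    using t by (intro add_mono mult_left_mono) auto
  ultimately have b: "interp M x \<le> max (M ?l) (M ?u)" "min (M ?l) (M ?u) \<le> interp M x"
    unfolding im by (simp_all add: algebra_simps)
  have neq: "\<phi> x \<noteq> x" using x by (auto simp: Fix_def)
  have \<psi>up: "\<psi> x < x" if "x < \<phi> x"
    using i.mono[OF x(1) into[OF x(1)] that] left_inv[OF x(1)] by simp
  have \<psi>dn: "x < \<psi> x" if "\<phi> x < x"
    using i.mono[OF into[OF x(1)] x(1) that] left_inv[OF x(1)] by simp
  have om: "omega \<phi> x = (if x < \<phi> x then ?u else ?l)" "omega \<psi> x = (if x < \<phi> x then ?l else ?u)"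
    using neq omega_up[OF x(1)] omega_down[OF x(1)] i.omega_up[OF x(1)] i.omega_down[OF x(1)] \<psi>up \<psi>dn
    by (auto simp: lowF_i uppF_i)
  show "interp M x \<le> max (M (omega \<phi> x)) (M (omega \<psi> x))"
    "min (M (omega \<phi> x)) (M (omega \<psi> x)) \<le> interp M x"
    using b by (auto simp: om max.commute min.commute)
  have lu: "?u - ?l > 0" using g by simp
  have step: "interp M y \<le> interp M z" if "lowF y = ?l" "uppF y = ?u" "lowF z = ?l" "uppF z = ?u"
    "M ?u \<le> M ?l \<and> z \<le> y \<or> M ?l \<le> M ?u \<and> y \<le> z" for y z
  proof -
    have "(M ?u - M ?l) * (y - ?l) \<le> (M ?u - M ?l) * (z - ?l)"
      using that(5) by (auto intro: mult_left_mono mult_left_mono_neg)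
    then show ?thesis unfolding interp_def that(1-4) using lu by (simp add: divide_right_mono)
  qed
  note st = gap_step[OF x] and sti = i.gap_step[OF x(1) xi, unfolded lowF_i uppF_i]
  show "interp M (\<phi> x) \<le> interp M x" if "M (omega \<phi> x) \<le> M (omega \<psi> x)"
    using that neq by (intro step) (auto simp: st om split: if_splits)
  show "interp M x \<le> interp M (\<psi> x)" if "M (omega \<phi> x) \<le> M (omega \<psi> x)"
    using that neq \<psi>up \<psi>dn by (intro step) (auto simp: sti om split: if_splits)
qed

section \<open>Partition of unity adapted to the dynamics\<close>

text \<open>\<open>M\<close> will be the modulus of the weight. \<open>c1\<close> lives on a forward
  invariant set where forward products shrink, \<open>c2\<close> on a backward invariant set where
  backward products grow, and \<open>c3\<close> on fixed points with \<open>M\<close> close to 1,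
  where \<open>I - A\<close> is a mere multiplication. Hypothesis \<open>H\<close> excludes gaps
  along which \<open>M\<close> rises through 1; where \<open>M\<close> falls through 1 instead,
  sublevel sets of its interpolation are forward invariant.\<close>

lemma cutoffs:
  assumes M: "continuous_on {0..1} M" and bd: "\<And>p. p \<in> bdFix \<Longrightarrow> M p \<noteq> (1::real)"
    and H: "\<And>y. y \<in> {0..1} \<Longrightarrow> y \<notin> Fix \<Longrightarrow> \<not> (M (omega \<psi> y) < 1 \<and> 1 < M (omega \<phi> y))"
  obtains c1 c2 c3 :: "real \<Rightarrow> real" and E1 E2 :: "real set" where
    "continuous_on {0..1} c1" "continuous_on {0..1} c2" "continuous_on {0..1} c3"
    "\<And>x. x \<in> {0..1} \<Longrightarrow> c1 x + c2 x + c3 x = 1"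
    "compact E1" "E1 \<subseteq> {0..1}" "\<phi> ` E1 \<subseteq> E1" "\<And>y. y \<in> E1 \<Longrightarrow> M (omega \<phi> y) < 1"
    "\<And>x. x \<in> {0..1} \<Longrightarrow> c1 x \<noteq> 0 \<Longrightarrow> x \<in> E1"
    "compact E2" "E2 \<subseteq> {0..1}" "\<psi> ` E2 \<subseteq> E2" "\<And>y. y \<in> E2 \<Longrightarrow> M (omega \<psi> y) > 1"
    "\<And>x. x \<in> {0..1} \<Longrightarrow> c2 x \<noteq> 0 \<Longrightarrow> x \<in> E2"
    "\<And>x. x \<in> {0..1} \<Longrightarrow> c3 x \<noteq> 0 \<Longrightarrow> x \<in> Fix" "\<And>p. p \<in> bdFix \<Longrightarrow> c3 p = 0"
proof -
  interpret i: icc_map \<psi> \<phi> by (rule inverse_map)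
  have MF: "continuous_on Fix M" using M by (rule continuous_on_subset) (use Fix_Icc in blast)
  have "\<exists>\<delta>>0. \<forall>p\<in>bdFix. \<bar>M p - 1\<bar> \<ge> 3 * \<delta>"
  proof (cases "bdFix = {}")
    case True
    then show ?thesis by (intro exI[of _ 1]) auto
  next
    case False
    have "continuous_on bdFix (\<lambda>p. \<bar>M p - 1\<bar>)"
      by (intro continuous_intros continuous_on_subset[OF MF]) (auto simp: bdFix_def)
    then obtain p0 where p0: "p0 \<in> bdFix" "\<And>p. p \<in> bdFix \<Longrightarrow> \<bar>M p0 - 1\<bar> \<le> \<bar>M p - 1\<bar>"
      using continuous_attains_inf[OF compact_bdFix False] by blast
    show ?thesis using bd[OF p0(1)] p0(2) by (intro exI[of _ "\<bar>M p0 - 1\<bar> / 3"]) auto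
  qed
  then obtain \<delta> where \<delta>: "\<delta> > 0" "\<And>p. p \<in> bdFix \<Longrightarrow> \<bar>M p - 1\<bar> \<ge> 3 * \<delta>" by blast
  \<comment> \<open>\<rho> is 1 within distance \<delta> of 1 and 0 beyond 2 \<delta>; \<kappa> is
    positive exactly within distance \<delta>; \<sigma> falls from 1 to 0 between 1 - \<delta>/2 and
    1 + \<delta>/2.\<close>
  define \<rho> where "\<rho> t = max 0 (min 1 (2 - \<bar>t - 1\<bar> / \<delta>))" for t :: real
  define \<kappa> where "\<kappa> t = max 0 (1 - \<bar>t - 1\<bar> / \<delta>)" for t :: real
  define \<sigma> where "\<sigma> t = max 0 (min 1 (1/2 + (1 - t) / \<delta>))" for t :: real
  have \<rho>0: "\<rho> t = 0" and \<kappa>0: "\<kappa> t = 0" if "\<bar>t - 1\<bar> \<ge> 3 * \<delta>" for t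
  proof -
    have "3 \<le> \<bar>t - 1\<bar> / \<delta>" using that \<delta>(1) by (simp add: pos_le_divide_eq)
    then show "\<rho> t = 0" "\<kappa> t = 0" by (simp_all add: \<rho>_def \<kappa>_def)
  qed
  define c3 where "c3 x = (if x \<in> Fix then \<rho> (M x) else 0)" for x
  \<comment> \<open>Positive only at fixed points with \<open>M\<close> closer to 1 than \<delta>,
    where \<open>c3\<close> is 1. The closed condition \<open>e x \<le> 0\<close> removes them from
    \<open>E1\<close> and \<open>E2\<close>, so a fixed point of \<open>E1\<close> has
    \<open>M \<le> 1 - \<delta>\<close> and one of \<open>E2\<close> has
    \<open>M \<ge> 1 + \<delta>\<close>.\<close>
  define e where "e x = (if x \<in> Fix then \<kappa> (M x) else 0)" for x
  have cc3: "continuous_on {0..1} c3"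
    unfolding c3_def using \<delta>(1)
    by (intro continuous_on_extend_Fix \<rho>0 \<delta>(2)) (unfold \<rho>_def, intro continuous_intros MF, auto)
  have ce: "continuous_on {0..1} e"
    unfolding e_def using \<delta>(1)
    by (intro continuous_on_extend_Fix \<kappa>0 \<delta>(2)) (unfold \<kappa>_def, intro continuous_intros MF, auto)
  let ?m = "interp M"
  have cm: "continuous_on {0..1} ?m" by (rule interp_continuous[OF M])
  have cs: "continuous_on {0..1} (\<lambda>x. \<sigma> (?m x))"
    unfolding \<sigma>_def using \<delta>(1) by (intro continuous_intros cm) auto
  define c1 where "c1 x = (1 - c3 x) * \<sigma> (?m x)" for x
  define c2 where "c2 x = (1 - c3 x) * (1 - \<sigma> (?m x))" for x
  define E1 where "E1 = {0..1} \<inter> {x \<in> {0..1}. ?m x \<le> 1 + \<delta>/2} \<inter> {x \<in> {0..1}. e x \<le> 0}"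
  define E2 where "E2 = {0..1} \<inter> {x \<in> {0..1}. 1 - \<delta>/2 \<le> ?m x} \<inter> {x \<in> {0..1}. e x \<le> 0}"
  have comp: "compact E1" "compact E2"
    unfolding E1_def E2_def
    by (intro compact_Int_closed compact_Icc continuous_on_closed_Collect_le
        continuous_on_const cm ce closed_atLeastAtMost)+
  have e_le: "\<bar>M x - 1\<bar> \<ge> \<delta>" if "x \<in> Fix" "e x \<le> 0" for x
    using that \<delta>(1) by (simp add: e_def \<kappa>_def field_simps split: if_splits)
  have c3_1: "e x \<le> 0" if "c3 x \<noteq> 1" for x
  proof (rule ccontr)
    assume "\<not> e x \<le> 0"
    then have "x \<in> Fix" "\<bar>M x - 1\<bar> / \<delta> < 1" by (auto simp: e_def \<kappa>_def split: if_splits)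
    then have "c3 x = 1" by (simp add: c3_def \<rho>_def)
    then show False using that by simp
  qed
  have \<sigma>0: "t \<le> 1 + \<delta>/2" if "\<sigma> t \<noteq> 0" for t
  proof (rule ccontr)
    assume "\<not> ?thesis"
    then have "(1 - t) / \<delta> \<le> - (1/2)" using \<delta>(1) by (simp add: field_simps)
    then show False using that by (simp add: \<sigma>_def)
  qed
  have \<sigma>1: "1 - \<delta>/2 \<le> t" if "\<sigma> t \<noteq> 1" for t
  proof (rule ccontr)
    assume "\<not> ?thesis"
    then have "(1 - t) / \<delta> \<ge> 1/2" using \<delta>(1) by (simp add: field_simps)
    then have "1/2 + (1 - t) / \<delta> \<ge> 1" by linarith
    then have "\<sigma> t = 1" unfolding \<sigma>_def by linarith
    then show False using that by simp
  qed
  have bds: "\<bar>M (omega \<phi> y) - 1\<bar> \<ge> 3 * \<delta>" "\<bar>M (omega \<psi> y) - 1\<bar> \<ge> 3 * \<delta>"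
    if "y \<in> {0..1}" "y \<notin> Fix" for y
    using \<delta>(2) omega_bdFix[OF that] i.omega_bdFix[OF that(1)] that(2)
    by (auto simp: Fix_inverse bdFix_inverse)
  have E1: "M (omega \<phi> y) < 1 \<and> \<phi> y \<in> E1" if "y \<in> E1" for y
  proof -
    have y: "y \<in> {0..1}" "?m y \<le> 1 + \<delta>/2" "e y \<le> 0" using that by (auto simp: E1_def)
    show ?thesis
    proof (cases "y \<in> Fix")
      case True
      then show ?thesis
        using e_le[OF True y(3)] y(2) \<delta>(1) that by (simp add: interp_Fix omega_of_Fix Fix_eq)
    next
      case False
      note b = bds[OF y(1) False] and ib = interp_between[OF y(1) False, of M] and h = H[OF y(1) False]
      \<comment> \<open>Otherwise the forward end has \<open>M \<ge> 1 + 3 \<delta>\<close>, by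
        \<open>H\<close> so has the backward end, and the interpolation could not be as low as
        \<open>1 + \<delta>/2\<close>.\<close>
      have 1: "M (omega \<phi> y) < 1" using b ib(2) h y(2) \<delta>(1) by linarith
      have F: "\<phi> y \<notin> Fix" "\<phi> y \<in> {0..1}" using False y(1)
        by (auto simp: image_Fix_iff into simp del: atLeastAtMost_iff)
      \<comment> \<open>If both ends are below 1, so is the interpolation on the whole gap;
        otherwise \<open>M\<close> falls along the orbit and the interpolation decreases with
        it.\<close>
      have "?m (\<phi> y) \<le> 1 + \<delta>/2"
      proof (cases "M (omega \<psi> y) < 1")
        case True
        then show ?thesis
          using interp_between(1)[OF F(2,1), of M] 1 omega_inv_step[OF y(1)] omega_step[OF y(1)] \<delta>(1) by simp
      next
        case False
        then show ?thesis using ib(3) 1 y(2) by simp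
      qed
      then show ?thesis using 1 F by (simp add: E1_def e_def)
    qed
  qed
  have E2: "M (omega \<psi> y) > 1 \<and> \<psi> y \<in> E2" if "y \<in> E2" for y
  proof -
    have y: "y \<in> {0..1}" "1 - \<delta>/2 \<le> ?m y" "e y \<le> 0" using that by (auto simp: E2_def)
    show ?thesis
    proof (cases "y \<in> Fix")
      case True
      then have "omega \<psi> y = y" using i.omega_of_Fix Fix_inverse by simp
      then show ?thesis
        using e_le[OF True y(3)] y(2) \<delta>(1) that True by (simp add: interp_Fix Fix_eq_inv)
    next
      case False
      note b = bds[OF y(1) False] and ib = interp_between[OF y(1) False, of M] and h = H[OF y(1) False]
      have 1: "M (omega \<psi> y) > 1" using b ib(1) h y(2) \<delta>(1) by linarith
      have F: "\<psi> y \<notin> Fix" "\<psi> y \<in> {0..1}"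
        using False y(1) i.image_Fix_iff[OF y(1)]
          by (auto simp: Fix_inverse into_inv simp del: atLeastAtMost_iff)
      have "1 - \<delta>/2 \<le> ?m (\<psi> y)"
      proof (cases "M (omega \<phi> y) > 1")
        case True
        then show ?thesis
          using interp_between(2)[OF F(2,1), of M] 1 i.omega_inv_step[OF y(1)] i.omega_step[OF y(1)] \<delta>(1)
            by simp
      next
        case False
        then show ?thesis using ib(4) 1 y(2) by simp
      qed
      then show ?thesis using 1 F by (simp add: E2_def e_def)
    qed
  qed
  show ?thesis
  proof (rule that[of c1 c2 c3 E1 E2])
    show "continuous_on {0..1} c1" "continuous_on {0..1} c2"
      unfolding c1_def c2_def by (intro continuous_intros cc3 cs)+
    show "c1 x + c2 x + c3 x = 1" for x by (simp add: c1_def c2_def algebra_simps)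
    show "x \<in> E1" if "x \<in> {0..1}" "c1 x \<noteq> 0" for x
      using that c3_1[of x] \<sigma>0[of "?m x"] by (auto simp: c1_def E1_def)
    show "x \<in> E2" if "x \<in> {0..1}" "c2 x \<noteq> 0" for x
      using that c3_1[of x] \<sigma>1[of "?m x"] by (auto simp: c2_def E2_def)
    show "c3 p = 0" if "p \<in> bdFix" for p using that \<rho>0[OF \<delta>(2)[OF that]] by (simp add: c3_def)
    show "x \<in> Fix" if "c3 x \<noteq> 0" for x using that by (simp add: c3_def split: if_splits)
    show "E1 \<subseteq> {0..1}" "E2 \<subseteq> {0..1}" unfolding E1_def E2_def by blast+
    show "\<phi> ` E1 \<subseteq> E1" "\<And>y. y \<in> E1 \<Longrightarrow> M (omega \<phi> y) < 1" using E1 by blast+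
    show "\<psi> ` E2 \<subseteq> E2" "\<And>y. y \<in> E2 \<Longrightarrow> M (omega \<psi> y) > 1" using E2 by blast+
  qed (fact cc3 comp)+
qed

end

section \<open>Weighted composition operators on continuous functions\<close>

definition wcomp0 :: "(real \<Rightarrow> real) \<Rightarrow> (real \<Rightarrow> complex) \<Rightarrow> C0_Icc \<Rightarrow> C0_Icc" where
  "wcomp0 \<theta> b g = mk_C0 (\<lambda>x. b x * C0_fun g (\<theta> x))"

lemma bounded_clinear_funpow:
  fixes W :: "'a::complex_normed_vector \<Rightarrow> 'a"
  shows "bounded_clinear W \<Longrightarrow> bounded_clinear (W ^^ n)"
proof (induction n)
  case (Suc n)
  then have "bounded_clinear (\<lambda>x. W ((W ^^ n) x))"
    by (intro bounded_clinear_compose[of W "W ^^ n"]) auto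
  then show ?case by (simp add: o_def)
qed (simp add: id_def bounded_clinear_ident)

lemma bounded_clinear_suminf:
  fixes U :: "nat \<Rightarrow> 'a::complex_banach \<Rightarrow> 'b::complex_banach"
  assumes U: "\<And>n. bounded_clinear (U n)" "\<And>n h. norm (U n h) \<le> M n * norm h" and M: "summable M"
  shows "bounded_clinear (\<lambda>h. \<Sum>n. U n h)" "\<And>h. summable (\<lambda>n. U n h)"
proof -
  have sn: "summable (\<lambda>n. norm (U n h))" for h
    by (rule summable_comparison_test'[OF summable_mult2[OF M, of "norm h"]]) (use U(2) in auto)
  then show s: "summable (\<lambda>n. U n h)" for h by (rule summable_norm_cancel)
  show "bounded_clinear (\<lambda>h. \<Sum>n. U n h)"
  proof (rule bounded_clinearI[where K = "suminf M"])
    fix g h :: 'a and c :: complex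
    show "(\<Sum>n. U n (g + h)) = (\<Sum>n. U n g) + (\<Sum>n. U n h)"
      by (simp add: bounded_clinear_add[OF U(1)] suminf_add[OF s s])
    have "bounded_linear (\<lambda>x::'b. c *\<^sub>C x)"
      by (rule bounded_clinear_bl[OF bounded_clinear_scaleC_fun[OF bounded_clinear_ident]])
    then show "(\<Sum>n. U n (c *\<^sub>C h)) = c *\<^sub>C (\<Sum>n. U n h)"
      by (simp add: bounded_clinear_scaleC[OF U(1)] bounded_linear.suminf[OF _ s])
    have "norm (\<Sum>n. U n h) \<le> (\<Sum>n. M n * norm h)"
      by (rule order_trans[OF summable_norm[OF sn] suminf_le[OF U(2) sn summable_mult2[OF M]]])
    then show "norm (\<Sum>n. U n h) \<le> suminf M * norm h" by (simp add: suminf_mult2[OF M])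
  qed
qed

lemma cmod_inverse_less: "1 < cmod z \<Longrightarrow> cmod (1 / z) < 1"
  by (cases "z = 0") (simp_all add: norm_divide)

text \<open>Two-sided orbit sums of a wandering element are eigenvectors of \<open>W\<close>, and two-sided orbit sums
  of point evaluations annihilate the range of \<open>id - W\<close>.\<close>

lemma nullity_wandering:
  fixes W :: "'a::complex_banach \<Rightarrow> 'a"
  assumes W: "bounded_clinear W" "bounded_clinear W'" "\<And>x. W (W' x) = x"
    and wand: "\<And>n::nat. \<exists>\<beta> e. \<forall>i<n. cfunctional (e i) \<and> (\<forall>x. cmod (e i x) \<le> norm x) \<and>
      summable (\<lambda>k. norm ((W ^^ k) (\<beta> i))) \<and> summable (\<lambda>k. norm ((W' ^^ k) (\<beta> i))) \<and>
      (\<forall>j<n. e i (\<beta> j) = (if i = j then 1 else 0) \<and>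
        (\<forall>k>0. e i ((W ^^ k) (\<beta> j)) = 0 \<and> e i ((W' ^^ k) (\<beta> j)) = 0))"
  shows "nullity (\<lambda>x. x - W x) = \<infinity>"
proof (rule nullity_infiniteI)
  fix n :: nat
  obtain \<beta> e where w: "\<forall>i<n. cfunctional (e i) \<and> (\<forall>x. cmod (e i x) \<le> norm x) \<and>
      summable (\<lambda>k. norm ((W ^^ k) (\<beta> i))) \<and> summable (\<lambda>k. norm ((W' ^^ k) (\<beta> i))) \<and>
      (\<forall>j<n. e i (\<beta> j) = (if i = j then 1 else 0) \<and>
        (\<forall>k>0. e i ((W ^^ k) (\<beta> j)) = 0 \<and> e i ((W' ^^ k) (\<beta> j)) = 0))"
    using wand[of n] by (elim exE) (rule that)
  \<comment> \<open>The second sum starts at the first power of \<open>W'\<close>, so that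
    \<open>\<beta> i\<close> is counted once; \<open>W\<close> shifts the two-sided sum onto
    itself.\<close>
  define k where "k i = (\<Sum>m. (W ^^ m) (\<beta> i)) + (\<Sum>m. (W' ^^ Suc m) (\<beta> i))" for i
  have bl: "bounded_linear W" "bounded_linear W'" using W bounded_clinear_bl by auto
  have s1: "summable (\<lambda>m. (W ^^ m) (\<beta> i))" and s2: "summable (\<lambda>m. (W' ^^ m) (\<beta> i))" if "i < n" for i
    by (rule summable_norm_cancel, use w that in simp)+
  have s2': "summable (\<lambda>m. (W' ^^ Suc m) (\<beta> i))" if "i < n" for i
    by (rule summable_Suc_iff[of "\<lambda>m. (W' ^^ m) (\<beta> i)", THEN iffD2, OF s2[OF that]])
  have "W (k i) = k i" if i: "i < n" for i
  proof -
    have "W (\<Sum>m. (W ^^ m) (\<beta> i)) = (\<Sum>m. (W ^^ Suc m) (\<beta> i))"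
      by (simp add: bounded_linear.suminf[OF bl(1) s1[OF i]])
    also have "\<dots> = (\<Sum>m. (W ^^ m) (\<beta> i)) - \<beta> i"
      using suminf_split_head[OF s1[OF i]] by simp
    finally have 1: "W (\<Sum>m. (W ^^ m) (\<beta> i)) = (\<Sum>m. (W ^^ m) (\<beta> i)) - \<beta> i" .
    have "W (\<Sum>m. (W' ^^ Suc m) (\<beta> i)) = (\<Sum>m. W ((W' ^^ Suc m) (\<beta> i)))"
      by (rule bounded_linear.suminf[OF bl(1) s2'[OF i]])
    also have "\<dots> = (\<Sum>m. (W' ^^ m) (\<beta> i))" by (simp add: W(3))
    also have "\<dots> = \<beta> i + (\<Sum>m. (W' ^^ Suc m) (\<beta> i))"
      using suminf_split_head[OF s2[OF i]] by simp
    finally show ?thesis using 1 by (simp add: k_def bounded_clinear_add[OF W(1)])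
  qed
  moreover have "e i (k j) = (if i = j then 1 else 0)" if i: "i < n" and j: "j < n" for i j
  proof -
    have ebl: "bounded_linear (e i)"
      using w i by (intro bounded_linear_intro[where K = 1])
        (auto simp: cfunctional_def scaleC_of_real[symmetric] scaleR_conv_of_real)
    have z: "e i ((W ^^ Suc m) (\<beta> j)) = 0" "e i ((W' ^^ Suc m) (\<beta> j)) = 0" for m
      using w i j by blast+
    have "e i (\<Sum>m. (W ^^ m) (\<beta> j)) = e i (\<beta> j + (\<Sum>m. (W ^^ Suc m) (\<beta> j)))"
      using suminf_split_head[OF s1[OF j]] by simp
    also have "\<dots> = e i (\<beta> j) + (\<Sum>m. e i ((W ^^ Suc m) (\<beta> j)))"
      using s1[OF j] bounded_linear.suminf[OF ebl, of "\<lambda>m. (W ^^ Suc m) (\<beta> j)"]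
      by (simp add: linear_simps[OF ebl] summable_Suc_iff[of "\<lambda>m. (W ^^ m) (\<beta> j)", simplified])
    finally have 1: "e i (\<Sum>m. (W ^^ m) (\<beta> j)) = e i (\<beta> j)" using z(1) by simp
    have "e i (\<Sum>m. (W' ^^ Suc m) (\<beta> j)) = (\<Sum>m. e i ((W' ^^ Suc m) (\<beta> j)))"
      by (rule bounded_linear.suminf[OF ebl s2'[OF j]])
    then have 2: "e i (\<Sum>m. (W' ^^ Suc m) (\<beta> j)) = 0" by (simp only: z(2)) simp
    have "e i (k j) = e i (\<Sum>m. (W ^^ m) (\<beta> j)) + e i (\<Sum>m. (W' ^^ Suc m) (\<beta> j))"
      by (simp add: k_def linear_simps[OF ebl])
    then show ?thesis using 1 2 w i j by simp
  qed
  ultimately show "\<exists>k e. \<forall>i<n. k i - W (k i) = 0 \<and> cfunctional (e i) \<and>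
      (\<forall>j<n. e i (k j) = (if i = j then 1 else 0))"
    using w by (intro exI[of _ k] exI[of _ e]) auto
qed

lemma deficiency_wandering:
  fixes W :: "'a::complex_banach \<Rightarrow> 'a"
  assumes W: "bounded_clinear W" "bounded_clinear W'" "\<And>x. W' (W x) = x"
    and X0: "csubspace X0" "\<And>x. x \<in> X0 \<Longrightarrow> W x \<in> X0"
    and E: "finite E" "\<And>x. \<exists>x0\<in>X0. \<exists>z\<in>cspan E. x = x0 + z"
    and wand: "\<And>n::nat. \<exists>\<beta> e. \<forall>i<n. cfunctional (e i) \<and> \<beta> i \<in> X0 \<and>
      (\<forall>x\<in>X0. summable (\<lambda>k. cmod (e i ((W ^^ k) x))) \<and> summable (\<lambda>k. cmod (e i ((W' ^^ k) x)))) \<and>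
      (\<forall>j<n. e i (\<beta> j) = (if i = j then 1 else 0) \<and>
        (\<forall>k>0. e i ((W ^^ k) (\<beta> j)) = 0 \<and> e i ((W' ^^ k) (\<beta> j)) = 0))"
  shows "deficiency (\<lambda>x. x - W x) = \<infinity>"
proof (rule deficiency_infiniteI[OF _ X0(1) E])
  show "bounded_clinear (\<lambda>x. x - W x)"
    by (rule bounded_clinear_minus_fun[OF bounded_clinear_ident W(1)])
  fix n :: nat
  obtain \<beta> e where w: "\<forall>i<n. cfunctional (e i) \<and> \<beta> i \<in> X0 \<and>
      (\<forall>x\<in>X0. summable (\<lambda>k. cmod (e i ((W ^^ k) x))) \<and> summable (\<lambda>k. cmod (e i ((W' ^^ k) x)))) \<and>
      (\<forall>j<n. e i (\<beta> j) = (if i = j then 1 else 0) \<and>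
        (\<forall>k>0. e i ((W ^^ k) (\<beta> j)) = 0 \<and> e i ((W' ^^ k) (\<beta> j)) = 0))"
    using wand[of n] by (elim exE) (rule that)
  \<comment> \<open>Convergence is known only on \<open>X0\<close>. On combinations of the
    \<open>\<beta> j\<close> all terms but the one with exponent 0 vanish, so the value is read off
    directly.\<close>
  define l where "l i x = (\<Sum>m. e i ((W ^^ m) x)) + (\<Sum>m. e i ((W' ^^ Suc m) x))" for i x
  have Wn: "bounded_clinear (W ^^ k)" "bounded_clinear (W' ^^ k)" for k
    using W bounded_clinear_funpow by blast+
  have "l i (x - W x) = 0" if i: "i < n" and x: "x \<in> X0" for i x
  proof -
    have e: "cfunctional (e i)" using w i by blast
    have s1: "summable (\<lambda>k. e i ((W ^^ k) x))" and s2: "summable (\<lambda>k. e i ((W' ^^ k) x))"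
      by (rule summable_norm_cancel, use w i x in simp)+
    have "(\<lambda>m. e i ((W ^^ m) x) - e i ((W ^^ Suc m) x)) sums (e i ((W ^^ 0) x) - 0)"
      by (rule telescope_sums'[OF summable_LIMSEQ_zero[OF s1]])
    then have "(\<lambda>m. e i ((W ^^ m) (x - W x))) sums (e i x)"
      by (simp add: bounded_clinear_diff[OF Wn(1)] cfunctional_diff[OF e] funpow_swap1)
    moreover have "(\<lambda>m. e i ((W' ^^ Suc m) x) - e i ((W' ^^ m) x)) sums (0 - e i ((W' ^^ 0) x))"
      by (rule telescope_sums[OF summable_LIMSEQ_zero[OF s2]])
    then have "(\<lambda>m. e i ((W' ^^ Suc m) (x - W x))) sums (- e i x)"
    proof -
      have "(W' ^^ Suc m) (x - W x) = (W' ^^ Suc m) x - (W' ^^ m) x" for m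
      proof -
        have "(W' ^^ Suc m) (W x) = (W' ^^ m) (W' (W x))" by (simp add: funpow_swap1)
        then show ?thesis by (simp only: bounded_clinear_diff[OF Wn(2)] W(3))
      qed
      then show ?thesis
        using \<open>(\<lambda>m. e i ((W' ^^ Suc m) x) - e i ((W' ^^ m) x)) sums (0 - e i ((W' ^^ 0) x))\<close>
        by (simp only: cfunctional_diff[OF e]) simp
    qed
    ultimately show ?thesis unfolding l_def by (simp only: sums_unique[symmetric]) simp
  qed
  moreover have "l i (\<Sum>j<n. c j *\<^sub>C \<beta> j) = c i" if i: "i < n" for i c
  proof -
    have e: "cfunctional (e i)" using w i by blast
    have eV: "e i (V (\<Sum>j<n. c j *\<^sub>C \<beta> j)) = (\<Sum>j<n. c j * e i (V (\<beta> j)))" if "bounded_clinear V" for V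
      by (simp add: bounded_clinear_sum[OF that] bounded_clinear_scaleC[OF that] cfunctional_sum[OF e])
    have ez: "e i ((W ^^ Suc m) (\<beta> j)) = 0" "e i ((W' ^^ Suc m) (\<beta> j)) = 0" if "j < n" for j m
      using w i that by blast+
    have z: "e i ((W ^^ Suc m) (\<Sum>j<n. c j *\<^sub>C \<beta> j)) = 0" "e i ((W' ^^ Suc m) (\<Sum>j<n. c j *\<^sub>C \<beta> j)) = 0" for m
      unfolding eV[OF Wn(1)] eV[OF Wn(2)] by (rule sum.neutral, simp add: ez del: funpow.simps)+
    have "e i ((W ^^ m) (\<Sum>j<n. c j *\<^sub>C \<beta> j)) = 0" if "m \<notin> {0}" for m
    proof -
      have "m = Suc (m - 1)" using that by simp
      then show ?thesis using z(1)[of "m - 1"] by simp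
    qed
    from suminf_finite[of "{0}" "\<lambda>m. e i ((W ^^ m) (\<Sum>j<n. c j *\<^sub>C \<beta> j))", OF _ this]
    have "(\<Sum>m. e i ((W ^^ m) (\<Sum>j<n. c j *\<^sub>C \<beta> j))) = e i ((W ^^ 0) (\<Sum>j<n. c j *\<^sub>C \<beta> j))"
      by simp
    moreover have "e i ((W ^^ 0) (\<Sum>j<n. c j *\<^sub>C \<beta> j)) = (\<Sum>j<n. if i = j then c j else 0)"
      unfolding eV[OF Wn(1)] using w i by (intro sum.cong) auto
    ultimately show ?thesis unfolding l_def z(2) using i by simp
  qed
  ultimately show "\<exists>y e. \<forall>i<n. (\<forall>x\<in>X0. e i (x - W x) = (0::complex)) \<and>
      (\<forall>c. e i (\<Sum>j<n. c j *\<^sub>C y j) = c i)"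
    by (intro exI[of _ \<beta>] exI[of _ l]) blast
qed

section \<open>Wandering intervals\<close>

context icc_map
begin

lemma iter_partial_inv:
  assumes "x \<in> {0..1}" "k \<le> n"
  shows "(\<psi> ^^ (n - k)) ((\<phi> ^^ n) x) = (\<phi> ^^ k) x"
proof -
  have "(\<phi> ^^ n) x = (\<phi> ^^ (n - k)) ((\<phi> ^^ k) x)"
    using assms(2) by (simp add: funpow_add[symmetric, THEN fun_cong, unfolded o_def])
  then show ?thesis using iter_left_inv[OF iter_Icc[OF assms(1)]] by simp
qed

text \<open>The open fundamental interval between \<open>y\<close> and its image; minimum and
  maximum cover both directions of motion.\<close>

definition wint :: "real \<Rightarrow> real set" where
  "wint y = {x. min y (\<phi> y) < x \<and> x < max y (\<phi> y)}"

lemma wint_Icc: "y \<in> {0..1} \<Longrightarrow> x \<in> wint y \<Longrightarrow> x \<in> {0..1}"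
  using into[of y] by (auto simp: wint_def min_def max_def split: if_splits)

text \<open>Monotonicity puts \<open>\<phi> x\<close> strictly beyond \<open>\<phi> y\<close>, and
  the orbit keeps moving in that direction.\<close>

lemma wint_wandering:
  assumes y: "y \<in> {0..1}" and x: "x \<in> wint y" and n: "n > 0"
  shows "(\<phi> ^^ n) x \<notin> wint y"
proof -
  note xI = wint_Icc[OF y x]
  obtain m where m: "n = Suc m" using n gr0_implies_Suc by blast
  have \<phi>I: "\<phi> x \<in> {0..1}" by (rule into[OF xI])
  show ?thesis
  proof (cases "y \<le> \<phi> y")
    case True
    then have "y < x" "x < \<phi> y" using x by (auto simp: wint_def)
    then have "\<phi> y < \<phi> x" by (intro mono y xI)
    moreover have "\<phi> x \<le> (\<phi> ^^ m) (\<phi> x)"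
      using incseqD[OF orbit_increasing[OF xI], of 1 "Suc m"] \<open>\<phi> y < \<phi> x\<close> \<open>x < \<phi> y\<close>
      by (simp add: funpow_swap1)
    ultimately show ?thesis using True by (auto simp: wint_def m funpow_swap1)
  next
    case False
    then have "\<phi> y < x" "x < y" using x by (auto simp: wint_def)
    then have "\<phi> x < \<phi> y" by (intro mono y xI)
    moreover have "(\<phi> ^^ m) (\<phi> x) \<le> \<phi> x"
      using decseqD[OF orbit_decreasing[OF xI], of 1 "Suc m"] \<open>\<phi> x < \<phi> y\<close> \<open>\<phi> y < x\<close>
      by (simp add: funpow_swap1)
    ultimately show ?thesis using False by (auto simp: wint_def m funpow_swap1)
  qed
qed

lemma wint_not_Fix: "y \<in> {0..1} \<Longrightarrow> x \<in> wint y \<Longrightarrow> x \<notin> Fix"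
  using wint_wandering[of y x 1] by (auto simp: Fix_eq)

text \<open>Basing the interval at \<open>\<phi> y\<close> for the inverse map makes one and the
  same set wander in both time directions.\<close>

lemma wint_inverse: "y \<in> {0..1} \<Longrightarrow> icc_map.wint \<psi> (\<phi> y) = wint y"
proof -
  assume y: "y \<in> {0..1}"
  interpret i: icc_map \<psi> \<phi> by (rule inverse_map)
  show ?thesis by (auto simp: i.wint_def wint_def left_inv[OF y] min.commute max.commute)
qed

lemma omega_wint: "y \<in> {0..1} \<Longrightarrow> x \<in> wint y \<Longrightarrow> omega \<phi> x = omega \<phi> y"
  by (rule omega_between) (auto simp: wint_def)

lemma omega_inv_wint: "y \<in> {0..1} \<Longrightarrow> x \<in> wint y \<Longrightarrow> omega \<psi> x = omega \<psi> y"
proof -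
  assume y: "y \<in> {0..1}" and x: "x \<in> wint y"
  interpret i: icc_map \<psi> \<phi> by (rule inverse_map)
  show ?thesis
    using i.omega_wint[OF into[OF y]] x by (simp add: wint_inverse[OF y] omega_inv_step[OF y])
qed

text \<open>The n-th preimage of the interval lies between the n-th backward iterates of its two
  ends, which have a common limit.\<close>

lemma preimages_converge_uniformly:
  assumes y: "y \<in> {0..1}" and \<delta>: "\<delta> > 0"
  obtains N where "\<And>n x. n \<ge> N \<Longrightarrow> x \<in> {0..1} \<Longrightarrow> (\<phi> ^^ n) x \<in> wint y \<Longrightarrow> \<bar>x - omega \<psi> y\<bar> < \<delta>"
proof -
  interpret i: icc_map \<psi> \<phi> by (rule inverse_map)
  obtain N1 where N1: "\<And>n. n \<ge> N1 \<Longrightarrow> \<bar>(\<psi> ^^ n) y - omega \<psi> y\<bar> < \<delta>"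
    using metric_LIMSEQ_D[OF i.orbit_tendsto_omega[OF y] \<delta>] by (auto simp: dist_real_def)
  obtain N2 where N2: "\<And>n. n \<ge> N2 \<Longrightarrow> \<bar>(\<psi> ^^ n) (\<phi> y) - omega \<psi> y\<bar> < \<delta>"
    using metric_LIMSEQ_D[OF i.orbit_tendsto_omega[OF into[OF y]] \<delta>]
    by (auto simp: dist_real_def omega_inv_step[OF y])
  have "\<bar>x - omega \<psi> y\<bar> < \<delta>"
    if n: "n \<ge> max N1 N2" and x: "x \<in> {0..1}" "(\<phi> ^^ n) x \<in> wint y" for n x
  proof -
    have z: "(\<psi> ^^ n) ((\<phi> ^^ n) x) = x" by (rule iter_left_inv[OF x(1)])
    note mono = i.iter_mono[OF _ _ less_imp_le, of _ _ n]
    have "min ((\<psi> ^^ n) y) ((\<psi> ^^ n) (\<phi> y)) \<le> x \<and> x \<le> max ((\<psi> ^^ n) y) ((\<psi> ^^ n) (\<phi> y))"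
      using x(2) mono[of y "(\<phi> ^^ n) x"] mono[of "(\<phi> ^^ n) x" y] mono[of "\<phi> y" "(\<phi> ^^ n) x"]
        mono[of "(\<phi> ^^ n) x" "\<phi> y"] y into[OF y] iter_Icc[OF x(1), of n] z
      by (auto simp: wint_def min_def max_def split: if_splits)
    then show ?thesis using N1[of n] N2[of n] n by (auto simp: min_def max_def split: if_splits)
  qed
  then show ?thesis by (rule that)
qed

end

section \<open>The operator \<open>A\<close> and its one-sided inverses from orbit sums\<close>

locale weighted0 = icc_map +
  fixes a :: "real \<Rightarrow> complex"
  assumes cont_a: "continuous_on {0..1} a" and a_nonzero: "x \<in> {0..1} \<Longrightarrow> a x \<noteq> 0"
begin

abbreviation A where "A \<equiv> wcomp0 \<phi> a"
abbreviation A' where "A' \<equiv> wcomp0 \<psi> (\<lambda>x. 1 / a (\<psi> x))"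

lemma inverse_weighted: "weighted0 \<psi> \<phi> (\<lambda>x. 1 / a (\<psi> x))"
proof -
  interpret i: icc_map \<psi> \<phi> by (rule inverse_map)
  show ?thesis
  proof
    show "continuous_on {0..1} (\<lambda>x. 1 / a (\<psi> x))"
      by (intro continuous_intros continuous_on_compose2[OF cont_a cont_inv])
        (use into_inv a_nonzero in blast)+
    show "1 / a (\<psi> x) \<noteq> 0" if "x \<in> {0..1}" for x using a_nonzero[OF into_inv[OF that]] by simp
  qed
qed

lemma C0_fun_A: "x \<in> {0..1} \<Longrightarrow> C0_fun (A g) x = a x * C0_fun g (\<phi> x)"
  unfolding wcomp0_def
  by (rule C0_fun_mk_C0)
    (auto intro!: continuous_intros cont_a continuous_on_compose2[OF continuous_on_C0_fun cont]
      dest: into simp del: atLeastAtMost_iff)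

lemma bounded_clinear_A: "bounded_clinear A"
proof (rule bounded_clinearI[where K = "norm (mk_C0 a)"])
  fix f g :: C0_Icc and c
  show "A (f + g) = A f + A g" "A (c *\<^sub>C f) = c *\<^sub>C A f"
    by (rule C0_eqI; simp add: C0_fun_A algebra_simps)+
  show "norm (A f) \<le> norm (mk_C0 a) * norm f"
  proof (rule C0_norm_least)
    fix x :: real assume x: "x \<in> {0..1}"
    have "cmod (a x) \<le> norm (mk_C0 a)"
      using C0_norm_bound[of "mk_C0 a" x] C0_fun_mk_C0[OF cont_a x] by simp
    then show "cmod (C0_fun (A f) x) \<le> norm (mk_C0 a) * norm f"
      using x by (simp add: C0_fun_A norm_mult mult_mono C0_norm_bound)
  qed
qed

lemma A_inverse: "A (A' g) = g" "A' (A g) = g"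
proof -
  interpret i: weighted0 \<psi> \<phi> "\<lambda>x. 1 / a (\<psi> x)" by (rule inverse_weighted)
  show "A (A' g) = g"
    by (rule C0_eqI) (simp add: C0_fun_A i.C0_fun_A into left_inv a_nonzero del: atLeastAtMost_iff)
  show "A' (A g) = g"
    by (rule C0_eqI) (simp add: C0_fun_A i.C0_fun_A into_inv right_inv a_nonzero del: atLeastAtMost_iff)
qed

definition cocycle :: "nat \<Rightarrow> real \<Rightarrow> complex" where
  "cocycle n x = (\<Prod>k<n. a ((\<phi> ^^ k) x))"

lemma C0_fun_A_iter:
  "x \<in> {0..1} \<Longrightarrow> C0_fun ((A ^^ n) g) x = cocycle n x * C0_fun g ((\<phi> ^^ n) x)"
proof (induction n arbitrary: x)
  case (Suc n)
  have 1: "C0_fun ((A ^^ Suc n) g) x = a x * (cocycle n (\<phi> x) * C0_fun g ((\<phi> ^^ n) (\<phi> x)))"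
    using Suc.IH[OF into[OF Suc.prems]] by (simp add: C0_fun_A[OF Suc.prems])
  have 2: "cocycle (Suc n) x = a x * cocycle n (\<phi> x)"
    unfolding cocycle_def prod.lessThan_Suc_shift by (simp add: funpow_swap1)
  show ?case unfolding 1 2 by (simp add: funpow_swap1 mult.assoc)
qed (simp add: cocycle_def)

lemma cont_cmod_a: "continuous_on {0..1} (\<lambda>x. cmod (a x))"
  by (intro continuous_intros cont_a)

lemma weight_tendsto_omega:
  "x \<in> {0..1} \<Longrightarrow> (\<lambda>n. cmod (a ((\<phi> ^^ n) x))) \<longlonglongrightarrow> cmod (a (omega \<phi> x))"
  by (rule continuous_on_tendsto_compose[OF cont_cmod_a orbit_tendsto_omega omega_Icc])
    (auto simp: iter_Icc simp del: atLeastAtMost_iff)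

text \<open>\<open>L\<close> is the sum of \<eta> times the powers of \<open>A\<close>, which
  telescopes on \<open>g - A g\<close>. The cutoff \<eta> restricts evaluation to points of
  \<open>E\<close>, where the cocycle decays uniformly.\<close>

lemma left_orbit_sum:
  assumes E: "compact E" "E \<subseteq> {0..1}" "\<phi> ` E \<subseteq> E" "\<And>y. y \<in> E \<Longrightarrow> cmod (a (omega \<phi> y)) < 1"
    and \<eta>: "\<And>x. x \<in> {0..1} \<Longrightarrow> C0_fun \<eta> x \<noteq> 0 \<Longrightarrow> x \<in> E"
  obtains L where "bounded_clinear L" "\<And>g. L (g - A g) = mult_C0 \<eta> g"
proof -
  obtain C \<theta> where C: "0 \<le> \<theta>" "\<theta> < 1"
    "\<And>n y. y \<in> E \<Longrightarrow> (\<Prod>k<n. cmod (a ((\<phi> ^^ k) y))) \<le> C * \<theta> ^ n"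
  proof (rule uniform_exponential_decay[OF E(1) continuous_on_subset[OF cont E(2)] E(3)
        continuous_on_subset[OF cont_cmod_a E(2)]])
    show "(\<lambda>n. \<Prod>k<n. cmod (a ((\<phi> ^^ k) y))) \<longlonglongrightarrow> 0" if "y \<in> E" for y
      using that E(2) by (intro prod_tendsto_zero[OF weight_tendsto_omega E(4)]) auto
  qed auto
  define U where "U n h = mult_C0 \<eta> ((A ^^ n) h)" for n h
  have Ub: "bounded_clinear (U n)" for n
    unfolding U_def by (rule bounded_clinear_compose[OF bounded_clinear_mult_C0 bounded_clinear_funpow[OF
      bounded_clinear_A]])
  have Un: "norm (U n h) \<le> norm \<eta> * (C * \<theta> ^ n) * norm h" for n h
  proof (rule C0_norm_least)
    fix x :: real assume x: "x \<in> {0..1}"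
    show "cmod (C0_fun (U n h) x) \<le> norm \<eta> * (C * \<theta> ^ n) * norm h"
    proof (cases "C0_fun \<eta> x = 0")
      case True
      \<comment> \<open>\<open>C\<close> could be negative if \<open>E\<close> is empty, but then
        \<eta> is 0.\<close>
      have "0 \<le> C * \<theta> ^ n" if "y \<in> E" for y using order_trans[OF prod_nonneg C(3)[OF that]] by auto
      moreover have "norm \<eta> = 0 \<or> E \<noteq> {}"
      proof (cases "E = {}")
        case True
        then have "\<eta> = 0" using \<eta> by (intro C0_eqI) auto
        then show ?thesis by simp
      qed simp
      ultimately have "0 \<le> norm \<eta> * (C * \<theta> ^ n)"
        by (metis all_not_in_conv mult_nonneg_nonneg mult_zero_left norm_ge_zero order_refl)
      then show ?thesis using True by (simp add: U_def C0_fun_mult)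
    next
      case False
      have "cmod (cocycle n x) \<le> C * \<theta> ^ n"
        using C(3)[OF \<eta>[OF x False], of n] by (simp add: cocycle_def prod_norm)
      then have "cmod (C0_fun \<eta> x) * (cmod (cocycle n x) * cmod (C0_fun h ((\<phi> ^^ n) x))) \<le>
          norm \<eta> * ((C * \<theta> ^ n) * norm h)"
        by (intro mult_mono C0_norm_bound) (auto intro: order_trans[OF norm_ge_zero])
      then show ?thesis by (simp add: U_def C0_fun_mult C0_fun_A_iter[OF x] norm_mult mult.assoc)
    qed
  qed
  have M: "summable (\<lambda>n. norm \<eta> * (C * \<theta> ^ n))"
    using C by (intro summable_mult summable_geometric) auto
  note S = bounded_clinear_suminf[OF Ub Un M]
  have "(\<Sum>n. U n (g - A g)) = mult_C0 \<eta> g" for g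
  proof -
    have "(\<lambda>n. U n g - U (Suc n) g) sums (U 0 g - 0)"
      by (rule telescope_sums'[OF summable_LIMSEQ_zero[OF S(2)]])
    moreover have "U n g - U (Suc n) g = U n (g - A g)" for n
      unfolding bounded_clinear_diff[OF Ub] by (simp add: U_def funpow_swap1)
    ultimately have "(\<lambda>n. U n (g - A g)) sums (U 0 g - 0)" by simp
    then show ?thesis by (simp add: sums_unique[symmetric]) (simp add: U_def)
  qed
  then show ?thesis by (rule that[OF S(1)])
qed

text \<open>Now the cutoff is applied before the powers of \<open>A\<close>, so the n-th iterate of
  the point lies in \<open>E\<close>. The cocycle is therefore rewritten as a product along the
  backward orbit of that iterate.\<close>

lemma right_orbit_sum:
  assumes E: "compact E" "E \<subseteq> {0..1}" "\<psi> ` E \<subseteq> E" "\<And>y. y \<in> E \<Longrightarrow> cmod (a (omega \<psi> y)) < 1"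
    and \<eta>: "\<And>x. x \<in> {0..1} \<Longrightarrow> C0_fun \<eta> x \<noteq> 0 \<Longrightarrow> x \<in> E"
  obtains R where "bounded_clinear R" "\<And>h. R h - A (R h) = mult_C0 \<eta> h"
proof -
  interpret i: icc_map \<psi> \<phi> by (rule inverse_map)
  have cb: "continuous_on {0..1} (\<lambda>y. cmod (a (\<psi> y)))"
    by (rule continuous_on_compose2[OF cont_cmod_a cont_inv]) (use into_inv in blast)
  obtain C \<theta> where C: "0 \<le> \<theta>" "\<theta> < 1"
    "\<And>n y. y \<in> E \<Longrightarrow> (\<Prod>k<n. cmod (a (\<psi> ((\<psi> ^^ k) y)))) \<le> C * \<theta> ^ n"
  proof (rule uniform_exponential_decay[OF E(1) continuous_on_subset[OF cont_inv E(2)] E(3)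
        continuous_on_subset[OF cb E(2)]])
    fix y assume y: "y \<in> E"
    then have yI: "y \<in> {0..1}" using E(2) by blast
    have "(\<lambda>n. cmod (a ((\<psi> ^^ n) (\<psi> y)))) \<longlonglongrightarrow> cmod (a (omega \<psi> (\<psi> y)))"
      by (rule continuous_on_tendsto_compose[OF cont_cmod_a i.orbit_tendsto_omega i.omega_Icc])
        (auto simp: i.into[OF yI] i.iter_Icc[OF i.into[OF yI]] simp del: atLeastAtMost_iff)
    then have "(\<lambda>n. cmod (a (\<psi> ((\<psi> ^^ n) y)))) \<longlonglongrightarrow> cmod (a (omega \<psi> y))"
      by (simp add: funpow_swap1 i.omega_step[OF yI])
    then show "(\<lambda>n. \<Prod>k<n. cmod (a (\<psi> ((\<psi> ^^ k) y)))) \<longlonglongrightarrow> 0"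
      by (rule prod_tendsto_zero[OF _ E(4)[OF y]]) simp
  qed auto
  have coc: "cmod (cocycle n x) \<le> C * \<theta> ^ n" if x: "x \<in> {0..1}" "(\<phi> ^^ n) x \<in> E" for n x
  proof -
    have "cmod (cocycle n x) = (\<Prod>k<n. cmod (a ((\<phi> ^^ k) x)))" by (simp add: cocycle_def prod_norm)
    \<comment> \<open>Each factor is expressed through the end point of the orbit segment; the order
      of the factors is reversed next.\<close>
    also have "\<dots> = (\<Prod>k<n. cmod (a (\<psi> ((\<psi> ^^ (n - Suc k)) ((\<phi> ^^ n) x)))))"
    proof (rule prod.cong)
      fix k assume "k \<in> {..<n}"
      then have "\<psi> ((\<psi> ^^ (n - Suc k)) ((\<phi> ^^ n) x)) = (\<phi> ^^ k) x"
        using iter_partial_inv[OF x(1), of "Suc k" n] left_inv[OF iter_Icc[OF x(1), of k]] by simp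
      then show "cmod (a ((\<phi> ^^ k) x)) = cmod (a (\<psi> ((\<psi> ^^ (n - Suc k)) ((\<phi> ^^ n) x))))" by simp
    qed simp
    also have "\<dots> = (\<Prod>k<n. cmod (a (\<psi> ((\<psi> ^^ k) ((\<phi> ^^ n) x)))))"
      by (rule prod.nat_diff_reindex)
    also have "\<dots> \<le> C * \<theta> ^ n" by (rule C(3)[OF x(2)])
    finally show ?thesis .
  qed
  define U where "U n h = (A ^^ n) (mult_C0 \<eta> h)" for n h
  have Ub: "bounded_clinear (U n)" for n
    unfolding U_def by (rule bounded_clinear_compose[OF bounded_clinear_funpow[OF bounded_clinear_A]
      bounded_clinear_mult_C0])
  have Un: "norm (U n h) \<le> norm \<eta> * \<bar>C\<bar> * \<theta> ^ n * norm h" for n h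
  proof (rule C0_norm_least)
    fix x :: real assume x: "x \<in> {0..1}"
    show "cmod (C0_fun (U n h) x) \<le> norm \<eta> * \<bar>C\<bar> * \<theta> ^ n * norm h"
    proof (cases "C0_fun \<eta> ((\<phi> ^^ n) x) = 0")
      case True
      then show ?thesis using C(1) by (simp add: U_def C0_fun_A_iter[OF x] C0_fun_mult)
    next
      case False
      have "cmod (cocycle n x) \<le> C * \<theta> ^ n" by (rule coc[OF x \<eta>[OF iter_Icc[OF x] False]])
      also have "\<dots> \<le> \<bar>C\<bar> * \<theta> ^ n" using C(1) by (intro mult_right_mono) auto
      finally have "cmod (cocycle n x) * (cmod (C0_fun \<eta> ((\<phi> ^^ n) x)) * cmod (C0_fun h ((\<phi> ^^ n) x))) \<le>
          \<bar>C\<bar> * \<theta> ^ n * (norm \<eta> * norm h)"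
        using C(1) by (intro mult_mono C0_norm_bound) auto
      then show ?thesis by (simp add: U_def C0_fun_mult C0_fun_A_iter[OF x] norm_mult ac_simps)
    qed
  qed
  have M: "summable (\<lambda>n. norm \<eta> * \<bar>C\<bar> * \<theta> ^ n)"
    using C by (intro summable_mult summable_geometric) auto
  note S = bounded_clinear_suminf[OF Ub Un M]
  have "(\<Sum>n. U n h) - A (\<Sum>n. U n h) = mult_C0 \<eta> h" for h
  proof -
    have "A (\<Sum>n. U n h) = (\<Sum>n. U (Suc n) h)"
      using bounded_linear.suminf[OF bounded_clinear_bl[OF bounded_clinear_A] S(2), of h]
      by (simp add: U_def)
    then show ?thesis using suminf_split_head[OF S(2), of h] by (simp add: U_def)
  qed
  then show ?thesis by (rule that[OF S(1)])
qed

text \<open>Normalised to the spectral value 1; other nonzero values are reached by scaling the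
  weight.\<close>

definition noncritical :: bool where
  "noncritical \<longleftrightarrow> (\<forall>p\<in>Fix. a p \<noteq> 1) \<and> (\<forall>p\<in>bdFix. cmod (a p) \<noteq> 1)"

definition expanding_gap :: bool where
  "expanding_gap \<longleftrightarrow> (\<exists>y\<in>{0..1}. y \<notin> Fix \<and> cmod (a (omega \<psi> y)) < 1 \<and> 1 < cmod (a (omega \<phi> y)))"

definition contracting_gap :: bool where
  "contracting_gap \<longleftrightarrow> (\<exists>y\<in>{0..1}. y \<notin> Fix \<and> cmod (a (omega \<phi> y)) < 1 \<and> 1 < cmod (a (omega \<psi> y)))"

text \<open>On fixed points \<open>I - A\<close> is multiplication by \<open>1 - a\<close>, so it is
  inverted there by this quotient; vanishing on \<open>bdFix\<close> allows the extension by
  0.\<close>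

lemma quotient_on_Fix:
  assumes a1: "\<forall>p\<in>Fix. a p \<noteq> 1" and c: "continuous_on {0..1} c" "\<And>p. p \<in> bdFix \<Longrightarrow> c p = (0::real)"
  shows "continuous_on {0..1} (\<lambda>x. if x \<in> Fix then complex_of_real (c x) / (1 - a x) else 0)"
proof (rule continuous_on_extend_Fix)
  have "Fix \<subseteq> {0..1}" using Fix_Icc by blast
  then show "continuous_on Fix (\<lambda>x. complex_of_real (c x) / (1 - a x))"
    using a1 by (intro continuous_intros continuous_on_subset[OF c(1)] continuous_on_subset[OF cont_a]) auto
qed (simp add: c(2))

text \<open>Three pieces, one for each cutoff: the forward orbit sum on \<open>E1\<close>; on
  \<open>E2\<close>, the orbit sum for the inverse operator, using
  \<open>A' (g - A g) = - (g - A' g)\<close>; and division by \<open>1 - a\<close> on the fixed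
  points.\<close>

lemma left_inverse:
  assumes nc: noncritical and ng: "\<not> expanding_gap"
  obtains L where "bounded_clinear L" "\<And>g. L (g - A g) = g"
proof -
  interpret i: weighted0 \<psi> \<phi> "\<lambda>x. 1 / a (\<psi> x)" by (rule inverse_weighted)
  obtain c1 c2 c3 E1 E2 where
    c: "continuous_on {0..1} c1" "continuous_on {0..1} c2" "continuous_on {0..1} c3"
      "\<And>x. x \<in> {0..1} \<Longrightarrow> c1 x + c2 x + c3 x = (1::real)"
    and E1: "compact E1" "E1 \<subseteq> {0..1}" "\<phi> ` E1 \<subseteq> E1" "\<And>y. y \<in> E1 \<Longrightarrow> cmod (a (omega \<phi> y)) < 1"
      "\<And>x. x \<in> {0..1} \<Longrightarrow> c1 x \<noteq> 0 \<Longrightarrow> x \<in> E1"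
    and E2: "compact E2" "E2 \<subseteq> {0..1}" "\<psi> ` E2 \<subseteq> E2" "\<And>y. y \<in> E2 \<Longrightarrow> cmod (a (omega \<psi> y)) > 1"
      "\<And>x. x \<in> {0..1} \<Longrightarrow> c2 x \<noteq> 0 \<Longrightarrow> x \<in> E2"
    and c3: "\<And>x. x \<in> {0..1} \<Longrightarrow> c3 x \<noteq> 0 \<Longrightarrow> x \<in> Fix" "\<And>p. p \<in> bdFix \<Longrightarrow> c3 p = 0"
    by (rule cutoffs[OF cont_cmod_a]) (use nc ng in \<open>auto simp: noncritical_def expanding_gap_def\<close>)
  define \<eta>1 where "\<eta>1 = mk_C0 (\<lambda>x. complex_of_real (c1 x))"
  define \<eta>2 where "\<eta>2 = mk_C0 (\<lambda>x. complex_of_real (c2 x))"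
  define \<eta>3 where "\<eta>3 = mk_C0 (\<lambda>x. if x \<in> Fix then complex_of_real (c3 x) / (1 - a x) else 0)"
  have \<eta>1: "C0_fun \<eta>1 x = complex_of_real (c1 x)" if "x \<in> {0..1}" for x
    unfolding \<eta>1_def by (rule C0_fun_mk_C0[OF _ that]) (intro continuous_intros c)
  have \<eta>2: "C0_fun \<eta>2 x = complex_of_real (c2 x)" if "x \<in> {0..1}" for x
    unfolding \<eta>2_def by (rule C0_fun_mk_C0[OF _ that]) (intro continuous_intros c)
  have \<eta>3: "C0_fun \<eta>3 x = (if x \<in> Fix then complex_of_real (c3 x) / (1 - a x) else 0)" if "x \<in> {0..1}" for x
    unfolding \<eta>3_def
    by (rule C0_fun_mk_C0[OF quotient_on_Fix[OF _ c(3) c3(2)] that]) (use nc in \<open>auto simp: noncritical_def\<close>)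
  obtain L1 where L1: "bounded_clinear L1" "\<And>g. L1 (g - A g) = mult_C0 \<eta>1 g"
    by (rule left_orbit_sum[OF E1(1-4), of \<eta>1]) (use \<eta>1 E1(5) in auto)
  obtain L2 where L2: "bounded_clinear L2" "\<And>g. L2 (g - A' g) = mult_C0 \<eta>2 g"
  proof (rule i.left_orbit_sum[OF E2(1-3), of \<eta>2])
    fix y assume y: "y \<in> E2"
    have "\<psi> (omega \<psi> y) = omega \<psi> y" using y E2(2) i.omega_Fix i.Fix_eq by blast
    then show "cmod (1 / a (\<psi> (omega \<psi> y))) < 1"
      by (simp only:) (rule cmod_inverse_less[OF E2(4)[OF y]])
  qed (use \<eta>2 E2(5) in auto)
  define L where "L h = L1 h - L2 (A' h) + mult_C0 \<eta>3 h" for h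
  have "bounded_clinear L" unfolding L_def
    by (intro bounded_clinear_plus bounded_clinear_minus_fun L1 bounded_clinear_compose[OF L2(1)
      i.bounded_clinear_A]
        bounded_clinear_mult_C0)
  moreover have "L (g - A g) = g" for g
  proof -
    have "A' (g - A g) = - (g - A' g)"
      by (simp add: bounded_clinear_diff[OF i.bounded_clinear_A] A_inverse)
    then have "L2 (A' (g - A g)) = - mult_C0 \<eta>2 g"
      by (simp only: bounded_clinear_minus[OF L2(1)] L2(2))
    then have Lg: "L (g - A g) = mult_C0 \<eta>1 g + mult_C0 \<eta>2 g + mult_C0 \<eta>3 (g - A g)"
      by (simp add: L_def L1(2))
    show ?thesis
    proof (rule C0_eqI)
      fix x :: real assume x: "x \<in> {0..1}"
      have "C0_fun \<eta>3 x * (C0_fun g x - a x * C0_fun g (\<phi> x)) = complex_of_real (c3 x) * C0_fun g x"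
      proof (cases "x \<in> Fix")
        case True
        then have "1 - a x \<noteq> 0" using nc by (auto simp: noncritical_def)
        then show ?thesis using True by (simp add: \<eta>3[OF x] Fix_eq field_simps)
      next
        case False
        then show ?thesis using c3(1)[OF x] by (auto simp: \<eta>3[OF x])
      qed
      then have "C0_fun (L (g - A g)) x =
          (complex_of_real (c1 x) + complex_of_real (c2 x) + complex_of_real (c3 x)) * C0_fun g x"
        using x by (simp add: Lg C0_fun_mult C0_fun_A \<eta>1 \<eta>2 algebra_simps del: atLeastAtMost_iff)
      also have "complex_of_real (c1 x) + complex_of_real (c2 x) + complex_of_real (c3 x) = 1"
        using c(4)[OF x] by (metis of_real_1 of_real_add)
      finally show "C0_fun (L (g - A g)) x = C0_fun g x" by simp
    qed
  qed
  ultimately show ?thesis by (rule that)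
qed

text \<open>Right orbit sums require decay along backward orbits, so the cutoffs are taken for the
  inverse map; this is why the excluded gaps are the contracting ones.\<close>

lemma right_inverse:
  assumes nc: noncritical and ng: "\<not> contracting_gap"
  obtains R where "bounded_clinear R" "\<And>h. R h - A (R h) = h"
proof -
  interpret i: weighted0 \<psi> \<phi> "\<lambda>x. 1 / a (\<psi> x)" by (rule inverse_weighted)
  obtain c1 c2 c3 E1 E2 where
    c: "continuous_on {0..1} c1" "continuous_on {0..1} c2" "continuous_on {0..1} c3"
      "\<And>x. x \<in> {0..1} \<Longrightarrow> c1 x + c2 x + c3 x = (1::real)"
    and E1: "compact E1" "E1 \<subseteq> {0..1}" "\<psi> ` E1 \<subseteq> E1" "\<And>y. y \<in> E1 \<Longrightarrow> cmod (a (omega \<psi> y)) < 1"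
      "\<And>x. x \<in> {0..1} \<Longrightarrow> c1 x \<noteq> 0 \<Longrightarrow> x \<in> E1"
    and E2: "compact E2" "E2 \<subseteq> {0..1}" "\<phi> ` E2 \<subseteq> E2" "\<And>y. y \<in> E2 \<Longrightarrow> cmod (a (omega \<phi> y)) > 1"
      "\<And>x. x \<in> {0..1} \<Longrightarrow> c2 x \<noteq> 0 \<Longrightarrow> x \<in> E2"
    and c3: "\<And>x. x \<in> {0..1} \<Longrightarrow> c3 x \<noteq> 0 \<Longrightarrow> x \<in> i.Fix" "\<And>p. p \<in> i.bdFix \<Longrightarrow> c3 p = 0"
    by (rule i.cutoffs[OF cont_cmod_a])
      (use nc ng in \<open>auto simp: noncritical_def contracting_gap_def Fix_inverse bdFix_inverse\<close>)
  define \<eta>1 where "\<eta>1 = mk_C0 (\<lambda>x. complex_of_real (c1 x))"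
  define \<eta>2 where "\<eta>2 = mk_C0 (\<lambda>x. complex_of_real (c2 x))"
  define \<eta>3 where "\<eta>3 = mk_C0 (\<lambda>x. if x \<in> Fix then complex_of_real (c3 x) / (1 - a x) else 0)"
  have \<eta>1: "C0_fun \<eta>1 x = complex_of_real (c1 x)" if "x \<in> {0..1}" for x
    unfolding \<eta>1_def by (rule C0_fun_mk_C0[OF _ that]) (intro continuous_intros c)
  have \<eta>2: "C0_fun \<eta>2 x = complex_of_real (c2 x)" if "x \<in> {0..1}" for x
    unfolding \<eta>2_def by (rule C0_fun_mk_C0[OF _ that]) (intro continuous_intros c)
  have \<eta>3: "C0_fun \<eta>3 x = (if x \<in> Fix then complex_of_real (c3 x) / (1 - a x) else 0)" if "x \<in> {0..1}" for x
    unfolding \<eta>3_def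
    by (rule C0_fun_mk_C0[OF quotient_on_Fix[OF _ c(3) c3(2)[unfolded bdFix_inverse]] that])
      (use nc in \<open>auto simp: noncritical_def\<close>)
  obtain R1 where R1: "bounded_clinear R1" "\<And>h. R1 h - A (R1 h) = mult_C0 \<eta>1 h"
    by (rule right_orbit_sum[OF E1(1-4), of \<eta>1]) (use \<eta>1 E1(5) in auto)
  obtain R2 where R2: "bounded_clinear R2" "\<And>h. R2 h - A' (R2 h) = mult_C0 \<eta>2 h"
  proof (rule i.right_orbit_sum[OF E2(1-3), of \<eta>2])
    fix y assume y: "y \<in> E2"
    have "\<psi> (omega \<phi> y) = omega \<phi> y" using y E2(2) omega_Fix Fix_eq_inv by blast
    then show "cmod (1 / a (\<psi> (omega \<phi> y))) < 1"
      by (simp only:) (rule cmod_inverse_less[OF E2(4)[OF y]])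
  qed (use \<eta>2 E2(5) in auto)
  define R where "R h = R1 h - A' (R2 h) + mult_C0 \<eta>3 h" for h
  have "bounded_clinear R" unfolding R_def
    by (intro bounded_clinear_plus bounded_clinear_minus_fun R1 bounded_clinear_compose[OF
      i.bounded_clinear_A R2(1)]
        bounded_clinear_mult_C0)
  moreover have "R h - A (R h) = h" for h
  proof -
    have "R h - A (R h) = (R1 h - A (R1 h)) + (R2 h - A' (R2 h)) + (mult_C0 \<eta>3 h - A (mult_C0 \<eta>3 h))"
      by (simp add: R_def bounded_clinear_rules[OF bounded_clinear_A] A_inverse algebra_simps)
    then have Rh: "R h - A (R h) = mult_C0 \<eta>1 h + mult_C0 \<eta>2 h + (mult_C0 \<eta>3 h - A (mult_C0 \<eta>3 h))"
      by (simp only: R1(2) R2(2))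
    show ?thesis
    proof (rule C0_eqI)
      fix x :: real assume x: "x \<in> {0..1}"
      have "C0_fun \<eta>3 x * C0_fun h x - a x * (C0_fun \<eta>3 (\<phi> x) * C0_fun h (\<phi> x)) =
        complex_of_real (c3 x) * C0_fun h x"
      proof (cases "x \<in> Fix")
        case True
        then have "1 - a x \<noteq> 0" using nc by (auto simp: noncritical_def)
        then have "C0_fun \<eta>3 x * (1 - a x) = complex_of_real (c3 x)" using True by (simp add: \<eta>3[OF x])
        then show ?thesis using True
          by (simp add: Fix_eq algebra_simps) (metis (no_types, lifting) distrib_left mult.assoc mult.commute)
      next
        case False
        then have "\<phi> x \<notin> Fix" using image_Fix_iff[OF x] by simp
        then show ?thesis using False c3(1)[OF x]
          by (auto simp: \<eta>3[OF x] \<eta>3[OF into[OF x]] Fix_inverse)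
      qed
      then have "C0_fun (R h - A (R h)) x =
          (complex_of_real (c1 x) + complex_of_real (c2 x) + complex_of_real (c3 x)) * C0_fun h x"
        using x by (simp add: Rh C0_fun_mult C0_fun_A \<eta>1 \<eta>2 algebra_simps del: atLeastAtMost_iff)
      also have "complex_of_real (c1 x) + complex_of_real (c2 x) + complex_of_real (c3 x) = 1"
        using c(4)[OF x] by (metis of_real_1 of_real_add)
      finally show "C0_fun (R h - A (R h)) x = C0_fun h x" by simp
    qed
  qed
  ultimately show ?thesis by (rule that)
qed

section \<open>Wandering bumps, infinite nullity and infinite deficiency of
  \<open>I - A\<close>\<close>

text \<open>The n-th power moves the support to the n-th preimage of the wandering interval, which
  shrinks to the backward limit. There \<open>cmod a\<close> is at most \<theta>, so from some n on
  each step multiplies the norm by at most \<theta>.\<close>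

lemma summable_A_iter:
  assumes y: "y \<in> {0..1}" and p: "cmod (a (omega \<psi> y)) < 1"
    and supp: "\<And>x. C0_fun g x \<noteq> 0 \<Longrightarrow> x \<in> wint y"
  shows "summable (\<lambda>n. norm ((A ^^ n) g))"
proof -
  interpret i: icc_map \<psi> \<phi> by (rule inverse_map)
  let ?p = "omega \<psi> y"
  have pI: "?p \<in> {0..1}" by (rule i.omega_Icc[OF y])
  obtain \<theta> where \<theta>: "cmod (a ?p) < \<theta>" "\<theta> < 1" using dense[OF p] by blast
  obtain \<delta> where \<delta>: "\<delta> > 0" "\<And>x. x \<in> {0..1} \<Longrightarrow> \<bar>x - ?p\<bar> < \<delta> \<Longrightarrow> \<bar>cmod (a x) - cmod (a ?p)\<bar> < \<theta> - cmod (a ?p)"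
    using cont_cmod_a[unfolded continuous_on_iff dist_real_def] pI \<theta>(1) by (metis diff_gt_0_iff_gt)
  obtain N where N: "\<And>n x. n \<ge> N \<Longrightarrow> x \<in> {0..1} \<Longrightarrow> (\<phi> ^^ n) x \<in> wint y \<Longrightarrow> \<bar>x - ?p\<bar> < \<delta>"
    using preimages_converge_uniformly[OF y \<delta>(1)] by blast
  have "\<theta> \<ge> 0" using \<theta>(1) norm_ge_zero less_imp_le order_trans by blast
  show ?thesis
  proof (rule summable_ratio_test[OF \<theta>(2)])
    fix n assume n: "n \<ge> N"
    have "norm ((A ^^ Suc n) g) \<le> \<theta> * norm ((A ^^ n) g)"
    proof (rule C0_norm_least)
      fix x :: real assume x: "x \<in> {0..1}"
      show "cmod (C0_fun ((A ^^ Suc n) g) x) \<le> \<theta> * norm ((A ^^ n) g)"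
      proof (cases "C0_fun g ((\<phi> ^^ Suc n) x) = 0")
        case True
        then have "C0_fun ((A ^^ Suc n) g) x = 0" by (simp only: C0_fun_A_iter[OF x]) simp
        then show ?thesis using \<open>\<theta> \<ge> 0\<close> by simp
      next
        case False
        then have "\<bar>x - ?p\<bar> < \<delta>" using n by (intro N[of "Suc n"] x supp) auto
        then have "cmod (a x) \<le> \<theta>" using \<delta>(2)[OF x] by linarith
        then show ?thesis
          using \<open>\<theta> \<ge> 0\<close> by (simp add: C0_fun_A[OF x] norm_mult mult_mono C0_norm_bound)
      qed
    qed
    then show "norm (norm ((A ^^ Suc n) g)) \<le> \<theta> * norm (norm ((A ^^ n) g))" by simp
  qed
qed

lemma summable_A_iter_point:
  assumes x: "x \<in> {0..1}" and q: "cmod (a (omega \<phi> x)) < 1"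
  shows "summable (\<lambda>n. cmod (C0_fun ((A ^^ n) g) x))"
proof -
  have "summable (\<lambda>n. norm (cocycle n x))"
    by (rule summable_ratio_limit[OF weight_tendsto_omega[OF x] q]) (simp add: cocycle_def norm_mult)
  then have "summable (\<lambda>n. norm (cocycle n x) * norm g)" by (rule summable_mult2)
  then show ?thesis
    by (rule summable_comparison_test')
      (simp add: C0_fun_A_iter[OF x] norm_mult mult_left_mono C0_norm_bound)
qed

text \<open>Wandering separates the bumps from all proper iterates of the points. The bumps are
  continuously differentiable so that one system serves both operators.\<close>

lemma wint_bumps:
  assumes y: "y \<in> {0..1}" "y \<notin> Fix"
  shows "\<exists>(x :: nat \<Rightarrow> real) (\<beta> :: nat \<Rightarrow> C1_Icc). (\<forall>i<n. x i \<in> wint y) \<and>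
    (\<forall>i<n. \<forall>j<n. C1_fun (\<beta> i) (x j) = (if i = j then 1 else 0)) \<and>
    (\<forall>i<n. \<forall>z. C1_fun (\<beta> i) z \<noteq> 0 \<longrightarrow> z \<in> wint y) \<and>
    (\<forall>i<n. \<forall>j<n. \<forall>k>0. C1_fun (\<beta> i) ((\<phi> ^^ k) (x j)) = 0 \<and> C1_fun (\<beta> i) ((\<psi> ^^ k) (x j)) = 0)"
proof -
  interpret i: icc_map \<psi> \<phi> by (rule inverse_map)
  have "\<phi> y \<noteq> y" using y by (auto simp: Fix_def)
  then have "0 \<le> min y (\<phi> y)" "min y (\<phi> y) < max y (\<phi> y)" "max y (\<phi> y) \<le> 1"
    using y(1) into[OF y(1)] by auto
  from exists_bumps[OF this, of n]
  obtain x :: "nat \<Rightarrow> real" and \<beta> :: "nat \<Rightarrow> C1_Icc" where b: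
    "\<forall>i<n. min y (\<phi> y) < x i \<and> x i < max y (\<phi> y)"
    "\<forall>i<n. \<forall>j<n. C1_fun (\<beta> i) (x j) = (if i = j then 1 else 0)"
    "\<forall>i<n. \<forall>z. \<not> (min y (\<phi> y) < z \<and> z < max y (\<phi> y)) \<longrightarrow> C1_fun (\<beta> i) z = 0"
    by (elim exE conjE) (rule that)
  have xw: "x i \<in> wint y" if "i < n" for i using b(1) that by (simp add: wint_def)
  have bw: "z \<in> wint y" if "i < n" "C1_fun (\<beta> i) z \<noteq> 0" for i z
    unfolding wint_def mem_Collect_eq using b(3) that by blast
  have "C1_fun (\<beta> i) ((\<phi> ^^ k) (x j)) = 0 \<and> C1_fun (\<beta> i) ((\<psi> ^^ k) (x j)) = 0"
    if ij: "i < n" "j < n" "k > 0" for i j k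
  proof
    show "C1_fun (\<beta> i) ((\<phi> ^^ k) (x j)) = 0"
      using bw[OF ij(1)] wint_wandering[OF y(1) xw[OF ij(2)] ij(3)] by blast
    show "C1_fun (\<beta> i) ((\<psi> ^^ k) (x j)) = 0"
      using bw[OF ij(1)] i.wint_wandering[OF into[OF y(1)], of "x j" k] xw[OF ij(2)] ij(3)
      unfolding wint_inverse[OF y(1)] by blast
  qed
  then show ?thesis using b(2) xw bw by (intro exI[of _ x] exI[of _ \<beta>]) blast
qed

lemma inv_omega: "y \<in> {0..1} \<Longrightarrow> \<psi> (omega \<phi> y) = omega \<phi> y" "y \<in> {0..1} \<Longrightarrow> \<psi> (omega \<psi> y) = omega \<psi> y"
proof -
  interpret i: icc_map \<psi> \<phi> by (rule inverse_map)
  assume y: "y \<in> {0..1}"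
  show "\<psi> (omega \<phi> y) = omega \<phi> y" by (rule Fix_eq_inv[OF omega_Fix[OF y]])
  show "\<psi> (omega \<psi> y) = omega \<psi> y" by (rule i.Fix_eq[OF i.omega_Fix[OF y]])
qed

text \<open>Powers of \<open>A\<close> push a bump towards the backward end, where
  \<open>cmod a < 1\<close>, and powers of the inverse push it towards the forward end, where
  \<open>cmod a > 1\<close>; so both halves of the orbit sum converge.\<close>

lemma nullity_A:
  assumes expanding_gap
  shows "nullity (\<lambda>g. g - A g) = \<infinity>"
proof -
  interpret i: weighted0 \<psi> \<phi> "\<lambda>x. 1 / a (\<psi> x)" by (rule inverse_weighted)
  obtain y where y: "y \<in> {0..1}" "y \<notin> Fix" "cmod (a (omega \<psi> y)) < 1" "1 < cmod (a (omega \<phi> y))"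
    using assms by (auto simp: expanding_gap_def)
  show ?thesis
  proof (rule nullity_wandering[OF bounded_clinear_A i.bounded_clinear_A A_inverse(1)])
    fix n :: nat
    obtain x :: "nat \<Rightarrow> real" and \<beta> where wb: "\<forall>i<n. x i \<in> wint y"
      "\<forall>i<n. \<forall>j<n. C1_fun (\<beta> i) (x j) = (if i = j then 1 else 0)"
      "\<forall>i<n. \<forall>z. C1_fun (\<beta> i) z \<noteq> 0 \<longrightarrow> z \<in> wint y"
      "\<forall>i<n. \<forall>j<n. \<forall>k>0. C1_fun (\<beta> i) ((\<phi> ^^ k) (x j)) = 0 \<and> C1_fun (\<beta> i) ((\<psi> ^^ k) (x j)) = 0"
      using wint_bumps[OF y(1,2), of n] by (elim exE conjE) (rule that)
    have b: "x i \<in> wint y" "j < n \<Longrightarrow> C1_fun (\<beta> i) (x j) = (if i = j then 1 else 0)"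
      "C1_fun (\<beta> i) z \<noteq> 0 \<Longrightarrow> z \<in> wint y"
      "j < n \<Longrightarrow> k > 0 \<Longrightarrow> C1_fun (\<beta> i) ((\<phi> ^^ k) (x j)) = 0"
      "j < n \<Longrightarrow> k > 0 \<Longrightarrow> C1_fun (\<beta> i) ((\<psi> ^^ k) (x j)) = 0" if "i < n" for i j z k
      using wb that by blast+
    have xI: "x i \<in> {0..1}" if "i < n" for i by (rule wint_Icc[OF y(1) b(1)[OF that]])
    have "cmod (1 / a (\<psi> (omega \<phi> (\<phi> y)))) < 1"
      unfolding omega_step[OF y(1)] inv_omega(1)[OF y(1)] by (rule cmod_inverse_less[OF y(4)])
    then have "summable (\<lambda>k. norm ((A' ^^ k) (embed_C1 (\<beta> i))))" if "i < n" for i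
      using b(3)[OF that] by (intro i.summable_A_iter[OF into[OF y(1)]])
        (auto simp: C0_fun_embed wint_inverse[OF y(1)])
    moreover have "summable (\<lambda>k. norm ((A ^^ k) (embed_C1 (\<beta> i))))" if "i < n" for i
      using b(3)[OF that] by (intro summable_A_iter[OF y(1,3)]) (auto simp: C0_fun_embed)
    ultimately show "\<exists>\<beta> e. \<forall>i<n. cfunctional (e i) \<and> (\<forall>x. cmod (e i x) \<le> norm x) \<and>
      summable (\<lambda>k. norm ((A ^^ k) (\<beta> i))) \<and> summable (\<lambda>k. norm ((A' ^^ k) (\<beta> i))) \<and>
      (\<forall>j<n. e i (\<beta> j) = (if i = j then 1 else 0) \<and>
        (\<forall>k>0. e i ((A ^^ k) (\<beta> j)) = 0 \<and> e i ((A' ^^ k) (\<beta> j)) = 0))"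
      using b by (intro exI[of _ "\<lambda>i. embed_C1 (\<beta> i)"] exI[of _ "\<lambda>i f. C0_fun f (x i)"])
        (auto simp: C0_functional C0_norm_bound C0_fun_embed C0_fun_A_iter[OF xI] i.C0_fun_A_iter[OF xI])
  qed
qed

text \<open>Evaluating powers of \<open>A\<close> at a point follows its forward orbit, so in a
  contracting gap the two-sided sums of point evaluations converge for every continuous function,
  and \<open>X0\<close> can be the whole space.\<close>

lemma deficiency_A:
  assumes contracting_gap
  shows "deficiency (\<lambda>g. g - A g) = \<infinity>"
proof -
  interpret i: weighted0 \<psi> \<phi> "\<lambda>x. 1 / a (\<psi> x)" by (rule inverse_weighted)
  obtain y where y: "y \<in> {0..1}" "y \<notin> Fix" "cmod (a (omega \<phi> y)) < 1" "1 < cmod (a (omega \<psi> y))"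
    using assms by (auto simp: contracting_gap_def)
  show ?thesis
  proof (rule deficiency_wandering[OF bounded_clinear_A i.bounded_clinear_A A_inverse(2), of UNIV "{}"])
    fix n :: nat
    obtain x :: "nat \<Rightarrow> real" and \<beta> where wb: "\<forall>i<n. x i \<in> wint y"
      "\<forall>i<n. \<forall>j<n. C1_fun (\<beta> i) (x j) = (if i = j then 1 else 0)"
      "\<forall>i<n. \<forall>z. C1_fun (\<beta> i) z \<noteq> 0 \<longrightarrow> z \<in> wint y"
      "\<forall>i<n. \<forall>j<n. \<forall>k>0. C1_fun (\<beta> i) ((\<phi> ^^ k) (x j)) = 0 \<and> C1_fun (\<beta> i) ((\<psi> ^^ k) (x j)) = 0"
      using wint_bumps[OF y(1,2), of n] by (elim exE conjE) (rule that)
    have b: "x i \<in> wint y" "j < n \<Longrightarrow> C1_fun (\<beta> i) (x j) = (if i = j then 1 else 0)"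
      "C1_fun (\<beta> i) z \<noteq> 0 \<Longrightarrow> z \<in> wint y"
      "j < n \<Longrightarrow> k > 0 \<Longrightarrow> C1_fun (\<beta> i) ((\<phi> ^^ k) (x j)) = 0"
      "j < n \<Longrightarrow> k > 0 \<Longrightarrow> C1_fun (\<beta> i) ((\<psi> ^^ k) (x j)) = 0" if "i < n" for i j z k
      using wb that by blast+
    have xI: "x i \<in> {0..1}" if "i < n" for i by (rule wint_Icc[OF y(1) b(1)[OF that]])
    have "summable (\<lambda>k. cmod (C0_fun ((A ^^ k) g) (x i)))" if "i < n" for i g
      using y(3) by (intro summable_A_iter_point xI that) (simp add: omega_wint[OF y(1) b(1)[OF that]])
    moreover have "summable (\<lambda>k. cmod (C0_fun ((A' ^^ k) g) (x i)))" if "i < n" for i g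
    proof (rule i.summable_A_iter_point[OF xI[OF that]])
      show "cmod (1 / a (\<psi> (omega \<psi> (x i)))) < 1"
        unfolding omega_inv_wint[OF y(1) b(1)[OF that]] inv_omega(2)[OF y(1)]
        by (rule cmod_inverse_less[OF y(4)])
    qed
    ultimately show "\<exists>\<beta> e. \<forall>i<n. cfunctional (e i) \<and> \<beta> i \<in> UNIV \<and>
      (\<forall>x\<in>UNIV. summable (\<lambda>k. cmod (e i ((A ^^ k) x))) \<and> summable (\<lambda>k. cmod (e i ((A' ^^ k) x)))) \<and>
      (\<forall>j<n. e i (\<beta> j) = (if i = j then 1 else 0) \<and>
        (\<forall>k>0. e i ((A ^^ k) (\<beta> j)) = 0 \<and> e i ((A' ^^ k) (\<beta> j)) = 0))"
      using b by (intro exI[of _ "\<lambda>i. embed_C1 (\<beta> i)"] exI[of _ "\<lambda>i f. C0_fun f (x i)"])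
        (auto simp: C0_functional C0_fun_embed C0_fun_A_iter[OF xI] i.C0_fun_A_iter[OF xI])
  qed (auto simp: complex_vector.subspace_UNIV)
qed

end

section \<open>Weighted composition operators on continuously differentiable functions\<close>

definition wcomp1 :: "(real \<Rightarrow> real) \<Rightarrow> C1_Icc \<Rightarrow> C1_Icc \<Rightarrow> C1_Icc" where
  "wcomp1 \<theta> b f = mk_C1 (\<lambda>x. C1_fun b x * C1_fun f (\<theta> x))"

definition deriv_weight :: "(real \<Rightarrow> real) \<Rightarrow> C1_Icc \<Rightarrow> real \<Rightarrow> complex" where
  "deriv_weight \<theta> b x = C1_fun b x * complex_of_real (deriv_Icc \<theta> x)"

lemma C1_comp_has_derivative:
  fixes \<theta> :: "real \<Rightarrow> real"
  assumes \<theta>: "C1_on_Icc \<theta>" "\<theta> ` {0..1} \<subseteq> {0..1}" and x: "x \<in> {0..1}"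
  shows "((\<lambda>x. C1_fun f (\<theta> x)) has_vector_derivative
    complex_of_real (deriv_Icc \<theta> x) * C0_fun (deriv_C1 f) (\<theta> x)) (at x within {0..1})"
proof -
  have "\<theta> x \<in> {0..1}" using \<theta>(2) x by blast
  then have "(C1_fun f has_vector_derivative C0_fun (deriv_C1 f) (\<theta> x)) (at (\<theta> x) within \<theta> ` {0..1})"
    by (rule has_vector_derivative_within_subset[OF C1_fun_has_deriv \<theta>(2)])
  from vector_diff_chain_within[OF has_vector_derivative_deriv_Icc[OF \<theta>(1) x] this]
  show ?thesis by (simp add: o_def scaleR_conv_of_real)
qed

lemma wcomp1_has_derivative:
  fixes \<theta> :: "real \<Rightarrow> real"
  assumes \<theta>: "C1_on_Icc \<theta>" "\<theta> ` {0..1} \<subseteq> {0..1}" and x: "x \<in> {0..1}"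
  shows "((\<lambda>x. C1_fun b x * C1_fun f (\<theta> x)) has_vector_derivative
    deriv_weight \<theta> b x * C0_fun (deriv_C1 f) (\<theta> x) + C0_fun (deriv_C1 b) x * C1_fun f (\<theta> x))
    (at x within {0..1})"
  using has_vector_derivative_mult[OF C1_fun_has_deriv[OF x, of b] C1_comp_has_derivative[OF assms, of f]]
  by (simp add: deriv_weight_def mult.assoc)

lemma continuous_on_deriv_weight:
  fixes \<theta> :: "real \<Rightarrow> real"
  assumes "C1_on_Icc \<theta>"
  shows "continuous_on {0..1} (deriv_weight \<theta> b)"
  unfolding deriv_weight_def
  by (intro continuous_intros continuous_on_C1_fun C1_on_Icc_deriv_continuous assms)

locale weighted1 = icc_map +
  fixes w :: C1_Icc
  assumes C1_map: "C1_on_Icc \<phi>" and C1_inv: "C1_on_Icc \<psi>"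
    and w_nonzero: "x \<in> {0..1} \<Longrightarrow> C1_fun w x \<noteq> 0"
begin

lemma image_Icc: "\<phi> ` {0..1} \<subseteq> {0..1}" "\<psi> ` {0..1} \<subseteq> {0..1}"
  using into into_inv by blast+

text \<open>The chain rule for \<psi> o \<phi>; in particular the derivative of \<phi> has no zero,
  so neither has the weight \<open>a\<close>.\<close>

lemma deriv_inverse: "x \<in> {0..1} \<Longrightarrow> deriv_Icc \<psi> (\<phi> x) * deriv_Icc \<phi> x = 1"
proof -
  assume x: "x \<in> {0..1}"
  have "(\<psi> has_vector_derivative deriv_Icc \<psi> (\<phi> x)) (at (\<phi> x) within \<phi> ` {0..1})"
    by (rule has_vector_derivative_within_subset[OF has_vector_derivative_deriv_Icc[OF C1_inv into[OF x]]
      image_Icc(1)])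
  from vector_diff_chain_within[OF has_vector_derivative_deriv_Icc[OF C1_map x] this]
  have "((\<psi> \<circ> \<phi>) has_vector_derivative deriv_Icc \<phi> x * deriv_Icc \<psi> (\<phi> x)) (at x within {0..1})" by simp
  then have "((\<lambda>x. x) has_vector_derivative deriv_Icc \<phi> x * deriv_Icc \<psi> (\<phi> x)) (at x within {0..1})"
    by (rule has_vector_derivative_transform[OF x, rotated]) (simp add: left_inv del: atLeastAtMost_iff)
  from deriv_Icc_eqI[OF this x] deriv_Icc_eqI[OF has_vector_derivative_id x]
  show ?thesis by (simp add: mult.commute)
qed

abbreviation a where "a \<equiv> deriv_weight \<phi> w"
abbreviation T where "T \<equiv> wcomp1 \<phi> w"

lemma weighted0: "weighted0 \<phi> \<psi> a"
proof
  show "continuous_on {0..1} a" by (rule continuous_on_deriv_weight[OF C1_map])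
  show "a x \<noteq> 0" if "x \<in> {0..1}" for x
    using w_nonzero[OF that] deriv_inverse[OF that] by (auto simp: deriv_weight_def)
qed

sublocale W0: weighted0 \<phi> \<psi> a by (rule weighted0)

definition w' :: C1_Icc where "w' = mk_C1 (\<lambda>x. 1 / C1_fun w (\<psi> x))"

lemma w'_C1: "C1_on_Icc (\<lambda>x. 1 / C1_fun w (\<psi> x))"
proof (rule C1_on_IccI)
  fix x :: real assume x: "x \<in> {0..1}"
  have nz: "C1_fun w (\<psi> x) \<noteq> 0" by (rule w_nonzero[OF into_inv[OF x]])
  have "((\<lambda>z. inverse z) has_field_derivative - (inverse (C1_fun w (\<psi> x)))\<^sup>2)
      (at (C1_fun w (\<psi> x)) within (\<lambda>x. C1_fun w (\<psi> x)) ` {0..1})"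
    using DERIV_inverse[OF nz] by (simp add: numeral_2_eq_2)
  from field_vector_diff_chain_within[OF C1_comp_has_derivative[OF C1_inv image_Icc(2) x, of w] this]
  show "((\<lambda>x. 1 / C1_fun w (\<psi> x)) has_vector_derivative
      complex_of_real (deriv_Icc \<psi> x) * C0_fun (deriv_C1 w) (\<psi> x) * (- (inverse (C1_fun w (\<psi> x)))\<^sup>2))
      (at x within {0..1})"
    by (simp add: o_def inverse_eq_divide)
next
  have "continuous_on {0..1} (\<lambda>x. C0_fun (deriv_C1 w) (\<psi> x))"
    by (rule continuous_on_compose2[OF continuous_on_C0_fun cont_inv image_Icc(2)])
  moreover have "continuous_on {0..1} (\<lambda>x. C1_fun w (\<psi> x))"
    by (rule continuous_on_compose2[OF continuous_on_C1_fun cont_inv image_Icc(2)])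
  ultimately show "continuous_on {0..1} (\<lambda>x. complex_of_real (deriv_Icc \<psi> x) * C0_fun (deriv_C1 w) (\<psi> x) *
      (- (inverse (C1_fun w (\<psi> x)))\<^sup>2))"
    by (intro continuous_intros C1_on_Icc_deriv_continuous C1_inv)
      (auto intro!: w_nonzero into_inv simp del: atLeastAtMost_iff)
qed

lemma C1_fun_w': "x \<in> {0..1} \<Longrightarrow> C1_fun w' x = 1 / C1_fun w (\<psi> x)"
  unfolding w'_def by (rule C1_fun_mk_C1[OF w'_C1])

lemma inverse_weighted1: "weighted1 \<psi> \<phi> w'"
proof -
  interpret i: icc_map \<psi> \<phi> by (rule inverse_map)
  show ?thesis
    by unfold_locales (simp_all add: C1_map C1_inv C1_fun_w' w_nonzero into_inv del: atLeastAtMost_iff)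
qed

text \<open>Identifies the derivative weight of the inverse of \<open>T\<close> with the weight of
  the inverse of \<open>A\<close>, so that the modulus conditions carry over to backward
  orbits.\<close>

lemma deriv_weight_inverse: "x \<in> {0..1} \<Longrightarrow> deriv_weight \<psi> w' x = 1 / a (\<psi> x)"
proof -
  assume x: "x \<in> {0..1}"
  have "deriv_Icc \<psi> x * deriv_Icc \<phi> (\<psi> x) = 1" using deriv_inverse[OF into_inv[OF x]] right_inv[OF x] by simp
  then have "deriv_Icc \<psi> x = 1 / deriv_Icc \<phi> (\<psi> x)"
    by (metis div_by_0 mult_zero_right nonzero_eq_divide_eq zero_neq_one)
  then show ?thesis using x by (simp add: deriv_weight_def C1_fun_w' del: atLeastAtMost_iff)
qed

abbreviation T' where "T' \<equiv> wcomp1 \<psi> w'"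

lemma C1_fun_T: "x \<in> {0..1} \<Longrightarrow> C1_fun (T f) x = C1_fun w x * C1_fun f (\<phi> x)"
  unfolding wcomp1_def
proof (rule C1_fun_mk_C1)
  have "continuous_on {0..1} (\<lambda>x. C0_fun (deriv_C1 f) (\<phi> x))"
    by (rule continuous_on_compose2[OF continuous_on_C0_fun cont image_Icc(1)])
  moreover have "continuous_on {0..1} (\<lambda>x. C1_fun f (\<phi> x))"
    by (rule continuous_on_compose2[OF continuous_on_C1_fun cont image_Icc(1)])
  ultimately show "C1_on_Icc (\<lambda>x. C1_fun w x * C1_fun f (\<phi> x))"
    by (intro C1_on_IccI[OF wcomp1_has_derivative[OF C1_map image_Icc(1)]] continuous_intros
        W0.cont_a continuous_on_C0_fun)
qed

lemma deriv_T: "deriv_C1 (T f) = W0.A (deriv_C1 f) + mult_comp (deriv_C1 w) \<phi> f"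
proof (rule C0_eqI)
  fix x :: real assume x: "x \<in> {0..1}"
  have "(C1_fun (T f) has_vector_derivative
      a x * C0_fun (deriv_C1 f) (\<phi> x) + C0_fun (deriv_C1 w) x * C1_fun f (\<phi> x)) (at x within {0..1})"
    by (rule has_vector_derivative_transform[OF x _ wcomp1_has_derivative[OF C1_map image_Icc(1) x]])
      (simp add: C1_fun_T del: atLeastAtMost_iff)
  then show "C0_fun (deriv_C1 (T f)) x = C0_fun (W0.A (deriv_C1 f) + mult_comp (deriv_C1 w) \<phi> f) x"
    using x by (simp add: deriv_C1.rep_eq deriv_Icc_eqI W0.C0_fun_A C0_fun_mult_comp[OF cont image_Icc(1)]
        del: atLeastAtMost_iff)
qed

lemma bounded_clinear_T: "bounded_clinear T"
proof -
  have mc: "bounded_clinear (mult_comp (deriv_C1 w) \<phi>)"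
    by (rule approximableD[OF approximable_mult_comp[OF cont image_Icc(1)]])
  obtain K1 where K1: "\<And>g. norm (W0.A g) \<le> K1 * norm g" "K1 > 0"
    using bounded_clinear_bound[OF W0.bounded_clinear_A] by blast
  obtain K2 where K2: "\<And>f. norm (mult_comp (deriv_C1 w) \<phi> f) \<le> K2 * norm f"
    using bounded_clinear_bound[OF mc] by blast
  show ?thesis
  proof (rule bounded_clinearI[where K = "norm w + K1 + K2"])
    fix f g :: C1_Icc and c
    show "T (f + g) = T f + T g" "T (c *\<^sub>C f) = c *\<^sub>C T f"
      by (rule C1_eqI; simp add: C1_fun_T algebra_simps)+
    have "cmod (C1_fun (T f) 0) \<le> norm w * norm f"
      by (simp add: C1_fun_T norm_mult mult_mono C1_norm_bound)
    moreover have "norm (W0.A (deriv_C1 f)) \<le> K1 * norm f"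
      using order_trans[OF K1(1) mult_left_mono[OF norm_deriv_C1[of f]]] K1(2) by simp
    ultimately show "norm (T f) \<le> (norm w + K1 + K2) * norm f"
      unfolding norm_C1_eq[of "T f"] deriv_T distrib_right
      using norm_triangle_ineq[of "W0.A (deriv_C1 f)" "mult_comp (deriv_C1 w) \<phi> f"] K2[of f] by linarith
  qed
qed

lemma T_inverse: "T (T' f) = f" "T' (T f) = f"
proof -
  interpret i: weighted1 \<psi> \<phi> w' by (rule inverse_weighted1)
  show "T (T' f) = f"
    by (rule C1_eqI) (simp add: C1_fun_T i.C1_fun_T into left_inv C1_fun_w' w_nonzero del: atLeastAtMost_iff)
  show "T' (T f) = f"
    by (rule C1_eqI) (simp add: C1_fun_T i.C1_fun_T into_inv right_inv C1_fun_w' w_nonzero del: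
      atLeastAtMost_iff)
qed

definition wcocycle :: "nat \<Rightarrow> real \<Rightarrow> complex" where
  "wcocycle n x = (\<Prod>k<n. C1_fun w ((\<phi> ^^ k) x))"

lemma C1_fun_T_iter:
  "x \<in> {0..1} \<Longrightarrow> C1_fun ((T ^^ n) f) x = wcocycle n x * C1_fun f ((\<phi> ^^ n) x)"
proof (induction n arbitrary: x)
  case (Suc n)
  have 1: "C1_fun ((T ^^ Suc n) f) x = C1_fun w x * (wcocycle n (\<phi> x) * C1_fun f ((\<phi> ^^ n) (\<phi> x)))"
    using Suc.IH[OF into[OF Suc.prems]] by (simp add: C1_fun_T[OF Suc.prems])
  have 2: "wcocycle (Suc n) x = C1_fun w x * wcocycle n (\<phi> x)"
    unfolding wcocycle_def prod.lessThan_Suc_shift by (simp add: funpow_swap1)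
  show ?case unfolding 1 2 by (simp add: funpow_swap1 mult.assoc)
qed (simp add: wcocycle_def)

section \<open>Orbit sums in the norm of continuously differentiable functions\<close>

text \<open>As for \<open>A\<close>, except for the lower-order term. The iterates vanish at the
  backward limit \<open>?p\<close> and have their support within \<delta> of it, so they are bounded
  by \<delta> times the norm of their derivative, and the extra term costs an arbitrarily small part
  of the contraction rate.\<close>

lemma summable_T_iter:
  assumes y: "y \<in> {0..1}" and p: "cmod (a (omega \<psi> y)) < 1"
    and supp: "\<And>x. C1_fun f x \<noteq> 0 \<Longrightarrow> x \<in> wint y"
  shows "summable (\<lambda>n. norm ((T ^^ n) f))"
proof -
  interpret i: icc_map \<psi> \<phi> by (rule inverse_map)
  let ?p = "omega \<psi> y"
  have pF: "?p \<in> Fix" using i.omega_Fix[OF y] by (simp add: Fix_inverse)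
  have pI: "?p \<in> {0..1}" by (rule Fix_Icc[OF pF])
  obtain \<theta> where \<theta>: "cmod (a ?p) < \<theta>" "\<theta> < 1" using dense[OF p] by blast
  have \<theta>0: "\<theta> \<ge> 0" using \<theta>(1) norm_ge_zero less_imp_le order_trans by blast
  obtain \<delta>0 where \<delta>0: "\<delta>0 > 0" "\<And>x. x \<in> {0..1} \<Longrightarrow> \<bar>x - ?p\<bar> < \<delta>0 \<Longrightarrow> \<bar>cmod (a x) - cmod (a ?p)\<bar> < \<theta> - cmod (a ?p)"
    using W0.cont_cmod_a[unfolded continuous_on_iff dist_real_def] pI \<theta>(1) by (metis diff_gt_0_iff_gt)
  \<comment> \<open>The room between \<theta> and \<theta>' is reserved for the lower-order
    term.\<close>
  define \<theta>' where "\<theta>' = (\<theta> + 1) / 2"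
  have \<theta>': "\<theta>' < 1" "\<theta> < \<theta>'" using \<theta>(2) by (auto simp: \<theta>'_def)
  define D where "D = norm (deriv_C1 w) + 1"
  have D: "D > 0" by (simp add: D_def add_nonneg_pos)
  \<comment> \<open>Strictly below \<delta>0, so that late iterates are supported well inside the
    region with \<open>cmod (a x) \<le> \<theta>\<close>; the second bound fits the lower-order term
    into \<open>\<theta>' - \<theta>\<close>.\<close>
  define \<delta> where "\<delta> = min (\<delta>0 / 2) ((\<theta>' - \<theta>) / D)"
  have \<delta>: "\<delta> > 0" "\<delta> < \<delta>0" "D * \<delta> \<le> \<theta>' - \<theta>"
    using \<delta>0(1) \<theta>' D by (auto simp: \<delta>_def min_def field_simps split: if_splits)
  obtain N where N: "\<And>n x. n \<ge> N \<Longrightarrow> x \<in> {0..1} \<Longrightarrow> (\<phi> ^^ n) x \<in> wint y \<Longrightarrow> \<bar>x - ?p\<bar> < \<delta>"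
    using preimages_converge_uniformly[OF y \<delta>(1)] by blast
  have nz: "x \<in> {0..1} \<Longrightarrow> (\<phi> ^^ n) x \<in> wint y" if "C1_fun ((T ^^ n) f) x \<noteq> 0" for n x
    using that supp C1_fun_T_iter[of x n f] by auto
  \<comment> \<open>Fixed points lie in no wandering interval, so every iterate vanishes at
    \<open>?p\<close>.\<close>
  have z0: "C1_fun ((T ^^ n) f) x = 0" if "x \<in> Fix" for n x
  proof (rule ccontr)
    assume "C1_fun ((T ^^ n) f) x \<noteq> 0"
    from nz[OF this Fix_Icc[OF that]] have "x \<in> wint y" by (simp add: iter_Fix[OF that])
    then show False using wint_not_Fix[OF y] that by blast
  qed
  show ?thesis
  proof (rule summable_ratio_test[OF \<theta>'(1)])
    fix n assume n: "n \<ge> N"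
    let ?g = "(T ^^ n) f"
    have "norm (deriv_C1 (T ?g)) \<le> \<theta>' * norm (deriv_C1 ?g)"
    proof (rule C0_norm_least)
      fix x :: real assume x: "x \<in> {0..1}"
      show "cmod (C0_fun (deriv_C1 (T ?g)) x) \<le> \<theta>' * norm (deriv_C1 ?g)"
      proof (cases "\<bar>x - ?p\<bar> < \<delta>0")
        case True
        have "cmod (a x) \<le> \<theta>" using \<delta>0(2)[OF x True] by linarith
        then have 1: "cmod (a x) * cmod (C0_fun (deriv_C1 ?g) (\<phi> x)) \<le> \<theta> * norm (deriv_C1 ?g)"
          using \<theta>0 by (intro mult_mono C0_norm_bound) auto
        have "cmod (C1_fun ?g (\<phi> x)) \<le> norm (deriv_C1 ?g) * \<delta>"
        proof (cases "C1_fun ?g (\<phi> x) = 0")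
          case False
          have "\<bar>\<phi> x - ?p\<bar> < \<delta>" by (rule N[OF n into[OF x] nz[OF False into[OF x]]])
          then have "norm (deriv_C1 ?g) * \<bar>\<phi> x - ?p\<bar> \<le> norm (deriv_C1 ?g) * \<delta>" by (intro mult_left_mono) auto
          then show ?thesis using C1_lipschitz[OF into[OF x] pI, of ?g] z0[OF pF, of n] by simp
        qed (use \<delta>(1) in simp)
        then have "cmod (C0_fun (deriv_C1 w) x) * cmod (C1_fun ?g (\<phi> x)) \<le> D * (norm (deriv_C1 ?g) * \<delta>)"
          using D C0_norm_bound[of "deriv_C1 w" x] by (intro mult_mono) (auto simp: D_def)
        also have "\<dots> \<le> (\<theta>' - \<theta>) * norm (deriv_C1 ?g)"
          using mult_right_mono[OF \<delta>(3), of "norm (deriv_C1 ?g)"] by (simp add: ac_simps)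
        finally have 2: "cmod (C0_fun (deriv_C1 w) x * C1_fun ?g (\<phi> x)) \<le> (\<theta>' - \<theta>) * norm (deriv_C1 ?g)"
          by (simp add: norm_mult)
        have "C0_fun (deriv_C1 (T ?g)) x =
          a x * C0_fun (deriv_C1 ?g) (\<phi> x) + C0_fun (deriv_C1 w) x * C1_fun ?g (\<phi> x)"
          unfolding deriv_T using x
            by (simp add: W0.C0_fun_A C0_fun_mult_comp[OF cont image_Icc(1)] del: atLeastAtMost_iff)
        then have "cmod (C0_fun (deriv_C1 (T ?g)) x) \<le>
            \<theta> * norm (deriv_C1 ?g) + (\<theta>' - \<theta>) * norm (deriv_C1 ?g)"
          using norm_triangle_mono[of "a x * C0_fun (deriv_C1 ?g) (\<phi> x)", OF _ 2] 1 by (simp add: norm_mult)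
        then show ?thesis by (simp add: algebra_simps)
      next
        case False
        \<comment> \<open>Here \<open>T ?g\<close> vanishes in a whole neighbourhood of
          \<open>x\<close>, since its support lies within \<delta> of \<open>?p\<close>.\<close>
        have "(C1_fun (T ?g) has_vector_derivative 0) (at x within {0..1})"
        proof (rule has_vector_derivative_transform_within[OF has_vector_derivative_const[of 0]])
          show "0 < \<delta>0 - \<delta>" using \<delta>(2) by simp
          fix z assume z: "z \<in> {0..1}" "dist z x < \<delta>0 - \<delta>"
          show "0 = C1_fun (T ?g) z"
          proof (rule ccontr)
            assume "0 \<noteq> C1_fun (T ?g) z"
            then have "C1_fun ((T ^^ Suc n) f) z \<noteq> 0" by simp
            from N[OF _ z(1) nz[OF this z(1)]] have "\<bar>z - ?p\<bar> < \<delta>" using n by simp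
            then show False using False z(2) by (simp add: dist_real_def)
          qed
        qed (rule x)
        then have "C0_fun (deriv_C1 (T ?g)) x = 0"
          using x by (simp add: deriv_C1.rep_eq deriv_Icc_eqI del: atLeastAtMost_iff)
        then show ?thesis using \<theta>0 \<theta>'(2) by simp
      qed
    qed
    moreover have "C1_fun ((T ^^ k) f) 0 = 0" for k by (rule z0[OF Fix_01(1)])
    ultimately show "norm (norm ((T ^^ Suc n) f)) \<le> \<theta>' * norm (norm ((T ^^ n) f))"
      unfolding norm_C1_eq real_norm_def using \<theta>0 \<theta>'(2) by (simp del: funpow.simps) simp
  qed
qed

text \<open>The product of \<open>w\<close> alone may fail to decay. But \<open>f\<close> vanishes
  at the limit \<open>?q\<close>, so its value along the orbit is at most a constant times the
  distance to \<open>?q\<close>, and this distance shrinks asymptotically by the derivative of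
  \<phi>; together the ratio tends to \<open>cmod (a ?q)\<close>.\<close>

lemma summable_T_iter_point:
  assumes x: "x \<in> {0..1}" "x \<notin> Fix" and q: "cmod (a (omega \<phi> x)) < 1"
    and f: "C1_fun f (omega \<phi> x) = 0"
  shows "summable (\<lambda>n. cmod (C1_fun ((T ^^ n) f) x))"
proof -
  let ?q = "omega \<phi> x"
  let ?x = "\<lambda>n. (\<phi> ^^ n) x"
  have qI: "?q \<in> {0..1}" and qF: "?q \<in> Fix" using omega_Icc omega_Fix x(1) by auto
  have ne: "?x n \<noteq> ?q" for n using iter_Fix_iff[OF x(1), of n] x(2) qF by auto
  define s where "s n = wcocycle n x * complex_of_real (?x n - ?q)" for n
  have "(\<phi> has_vector_derivative deriv_Icc \<phi> ?q) (at ?q within {0..1})"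
    by (rule has_vector_derivative_deriv_Icc[OF C1_map qI])
  then have "((\<lambda>z. (\<phi> z - \<phi> ?q) / (z - ?q)) \<longlongrightarrow> deriv_Icc \<phi> ?q) (at ?q within {0..1})"
    by (simp add: has_real_derivative_iff_has_vector_derivative[symmetric] has_field_derivative_iff)
  moreover have "filterlim ?x (at ?q within {0..1}) sequentially"
    using orbit_tendsto_omega[OF x(1)] ne iter_Icc[OF x(1)]
    by (auto simp: filterlim_at simp del: atLeastAtMost_iff)
  ultimately have "(\<lambda>n. (\<phi> (?x n) - \<phi> ?q) / (?x n - ?q)) \<longlonglongrightarrow> deriv_Icc \<phi> ?q"
    by (rule filterlim_compose)
  moreover have "(\<lambda>n. C1_fun w (?x n)) \<longlonglongrightarrow> C1_fun w ?q"
    by (rule continuous_on_tendsto_compose[OF continuous_on_C1_fun orbit_tendsto_omega[OF x(1)] qI])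
      (use iter_Icc[OF x(1)] in auto)
  ultimately have "(\<lambda>n. cmod (C1_fun w (?x n)) * \<bar>(\<phi> (?x n) - \<phi> ?q) / (?x n - ?q)\<bar>)
      \<longlonglongrightarrow> cmod (C1_fun w ?q) * \<bar>deriv_Icc \<phi> ?q\<bar>"
    by (intro tendsto_mult tendsto_norm tendsto_rabs)
  moreover have "cmod (C1_fun w ?q) * \<bar>deriv_Icc \<phi> ?q\<bar> < 1" using q by (simp add: deriv_weight_def norm_mult)
  moreover have "norm (s (Suc n)) \<le>
    (cmod (C1_fun w (?x n)) * \<bar>(\<phi> (?x n) - \<phi> ?q) / (?x n - ?q)\<bar>) * norm (s n)" for n
  proof -
    have ns: "norm (s n) = cmod (wcocycle n x) * \<bar>?x n - ?q\<bar>" for n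
      by (simp only: s_def norm_mult norm_of_real)
    have "wcocycle (Suc n) x = wcocycle n x * C1_fun w (?x n)" by (simp add: wcocycle_def)
    then show ?thesis
      using ne[of n] unfolding ns by (simp add: norm_mult Fix_eq[OF qF] abs_divide)
  qed
  ultimately have "summable (\<lambda>n. norm (s n))" by (rule summable_ratio_limit)
  then have "summable (\<lambda>n. norm (s n) * norm (deriv_C1 f))" by (rule summable_mult2)
  then show ?thesis
  proof (rule summable_comparison_test')
    fix n
    have "cmod (C1_fun f (?x n)) \<le> norm (deriv_C1 f) * \<bar>?x n - ?q\<bar>"
      using C1_lipschitz[OF iter_Icc[OF x(1)] qI, of f] f by simp
    from mult_left_mono[OF this norm_ge_zero[of "wcocycle n x"]]
    show "norm (cmod (C1_fun ((T ^^ n) f) x)) \<le> norm (s n) * norm (deriv_C1 f)"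
      unfolding s_def norm_mult norm_of_real by (simp add: C1_fun_T_iter[OF x(1)] norm_mult ac_simps)
  qed
qed

lemma nullity_T:
  assumes "W0.expanding_gap"
  shows "nullity (\<lambda>f. f - T f) = \<infinity>"
proof -
  interpret i: weighted1 \<psi> \<phi> w' by (rule inverse_weighted1)
  obtain y where y: "y \<in> {0..1}" "y \<notin> Fix" "cmod (a (omega \<psi> y)) < 1" "1 < cmod (a (omega \<phi> y))"
    using assms by (auto simp: W0.expanding_gap_def)
  show ?thesis
  proof (rule nullity_wandering[OF bounded_clinear_T i.bounded_clinear_T T_inverse(1)])
    fix n :: nat
    obtain x :: "nat \<Rightarrow> real" and \<beta> where wb: "\<forall>i<n. x i \<in> wint y"
      "\<forall>i<n. \<forall>j<n. C1_fun (\<beta> i) (x j) = (if i = j then 1 else 0)"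
      "\<forall>i<n. \<forall>z. C1_fun (\<beta> i) z \<noteq> 0 \<longrightarrow> z \<in> wint y"
      "\<forall>i<n. \<forall>j<n. \<forall>k>0. C1_fun (\<beta> i) ((\<phi> ^^ k) (x j)) = 0 \<and> C1_fun (\<beta> i) ((\<psi> ^^ k) (x j)) = 0"
      using W0.wint_bumps[OF y(1,2), of n] by (elim exE conjE) (rule that)
    have b: "x i \<in> wint y" "j < n \<Longrightarrow> C1_fun (\<beta> i) (x j) = (if i = j then 1 else 0)"
      "C1_fun (\<beta> i) z \<noteq> 0 \<Longrightarrow> z \<in> wint y"
      "j < n \<Longrightarrow> k > 0 \<Longrightarrow> C1_fun (\<beta> i) ((\<phi> ^^ k) (x j)) = 0"
      "j < n \<Longrightarrow> k > 0 \<Longrightarrow> C1_fun (\<beta> i) ((\<psi> ^^ k) (x j)) = 0" if "i < n" for i j z k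
      using wb that by blast+
    have xI: "x i \<in> {0..1}" if "i < n" for i by (rule wint_Icc[OF y(1) b(1)[OF that]])
    have "cmod (deriv_weight \<psi> w' (omega \<phi> (\<phi> y))) < 1"
      unfolding omega_step[OF y(1)] deriv_weight_inverse[OF omega_Icc[OF y(1)]] W0.inv_omega(1)[OF y(1)]
      by (rule cmod_inverse_less[OF y(4)])
    then have "summable (\<lambda>k. norm ((T' ^^ k) (\<beta> i)))" if "i < n" for i
      using b(3)[OF that] by (intro i.summable_T_iter[OF into[OF y(1)]])
        (auto simp: wint_inverse[OF y(1)])
    moreover have "summable (\<lambda>k. norm ((T ^^ k) (\<beta> i)))" if "i < n" for i
      using b(3)[OF that] by (intro summable_T_iter[OF y(1,3)]) auto
    ultimately show "\<exists>\<beta> e. \<forall>i<n. cfunctional (e i) \<and> (\<forall>x. cmod (e i x) \<le> norm x) \<and>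
      summable (\<lambda>k. norm ((T ^^ k) (\<beta> i))) \<and> summable (\<lambda>k. norm ((T' ^^ k) (\<beta> i))) \<and>
      (\<forall>j<n. e i (\<beta> j) = (if i = j then 1 else 0) \<and>
        (\<forall>k>0. e i ((T ^^ k) (\<beta> j)) = 0 \<and> e i ((T' ^^ k) (\<beta> j)) = 0))"
      using b by (intro exI[of _ \<beta>] exI[of _ "\<lambda>i f. C1_fun f (x i)"])
        (auto simp: C1_functional C1_norm_bound C1_fun_T_iter[OF xI] i.C1_fun_T_iter[OF xI])
  qed
qed

text \<open>The orbit sums are controlled by \<open>summable_T_iter_point\<close>, which asks for
  zeros at both ends of the gap. These functions form the subspace \<open>X0\<close>, and the
  constant 1 with the affine function \<open>h\<close> fills up the rest.\<close>

lemma deficiency_T: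
  assumes "W0.contracting_gap"
  shows "deficiency (\<lambda>f. f - T f) = \<infinity>"
proof -
  interpret i: weighted1 \<psi> \<phi> w' by (rule inverse_weighted1)
  obtain y where y: "y \<in> {0..1}" "y \<notin> Fix" "cmod (a (omega \<phi> y)) < 1" "1 < cmod (a (omega \<psi> y))"
    using assms by (auto simp: W0.contracting_gap_def)
  let ?p = "omega \<psi> y" and ?q = "omega \<phi> y"
  have pF: "?p \<in> Fix" and qF: "?q \<in> Fix" using i.omega_Fix[OF y(1)] omega_Fix[OF y(1)]
    by (auto simp: Fix_inverse)
  have pq: "?p \<noteq> ?q" using y(3,4) by auto
  have pI: "?p \<in> {0..1}" and qI: "?q \<in> {0..1}" using pF qF Fix_Icc by auto
  define h where "h = mk_C1 (\<lambda>x. complex_of_real ((x - ?p) / (?q - ?p)))"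
  have "C1_on_Icc (\<lambda>x. complex_of_real ((x - ?p) / (?q - ?p)))"
    by (rule C1_on_IccI[where f' = "\<lambda>_. complex_of_real (1 / (?q - ?p))"])
      (auto intro!: has_vector_derivative_of_real derivative_eq_intros)
  from C1_fun_mk_C1[OF this] have h: "C1_fun h ?p = 0" "C1_fun h ?q = 1"
    using pI qI pq by (auto simp: h_def)
  define X0 where "X0 = {f. C1_fun f ?p = 0 \<and> C1_fun f ?q = 0}"
  show ?thesis
  proof (rule deficiency_wandering[OF bounded_clinear_T i.bounded_clinear_T T_inverse(2), of X0 "{1, h}"])
    show "csubspace X0" unfolding X0_def by (rule complex_vector.subspaceI) auto
    show "T f \<in> X0" if "f \<in> X0" for f
      using that by (simp add: X0_def C1_fun_T[OF pI] C1_fun_T[OF qI] Fix_eq[OF pF] Fix_eq[OF qF])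
    show "\<exists>f0\<in>X0. \<exists>z\<in>cspan {1, h}. f = f0 + z" for f
    proof -
      let ?z = "C1_fun f ?p *\<^sub>C 1 + (C1_fun f ?q - C1_fun f ?p) *\<^sub>C h"
      have "f - ?z \<in> X0" using pI qI by (simp add: X0_def h)
      moreover have "?z \<in> cspan {1, h}"
        by (intro complex_vector.span_add complex_vector.span_scale complex_vector.span_base) auto
      ultimately show ?thesis by (intro bexI[of _ "f - ?z"] bexI[of _ ?z]) auto
    qed
    fix n :: nat
    obtain x :: "nat \<Rightarrow> real" and \<beta> where wb: "\<forall>i<n. x i \<in> wint y"
      "\<forall>i<n. \<forall>j<n. C1_fun (\<beta> i) (x j) = (if i = j then 1 else 0)"
      "\<forall>i<n. \<forall>z. C1_fun (\<beta> i) z \<noteq> 0 \<longrightarrow> z \<in> wint y"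
      "\<forall>i<n. \<forall>j<n. \<forall>k>0. C1_fun (\<beta> i) ((\<phi> ^^ k) (x j)) = 0 \<and> C1_fun (\<beta> i) ((\<psi> ^^ k) (x j)) = 0"
      using W0.wint_bumps[OF y(1,2), of n] by (elim exE conjE) (rule that)
    have b: "x i \<in> wint y" "j < n \<Longrightarrow> C1_fun (\<beta> i) (x j) = (if i = j then 1 else 0)"
      "C1_fun (\<beta> i) z \<noteq> 0 \<Longrightarrow> z \<in> wint y"
      "j < n \<Longrightarrow> k > 0 \<Longrightarrow> C1_fun (\<beta> i) ((\<phi> ^^ k) (x j)) = 0"
      "j < n \<Longrightarrow> k > 0 \<Longrightarrow> C1_fun (\<beta> i) ((\<psi> ^^ k) (x j)) = 0" if "i < n" for i j z k
      using wb that by blast+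
    have xI: "x i \<in> {0..1}" and xF: "x i \<notin> Fix" if "i < n" for i
      by (rule wint_Icc[OF y(1) b(1)[OF that]], rule wint_not_Fix[OF y(1) b(1)[OF that]])
    have "\<beta> i \<in> X0" if "i < n" for i
      using b(3)[OF that] wint_not_Fix[OF y(1)] pF qF unfolding X0_def by blast
    moreover have "summable (\<lambda>k. cmod (C1_fun ((T ^^ k) f) (x i)))" if "i < n" "f \<in> X0" for i f
      using y(3) that(2) omega_wint[OF y(1) b(1)[OF that(1)]]
      by (intro summable_T_iter_point xI xF that(1)) (auto simp: X0_def)
    moreover have "summable (\<lambda>k. cmod (C1_fun ((T' ^^ k) f) (x i)))" if "i < n" "f \<in> X0" for i f
    proof (rule i.summable_T_iter_point[OF xI[OF that(1)]])
      note om = omega_inv_wint[OF y(1) b(1)[OF that(1)]]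
      show "x i \<notin> i.Fix" using xF[OF that(1)] by (simp add: Fix_inverse)
      show "cmod (deriv_weight \<psi> w' (omega \<psi> (x i))) < 1"
        unfolding om deriv_weight_inverse[OF pI] W0.inv_omega(2)[OF y(1)] by (rule cmod_inverse_less[OF y(4)])
      show "C1_fun f (omega \<psi> (x i)) = 0" using that(2) by (simp add: om X0_def)
    qed
    ultimately show "\<exists>\<beta> e. \<forall>i<n. cfunctional (e i) \<and> \<beta> i \<in> X0 \<and>
      (\<forall>x\<in>X0. summable (\<lambda>k. cmod (e i ((T ^^ k) x))) \<and> summable (\<lambda>k. cmod (e i ((T' ^^ k) x)))) \<and>
      (\<forall>j<n. e i (\<beta> j) = (if i = j then 1 else 0) \<and>
        (\<forall>k>0. e i ((T ^^ k) (\<beta> j)) = 0 \<and> e i ((T' ^^ k) (\<beta> j)) = 0))"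
      using b by (intro exI[of _ \<beta>] exI[of _ "\<lambda>i f. C1_fun f (x i)"])
        (auto simp: C1_functional C1_fun_T_iter[OF xI] i.C1_fun_T_iter[OF xI])
  qed simp
qed

text \<open>For a fixed vector of \<open>T\<close> the values of the iterates at a point form a
  constant sequence, which is also summable along the forward or the backward orbit; hence it is 0.
  Excluding expanding gaps makes one of the two directions available.\<close>

lemma eigenvector_zero:
  assumes nc: W0.noncritical and ng: "\<not> W0.expanding_gap" "\<not> W0.contracting_gap"
    and f: "T f = f" and F: "\<And>p. p \<in> Fix \<Longrightarrow> C1_fun f p = 0"
  shows "f = 0"
proof (rule C1_eqI)
  interpret i: weighted1 \<psi> \<phi> w' by (rule inverse_weighted1)
  fix x :: real assume x: "x \<in> {0..1}"
  have const: "c = 0" if "summable (\<lambda>n::nat. cmod c)" for c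
    using summable_LIMSEQ_zero[OF that] by (simp add: LIMSEQ_const_iff)
  have "C1_fun f x = 0"
  proof (cases "x \<in> Fix")
    case False
    have bd: "cmod (a (omega \<phi> x)) \<noteq> 1" "cmod (a (omega \<psi> x)) \<noteq> 1"
      using nc omega_bdFix[OF x False] i.omega_bdFix[OF x] False
      by (auto simp: W0.noncritical_def Fix_inverse bdFix_inverse)
    then consider "cmod (a (omega \<phi> x)) < 1" | "cmod (a (omega \<psi> x)) > 1"
      using ng(1) x False unfolding W0.expanding_gap_def by (meson linorder_neqE_linordered_idom)
    then show ?thesis
    proof cases
      case 1
      have "(T ^^ n) f = f" for n using f by (induction n) auto
      then show ?thesis
        using summable_T_iter_point[OF x False 1 F[OF omega_Fix[OF x]]] const by simp
    next
      case 2
      have T'f: "T' f = f" using T_inverse(2)[of f] f by simp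
      have "(T' ^^ n) f = f" for n using T'f by (induction n) auto
      moreover have "cmod (deriv_weight \<psi> w' (omega \<psi> x)) < 1"
        unfolding deriv_weight_inverse[OF i.omega_Icc[OF x]] W0.inv_omega(2)[OF x]
          by (rule cmod_inverse_less[OF 2])
      moreover have "C1_fun f (omega \<psi> x) = 0" using F i.omega_Fix[OF x] by (simp add: Fix_inverse)
      ultimately show ?thesis
        using i.summable_T_iter_point[OF x, of f] False const by (simp add: Fix_inverse)
    qed
  qed (use F in blast)
  then show "C1_fun f x = C1_fun 0 x" by simp
qed

text \<open>Conjugating by \<open>f \<mapsto> (f(0), f')\<close> turns \<open>I - T\<close> into \<open>(I - A) \<oplus> 1\<close> plus an approximable operator.\<close>

definition lift :: "(C0_Icc \<Rightarrow> C0_Icc) \<Rightarrow> C1_Icc \<Rightarrow> C1_Icc" where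
  "lift B f = primitive_C0 (B (deriv_C1 f)) + C1_fun f 0 *\<^sub>C 1"

lemma bounded_clinear_lift: "bounded_clinear B \<Longrightarrow> bounded_clinear (lift B)"
  unfolding lift_def
  by (intro bounded_clinear_plus finite_rankD[OF finite_rank_eval_C1]
      bounded_clinear_compose[OF bounded_clinear_primitive bounded_clinear_compose[OF _
        bounded_clinear_deriv_C1]])

lemma lift_lift: "(\<And>g. B (R g) = g) \<Longrightarrow> lift B (lift R f) = f"
  by (rule C1_eq_iff_deriv)
    (simp_all add: lift_def deriv_C1_add deriv_C1_scaleC deriv_C1_one deriv_primitive primitive_at_0
      complex_vector.scale_zero_right)

text \<open>The second term corrects the value at 0: \<open>lift\<close> keeps \<open>f 0\<close>,
  whereas \<open>f - T f\<close> has the value \<open>(1 - w 0) f 0\<close> there because 0 is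
  fixed.\<close>

definition defect :: "C1_Icc \<Rightarrow> C1_Icc" where
  "defect f = - primitive_C0 (mult_comp (deriv_C1 w) \<phi> f) + C1_fun f 0 *\<^sub>C ((- C1_fun w 0) *\<^sub>C 1)"

lemma approximable_defect: "approximable defect"
  unfolding defect_def
  by (intro approximable_add_finite_rank finite_rank_eval_C1
      approximable_compose_left[OF approximable_mult_comp[OF cont image_Icc(1)]
        bounded_clinear_uminus[OF bounded_clinear_primitive]])

lemma shifted_T_eq: "f - T f = lift (\<lambda>g. g - W0.A g) f + defect f"
proof (rule C1_eq_iff_deriv)
  show "C1_fun (f - T f) 0 = C1_fun (lift (\<lambda>g. g - W0.A g) f + defect f) 0"
    by (simp add: lift_def defect_def primitive_at_0 C1_fun_T fix_0 algebra_simps)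
  have "deriv_C1 (- g) = - deriv_C1 g" for g
    by (rule bounded_clinear_minus[OF bounded_clinear_deriv_C1])
  then show "deriv_C1 (f - T f) = deriv_C1 (lift (\<lambda>g. g - W0.A g) f + defect f)"
    by (simp add: lift_def defect_def deriv_C1_add deriv_C1_diff deriv_C1_scaleC deriv_C1_one deriv_primitive
        deriv_T complex_vector.scale_zero_right)
qed

lemma bounded_clinear_B: "bounded_clinear (\<lambda>g. g - W0.A g)"
  by (rule bounded_clinear_minus_fun[OF bounded_clinear_ident W0.bounded_clinear_A])

lemma T_right_invertible:
  assumes R: "bounded_clinear R" "\<And>h. R h - W0.A (R h) = h"
  shows "closed (range (\<lambda>f. f - T f))" "deficiency (\<lambda>f. f - T f) < \<infinity>"
  unfolding shifted_T_eq
  using right_invertible_perturbation[OF bounded_clinear_lift[OF bounded_clinear_B] bounded_clinear_lift[OF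
    R(1)]
      lift_lift[of "\<lambda>g. g - W0.A g" R, OF R(2)] approximable_defect] by auto

lemma T_left_invertible:
  assumes L: "bounded_clinear L" "\<And>h. L (h - W0.A h) = h"
  shows "closed (range (\<lambda>f. f - T f))" "nullity (\<lambda>f. f - T f) < \<infinity>"
  unfolding shifted_T_eq
  using left_invertible_perturbation[OF bounded_clinear_lift[OF bounded_clinear_B] bounded_clinear_lift[OF L(1)]
      lift_lift[of L "\<lambda>g. g - W0.A g", OF L(2)] approximable_defect] by auto

lemma T_invertible:
  assumes L: "bounded_clinear L" "\<And>h. L (h - W0.A h) = h" "\<And>h. L h - W0.A (L h) = h"
  shows "Fredholm (\<lambda>f. f - T f)" "Fredholm_index (\<lambda>f. f - T f) = 0"
  unfolding shifted_T_eq
  using invertible_perturbation[OF bounded_clinear_lift[OF bounded_clinear_B] bounded_clinear_lift[OF L(1)]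
      lift_lift[of L "\<lambda>g. g - W0.A g", OF L(2)] lift_lift[of "\<lambda>g. g - W0.A g" L, OF L(3)]
        approximable_defect] by auto

end

section \<open>Singular windows at critical fixed points\<close>

lemma not_semi_FredholmI:
  assumes "closed (range S) \<Longrightarrow> nullity S = \<infinity>" "closed (range S) \<Longrightarrow> deficiency S = \<infinity>"
  shows "\<not> semi_Fredholm S"
  using assms by (auto simp: semi_Fredholm_def)

text \<open>A bounded function on a short window has a uniformly small primitive. This passes
  near-kernel functions of \<open>I - A\<close> on to \<open>I - T\<close>, as it makes the
  lower-order term small.\<close>

lemma primitive_small:
  assumes supp: "\<And>z. C0_fun g z \<noteq> 0 \<Longrightarrow> \<bar>z - p\<bar> < \<rho>" and c: "\<And>z. cmod (C0_fun g z) \<le> c" and \<rho>: "\<rho> > 0"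
  shows "cmod (C1_fun (primitive_C0 g) z) \<le> 2 * c * \<rho>"
proof -
  have c0: "c \<ge> 0" using c[of 0] norm_ge_zero order_trans by blast
  show ?thesis
  proof (cases "z \<in> {0..1}")
    case False
    then show ?thesis using c0 \<rho> by (simp add: C1_fun_outside)
  next
    case True
    have int: "(\<lambda>_::real. c) integrable_on {max 0 (p - \<rho>)..min z (p + \<rho>)}" by (rule integrable_const_ivl)
    have I: "{p - \<rho>..p + \<rho>} \<inter> {0..z} = {max 0 (p - \<rho>)..min z (p + \<rho>)}" by auto
    have "norm (integral {0..z} (C0_fun g)) \<le> integral {0..z} (\<lambda>t. if t \<in> {p - \<rho>..p + \<rho>} then c else 0)"
    proof (rule integral_norm_bound_integral)
      show "C0_fun g integrable_on {0..z}"
        by (rule integrable_continuous_interval, rule continuous_on_subset[OF continuous_on_C0_fun])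
          (use True in auto)
      show "(\<lambda>t. if t \<in> {p - \<rho>..p + \<rho>} then c else 0) integrable_on {0..z}"
        using int unfolding I[symmetric] by (rule integrable_restrict_Int[THEN iffD2])
      show "norm (C0_fun g t) \<le> (if t \<in> {p - \<rho>..p + \<rho>} then c else 0)" for t
        using supp[of t] c[of t] c0 by (cases "C0_fun g t = 0") auto
    qed
    also have "\<dots> = integral ({p - \<rho>..p + \<rho>} \<inter> {0..z}) (\<lambda>_. c)"
      using integral_restrict_Int[of "{0..z}" "{p - \<rho>..p + \<rho>}" "\<lambda>_. c"] by (simp add: Int_commute)
    also have "\<dots> \<le> 2 * \<rho> * c"
      unfolding I using c0 \<rho> by (simp add: content_real_if mult_right_mono)
    finally show ?thesis using True by (simp add: C1_fun_primitive ac_simps)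
  qed
qed

context weighted0
begin

text \<open>On a window \<open>(u, v)\<close> the operator \<open>I - A\<close> almost annihilates the functions \<open>G \<beta>\<close>, and the
  functionals \<open>l x\<close> almost annihilate its range; the functionals \<open>e x\<close> and the functions \<open>Y \<beta>\<close> witness
  that these systems are nondegenerate.\<close>

definition singular_window where
  "singular_window \<epsilon> h u v l e G Y \<longleftrightarrow> 0 \<le> u \<and> u < v \<and> v \<le> 1 \<and>
    (\<forall>\<beta>. (\<forall>z. C1_fun \<beta> z \<noteq> 0 \<longrightarrow> u < z \<and> z < v) \<and> (\<forall>z. cmod (C1_fun \<beta> z) \<le> 1) \<longrightarrow>
      norm (G \<beta> - A (G \<beta>)) \<le> \<epsilon> \<and> (\<forall>z. cmod (C1_fun (primitive_C0 (G \<beta>)) z) \<le> \<epsilon>) \<and>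
      norm (Y \<beta> :: C0_Icc) \<le> 2 \<and>
      (\<forall>x. u < x \<and> x < v \<longrightarrow> e x (G \<beta>) = C1_fun \<beta> x \<and> l x (Y \<beta>) = C1_fun \<beta> x)) \<and>
    (\<forall>x. u < x \<and> x < v \<longrightarrow> cfunctional (e x) \<and> (\<forall>g. cmod (e x g) \<le> norm g) \<and>
      cfunctional (l x) \<and> (\<forall>g. cmod (l x (g - A g)) \<le> \<epsilon> * norm g)) \<and>
    (\<forall>x x' f. u < x \<and> x < v \<and> u < x' \<and> x' < v \<longrightarrow>
      cmod (l x (mult_comp h \<phi> f) - l x' (mult_comp h \<phi> f)) \<le> \<epsilon> * norm f)"

lemma mult_comp_eq: "x \<in> {0..1} \<Longrightarrow> C0_fun (mult_comp h \<phi> f) x = C0_fun h x * C1_fun f (\<phi> x)"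
  by (rule C0_fun_mult_comp[OF cont]) (use into in blast)

text \<open>Around such a point \<open>A\<close> is multiplication by a function close to 1, so
  bumps and point evaluations can be taken as they are.\<close>

lemma singular_window_interior:
  assumes p: "p \<in> Fix" "p \<notin> bdFix" "a p = 1" and \<epsilon>: "\<epsilon> > 0"
  shows "\<exists>u v l e G Y. singular_window \<epsilon> h u v l e G Y"
proof -
  have pI: "p \<in> {0..1}" by (rule Fix_Icc[OF p(1)])
  obtain d where d: "d > 0" "\<And>x. x \<in> {0..1} \<Longrightarrow> \<bar>x - p\<bar> < d \<Longrightarrow> x \<in> Fix"
    using p unfolding bdFix_def by blast
  obtain d1 where d1: "d1 > 0" "\<And>x. x \<in> {0..1} \<Longrightarrow> \<bar>x - p\<bar> < d1 \<Longrightarrow> cmod (a x - 1) < \<epsilon>"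
    using cont_a[unfolded continuous_on_iff] pI \<epsilon> p(3) by (metis dist_norm real_norm_def)
  have "\<epsilon> / 4 > 0" using \<epsilon> by simp
  then obtain d2 where d2: "d2 > 0" "\<And>x. x \<in> {0..1} \<Longrightarrow> \<bar>x - p\<bar> < d2 \<Longrightarrow> cmod (C0_fun h x - C0_fun h p) < \<epsilon> / 4"
    using continuous_on_C0_fun[of h, unfolded continuous_on_iff] pI by (metis dist_norm real_norm_def)
  have h1: "norm h + 1 > 0" by (simp add: add_nonneg_pos)
  \<comment> \<open>In order: all points of the window are fixed; \<open>a\<close> is within
    \<epsilon> of 1; \<open>h\<close> varies by at most \<open>\<epsilon> / 2\<close>;
    \<open>norm h\<close> times the variation of \<open>f\<close> is at most
    \<open>\<epsilon> / 2\<close> times the norm of \<open>f\<close>; the primitive of a bump is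
    small.\<close>
  define \<rho> where "\<rho> = Min {d, d1, d2, \<epsilon> / (4 * (norm h + 1)), \<epsilon> / 4}"
  have "\<epsilon> / (4 * (norm h + 1)) > 0" using \<epsilon> h1 by simp
  then have \<rho>_pos: "\<rho> > 0" using d(1) d1(1) d2(1) \<epsilon> by (simp add: \<rho>_def)
  have \<rho>_le: "\<rho> \<le> d" "\<rho> \<le> d1" "\<rho> \<le> d2" "\<rho> \<le> \<epsilon> / (4 * (norm h + 1))" "\<rho> \<le> \<epsilon> / 4"
    unfolding \<rho>_def by (rule Min_le; simp)+
  note \<rho> = \<rho>_pos \<rho>_le
  have h\<rho>: "2 * norm h * \<rho> \<le> \<epsilon> / 2"
  proof -
    have "2 * norm h * \<rho> \<le> 2 * (norm h + 1) * (\<epsilon> / (4 * (norm h + 1)))"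
      using \<rho>(1,5) by (intro mult_mono) auto
    also have "\<dots> = \<epsilon> / 2" using h1 by (simp add: field_simps)
    finally show ?thesis .
  qed
  define u where "u = max 0 (p - \<rho>)"
  define v where "v = min 1 (p + \<rho>)"
  have uv: "0 \<le> u" "u < v" "v \<le> 1" using pI \<rho>(1) by (auto simp: u_def v_def)
  have win: "x \<in> {0..1}" "\<bar>x - p\<bar> < \<rho>" "x \<in> Fix" "cmod (a x - 1) \<le> \<epsilon>" "cmod (C0_fun h x - C0_fun h p) \<le> \<epsilon> / 4"
    if "u < x" "x < v" for x
  proof -
    show x: "x \<in> {0..1}" "\<bar>x - p\<bar> < \<rho>" using that by (auto simp: u_def v_def)
    then show "x \<in> Fix" "cmod (a x - 1) \<le> \<epsilon>" "cmod (C0_fun h x - C0_fun h p) \<le> \<epsilon> / 4"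
      using d(2) d1(2) d2(2) \<rho> by (auto intro!: less_imp_le)
  qed
  have "singular_window \<epsilon> h u v (\<lambda>x g. C0_fun g x) (\<lambda>x g. C0_fun g x) embed_C1 embed_C1"
    unfolding singular_window_def
  proof (intro conjI allI impI uv)
    fix \<beta> assume \<beta>: "(\<forall>z. C1_fun \<beta> z \<noteq> 0 \<longrightarrow> u < z \<and> z < v) \<and> (\<forall>z. cmod (C1_fun \<beta> z) \<le> 1)"
    show "norm (embed_C1 \<beta> - A (embed_C1 \<beta>)) \<le> \<epsilon>"
    proof (rule C0_norm_least)
      fix z :: real assume z: "z \<in> {0..1}"
      show "cmod (C0_fun (embed_C1 \<beta> - A (embed_C1 \<beta>)) z) \<le> \<epsilon>"
      proof (cases "u < z \<and> z < v")
        case True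
        then have "\<phi> z = z" using win(3) Fix_eq by blast
        then have "C0_fun (embed_C1 \<beta> - A (embed_C1 \<beta>)) z = - (a z - 1) * C1_fun \<beta> z"
          by (simp add: C0_fun_A[OF z] C0_fun_embed algebra_simps)
        also have "cmod \<dots> \<le> \<epsilon> * 1" unfolding norm_mult norm_minus_cancel
          using True win(4) \<beta> \<epsilon> by (intro mult_mono) auto
        finally show ?thesis by simp
      next
        case False
        have "C1_fun \<beta> (\<phi> z) = 0"
        proof (rule ccontr)
          assume "C1_fun \<beta> (\<phi> z) \<noteq> 0"
          then have w: "u < \<phi> z" "\<phi> z < v" using \<beta> by auto
          then have "z \<in> Fix" using win(3) image_Fix_iff[OF z] by blast
          then show False using w False by (simp add: Fix_eq)
        qed
        moreover have "C1_fun \<beta> z = 0" using False \<beta> by blast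
        ultimately show ?thesis using \<epsilon> by (simp add: C0_fun_A[OF z] C0_fun_embed)
      qed
    qed
    show "cmod (C1_fun (primitive_C0 (embed_C1 \<beta>)) z) \<le> \<epsilon>" for z
    proof -
      have "cmod (C1_fun (primitive_C0 (embed_C1 \<beta>)) z) \<le> 2 * 1 * \<rho>"
        by (rule primitive_small[of _ p]) (use \<beta> win(2) \<rho>(1) in \<open>auto simp: C0_fun_embed\<close>)
      then show ?thesis using \<rho>(6) \<epsilon> by simp
    qed
    have "norm (embed_C1 \<beta>) \<le> 1" by (rule C0_norm_least) (use \<beta> in \<open>auto simp: C0_fun_embed\<close>)
    then show "norm (embed_C1 \<beta>) \<le> 2" by simp
  next
    fix x g assume x: "u < x \<and> x < v"
    then have xI: "x \<in> {0..1}" and xF: "\<phi> x = x" using win Fix_eq by blast+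
    have "C0_fun (g - A g) x = - (a x - 1) * C0_fun g x" by (simp add: C0_fun_A[OF xI] xF algebra_simps)
    also have "cmod \<dots> \<le> \<epsilon> * norm g" unfolding norm_mult norm_minus_cancel
      using x win(4) \<epsilon> by (intro mult_mono C0_norm_bound) auto
    finally show "cmod (C0_fun (g - A g) x) \<le> \<epsilon> * norm g" .
  next
    fix x x' f assume xx: "u < x \<and> x < v \<and> u < x' \<and> x' < v"
    then have I: "x \<in> {0..1}" "x' \<in> {0..1}" and F: "\<phi> x = x" "\<phi> x' = x'" using win Fix_eq by blast+
    have "cmod (C0_fun h x - C0_fun h x') \<le> \<epsilon> / 4 + \<epsilon> / 4"
      using xx win(5)[of x] win(5)[of x'] norm_triangle_ineq4[of "C0_fun h x - C0_fun h p"
        "C0_fun h x' - C0_fun h p"] by simp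
    then have 1: "cmod ((C0_fun h x - C0_fun h x') * C1_fun f x) \<le> \<epsilon> / 2 * norm f"
      unfolding norm_mult using \<epsilon> by (intro mult_mono C1_norm_bound) auto
    have "\<bar>x - x'\<bar> \<le> 2 * \<rho>" using xx win(2)[of x] win(2)[of x'] by linarith
    then have "cmod (C1_fun f x - C1_fun f x') \<le> norm f * (2 * \<rho>)"
      using mult_mono[OF norm_deriv_C1[of f], of "\<bar>x - x'\<bar>" "2 * \<rho>"] C1_lipschitz[OF I, of f] by simp
    then have "cmod (C0_fun h x' * (C1_fun f x - C1_fun f x')) \<le> norm h * (norm f * (2 * \<rho>))"
      unfolding norm_mult by (intro mult_mono C0_norm_bound) auto
    also have "\<dots> \<le> \<epsilon> / 2 * norm f" using mult_right_mono[OF h\<rho>, of "norm f"] by (simp add: ac_simps)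
    finally have 2: "cmod (C0_fun h x' * (C1_fun f x - C1_fun f x')) \<le> \<epsilon> / 2 * norm f" .
    have "C0_fun (mult_comp h \<phi> f) x - C0_fun (mult_comp h \<phi> f) x' =
        (C0_fun h x - C0_fun h x') * C1_fun f x + C0_fun h x' * (C1_fun f x - C1_fun f x')"
      by (simp add: mult_comp_eq[OF I(1)] mult_comp_eq[OF I(2)] F algebra_simps)
    then show "cmod (C0_fun (mult_comp h \<phi> f) x - C0_fun (mult_comp h \<phi> f) x') \<le> \<epsilon> * norm f"
      using norm_triangle_mono[OF 1 2] by simp
  qed (auto simp: C0_functional C0_norm_bound C0_fun_embed)
  then show ?thesis by blast
qed

lemma A_iter_inverse: "(A ^^ k) ((A' ^^ k) g) = g"
proof (induction k arbitrary: g)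
  case (Suc k)
  have "(A ^^ Suc k) ((A' ^^ Suc k) g) = (A ^^ k) (A (A' ((A' ^^ k) g)))" by (simp add: funpow_swap1)
  then show ?case using Suc by (simp add: A_inverse)
qed simp

lemma continuous_cocycle: "continuous_on {0..1} (cocycle k)"
  unfolding cocycle_def
  by (intro continuous_on_prod continuous_on_compose2[OF cont_a iter_continuous]) (use iter_Icc in auto)

text \<open>Near a boundary fixed point with \<open>cmod (a p) = 1\<close> the cocycle stays between \<open>1/2\<close> and \<open>2\<close> along
  arbitrarily long orbit segments, so averaging over such a segment is almost invariant.\<close>

lemma singular_window_boundary:
  assumes p: "p \<in> bdFix" "cmod (a p) = 1" and \<epsilon>: "\<epsilon> > 0"
  shows "\<exists>u v l e G Y. singular_window \<epsilon> h u v l e G Y"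
proof -
  interpret i: weighted0 \<psi> \<phi> "\<lambda>x. 1 / a (\<psi> x)" by (rule inverse_weighted)
  have pF: "p \<in> Fix" using p(1) by (simp add: bdFix_def)
  have pI: "p \<in> {0..1}" by (rule Fix_Icc[OF pF])
  \<comment> \<open>The tent function below changes by at most \<open>2 / N\<close> per step and the
    inverse cocycle costs another factor 2, whence \<open>4 / N \<le> \<epsilon>\<close>.\<close>
  obtain N0 :: nat where "4 / \<epsilon> \<le> real N0" using real_arch_simple by blast
  define N where "N = Suc N0"
  have "4 / \<epsilon> \<le> real N" using \<open>4 / \<epsilon> \<le> real N0\<close> by (simp add: N_def)
  then have N: "4 / real N \<le> \<epsilon>" "N > 0" using \<epsilon> by (auto simp: N_def field_simps)
  define L where "L = 2 * N"
  have L: "L > 0" "N < L" using N(2) by (auto simp: L_def)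
  have h1: "norm h + 1 > 0" by (simp add: add_nonneg_pos)
  define \<rho> where "\<rho> = min (\<epsilon> / 8) (\<epsilon> / (8 * (norm h + 1)))"
  have \<rho>: "\<rho> > 0" "8 * \<rho> \<le> \<epsilon>" using \<epsilon> h1 by (auto simp: \<rho>_def)
  have h\<rho>: "2 * norm h * \<rho> \<le> \<epsilon> / 4"
  proof -
    have "2 * norm h * \<rho> \<le> 2 * (norm h + 1) * (\<epsilon> / (8 * (norm h + 1)))"
      using \<rho>(1) by (intro mult_mono) (auto simp: \<rho>_def)
    also have "\<dots> = \<epsilon> / 4" using h1 by (simp add: field_simps)
    finally show ?thesis .
  qed
  have "\<forall>\<^sub>F x in at p within {0..1}. \<forall>k\<in>{..L}. 1/2 < cmod (cocycle k x) \<and> cmod (cocycle k x) < 2 \<and>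
    \<bar>(\<phi> ^^ k) x - p\<bar> < \<rho>"
  proof (rule eventually_ball_finite, simp, intro ballI)
    fix k
    \<comment> \<open>At \<open>p\<close> the cocycle has modulus 1 for every k, so near
      \<open>p\<close> it stays between 1/2 and 2 for the finitely many k \<le> L.\<close>
    have "cocycle k p = a p ^ k" by (simp add: cocycle_def iter_Fix[OF pF])
    then have cp: "cmod (cocycle k p) = 1" by (simp add: norm_power p(2))
    have "((\<lambda>x. cmod (cocycle k x)) \<longlongrightarrow> cmod (cocycle k p)) (at p within {0..1})"
      using continuous_cocycle pI by (intro tendsto_norm) (auto simp: continuous_on_def)
    then have t: "((\<lambda>x. cmod (cocycle k x)) \<longlongrightarrow> 1) (at p within {0..1})" by (simp add: cp)
    have "((\<phi> ^^ k) \<longlongrightarrow> (\<phi> ^^ k) p) (at p within {0..1})"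
      using iter_continuous pI by (auto simp: continuous_on_def)
    then have "\<forall>\<^sub>F x in at p within {0..1}. dist ((\<phi> ^^ k) x) p < \<rho>"
      using tendstoD[OF _ \<rho>(1)] by (simp add: iter_Fix[OF pF])
    with order_tendstoD(1)[OF t, of "1/2", simplified] order_tendstoD(2)[OF t, of 2, simplified]
    show "\<forall>\<^sub>F x in at p within {0..1}. 1/2 < cmod (cocycle k x) \<and> cmod (cocycle k x) < 2 \<and> \<bar>(\<phi> ^^ k) x - p\<bar> < \<rho>"
      by eventually_elim (auto simp: dist_real_def)
  qed
  then obtain \<delta> where \<delta>: "\<delta> > 0" "\<And>x k. x \<in> {0..1} \<Longrightarrow> x \<noteq> p \<Longrightarrow> \<bar>x - p\<bar> < \<delta> \<Longrightarrow> k \<le> L \<Longrightarrow>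
      1/2 < cmod (cocycle k x) \<and> cmod (cocycle k x) < 2 \<and> \<bar>(\<phi> ^^ k) x - p\<bar> < \<rho>"
    unfolding eventually_at dist_real_def by auto
  obtain x0 where x0: "x0 \<in> {0..1}" "x0 \<notin> Fix" "\<bar>x0 - p\<bar> < \<delta>"
    using p(1) \<delta>(1) unfolding bdFix_def by blast
  \<comment> \<open>Since the orbit segment stays within \<rho> of \<open>p\<close>,
    \<open>l x (mult_comp h \<phi> f)\<close> is close to \<open>C1_fun f p * \<sigma> x\<close>;
    continuity of \<sigma> then makes the functionals at neighbouring points nearly agree on this
    term.\<close>
  define \<sigma> where "\<sigma> x = (\<Sum>k<L. cocycle k x * C0_fun h ((\<phi> ^^ k) x)) / of_nat L" for x
  have "continuous_on {0..1} \<sigma>" unfolding \<sigma>_def using L(1)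
    by (intro continuous_intros continuous_cocycle continuous_on_compose2[OF continuous_on_C0_fun
      iter_continuous])
      (use iter_Icc in auto)
  moreover have "\<epsilon> / 4 > 0" using \<epsilon> by simp
  ultimately obtain s0 where s0: "s0 > 0" "\<And>x. x \<in> {0..1} \<Longrightarrow> \<bar>x - x0\<bar> < s0 \<Longrightarrow> cmod (\<sigma> x - \<sigma> x0) < \<epsilon> / 4"
    unfolding continuous_on_iff using x0(1) by (metis dist_norm real_norm_def)
  define s where "s = min s0 (\<delta> - \<bar>x0 - p\<bar>)"
  have s: "s > 0" "s \<le> s0" "\<And>x. \<bar>x - x0\<bar> < s \<Longrightarrow> \<bar>x - p\<bar> < \<delta>"
    using s0(1) x0(3) by (auto simp: s_def)
  \<comment> \<open>The window is a part of the wandering interval adjacent to \<open>x0\<close>,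
    short enough that \<sigma> is nearly constant on it and that it stays within \<delta> of
    \<open>p\<close>.\<close>
  define u where "u = (if x0 < \<phi> x0 then x0 else max (\<phi> x0) (x0 - s))"
  define v where "v = (if x0 < \<phi> x0 then min (\<phi> x0) (x0 + s) else x0)"
  have \<phi>x0: "\<phi> x0 \<in> {0..1}" "\<phi> x0 \<noteq> x0" using into[OF x0(1)] x0 by (auto simp: Fix_def)
  have uv: "0 \<le> u" "u < v" "v \<le> 1" using x0(1) \<phi>x0 s(1) by (auto simp: u_def v_def)
  have win: "x \<in> wint x0" "\<bar>x - x0\<bar> < s" if "u < x" "x < v" for x
    using that \<phi>x0(2) by (auto simp: u_def v_def wint_def split: if_splits)
  have wI: "x \<in> {0..1}" and wc: "k \<le> L \<Longrightarrow> 1/2 < cmod (cocycle k x) \<and> cmod (cocycle k x) < 2 \<and>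
    \<bar>(\<phi> ^^ k) x - p\<bar> < \<rho>"
    if "u < x" "x < v" for x k
  proof -
    show xI: "x \<in> {0..1}" by (rule wint_Icc[OF x0(1) win(1)[OF that]])
    have "x \<noteq> p" using wint_not_Fix[OF x0(1) win(1)[OF that]] pF by blast
    then show "k \<le> L \<Longrightarrow> 1/2 < cmod (cocycle k x) \<and> cmod (cocycle k x) < 2 \<and> \<bar>(\<phi> ^^ k) x - p\<bar> < \<rho>"
      using \<delta>(2)[OF xI _ s(3)[OF win(2)[OF that]]] by blast
  qed
  \<comment> \<open>The translates of \<beta> along the segment have disjoint supports because the
    window wanders, so the sup norm sees one term at a time.\<close>
  define H where "H c \<beta> = (\<Sum>k<L. c k *\<^sub>C (A' ^^ k) (embed_C1 \<beta>))" for c \<beta>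
  have val: "C0_fun ((A' ^^ k) (embed_C1 \<beta>)) ((\<phi> ^^ k) x) = C1_fun \<beta> x / cocycle k x"
    if x: "u < x" "x < v" and k: "k \<le> L" for x k \<beta>
  proof -
    have "cocycle k x * C0_fun ((A' ^^ k) (embed_C1 \<beta>)) ((\<phi> ^^ k) x) =
      C0_fun ((A ^^ k) ((A' ^^ k) (embed_C1 \<beta>))) x"
      by (simp add: C0_fun_A_iter[OF wI[OF x]])
    also have "\<dots> = C1_fun \<beta> x" by (simp add: A_iter_inverse C0_fun_embed)
    finally have "cocycle k x * C0_fun ((A' ^^ k) (embed_C1 \<beta>)) ((\<phi> ^^ k) x) = C1_fun \<beta> x" .
    moreover have "cocycle k x \<noteq> 0" using wc[OF x k] by auto
    ultimately show ?thesis by (simp add: field_simps)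
  qed
  have supp: "\<exists>x. u < x \<and> x < v \<and> z = (\<phi> ^^ k) x"
    if z: "C0_fun ((A' ^^ k) (embed_C1 \<beta>)) z \<noteq> 0" and \<beta>: "\<forall>z. C1_fun \<beta> z \<noteq> 0 \<longrightarrow> u < z \<and> z < v" for \<beta> k z
  proof -
    have zI: "z \<in> {0..1}" using z C0_fun_outside by blast
    have "C1_fun \<beta> ((\<psi> ^^ k) z) \<noteq> 0"
      using z by (auto simp: i.C0_fun_A_iter[OF zI] C0_fun_embed)
    then show ?thesis using \<beta> i.iter_left_inv[OF zI, of k] by metis
  qed
  have disj: "k = j" if x: "u < x" "x < v" and x': "u < x'" "x' < v" and eq: "(\<phi> ^^ j) x = (\<phi> ^^ k) x'"
    for x x' j k
  proof -
    have *: False if "u < x" "x < v" "u < x'" "x' < v" "(\<phi> ^^ j) x = (\<phi> ^^ k) x'" "j < k" for x x' j k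
    proof -
      have "(\<psi> ^^ j) ((\<phi> ^^ k) x') = (\<phi> ^^ (k - j)) x'"
        using iter_partial_inv[OF wI[OF that(3,4)], of "k - j" k] that(6) by simp
      moreover have "(\<psi> ^^ j) ((\<phi> ^^ j) x) = x" by (rule iter_left_inv[OF wI[OF that(1,2)]])
      ultimately have "(\<phi> ^^ (k - j)) x' = x" using that(5) by simp
      then show False using wint_wandering[OF x0(1) win(1)[OF that(3,4)], of "k - j"] win(1)[OF that(1,2)]
        that(6) by simp
    qed
    show ?thesis using *[OF x x' eq] *[OF x' x eq[symmetric]] by (meson linorder_neqE_nat)
  qed
  have Hval: "C0_fun (H c \<beta>) ((\<phi> ^^ j) x) = c j * (C1_fun \<beta> x / cocycle j x)"
    if x: "u < x" "x < v" and j: "j < L" and \<beta>: "\<forall>z. C1_fun \<beta> z \<noteq> 0 \<longrightarrow> u < z \<and> z < v" for c \<beta> j x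
  proof -
    have z: "C0_fun ((A' ^^ k) (embed_C1 \<beta>)) ((\<phi> ^^ j) x) = 0" if "k \<noteq> j" for k
      using supp[OF _ \<beta>, of k "(\<phi> ^^ j) x"] disj[OF x] that by blast
    have "C0_fun (H c \<beta>) ((\<phi> ^^ j) x) = (\<Sum>k<L. if k = j then c j * (C1_fun \<beta> x / cocycle j x) else 0)"
      unfolding H_def C0_fun_sum using z val[OF x less_imp_le[OF j], of \<beta>] by (intro sum.cong) auto
    then show ?thesis using j by simp
  qed
  have Hsupp: "\<exists>x j. u < x \<and> x < v \<and> j < L \<and> z = (\<phi> ^^ j) x"
    if "C0_fun (H c \<beta>) z \<noteq> 0" and \<beta>: "\<forall>z. C1_fun \<beta> z \<noteq> 0 \<longrightarrow> u < z \<and> z < v" for c \<beta> z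
  proof -
    have "\<exists>k<L. C0_fun ((A' ^^ k) (embed_C1 \<beta>)) z \<noteq> 0"
    proof (rule ccontr)
      assume "\<not> ?thesis"
      then have "C0_fun (H c \<beta>) z = 0" unfolding H_def C0_fun_sum by (intro sum.neutral) auto
      then show False using that(1) by simp
    qed
    then show ?thesis using supp[OF _ \<beta>] by blast
  qed
  have Hnorm: "cmod (C0_fun (H c \<beta>) z) \<le> 2 * C"
    if c: "\<And>k. k < L \<Longrightarrow> cmod (c k) \<le> C" and C: "C \<ge> 0"
      and \<beta>: "\<forall>z. C1_fun \<beta> z \<noteq> 0 \<longrightarrow> u < z \<and> z < v" "\<forall>z. cmod (C1_fun \<beta> z) \<le> 1" for c C \<beta> z
  proof (cases "C0_fun (H c \<beta>) z = 0")
    case False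
    then obtain x j where xj: "u < x" "x < v" "j < L" "z = (\<phi> ^^ j) x" using Hsupp[OF _ \<beta>(1)] by blast
    have "1/2 < cmod (cocycle j x)" using wc[OF xj(1,2)] xj(3) by simp
    then have "cmod (C1_fun \<beta> x) / cmod (cocycle j x) \<le> 1 / (1/2)" using \<beta>(2) by (intro frac_le) auto
    then have "cmod (c j) * (cmod (C1_fun \<beta> x) / cmod (cocycle j x)) \<le> C * 2"
      using c[OF xj(3)] C by (intro mult_mono) auto
    then show ?thesis unfolding xj(4) Hval[OF xj(1-3) \<beta>(1)] by (simp add: norm_mult norm_divide)
  qed (use C in simp)
  \<comment> \<open>A tent of height 2 at N. Its zeros at 0 and L let \<open>A\<close> act as a
    shift of the coefficients without boundary terms, and its small steps make the sum almost
    invariant.\<close>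
  define t where "t k = complex_of_real (2 * real (min k (L - k)) / real N)" for k
  have t0: "t 0 = 0" "t L = 0" "t N = 2" using N(2) by (auto simp: t_def L_def)
  have t2: "cmod (t k) \<le> 2" for k
  proof -
    have "real (min k (L - k)) \<le> real N" by (simp add: L_def)
    then show ?thesis unfolding t_def norm_of_real using N(2) by (simp add: divide_le_eq)
  qed
  have tstep: "cmod (t k - t (Suc k)) \<le> 2 / real N" for k
  proof -
    have "t k - t (Suc k) =
      complex_of_real (2 * (real (min k (L - k)) - real (min (Suc k) (L - Suc k))) / real N)"
      by (simp add: t_def diff_divide_distrib right_diff_distrib)
    also have "cmod \<dots> = 2 * \<bar>real (min k (L - k)) - real (min (Suc k) (L - Suc k))\<bar> / real N"
      unfolding norm_of_real abs_divide abs_mult by simp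
    also have "\<dots> \<le> 2 * 1 / real N"
      by (intro divide_right_mono mult_left_mono) auto
    finally show ?thesis by simp
  qed
  have BH: "H t \<beta> - A (H t \<beta>) = H (\<lambda>k. t k - t (Suc k)) \<beta>" for \<beta>
  proof -
    have "A (H t \<beta>) = (\<Sum>k<L. t k *\<^sub>C A ((A' ^^ k) (embed_C1 \<beta>)))"
      by (simp add: H_def bounded_clinear_rules[OF bounded_clinear_A])
    also have "\<dots> = (\<Sum>k<Suc L. t k *\<^sub>C A ((A' ^^ k) (embed_C1 \<beta>)))" by (simp add: t0)
    also have "\<dots> = (\<Sum>k<L. t (Suc k) *\<^sub>C (A' ^^ k) (embed_C1 \<beta>))"
      unfolding sum.lessThan_Suc_shift by (simp add: t0 A_inverse)
    finally show ?thesis by (simp add: H_def complex_vector.scale_left_diff_distrib sum_subtractf)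
  qed
  \<comment> \<open>Evaluation at the top of the tent; division by the height 2 keeps the norm at
    most 1, as the cocycle is below 2.\<close>
  define e where "e x g = cocycle N x / 2 * C0_fun g ((\<phi> ^^ N) x)" for x g
  \<comment> \<open>The average telescopes on the range of \<open>I - A\<close>, leaving two
    boundary terms divided by the length L.\<close>
  define l where "l x g = (\<Sum>k<L. cocycle k x * C0_fun g ((\<phi> ^^ k) x)) / of_nat L" for x g
  have "singular_window \<epsilon> h u v l e (H t) (H (\<lambda>_. 1))"
    unfolding singular_window_def
  proof (intro conjI allI impI uv)
    fix \<beta> assume "(\<forall>z. C1_fun \<beta> z \<noteq> 0 \<longrightarrow> u < z \<and> z < v) \<and> (\<forall>z. cmod (C1_fun \<beta> z) \<le> 1)"
    then have \<beta>: "\<forall>z. C1_fun \<beta> z \<noteq> 0 \<longrightarrow> u < z \<and> z < v" "\<forall>z. cmod (C1_fun \<beta> z) \<le> 1" by auto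
    have "norm (H t \<beta> - A (H t \<beta>)) \<le> 2 * (2 / real N)"
      unfolding BH by (rule C0_norm_least, rule Hnorm[OF tstep _ \<beta>]) simp
    then show "norm (H t \<beta> - A (H t \<beta>)) \<le> \<epsilon>" using N(1) by simp
    have H4: "cmod (C0_fun (H t \<beta>) z) \<le> 4" for z
      by (rule order_trans[OF Hnorm[OF t2 _ \<beta>]]) simp_all
    have "\<bar>z - p\<bar> < \<rho>" if "C0_fun (H t \<beta>) z \<noteq> 0" for z
      using Hsupp[OF that \<beta>(1)] wc by (metis less_imp_le)
    then have "cmod (C1_fun (primitive_C0 (H t \<beta>)) z) \<le> 2 * 4 * \<rho>" for z
      using primitive_small[OF _ H4 \<rho>(1)] by blast
    then show "cmod (C1_fun (primitive_C0 (H t \<beta>)) z) \<le> \<epsilon>" for z using \<rho>(2) order_trans by fastforce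
    have "norm (H (\<lambda>_. 1) \<beta>) \<le> 2 * 1"
      by (rule C0_norm_least, rule Hnorm[OF _ _ \<beta>]) auto
    then show "norm (H (\<lambda>_. 1) \<beta>) \<le> 2" by simp
    fix x assume "u < x \<and> x < v"
    then have x: "u < x" "x < v" by auto
    have nz: "cocycle k x \<noteq> 0" if "k \<le> L" for k using wc[OF x that] by auto
    show "e x (H t \<beta>) = C1_fun \<beta> x"
      using nz[of N] L(2) unfolding e_def Hval[OF x L(2) \<beta>(1)] by (simp add: t0)
    have "l x (H (\<lambda>_. 1) \<beta>) = (\<Sum>k<L. C1_fun \<beta> x) / of_nat L"
      unfolding l_def using nz by (intro arg_cong2[of _ _ _ _ "(/)"] sum.cong) (auto simp: Hval[OF x _ \<beta>(1)])
    then show "l x (H (\<lambda>_. 1) \<beta>) = C1_fun \<beta> x" using L(1) by simp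
  next
    fix x assume "u < x \<and> x < v"
    then have x: "u < x" "x < v" by auto
    show "cfunctional (e x)" "cfunctional (l x)"
      unfolding e_def l_def cfunctional_def
      by (auto simp: algebra_simps sum.distrib add_divide_distrib sum_distrib_left)
    show "cmod (e x g) \<le> norm g" for g
    proof -
      have "cmod (cocycle N x) / 2 * cmod (C0_fun g ((\<phi> ^^ N) x)) \<le> 1 * norm g"
        using wc[OF x, of N] L(2) by (intro mult_mono C0_norm_bound) auto
      then show ?thesis by (simp add: e_def norm_mult norm_divide)
    qed
    show "cmod (l x (g - A g)) \<le> \<epsilon> * norm g" for g
    proof -
      let ?q = "\<lambda>k. cocycle k x * C0_fun g ((\<phi> ^^ k) x)"
      have "cocycle k x * C0_fun (g - A g) ((\<phi> ^^ k) x) = ?q k - ?q (Suc k)" for k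
        by (simp add: C0_fun_A[OF iter_Icc[OF wI[OF x]]] cocycle_def algebra_simps)
      then have "(\<Sum>k<L. cocycle k x * C0_fun (g - A g) ((\<phi> ^^ k) x)) = ?q 0 - ?q L"
        by (simp only: sum_lessThan_telescope'[of ?q L])
      then have "l x (g - A g) = (?q 0 - ?q L) / of_nat L" by (simp only: l_def)
      then have "cmod (l x (g - A g)) = cmod (?q 0 - ?q L) / real L" by (simp add: norm_divide)
      also have "cmod (?q 0 - ?q L) \<le> 1 * norm g + 2 * norm g"
      proof (rule order_trans[OF norm_triangle_ineq4 add_mono])
        show "cmod (?q 0) \<le> 1 * norm g" by (simp add: cocycle_def C0_norm_bound)
        show "cmod (?q L) \<le> 2 * norm g" unfolding norm_mult
          using wc[OF x, of L] by (intro mult_mono C0_norm_bound) auto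
      qed
      also have "(1 * norm g + 2 * norm g) / real L \<le> \<epsilon> * norm g"
      proof -
        have "3 / real L \<le> 4 / real N" using N(2) by (simp add: L_def field_simps)
        then have "3 / real L \<le> \<epsilon>" using N(1) by linarith
        from mult_right_mono[OF this, of "norm g"] show ?thesis by simp
      qed
      finally show ?thesis using L(1) by (simp add: divide_right_mono)
    qed
  next
    fix x x' f assume xx: "u < x \<and> x < v \<and> u < x' \<and> x' < v"
    have approx: "cmod (l x (mult_comp h \<phi> f) - C1_fun f p * \<sigma> x) \<le> \<epsilon> / 4 * norm f" if x: "u < x" "x < v" for x
    proof -
      have "l x (mult_comp h \<phi> f) - C1_fun f p * \<sigma> x =
          (\<Sum>k<L. cocycle k x * (C0_fun h ((\<phi> ^^ k) x) * (C1_fun f ((\<phi> ^^ Suc k) x) - C1_fun f p))) / of_nat L"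
        unfolding l_def \<sigma>_def
        by (simp add: mult_comp_eq[OF iter_Icc[OF wI[OF x]]] algebra_simps sum_subtractf sum_distrib_left
          diff_divide_distrib)
      also have "cmod \<dots> \<le> (\<Sum>k<L. 2 * norm h * \<rho> * norm f) / real L"
        unfolding norm_divide norm_of_nat
      proof (rule divide_right_mono, rule order_trans[OF norm_sum], rule sum_mono)
        fix k assume "k \<in> {..<L}"
        then have k: "k \<le> L" "Suc k \<le> L" by auto
        have "cmod (C1_fun f ((\<phi> ^^ Suc k) x) - C1_fun f p) \<le> norm f * \<rho>"
          using C1_lipschitz[OF iter_Icc[OF wI[OF x]] pI, of f "Suc k"] wc[OF x k(2)]
            mult_mono[OF norm_deriv_C1[of f], of "\<bar>(\<phi> ^^ Suc k) x - p\<bar>" \<rho>] by simp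
        then have "cmod (cocycle k x) * (cmod (C0_fun h ((\<phi> ^^ k) x)) * cmod (C1_fun f ((\<phi> ^^ Suc k) x) -
          C1_fun f p))
            \<le> 2 * (norm h * (norm f * \<rho>))"
          using wc[OF x k(1)] \<rho>(1) by (intro mult_mono C0_norm_bound) auto
        then show "norm (cocycle k x * (C0_fun h ((\<phi> ^^ k) x) * (C1_fun f ((\<phi> ^^ Suc k) x) - C1_fun f p)))
            \<le> 2 * norm h * \<rho> * norm f" by (simp add: norm_mult ac_simps)
      qed simp
      also have "\<dots> = 2 * norm h * \<rho> * norm f" using L(1) by simp
      also have "\<dots> \<le> \<epsilon> / 4 * norm f" by (rule mult_right_mono[OF h\<rho>]) simp
      finally show ?thesis .
    qed
    have x: "u < x" "x < v" and x': "u < x'" "x' < v" using xx by auto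
    have "cmod (\<sigma> x - \<sigma> x0) < \<epsilon> / 4" "cmod (\<sigma> x' - \<sigma> x0) < \<epsilon> / 4"
      using s0(2)[OF wI[OF x]] s0(2)[OF wI[OF x']] win(2)[OF x] win(2)[OF x'] s(2) by auto
    then have "cmod (\<sigma> x - \<sigma> x') \<le> \<epsilon> / 2"
      using norm_triangle_ineq4[of "\<sigma> x - \<sigma> x0" "\<sigma> x' - \<sigma> x0"] by simp
    then have "cmod (C1_fun f p) * cmod (\<sigma> x - \<sigma> x') \<le> norm f * (\<epsilon> / 2)"
      by (intro mult_mono C1_norm_bound) auto
    then have 3: "cmod (C1_fun f p * \<sigma> x - C1_fun f p * \<sigma> x') \<le> \<epsilon> / 2 * norm f"
      unfolding right_diff_distrib[symmetric] norm_mult by (simp add: mult.commute[of \<epsilon>])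
    have "l x (mult_comp h \<phi> f) - l x' (mult_comp h \<phi> f) =
        ((l x (mult_comp h \<phi> f) - C1_fun f p * \<sigma> x) - (l x' (mult_comp h \<phi> f) - C1_fun f p * \<sigma> x'))
        + (C1_fun f p * \<sigma> x - C1_fun f p * \<sigma> x')" by simp
    also have "cmod \<dots> \<le> (\<epsilon> / 4 * norm f + \<epsilon> / 4 * norm f) + \<epsilon> / 2 * norm f"
      by (intro norm_triangle_mono 3 order_trans[OF norm_triangle_ineq4 add_mono] approx x x')
    finally show "cmod (l x (mult_comp h \<phi> f) - l x' (mult_comp h \<phi> f)) \<le> \<epsilon> * norm f" by simp
  qed
  then show ?thesis by blast
qed

lemma singular_window_exists:
  assumes "\<not> noncritical" "\<epsilon> > 0"
  shows "\<exists>u v l e G Y. singular_window \<epsilon> h u v l e G Y"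
  using assms singular_window_interior[OF _ _ _ assms(2)] singular_window_boundary[OF _ _ assms(2)]
  unfolding noncritical_def by (metis norm_one)

text \<open>On the lower-order term only differences of the functionals \<open>l x\<close> are
  small, so these are used in pairs of points: hence \<open>2 * n\<close> bumps, of which those with
  even index provide the functions.\<close>

lemma singular_systems:
  fixes n :: nat
  assumes "\<not> noncritical" "\<epsilon> > 0"
  obtains g y :: "nat \<Rightarrow> C0_Icc" and e l :: "nat \<Rightarrow> C0_Icc \<Rightarrow> complex" where
    "\<forall>i<n. norm (g i - A (g i)) \<le> \<epsilon> \<and> (\<forall>z. cmod (C1_fun (primitive_C0 (g i)) z) \<le> \<epsilon>) \<and> norm (y i) \<le> 2 \<and>
      cfunctional (e i) \<and> (\<forall>g. cmod (e i g) \<le> norm g) \<and> (\<forall>j<n. e i (g j) = (if i = j then 1 else 0)) \<and>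
      cfunctional (l i) \<and> (\<forall>g. cmod (l i (g - A g)) \<le> \<epsilon> * norm g) \<and> (\<forall>j<n. l i (y j) =
        (if i = j then 1 else 0)) \<and>
      (\<forall>f. cmod (l i (mult_comp h \<phi> f)) \<le> \<epsilon> * norm f)"
proof -
  have "\<epsilon> / 2 > 0" using assms(2) by simp
  obtain u v l e G Y where w: "singular_window (\<epsilon> / 2) h u v l e G Y"
    using singular_window_exists[OF assms(1) \<open>\<epsilon> / 2 > 0\<close>] by blast
  have uv: "0 \<le> u" "u < v" "v \<le> 1" using w unfolding singular_window_def by auto
  from exists_bumps[OF uv, of "2 * n"]
  obtain x :: "nat \<Rightarrow> real" and \<beta> :: "nat \<Rightarrow> C1_Icc" where b:
    "\<forall>i<2*n. u < x i \<and> x i < v"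
    "\<forall>i<2*n. \<forall>j<2*n. C1_fun (\<beta> i) (x j) = (if i = j then 1 else 0)"
    "\<forall>i<2*n. \<forall>z. \<not> (u < z \<and> z < v) \<longrightarrow> C1_fun (\<beta> i) z = 0"
    "\<forall>i<2*n. \<forall>z. cmod (C1_fun (\<beta> i) z) \<le> 1"
    by (elim exE conjE) (rule that)
  have wb: "norm (G \<beta> - A (G \<beta>)) \<le> \<epsilon> / 2" "cmod (C1_fun (primitive_C0 (G \<beta>)) z) \<le> \<epsilon> / 2" "norm (Y \<beta>) \<le> 2"
    "u < x \<Longrightarrow> x < v \<Longrightarrow> e x (G \<beta>) = C1_fun \<beta> x" "u < x \<Longrightarrow> x < v \<Longrightarrow> l x (Y \<beta>) = C1_fun \<beta> x"
    if "\<forall>z. C1_fun \<beta> z \<noteq> 0 \<longrightarrow> u < z \<and> z < v" "\<forall>z. cmod (C1_fun \<beta> z) \<le> 1" for \<beta> z x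
    using w that unfolding singular_window_def by auto
  have wx: "cfunctional (e x)" "cmod (e x g) \<le> norm g" "cfunctional (l x)"
    "cmod (l x (g - A g)) \<le> \<epsilon> / 2 * norm g"
    if "u < x" "x < v" for x g
    using w that unfolding singular_window_def by auto
  have wd: "cmod (l x (mult_comp h \<phi> f) - l x' (mult_comp h \<phi> f)) \<le> \<epsilon> / 2 * norm f"
    if "u < x" "x < v" "u < x'" "x' < v" for x x' f
    using w that unfolding singular_window_def by blast
  have bs: "\<forall>z. C1_fun (\<beta> k) z \<noteq> 0 \<longrightarrow> u < z \<and> z < v" "\<forall>z. cmod (C1_fun (\<beta> k) z) \<le> 1" if "k < 2 * n" for k
    using b(3,4) that by blast+
  have xs: "u < x k" "x k < v" if "k < 2 * n" for k using b(1) that by auto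
  show ?thesis
  proof (rule that[of "\<lambda>i. G (\<beta> (2 * i))" "\<lambda>i. Y (\<beta> (2 * i))" "\<lambda>i. e (x (2 * i))"
        "\<lambda>i g. l (x (2 * i)) g - l (x (2 * i + 1)) g"], intro allI impI conjI)
    fix i assume i: "i < n"
    have i1: "2 * i < 2 * n" and i2: "2 * i + 1 < 2 * n" using i by auto
    show "norm (G (\<beta> (2 * i)) - A (G (\<beta> (2 * i)))) \<le> \<epsilon>" using wb(1)[OF bs[OF i1]] assms(2) by simp
    show "cmod (C1_fun (primitive_C0 (G (\<beta> (2 * i)))) z) \<le> \<epsilon>" for z
      using wb(2)[OF bs[OF i1], of z] assms(2) by simp
    show "norm (Y (\<beta> (2 * i))) \<le> 2" by (rule wb(3)[OF bs[OF i1]])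
    show "cfunctional (e (x (2 * i)))" "cmod (e (x (2 * i)) g) \<le> norm g" for g using wx(1,2)[OF xs[OF i1]]
      by auto
    show "e (x (2 * i)) (G (\<beta> (2 * j))) = (if i = j then 1 else 0)" if "j < n" for j
      using wb(4)[OF bs[of "2 * j"] xs[OF i1]] b(2) i that by auto
    note l1 = wx(3)[OF xs[OF i1]] and l2 = wx(3)[OF xs[OF i2]]
    show "cfunctional (\<lambda>g. l (x (2 * i)) g - l (x (2 * i + 1)) g)"
      using l1 l2 by (simp add: cfunctional_def algebra_simps)
    show "cmod (l (x (2 * i)) (g - A g) - l (x (2 * i + 1)) (g - A g)) \<le> \<epsilon> * norm g" for g
      using wx(4)[OF xs[OF i1], of g] wx(4)[OF xs[OF i2], of g]
        norm_triangle_ineq4[of "l (x (2 * i)) (g - A g)" "l (x (2 * i + 1)) (g - A g)"] by simp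
    show "l (x (2 * i)) (Y (\<beta> (2 * j))) - l (x (2 * i + 1)) (Y (\<beta> (2 * j))) = (if i = j then 1 else 0)"
      if "j < n" for j
    proof -
      have j: "2 * j < 2 * n" "2 * j \<noteq> 2 * i + 1" using that by presburger+
      have "C1_fun (\<beta> (2 * j)) (x (2 * i + 1)) = 0" using b(2) j i2 by simp
      moreover have "C1_fun (\<beta> (2 * j)) (x (2 * i)) = (if i = j then 1 else 0)" using b(2) j i1 by simp
      ultimately show ?thesis
        using wb(5)[OF bs[OF j(1)] xs[OF i1]] wb(5)[OF bs[OF j(1)] xs[OF i2]] by simp
    qed
    show "cmod (l (x (2 * i)) (mult_comp h \<phi> f) - l (x (2 * i + 1)) (mult_comp h \<phi> f)) \<le> \<epsilon> * norm f" for f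
    proof -
      have "\<epsilon> / 2 * norm f \<le> \<epsilon> * norm f" using assms(2) by (intro mult_right_mono) auto
      then show ?thesis using wd[OF xs[OF i1] xs[OF i2], of f] by linarith
    qed
  qed
qed

lemma not_semi_Fredholm_A:
  assumes "\<not> noncritical"
  shows "\<not> semi_Fredholm (\<lambda>g. g - A g)"
proof (rule not_semi_FredholmI)
  have S: "bounded_clinear (\<lambda>g. g - A g)"
    by (rule bounded_clinear_minus_fun[OF bounded_clinear_ident bounded_clinear_A])
  assume cl: "closed (range (\<lambda>g. g - A g))"
  show "nullity (\<lambda>g. g - A g) = \<infinity>"
  proof (rule singular_system_nullity[OF S cl])
    fix n :: nat and \<epsilon> :: real assume \<epsilon>: "\<epsilon> > 0"
    show "\<exists>g e. \<forall>i<n. norm (g i - A (g i)) \<le> \<epsilon> \<and> cfunctional (e i) \<and>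
        (\<forall>x. cmod (e i x) \<le> norm x) \<and> (\<forall>j<n. e i (g j) = (if i = j then 1 else 0))"
      by (rule singular_systems[OF assms \<epsilon>, of n 0]) blast
  qed
  show "deficiency (\<lambda>g. g - A g) = \<infinity>"
  proof (rule singular_system_deficiency[OF S cl, of 2])
    fix n :: nat and \<epsilon> :: real assume \<epsilon>: "\<epsilon> > 0"
    show "\<exists>y e. \<forall>i<n. norm (y i) \<le> 2 \<and> cfunctional (e i) \<and>
        (\<forall>x. cmod (e i (x - A x)) \<le> \<epsilon> * norm x) \<and> (\<forall>j<n. e i (y j) = (if i = j then 1 else 0))"
      by (rule singular_systems[OF assms \<epsilon>, of n 0]) blast
  qed
qed

end

context weighted1
begin

text \<open>Primitives of the functions found for \<open>A\<close> serve for \<open>T\<close>: they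
  are uniformly small, which tames the lower-order term. The functionals are composed with the
  derivative, and those for the range are small on that term too.\<close>

lemma not_semi_Fredholm_T:
  assumes "\<not> W0.noncritical"
  shows "\<not> semi_Fredholm (\<lambda>f. f - T f)"
proof (rule not_semi_FredholmI)
  let ?h = "deriv_C1 w"
  have S: "bounded_clinear (\<lambda>f. f - T f)"
    by (rule bounded_clinear_minus_fun[OF bounded_clinear_ident bounded_clinear_T])
  have cf: "cfunctional (\<lambda>f. e (deriv_C1 f))" if "cfunctional e" for e
    using that by (simp add: cfunctional_def deriv_C1_add deriv_C1_scaleC)
  have dS: "deriv_C1 (f - T f) = (deriv_C1 f - W0.A (deriv_C1 f)) - mult_comp ?h \<phi> f" for f
    by (simp add: deriv_C1_diff deriv_T)
  assume cl: "closed (range (\<lambda>f. f - T f))"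
  show "nullity (\<lambda>f. f - T f) = \<infinity>"
  proof (rule singular_system_nullity[OF S cl])
    fix n :: nat and \<epsilon> :: real assume \<epsilon>: "\<epsilon> > 0"
    define \<epsilon>' where "\<epsilon>' = \<epsilon> / (norm ?h + 1)"
    have h1: "norm ?h + 1 > 0" by (simp add: add_nonneg_pos)
    have \<epsilon>': "\<epsilon>' > 0" "\<epsilon>' + norm ?h * \<epsilon>' = \<epsilon>"
    proof -
      show "\<epsilon>' > 0" using \<epsilon> h1 by (simp add: \<epsilon>'_def)
      have "\<epsilon>' + norm ?h * \<epsilon>' = (norm ?h + 1) * \<epsilon>'" by (simp add: algebra_simps)
      then show "\<epsilon>' + norm ?h * \<epsilon>' = \<epsilon>" using h1 by (simp add: \<epsilon>'_def)
    qed
    obtain g and e :: "nat \<Rightarrow> C0_Icc \<Rightarrow> complex"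
      where g: "\<forall>i<n. norm (g i - W0.A (g i)) \<le> \<epsilon>' \<and> (\<forall>z. cmod (C1_fun (primitive_C0 (g i)) z) \<le> \<epsilon>') \<and>
      cfunctional (e i) \<and> (\<forall>g. cmod (e i g) \<le> norm g) \<and> (\<forall>j<n. e i (g j) = (if i = j then 1 else 0))"
      by (rule W0.singular_systems[OF assms \<epsilon>'(1), of n ?h]) blast
    have "norm (primitive_C0 (g i) - T (primitive_C0 (g i))) \<le> \<epsilon>" if i: "i < n" for i
    proof -
      have gi: "norm (g i - W0.A (g i)) \<le> \<epsilon>'" "\<And>z. cmod (C1_fun (primitive_C0 (g i)) z) \<le> \<epsilon>'" using g i by auto
      have "norm (mult_comp ?h \<phi> (primitive_C0 (g i))) \<le> norm ?h * \<epsilon>'"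
      proof (rule C0_norm_least)
        fix x :: real assume x: "x \<in> {0..1}"
        show "cmod (C0_fun (mult_comp ?h \<phi> (primitive_C0 (g i))) x) \<le> norm ?h * \<epsilon>'"
          unfolding W0.mult_comp_eq[OF x] norm_mult by (intro mult_mono C0_norm_bound gi) auto
      qed
      moreover have "C1_fun (primitive_C0 (g i) - T (primitive_C0 (g i))) 0 = 0"
        by (simp add: C1_fun_T primitive_at_0 fix_0)
      ultimately show ?thesis
        unfolding norm_C1_eq dS deriv_primitive
        using gi(1) \<epsilon>'(2) norm_triangle_ineq4[of "g i - W0.A (g i)" "mult_comp ?h \<phi> (primitive_C0 (g i))"]
          by simp
    qed
    moreover have "cmod (e i (deriv_C1 f)) \<le> norm f" if "i < n" for i f
      using g that norm_deriv_C1[of f] order_trans by blast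
    ultimately show "\<exists>g e. \<forall>i<n. norm (g i - T (g i)) \<le> \<epsilon> \<and> cfunctional (e i) \<and>
        (\<forall>x. cmod (e i x) \<le> norm x) \<and> (\<forall>j<n. e i (g j) = (if i = j then 1 else 0))"
      using g cf
      by (intro exI[of _ "\<lambda>i. primitive_C0 (g i)"] exI[of _ "\<lambda>i f. e i (deriv_C1 f)"])
        (simp add: deriv_primitive)
  qed
  show "deficiency (\<lambda>f. f - T f) = \<infinity>"
  proof (rule singular_system_deficiency[OF S cl, of 2])
    fix n :: nat and \<epsilon> :: real assume "\<epsilon> > 0"
    then have \<epsilon>: "\<epsilon> / 2 > 0" by simp
    obtain y and l :: "nat \<Rightarrow> C0_Icc \<Rightarrow> complex" where y: "\<forall>i<n. norm (y i) \<le> 2 \<and>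
      cfunctional (l i) \<and> (\<forall>g. cmod (l i (g - W0.A g)) \<le> \<epsilon> / 2 * norm g) \<and> (\<forall>j<n. l i (y j) =
        (if i = j then 1 else 0)) \<and>
      (\<forall>f. cmod (l i (mult_comp ?h \<phi> f)) \<le> \<epsilon> / 2 * norm f)"
      by (rule W0.singular_systems[OF assms \<epsilon>, of n ?h]) blast
    have "cmod (l i (deriv_C1 (f - T f))) \<le> \<epsilon> * norm f" if i: "i < n" for i f
    proof -
      have li: "cfunctional (l i)" "cmod (l i (deriv_C1 f - W0.A (deriv_C1 f))) \<le> \<epsilon> / 2 * norm (deriv_C1 f)"
        "cmod (l i (mult_comp ?h \<phi> f)) \<le> \<epsilon> / 2 * norm f" using y i by auto
      have "\<epsilon> / 2 * norm (deriv_C1 f) \<le> \<epsilon> / 2 * norm f" using \<epsilon> by (intro mult_left_mono norm_deriv_C1) auto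
      then show ?thesis unfolding dS cfunctional_diff[OF li(1)]
        using li(2,3) norm_triangle_ineq4[of "l i (deriv_C1 f - W0.A (deriv_C1 f))" "l i (mult_comp ?h \<phi> f)"]
        by (simp add: cfunctional_diff[OF li(1)])
    qed
    then show "\<exists>y e. \<forall>i<n. norm (y i) \<le> 2 \<and> cfunctional (e i) \<and>
        (\<forall>x. cmod (e i (x - T x)) \<le> \<epsilon> * norm x) \<and> (\<forall>j<n. e i (y j) = (if i = j then 1 else 0))"
      using y cf
      by (intro exI[of _ "\<lambda>i. primitive_C0 (y i)"] exI[of _ "\<lambda>i f. l i (deriv_C1 f)"])
        (simp add: deriv_primitive norm_primitive)
  qed
qed

end

section \<open>Spectra\<close>

lemma cdim_enat_zero: "cdim_enat {0} = 0"
proof -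
  have "cdim {0::'a} \<le> card ({}::'a set)" by (rule complex_vector.dim_le_card) auto
  then show ?thesis unfolding cdim_enat_def by (auto simp: zero_enat_def intro!: exI[of _ "{}"])
qed

lemma resolvent_set_iff:
  "\<mu> \<in> resolvent_set T \<longleftrightarrow> (\<exists>R. bounded_clinear R \<and> (\<forall>x. R (shifted \<mu> T x) = x) \<and> (\<forall>x. shifted \<mu> T (R x) = x))"
  by (simp add: resolvent_set_def fun_eq_iff)

lemma bounded_clinear_shifted: "bounded_clinear T \<Longrightarrow> bounded_clinear (shifted \<mu> T)"
  unfolding shifted_def
  by (intro bounded_clinear_minus_fun bounded_clinear_scaleC_fun bounded_clinear_ident)

lemma resolvent_Fredholm:
  fixes T :: "'a::complex_banach \<Rightarrow> 'a"
  assumes T: "bounded_clinear T" and \<mu>: "\<mu> \<in> resolvent_set T"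
  shows "Fredholm (shifted \<mu> T)" "Fredholm_index (shifted \<mu> T) = 0"
proof -
  obtain R where R: "\<And>x. R (shifted \<mu> T x) = x" "\<And>x. shifted \<mu> T (R x) = x"
    using \<mu> unfolding resolvent_set_iff by blast
  have S: "bounded_clinear (shifted \<mu> T)" by (rule bounded_clinear_shifted[OF T])
  have rng: "range (shifted \<mu> T) = UNIV" using R(2) by (metis surj_def)
  have ker: "op_kernel (shifted \<mu> T) = {0}"
    using R(1) bounded_clinear_zero[OF S] unfolding op_kernel_def
      by (metis (mono_tags, lifting) Collect_cong singleton_conv)
  have n: "nullity (shifted \<mu> T) = 0" by (simp add: nullity_def ker cdim_enat_zero)
  have "(LEAST n. \<exists>B::'a set. finite B \<and> card B = n \<and> cspan (UNIV \<union> B) = UNIV) = 0"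
    by (rule Least_eq_0) (auto intro!: exI[of _ "{}"])
  then have d: "deficiency (shifted \<mu> T) = 0"
    by (auto simp: deficiency_def ccodim_enat_def rng zero_enat_def intro!: exI[of _ "{}"])
  show "Fredholm (shifted \<mu> T)" using S by (simp add: Fredholm_def rng n d)
  show "Fredholm_index (shifted \<mu> T) = 0" by (simp add: Fredholm_index_def n d)
qed

text \<open>The level set is compact and covered by isolating neighbourhoods, hence finite. Removing
  these open sets leaves a compact set on which the distance of \<open>g\<close> to \<open>c\<close>
  has a positive minimum.\<close>

lemma isolated_level_set:
  fixes F :: "'a::metric_space set" and g :: "'a \<Rightarrow> 'b::metric_space"
  assumes cF: "compact F" and cg: "continuous_on F g"
    and iso: "\<And>p. p \<in> {p \<in> F. g p = c} \<Longrightarrow> p isolated_in F"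
  shows "finite {p \<in> F. g p = c}"
    and "\<exists>e>0. \<forall>p\<in>F. dist (g p) c < e \<longrightarrow> g p = c"
proof -
  define J where "J = {p \<in> F. g p = c}"
  have JD: "p \<in> J \<longleftrightarrow> p \<in> F \<and> g p = c" for p by (simp add: J_def)
  have "\<forall>p\<in>J. \<exists>U. open U \<and> U \<inter> F = {p}"
    using iso by (auto simp: J_def isolated_in_def)
  then obtain U where U: "\<And>p. p \<in> J \<Longrightarrow> open (U p)" "\<And>p. p \<in> J \<Longrightarrow> U p \<inter> F = {p}" by metis
  have nbhd: "p = q" if "q \<in> J" "p \<in> U q" "p \<in> F" for p q
  proof -
    have "p \<in> U q \<inter> F" using that by blast
    then show ?thesis unfolding U(2)[OF that(1)] by simp
  qed
  have self: "p \<in> U p" if "p \<in> J" for p using U(2)[OF that] by blast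
  have "closed J" unfolding J_def
    by (rule continuous_closed_preimage_constant[OF cg compact_imp_closed[OF cF]])
  moreover have "J \<subseteq> F" by (auto simp: J_def)
  ultimately have cJ: "compact J" using cF by (metis closed_Int_compact inf.absorb_iff1)
  have cov: "J \<subseteq> (\<Union>p\<in>J. U p)" using self by blast
  obtain D where D: "D \<subseteq> J" "finite D" "J \<subseteq> (\<Union>p\<in>D. U p)"
    by (rule compactE_image[OF cJ U(1) cov])
  have "J \<subseteq> D"
  proof
    fix p assume p: "p \<in> J"
    then obtain q where q: "q \<in> D" "p \<in> U q" using D(3) by blast
    then have "p = q" using nbhd[of q p] p D(1) JD by blast
    then show "p \<in> D" using q(1) by simp
  qed
  then show "finite {p \<in> F. g p = c}" using D(2) finite_subset by (auto simp: J_def)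
  define G where "G = F - (\<Union>p\<in>J. U p)"
  have cG: "compact G" unfolding G_def using cF U(1) by (intro compact_diff) auto
  have out: "p \<in> G" if "p \<in> F" "g p \<noteq> c" for p
    using that nbhd JD unfolding G_def by blast
  show "\<exists>e>0. \<forall>p\<in>F. dist (g p) c < e \<longrightarrow> g p = c"
  proof (cases "G = {}")
    case True
    then show ?thesis using out by (intro exI[of _ 1]) auto
  next
    case False
    have "continuous_on G (\<lambda>p. dist (g p) c)"
      by (intro continuous_intros continuous_on_subset[OF cg]) (auto simp: G_def)
    from continuous_attains_inf[OF cG False this]
    obtain p0 where p0: "p0 \<in> G" "\<And>p. p \<in> G \<Longrightarrow> dist (g p0) c \<le> dist (g p) c" by auto
    have "g p0 \<noteq> c" using p0(1) self JD unfolding G_def by blast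
    then show ?thesis using out p0(2) by (intro exI[of _ "dist (g p0) c"]) (auto simp: not_less[symmetric])
  qed
qed

text \<open>A trivial kernel and index zero leave deficiency zero, so the operator is bijective, and
  the open mapping bound makes its inverse continuous.\<close>

lemma injective_index_zero_resolvent:
  fixes T :: "'a::complex_banach \<Rightarrow> 'a"
  assumes F: "Fredholm (shifted \<mu> T)" "Fredholm_index (shifted \<mu> T) = 0"
    and ker: "op_kernel (shifted \<mu> T) = {0}"
  shows "\<mu> \<in> resolvent_set T"
proof -
  let ?S = "shifted \<mu> T"
  have S: "bounded_clinear ?S" and cl: "closed (range ?S)" and df: "deficiency ?S < \<infinity>"
    using F(1) by (auto simp: Fredholm_def)
  have "nullity ?S = 0" by (simp add: nullity_def ker cdim_enat_zero)
  then have "the_enat (deficiency ?S) = 0" using F(2) by (simp add: Fredholm_index_def zero_enat_def)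
  then have d0: "deficiency ?S = enat 0" using df by (cases "deficiency ?S") auto
  obtain B where B: "finite B" "cspan (range ?S \<union> B) = UNIV" using deficiency_finiteD[OF df] by blast
  define P where "P = (\<lambda>n. \<exists>B. finite B \<and> card B = n \<and> cspan (range ?S \<union> B) = UNIV)"
  have ex: "\<exists>B. finite B \<and> cspan (range ?S \<union> B) = UNIV" by (intro exI[of _ B] conjI B)
  have "deficiency ?S = enat (Least P)" unfolding deficiency_def ccodim_enat_def P_def by (rule if_P[OF ex])
  then have "Least P = 0" using d0 by simp
  moreover have "P (card B)" unfolding P_def by (intro exI[of _ B] conjI B refl)
  ultimately have "P 0" by (metis LeastI)
  then obtain B' where "finite B'" "card B' = 0" "cspan (range ?S \<union> B') = UNIV" unfolding P_def by blast
  then have "cspan (range ?S \<union> {}) = UNIV" by simp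
  then have "cspan (range ?S) = UNIV" by simp
  then have rng: "range ?S = UNIV"
    using bounded_clinear_range_subspace[OF S] complex_vector.span_eq_iff[of "range ?S"] by simp
  have inj: "x = y" if "?S x = ?S y" for x y
  proof -
    have "x - y \<in> op_kernel ?S" using that by (simp add: op_kernel_def bounded_clinear_diff[OF S])
    then show ?thesis using ker by simp
  qed
  obtain C where C: "C > 0" "\<And>x. \<exists>x'. ?S x' = ?S x \<and> norm x' \<le> C * norm (?S x)"
    using closed_range_bounded_preimage[OF bounded_clinear_bl[OF S] cl] by blast
  have bd: "norm x \<le> C * norm (?S x)" for x using C(2)[of x] inj by blast
  have "\<forall>y. \<exists>x. ?S x = y" using rng by (metis surj_def)
  then obtain R where R: "\<And>y. ?S (R y) = y" by metis
  have R2: "R (?S x) = x" for x by (rule inj) (simp add: R)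
  have "bounded_clinear R"
  proof (rule bounded_clinearI[where K = C])
    fix x y :: 'a and c
    show "R (x + y) = R x + R y" by (rule inj) (simp add: R bounded_clinear_add[OF S])
    show "R (c *\<^sub>C x) = c *\<^sub>C R x" by (rule inj) (simp add: R bounded_clinear_scaleC[OF S])
    show "norm (R x) \<le> C * norm x" using bd[of "R x"] by (simp add: R)
  qed
  then show ?thesis using R R2 unfolding resolvent_set_iff by blast
qed

lemma scaled_operator:
  fixes S :: "'a::complex_banach \<Rightarrow> 'b::complex_banach"
  assumes \<mu>: "\<mu> \<noteq> 0" and S: "bounded_clinear S" and S': "\<And>x. S' x = \<mu> *\<^sub>C S x"
  shows "range S' = range S" "op_kernel S' = op_kernel S" "nullity S' = nullity S"
    "deficiency S' = deficiency S"
    "semi_Fredholm S' \<longleftrightarrow> semi_Fredholm S" "Fredholm S' \<longleftrightarrow> Fredholm S" "Fredholm_index S' = Fredholm_index S"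
proof -
  have S'': "S' x = S (\<mu> *\<^sub>C x)" for x by (simp add: S' bounded_clinear_scaleC[OF S])
  have "S x = S' ((1 / \<mu>) *\<^sub>C x)" for x using \<mu> by (simp add: S'' scaleC_scaleC scaleC_one)
  then show r: "range S' = range S" using S''
    by (metis (no_types, lifting) image_iff subsetI subset_antisym UNIV_I)
  show k: "op_kernel S' = op_kernel S" using \<mu> by (simp add: op_kernel_def S')
  show n: "nullity S' = nullity S" "deficiency S' = deficiency S"
    by (simp_all add: nullity_def deficiency_def r k)
  have "bounded_clinear S'" using bounded_clinear_scaleC_fun[OF S, of \<mu>] S' by (metis ext)
  then show "semi_Fredholm S' \<longleftrightarrow> semi_Fredholm S" "Fredholm S' \<longleftrightarrow> Fredholm S"
    using S by (simp_all add: semi_Fredholm_def Fredholm_def r n)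
  show "Fredholm_index S' = Fredholm_index S" by (simp add: Fredholm_index_def n)
qed

text \<open>Induction on the points: imposing one more zero lowers the dimension by at most
  one.\<close>

lemma finite_dimensional_by_evaluations:
  assumes "finite J" "csubspace K" "\<And>f. f \<in> K \<Longrightarrow> (\<And>p. p \<in> J \<Longrightarrow> C1_fun f p = 0) \<Longrightarrow> f = 0"
  shows "\<exists>B. finite B \<and> K \<subseteq> cspan B"
  using assms
proof (induction J arbitrary: K rule: finite_induct)
  case empty
  then show ?case by (intro exI[of _ "{}"]) auto
next
  case (insert p J)
  define K0 where "K0 = {f \<in> K. C1_fun f p = 0}"
  have sub: "csubspace K0"
    using insert.prems(1) unfolding K0_def
    by (intro complex_vector.subspaceI)
      (auto simp: complex_vector.subspace_0 complex_vector.subspace_add complex_vector.subspace_scale)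
  have "f = 0" if f: "f \<in> K0" "\<And>q. q \<in> J \<Longrightarrow> C1_fun f q = 0" for f
    using f insert.prems(2)[of f] by (auto simp: K0_def)
  then obtain B where B: "finite B" "K0 \<subseteq> cspan B" using insert.IH[OF sub] by blast
  show ?case
  proof (cases "K0 = K")
    case False
    then obtain f0 where f0: "f0 \<in> K" "C1_fun f0 p \<noteq> 0" by (auto simp: K0_def)
    have "K \<subseteq> cspan (insert f0 B)"
    proof
      fix f assume f: "f \<in> K"
      let ?k = "C1_fun f p / C1_fun f0 p"
      have "f - ?k *\<^sub>C f0 \<in> K0"
        using f f0 insert.prems(1)
          by (simp add: K0_def complex_vector.subspace_diff complex_vector.subspace_scale)
      then show "f \<in> cspan (insert f0 B)" unfolding complex_vector.span_insert using B(2) by blast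
    qed
    then show ?thesis using B(1) by blast
  qed (use B in blast)
qed

section \<open>Transfer to a general spectral value by scaling the weight\<close>

context weighted1
begin

text \<open>The earlier conditions with 1 replaced by \<mu>, expressed in the original weight so
  that \<mu> = 0 is covered and topological statements about sets of values make sense.\<close>

definition noncritical_value :: "complex \<Rightarrow> bool" where
  "noncritical_value \<mu> \<longleftrightarrow> (\<forall>p\<in>Fix. a p \<noteq> \<mu>) \<and> (\<forall>p\<in>bdFix. cmod (a p) \<noteq> cmod \<mu>)"

definition expanding_value :: "complex \<Rightarrow> bool" where
  "expanding_value \<mu> \<longleftrightarrow> (\<exists>y\<in>{0..1}. y \<notin> Fix \<and> cmod (a (omega \<psi> y)) < cmod \<mu> \<and> cmod \<mu> < cmod (a (omega \<phi> y)))"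

definition contracting_value :: "complex \<Rightarrow> bool" where
  "contracting_value \<mu> \<longleftrightarrow> (\<exists>y\<in>{0..1}. y \<notin> Fix \<and> cmod (a (omega \<phi> y)) < cmod \<mu> \<and> cmod \<mu> < cmod (a (omega \<psi> y)))"

text \<open>Each gap contributes an open annulus. Openness is what separates components in
  \<open>ess_spectrum5_eq\<close>.\<close>

lemma open_expanding: "open {\<mu>. expanding_value \<mu>}" and open_contracting: "open {\<mu>. contracting_value \<mu>}"
proof -
  have "{\<mu>. expanding_value \<mu>} =
    (\<Union>y\<in>{0..1} - Fix. {\<mu>. cmod (a (omega \<psi> y)) < cmod \<mu>} \<inter> {\<mu>. cmod \<mu> < cmod (a (omega \<phi> y))})"
    by (auto simp: expanding_value_def)
  then show "open {\<mu>. expanding_value \<mu>}" by (auto intro!: open_Collect_less continuous_intros)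
  have "{\<mu>. contracting_value \<mu>} =
    (\<Union>y\<in>{0..1} - Fix. {\<mu>. cmod (a (omega \<phi> y)) < cmod \<mu>} \<inter> {\<mu>. cmod \<mu> < cmod (a (omega \<psi> y))})"
    by (auto simp: contracting_value_def)
  then show "open {\<mu>. contracting_value \<mu>}" by (auto intro!: open_Collect_less continuous_intros)
qed

lemma zero_resolvent: "0 \<in> resolvent_set T" "0 \<in> resolvent_set W0.A"
proof -
  interpret i: weighted1 \<psi> \<phi> w' by (rule inverse_weighted1)
  interpret i0: weighted0 \<psi> \<phi> "\<lambda>x. 1 / a (\<psi> x)" by (rule W0.inverse_weighted)
  show "0 \<in> resolvent_set T" unfolding resolvent_set_iff
    by (intro exI[of _ "\<lambda>f. - T' f"] conjI bounded_clinear_uminus i.bounded_clinear_T)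
      (simp_all add: shifted_def bounded_clinear_minus[OF i.bounded_clinear_T] bounded_clinear_minus[OF
        bounded_clinear_T] T_inverse)
  show "0 \<in> resolvent_set W0.A" unfolding resolvent_set_iff
    by (intro exI[of _ "\<lambda>f. - W0.A' f"] conjI bounded_clinear_uminus i0.bounded_clinear_A)
      (simp_all add: shifted_def bounded_clinear_minus[OF i0.bounded_clinear_A] bounded_clinear_minus[OF
        W0.bounded_clinear_A] W0.A_inverse)
qed

lemma zero_noncritical: "noncritical_value 0" "\<not> expanding_value 0" "\<not> contracting_value 0"
  using W0.a_nonzero Fix_Icc
    by (auto simp: noncritical_value_def expanding_value_def contracting_value_def bdFix_def)

lemma scaled_weighted1: "\<mu> \<noteq> 0 \<Longrightarrow> weighted1 \<phi> \<psi> ((1 / \<mu>) *\<^sub>C w)"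
  by unfold_locales (simp_all add: C1_map C1_inv w_nonzero del: atLeastAtMost_iff)

lemma scaled_weight: "deriv_weight \<phi> ((1 / \<mu>) *\<^sub>C w) x = a x / \<mu>"
  by (simp add: deriv_weight_def)

lemma scaled_operators:
  assumes \<mu>: "\<mu> \<noteq> 0"
  shows "shifted \<mu> T f = \<mu> *\<^sub>C (f - wcomp1 \<phi> ((1 / \<mu>) *\<^sub>C w) f)"
    "shifted \<mu> W0.A g = \<mu> *\<^sub>C (g - wcomp0 \<phi> (deriv_weight \<phi> ((1 / \<mu>) *\<^sub>C w)) g)"
proof -
  interpret s: weighted1 \<phi> \<psi> "(1 / \<mu>) *\<^sub>C w" by (rule scaled_weighted1[OF \<mu>])
  show "shifted \<mu> T f = \<mu> *\<^sub>C (f - wcomp1 \<phi> ((1 / \<mu>) *\<^sub>C w) f)"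
    by (rule C1_eqI) (use \<mu> in \<open>simp add: shifted_def C1_fun_T s.C1_fun_T right_diff_distrib del:
      atLeastAtMost_iff\<close>)
  show "shifted \<mu> W0.A g = \<mu> *\<^sub>C (g - wcomp0 \<phi> (deriv_weight \<phi> ((1 / \<mu>) *\<^sub>C w)) g)"
    by (rule C0_eqI) (use \<mu> in \<open>simp add: shifted_def W0.C0_fun_A s.W0.C0_fun_A scaled_weight
      right_diff_distrib del: atLeastAtMost_iff\<close>)
qed

lemma scaled_conditions:
  assumes \<mu>: "\<mu> \<noteq> 0"
  shows "weighted0.noncritical \<phi> (deriv_weight \<phi> ((1 / \<mu>) *\<^sub>C w)) \<longleftrightarrow> noncritical_value \<mu>"
    "weighted0.expanding_gap \<phi> \<psi> (deriv_weight \<phi> ((1 / \<mu>) *\<^sub>C w)) \<longleftrightarrow> expanding_value \<mu>"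
    "weighted0.contracting_gap \<phi> \<psi> (deriv_weight \<phi> ((1 / \<mu>) *\<^sub>C w)) \<longleftrightarrow> contracting_value \<mu>"
proof -
  interpret s: weighted1 \<phi> \<psi> "(1 / \<mu>) *\<^sub>C w" by (rule scaled_weighted1[OF \<mu>])
  have "cmod \<mu> > 0" using \<mu> by simp
  then show "s.W0.noncritical \<longleftrightarrow> noncritical_value \<mu>" "s.W0.expanding_gap \<longleftrightarrow> expanding_value \<mu>"
    "s.W0.contracting_gap \<longleftrightarrow> contracting_value \<mu>"
    using \<mu> unfolding s.W0.noncritical_def noncritical_value_def s.W0.expanding_gap_def expanding_value_def
      s.W0.contracting_gap_def contracting_value_def
    by (simp_all add: scaled_weight norm_divide divide_less_eq less_divide_eq divide_eq_eq)
qed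

lemma resolvent_A: "noncritical_value \<mu> \<Longrightarrow> \<not> expanding_value \<mu> \<Longrightarrow> \<not> contracting_value \<mu> \<Longrightarrow> \<mu> \<in> resolvent_set W0.A"
proof (cases "\<mu> = 0")
  case False
  assume c: "noncritical_value \<mu>" "\<not> expanding_value \<mu>" "\<not> contracting_value \<mu>"
  interpret s: weighted1 \<phi> \<psi> "(1 / \<mu>) *\<^sub>C w" by (rule scaled_weighted1[OF False])
  note sc = scaled_conditions[OF False]
  obtain L where L: "bounded_clinear L" "\<And>g. L (g - s.W0.A g) = g"
    using s.W0.left_inverse c sc by blast
  obtain R where R: "bounded_clinear R" "\<And>h. R h - s.W0.A (R h) = h"
    using s.W0.right_inverse c sc by blast
  have "L h = R h" for h using L(2)[of "R h"] R(2)[of h] by simp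
  then have LR: "L h - s.W0.A (L h) = h" for h using R(2)[of h] by simp
  show ?thesis unfolding resolvent_set_iff
  proof (intro exI[of _ "\<lambda>h. (1 / \<mu>) *\<^sub>C L h"] conjI allI bounded_clinear_scaleC_fun L)
    show "(1 / \<mu>) *\<^sub>C L (shifted \<mu> W0.A g) = g" for g
      unfolding scaled_operators(2)[OF False] bounded_clinear_scaleC[OF L(1)] L(2)
      using False by (simp add: scaleC_scaleC scaleC_one)
    have "(1 / \<mu>) *\<^sub>C L h - s.W0.A ((1 / \<mu>) *\<^sub>C L h) = (1 / \<mu>) *\<^sub>C h" for h
      unfolding bounded_clinear_scaleC[OF s.W0.bounded_clinear_A] scaleC_diff_right[symmetric] LR ..
    then show "shifted \<mu> W0.A ((1 / \<mu>) *\<^sub>C L h) = h" for h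
      unfolding scaled_operators(2)[OF False] using False by (simp add: scaleC_scaleC scaleC_one)
  qed
qed (simp add: zero_resolvent)

text \<open>Lets exact one-sided inverses be treated as one-sided inverses modulo finite
  rank.\<close>

lemma finite_rank_zero: "finite_rank (\<lambda>_::'x::complex_normed_vector. 0::'y::complex_normed_vector)"
  using finite_rank_sum[of "{}" "\<lambda>_ _. 0::'y"] by simp

lemma critical_not_semi_Fredholm:
  assumes "\<not> noncritical_value \<mu>"
  shows "\<not> semi_Fredholm (shifted \<mu> T)" "\<not> semi_Fredholm (shifted \<mu> W0.A)"
proof -
  have \<mu>: "\<mu> \<noteq> 0" using assms zero_noncritical by auto
  interpret s: weighted1 \<phi> \<psi> "(1 / \<mu>) *\<^sub>C w" by (rule scaled_weighted1[OF \<mu>])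
  have nc: "\<not> s.W0.noncritical" using assms scaled_conditions[OF \<mu>] by simp
  have bT: "bounded_clinear (\<lambda>f. f - s.T f)"
    by (rule bounded_clinear_minus_fun[OF bounded_clinear_ident s.bounded_clinear_T])
  show "\<not> semi_Fredholm (shifted \<mu> T)"
    using s.not_semi_Fredholm_T[OF nc] scaled_operator(5)[OF \<mu> bT scaled_operators(1)[OF \<mu>]] by simp
  show "\<not> semi_Fredholm (shifted \<mu> W0.A)"
    using s.W0.not_semi_Fredholm_A[OF nc] scaled_operator(5)[OF \<mu> s.bounded_clinear_B scaled_operators(2)[OF
      \<mu>]] by simp
qed

lemma gap_infinite:
  shows "expanding_value \<mu> \<Longrightarrow> nullity (shifted \<mu> T) = \<infinity>" "expanding_value \<mu> \<Longrightarrow> nullity (shifted \<mu> W0.A) = \<infinity>"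
    "contracting_value \<mu> \<Longrightarrow> deficiency (shifted \<mu> T) = \<infinity>" "contracting_value \<mu> \<Longrightarrow> deficiency (shifted \<mu> W0.A) = \<infinity>"
proof -
  have main: "(expanding_value \<mu> \<longrightarrow> nullity (shifted \<mu> T) = \<infinity> \<and> nullity (shifted \<mu> W0.A) = \<infinity>) \<and>
    (contracting_value \<mu> \<longrightarrow> deficiency (shifted \<mu> T) = \<infinity> \<and> deficiency (shifted \<mu> W0.A) = \<infinity>)"
  proof (cases "\<mu> = 0")
    case False
    interpret s: weighted1 \<phi> \<psi> "(1 / \<mu>) *\<^sub>C w" by (rule scaled_weighted1[OF False])
    have bT: "bounded_clinear (\<lambda>f. f - s.T f)"
      by (rule bounded_clinear_minus_fun[OF bounded_clinear_ident s.bounded_clinear_T])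
    note oT = scaled_operator(3,4)[OF False bT scaled_operators(1)[OF False]]
    note oA = scaled_operator(3,4)[OF False s.bounded_clinear_B scaled_operators(2)[OF False]]
    show ?thesis
      using s.nullity_T s.deficiency_T s.W0.nullity_A s.W0.deficiency_A scaled_conditions[OF False]
      by (simp add: oT oA)
  qed (simp add: zero_noncritical)
  then show "expanding_value \<mu> \<Longrightarrow> nullity (shifted \<mu> T) = \<infinity>" "expanding_value \<mu> \<Longrightarrow> nullity (shifted \<mu> W0.A) = \<infinity>"
    "contracting_value \<mu> \<Longrightarrow> deficiency (shifted \<mu> T) = \<infinity>" "contracting_value \<mu> \<Longrightarrow>
      deficiency (shifted \<mu> W0.A) = \<infinity>" by auto
qed

lemma regular_T:
  assumes nc: "noncritical_value \<mu>"
  shows "\<not> contracting_value \<mu> \<Longrightarrow> closed (range (shifted \<mu> T)) \<and> deficiency (shifted \<mu> T) < \<infinity>"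
    "\<not> expanding_value \<mu> \<Longrightarrow> closed (range (shifted \<mu> T)) \<and> nullity (shifted \<mu> T) < \<infinity>"
    "\<not> expanding_value \<mu> \<Longrightarrow> \<not> contracting_value \<mu> \<Longrightarrow> Fredholm (shifted \<mu> T) \<and> Fredholm_index (shifted \<mu> T) = 0"
proof -
  have main: "(\<not> contracting_value \<mu> \<longrightarrow> closed (range (shifted \<mu> T)) \<and> deficiency (shifted \<mu> T) < \<infinity>) \<and>
    (\<not> expanding_value \<mu> \<longrightarrow> closed (range (shifted \<mu> T)) \<and> nullity (shifted \<mu> T) < \<infinity>) \<and>
    (\<not> expanding_value \<mu> \<longrightarrow> \<not> contracting_value \<mu> \<longrightarrow> Fredholm (shifted \<mu> T) \<and> Fredholm_index (shifted \<mu> T) = 0)"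
  proof (cases "\<mu> = 0")
    case True
    then show ?thesis
      using resolvent_Fredholm[OF bounded_clinear_T zero_resolvent(1)] by (simp add: Fredholm_def)
  next
    case False
    interpret s: weighted1 \<phi> \<psi> "(1 / \<mu>) *\<^sub>C w" by (rule scaled_weighted1[OF False])
    have bT: "bounded_clinear (\<lambda>f. f - s.T f)"
      by (rule bounded_clinear_minus_fun[OF bounded_clinear_ident s.bounded_clinear_T])
    note oT = scaled_operator[OF False bT scaled_operators(1)[OF False]]
    have nc': s.W0.noncritical using nc scaled_conditions[OF False] by simp
    have 1: "closed (range (shifted \<mu> T)) \<and> deficiency (shifted \<mu> T) < \<infinity>" if gap: "\<not> contracting_value \<mu>"
    proof -
      obtain R where R: "bounded_clinear R" "\<And>h. R h - s.W0.A (R h) = h"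
        using s.W0.right_inverse[OF nc'] gap scaled_conditions[OF False] by blast
      show ?thesis using s.T_right_invertible[OF R] by (simp only: oT)
    qed
    have 2: "closed (range (shifted \<mu> T)) \<and> nullity (shifted \<mu> T) < \<infinity>" if gap: "\<not> expanding_value \<mu>"
    proof -
      obtain L where L: "bounded_clinear L" "\<And>g. L (g - s.W0.A g) = g"
        using s.W0.left_inverse[OF nc'] gap scaled_conditions[OF False] by blast
      show ?thesis using s.T_left_invertible[OF L] by (simp only: oT)
    qed
    have 3: "Fredholm (shifted \<mu> T) \<and> Fredholm_index (shifted \<mu> T) = 0"
      if gap: "\<not> expanding_value \<mu>" "\<not> contracting_value \<mu>"
    proof -
      obtain L where L: "bounded_clinear L" "\<And>g. L (g - s.W0.A g) = g"
        using s.W0.left_inverse[OF nc'] gap scaled_conditions[OF False] by blast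
      obtain R where R: "bounded_clinear R" "\<And>h. R h - s.W0.A (R h) = h"
        using s.W0.right_inverse[OF nc'] gap scaled_conditions[OF False] by blast
      have "L h = R h" for h using L(2)[of "R h"] R(2)[of h] by simp
      then have LR: "L h - s.W0.A (L h) = h" for h using R(2)[of h] by simp
      show ?thesis using s.T_invertible[OF L LR] by (simp only: oT)
    qed
    show ?thesis using 1 2 3 by blast
  qed
  then show "\<not> contracting_value \<mu> \<Longrightarrow> closed (range (shifted \<mu> T)) \<and> deficiency (shifted \<mu> T) < \<infinity>"
    "\<not> expanding_value \<mu> \<Longrightarrow> closed (range (shifted \<mu> T)) \<and> nullity (shifted \<mu> T) < \<infinity>"
    "\<not> expanding_value \<mu> \<Longrightarrow> \<not> contracting_value \<mu> \<Longrightarrow> Fredholm (shifted \<mu> T) \<and> Fredholm_index (shifted \<mu> T) = 0"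
      by auto
qed

lemma regular_A:
  assumes nc: "noncritical_value \<mu>"
  shows "\<not> contracting_value \<mu> \<Longrightarrow> closed (range (shifted \<mu> W0.A)) \<and> deficiency (shifted \<mu> W0.A) < \<infinity>"
    "\<not> expanding_value \<mu> \<Longrightarrow> closed (range (shifted \<mu> W0.A)) \<and> nullity (shifted \<mu> W0.A) < \<infinity>"
    "\<not> expanding_value \<mu> \<Longrightarrow> \<not> contracting_value \<mu> \<Longrightarrow> Fredholm (shifted \<mu> W0.A) \<and>
      Fredholm_index (shifted \<mu> W0.A) = 0"
proof -
  have 3: "Fredholm (shifted \<mu> W0.A) \<and> Fredholm_index (shifted \<mu> W0.A) = 0"
    if "\<not> expanding_value \<mu>" "\<not> contracting_value \<mu>"
    using resolvent_Fredholm[OF W0.bounded_clinear_A resolvent_A[OF nc that]] by blast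
  have main: "(\<not> contracting_value \<mu> \<longrightarrow> closed (range (shifted \<mu> W0.A)) \<and> deficiency (shifted \<mu> W0.A) < \<infinity>) \<and>
    (\<not> expanding_value \<mu> \<longrightarrow> closed (range (shifted \<mu> W0.A)) \<and> nullity (shifted \<mu> W0.A) < \<infinity>)"
  proof (cases "\<mu> = 0")
    case True
    then show ?thesis using 3 zero_noncritical by (simp add: Fredholm_def)
  next
    case False
    interpret s: weighted1 \<phi> \<psi> "(1 / \<mu>) *\<^sub>C w" by (rule scaled_weighted1[OF False])
    note oA = scaled_operator[OF False s.bounded_clinear_B scaled_operators(2)[OF False]]
    have nc': s.W0.noncritical using nc scaled_conditions[OF False] by simp
    have 1: "closed (range (shifted \<mu> W0.A)) \<and> deficiency (shifted \<mu> W0.A) < \<infinity>" if gap: "\<not> contracting_value \<mu>"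
    proof -
      obtain R where R: "bounded_clinear R" "\<And>h. R h - s.W0.A (R h) = h"
        using s.W0.right_inverse[OF nc'] gap scaled_conditions[OF False] by blast
      show ?thesis
        using right_inverse_mod_finite_rank[OF s.bounded_clinear_B finite_rank_zero, of R] R(2)
          by (simp only: oA) simp
    qed
    have 2: "closed (range (shifted \<mu> W0.A)) \<and> nullity (shifted \<mu> W0.A) < \<infinity>" if gap: "\<not> expanding_value \<mu>"
    proof -
      obtain L where L: "bounded_clinear L" "\<And>g. L (g - s.W0.A g) = g"
        using s.W0.left_inverse[OF nc'] gap scaled_conditions[OF False] by blast
      show ?thesis
        using left_inverse_mod_finite_rank[OF s.bounded_clinear_B finite_rank_zero L(1)] L(2)
          by (simp only: oA) simp
    qed
    show ?thesis using 1 2 by blast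
  qed
  show "\<not> contracting_value \<mu> \<Longrightarrow> closed (range (shifted \<mu> W0.A)) \<and> deficiency (shifted \<mu> W0.A) < \<infinity>"
    "\<not> expanding_value \<mu> \<Longrightarrow> closed (range (shifted \<mu> W0.A)) \<and> nullity (shifted \<mu> W0.A) < \<infinity>"
    using main by auto
  show "\<not> expanding_value \<mu> \<Longrightarrow> \<not> contracting_value \<mu> \<Longrightarrow> Fredholm (shifted \<mu> W0.A) \<and>
    Fredholm_index (shifted \<mu> W0.A) = 0" by (rule 3)
qed

section \<open>Essential spectra from the classification of values\<close>

text \<open>This turns out to be the resolvent set of \<open>A\<close>, see
  \<open>resolvent_A_eq\<close>.\<close>

definition regular_values :: "complex set"
  where "regular_values = {\<mu>. noncritical_value \<mu> \<and> \<not> expanding_value \<mu> \<and> \<not> contracting_value \<mu>}"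

text \<open>The resolvent inclusion and the first four essential spectra follow from these
  properties alone. Stating it for an arbitrary \<open>X\<close> gives \<open>T\<close> and
  \<open>A\<close> the same answer without comparing them directly.\<close>

lemma spectral_classification:
  fixes X :: "'b::complex_banach \<Rightarrow> 'b"
  assumes X: "bounded_clinear X"
    and crit: "\<And>\<mu>. \<not> noncritical_value \<mu> \<Longrightarrow> \<not> semi_Fredholm (shifted \<mu> X)"
    and gap: "\<And>\<mu>. expanding_value \<mu> \<Longrightarrow> nullity (shifted \<mu> X) = \<infinity>" "\<And>\<mu>. contracting_value \<mu> \<Longrightarrow>
      deficiency (shifted \<mu> X) = \<infinity>"
    and reg: "\<And>\<mu>. noncritical_value \<mu> \<Longrightarrow> \<not> contracting_value \<mu> \<Longrightarrow> closed (range (shifted \<mu> X)) \<and>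
      deficiency (shifted \<mu> X) < \<infinity>"
      "\<And>\<mu>. noncritical_value \<mu> \<Longrightarrow> \<not> expanding_value \<mu> \<Longrightarrow> closed (range (shifted \<mu> X)) \<and> nullity (shifted \<mu> X) < \<infinity>"
      "\<And>\<mu>. noncritical_value \<mu> \<Longrightarrow> \<not> expanding_value \<mu> \<Longrightarrow> \<not> contracting_value \<mu> \<Longrightarrow> Fredholm (shifted \<mu> X) \<and>
        Fredholm_index (shifted \<mu> X) = 0"
  shows "resolvent_set X \<subseteq> regular_values"
    "ess_spectrum1 X = {\<mu>. \<not> noncritical_value \<mu> \<or> (expanding_value \<mu> \<and> contracting_value \<mu>)}"
    "ess_spectrum2 X = {\<mu>. \<not> noncritical_value \<mu> \<or> expanding_value \<mu>}"
    "ess_spectrum3 X = - regular_values" "ess_spectrum4 X = - regular_values"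
proof -
  have b: "bounded_clinear (shifted \<mu> X)" for \<mu> by (rule bounded_clinear_shifted[OF X])
  have semi: "semi_Fredholm (shifted \<mu> X) \<longleftrightarrow> noncritical_value \<mu> \<and> \<not> (expanding_value \<mu> \<and>
    contracting_value \<mu>)" for \<mu>
    using crit[of \<mu>] gap[of \<mu>] reg(1,2)[of \<mu>] b[of \<mu>]
    by (cases "noncritical_value \<mu>") (auto simp: semi_Fredholm_def)
  have Fred: "Fredholm (shifted \<mu> X) \<longleftrightarrow> \<mu> \<in> regular_values" for \<mu>
    using semi[of \<mu>] gap[of \<mu>] reg(3)[of \<mu>] by (auto simp: Fredholm_def semi_Fredholm_def regular_values_def)
  show res: "resolvent_set X \<subseteq> regular_values" using resolvent_Fredholm(1)[OF X] Fred by blast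
  show e1: "ess_spectrum1 X = {\<mu>. \<not> noncritical_value \<mu> \<or> (expanding_value \<mu> \<and> contracting_value \<mu>)}"
    by (auto simp: ess_spectrum1_def semi)
  have "nullity (shifted \<mu> X) = \<infinity> \<longleftrightarrow> expanding_value \<mu>" if "noncritical_value \<mu>" for \<mu>
    using gap(1)[of \<mu>] reg(2)[OF that] by (metis less_irrefl)
  moreover have "\<mu> \<in> op_spectrum X" if "expanding_value \<mu>" for \<mu> using res that
    by (auto simp: op_spectrum_def regular_values_def)
  ultimately show "ess_spectrum2 X = {\<mu>. \<not> noncritical_value \<mu> \<or> expanding_value \<mu>}"
    unfolding ess_spectrum2_def e1 semi by auto
  show e3: "ess_spectrum3 X = - regular_values" by (auto simp: ess_spectrum3_def Fred)
  show "ess_spectrum4 X = - regular_values" using reg(3)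
    by (auto simp: ess_spectrum4_def e3 Fred regular_values_def)
qed

lemmas classification_T = spectral_classification[OF bounded_clinear_T critical_not_semi_Fredholm(1)
  gap_infinite(1,3) regular_T]
lemmas classification_A = spectral_classification[OF W0.bounded_clinear_A critical_not_semi_Fredholm(2)
  gap_infinite(2,4) regular_A]

lemma resolvent_A_eq: "resolvent_set W0.A = regular_values"
  using classification_A(1) resolvent_A by (auto simp: regular_values_def)

lemma open_regular: "open regular_values"
  using open_resolvent_set[of W0.A] by (simp add: resolvent_A_eq)

text \<open>The complement of the first essential spectrum splits into the disjoint open sets \<open>regular_values\<close> and
  \<open>expanding_value \<union> contracting_value\<close>, so a component meeting the resolvent set stays in \<open>regular_values\<close>.\<close>

lemma ess_spectrum5_eq:
  assumes res: "resolvent_set X \<subseteq> regular_values"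
    and e1: "ess_spectrum1 X = {\<mu>. \<not> noncritical_value \<mu> \<or> (expanding_value \<mu> \<and> contracting_value \<mu>)}"
    and iso: "\<And>\<mu>. \<mu> \<in> regular_values \<Longrightarrow> \<mu> \<in> op_spectrum X \<Longrightarrow> \<mu> isolated_in op_spectrum X"
  shows "ess_spectrum5 X = - regular_values"
proof (intro equalityI subsetI)
  fix \<zeta> assume \<zeta>: "\<zeta> \<in> - regular_values"
  have "\<not> (\<zeta> \<in> C \<and> C \<inter> resolvent_set X \<noteq> {})" if C: "C \<in> components (- ess_spectrum1 X)" for C
  proof
    assume h: "\<zeta> \<in> C \<and> C \<inter> resolvent_set X \<noteq> {}"
    have con: "connected C" and sub: "C \<subseteq> - ess_spectrum1 X"
      using in_components_connected[OF C] in_components_subset[OF C] by auto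
    let ?V = "{\<mu>. expanding_value \<mu>} \<union> {\<mu>. contracting_value \<mu>}"
    have cov: "C \<subseteq> regular_values \<union> ?V" using sub by (auto simp: e1 regular_values_def)
    moreover have "regular_values \<inter> ?V \<inter> C = {}" by (auto simp: regular_values_def)
    moreover have "regular_values \<inter> C \<noteq> {}" using h res by blast
    moreover have "?V \<inter> C \<noteq> {}" using h cov \<zeta> by blast
    ultimately show False
      using connectedD[OF con open_regular open_Un[OF open_expanding open_contracting]] by blast
  qed
  moreover have "\<zeta> \<in> op_spectrum X" using res \<zeta> by (auto simp: op_spectrum_def)
  ultimately show "\<zeta> \<in> ess_spectrum5 X" unfolding ess_spectrum5_def by blast
next
  fix \<zeta> assume \<zeta>: "\<zeta> \<in> ess_spectrum5 X"
  show "\<zeta> \<in> - regular_values"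
  proof
    assume R: "\<zeta> \<in> regular_values"
    have "\<zeta> \<in> op_spectrum X" using \<zeta> by (simp add: ess_spectrum5_def)
    then obtain U where U: "open U" "U \<inter> op_spectrum X = {\<zeta>}" using iso[OF R] by (auto simp: isolated_in_def)
    then obtain r where r: "r > 0" "ball \<zeta> r \<subseteq> U \<inter> regular_values"
      using open_regular R open_contains_ball[of "U \<inter> regular_values"] by blast
    have sub: "ball \<zeta> r \<subseteq> - ess_spectrum1 X" using r(2) by (auto simp: e1 regular_values_def)
    let ?C = "connected_component_set (- ess_spectrum1 X) \<zeta>"
    have "\<zeta> \<in> ball \<zeta> r" using r(1) by simp
    then have "\<zeta> \<in> - ess_spectrum1 X" using sub by blast
    then have "?C \<in> components (- ess_spectrum1 X)" "\<zeta> \<in> ?C" by (auto simp: components_def)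
    moreover have "ball \<zeta> r \<subseteq> ?C" using r(1) sub by (intro connected_component_maximal) auto
    \<comment> \<open>Any point of the ball other than its centre would do: \<zeta> is isolated in
      the spectrum, so such a point is in the resolvent set and in the component of \<zeta>.\<close>
    moreover have "\<zeta> + of_real (r / 2) \<in> ball \<zeta> r" using r(1) by (simp add: dist_norm)
    moreover have "\<zeta> + of_real (r / 2) \<in> resolvent_set X"
    proof (rule ccontr)
      assume "\<zeta> + of_real (r / 2) \<notin> resolvent_set X"
      then have "\<zeta> + of_real (r / 2) \<in> U \<inter> op_spectrum X"
        using r \<open>\<zeta> + of_real (r / 2) \<in> ball \<zeta> r\<close> by (auto simp: op_spectrum_def)
      then show False using U(2) r(1) by auto
    qed
    ultimately show False using \<zeta> unfolding ess_spectrum5_def by blast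
  qed
qed

section \<open>The spectrum of \<open>T\<close> at regular values\<close>

definition isoFix :: "real set" where "isoFix = {x. x isolated_in Fix}"

lemma isoFix_Fix: "isoFix \<subseteq> Fix"
  by (auto simp: isoFix_def isolated_in_def)

text \<open>Difference quotients of \<phi> at \<open>p\<close> taken along other fixed points are
  all 1, hence so is the derivative.\<close>

lemma deriv_accumulation:
  assumes p: "p \<in> Fix" "p \<notin> isoFix"
  shows "a p = C1_fun w p"
proof -
  have pI: "p \<in> {0..1}" by (rule Fix_Icc[OF p(1)])
  have "p islimpt Fix"
    using p by (simp add: isoFix_def isolated_in_islimpt_iff)
  then obtain x where x: "\<And>n. x n \<in> Fix - {p}" "x \<longlonglongrightarrow> p"
    unfolding islimpt_sequential by blast
  have "(\<phi> has_vector_derivative deriv_Icc \<phi> p) (at p within {0..1})"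
    by (rule has_vector_derivative_deriv_Icc[OF C1_map pI])
  then have "((\<lambda>z. (\<phi> z - \<phi> p) / (z - p)) \<longlongrightarrow> deriv_Icc \<phi> p) (at p within {0..1})"
    by (simp add: has_real_derivative_iff_has_vector_derivative[symmetric] has_field_derivative_iff)
  moreover have "filterlim x (at p within {0..1}) sequentially"
    using x Fix_Icc by (auto simp: filterlim_at)
  ultimately have "(\<lambda>n. (\<phi> (x n) - \<phi> p) / (x n - p)) \<longlonglongrightarrow> deriv_Icc \<phi> p"
    by (rule filterlim_compose)
  moreover have "(\<phi> (x n) - \<phi> p) / (x n - p) = 1" for n
    using x(1)[of n] p(1) by (simp add: Fix_eq)
  ultimately have "deriv_Icc \<phi> p = 1" by (simp add: LIMSEQ_const_iff)
  then show ?thesis by (simp add: deriv_weight_def)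
qed

text \<open>At a fixed point that is not isolated, \<open>w p = \<mu>\<close> would give
  \<open>a p = \<mu>\<close>, which noncriticality excludes.\<close>

lemma w_isoFix: "noncritical_value \<mu> \<Longrightarrow> p \<in> Fix \<Longrightarrow> C1_fun w p = \<mu> \<Longrightarrow> p \<in> isoFix"
  using deriv_accumulation by (auto simp: noncritical_value_def)

lemma shifted_at_Fix: "p \<in> Fix \<Longrightarrow> C1_fun (shifted \<mu> T f) p = (\<mu> - C1_fun w p) * C1_fun f p"
  by (simp add: shifted_def C1_fun_T[OF Fix_Icc] Fix_eq algebra_simps)

lemma shifted_kernel_zero:
  assumes R: "\<mu> \<in> regular_values" and f: "shifted \<mu> T f = 0" and F: "\<And>p. p \<in> Fix \<Longrightarrow> C1_fun f p = 0"
  shows "f = 0"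
proof (cases "\<mu> = 0")
  case True
  then have "T f = 0" using f by (simp add: shifted_def)
  interpret i: weighted1 \<psi> \<phi> w' by (rule inverse_weighted1)
  show ?thesis using T_inverse(2)[of f] \<open>T f = 0\<close> bounded_clinear_zero[OF i.bounded_clinear_T] by simp
next
  case False
  interpret s: weighted1 \<phi> \<psi> "(1 / \<mu>) *\<^sub>C w" by (rule scaled_weighted1[OF False])
  have c: "s.W0.noncritical" "\<not> s.W0.expanding_gap" "\<not> s.W0.contracting_gap"
    using R scaled_conditions[OF False] by (auto simp: regular_values_def)
  have "f - s.T f = 0" using f scaled_operators(1)[OF False, of f] False by simp
  then have "s.T f = f" by simp
  then show ?thesis by (rule s.eigenvector_zero[OF c _ F])
qed

lemma kernel_trivial_resolvent:
  assumes "\<mu> \<in> regular_values" "op_kernel (shifted \<mu> T) = {0}"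
  shows "\<mu> \<in> resolvent_set T"
  using injective_index_zero_resolvent[OF _ _ assms(2)] regular_T(3)[of \<mu>] assms(1)
    by (auto simp: regular_values_def)

text \<open>Every function in the range of \<open>w p - T\<close> vanishes at \<open>p\<close>, so
  the constant 1 is missed.\<close>

lemma fixed_point_spectrum:
  assumes "p \<in> Fix"
  shows "C1_fun w p \<in> op_spectrum T"
  unfolding op_spectrum_def
proof
  assume "C1_fun w p \<in> resolvent_set T"
  then obtain R where R: "\<And>x. shifted (C1_fun w p) T (R x) = x" unfolding resolvent_set_iff by blast
  have "C1_fun (1::C1_Icc) p = 0" using R[of 1] shifted_at_Fix[OF assms, of "C1_fun w p" "R 1"] by simp
  then show False using Fix_Icc[OF assms] by simp
qed

text \<open>The index is 0 at regular values, so only a kernel can obstruct invertibility. Kernel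
  functions vanish at every fixed point with \<open>w p \<noteq> \<mu>\<close>, and zeros at all
  fixed points force them to be 0.\<close>

lemma spectrum_in_regular:
  assumes R: "\<mu> \<in> regular_values"
  shows "\<mu> \<in> op_spectrum T \<longleftrightarrow> \<mu> \<in> C1_fun w ` isoFix"
proof
  assume \<mu>: "\<mu> \<in> op_spectrum T"
  show "\<mu> \<in> C1_fun w ` isoFix"
  proof (rule ccontr)
    assume n: "\<mu> \<notin> C1_fun w ` isoFix"
    have ne: "C1_fun w p \<noteq> \<mu>" if "p \<in> Fix" for p
      using w_isoFix[OF _ that] R n by (auto simp: regular_values_def)
    have "f = 0" if "shifted \<mu> T f = 0" for f
    proof (rule shifted_kernel_zero[OF R that])
      fix p assume p: "p \<in> Fix"
      show "C1_fun f p = 0" using shifted_at_Fix[OF p, of \<mu> f] ne[OF p] that by simp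
    qed
    moreover have "shifted \<mu> T 0 = 0"
      by (rule bounded_clinear_zero[OF bounded_clinear_shifted[OF bounded_clinear_T]])
    ultimately have "op_kernel (shifted \<mu> T) = {0}" by (auto simp: op_kernel_def)
    then show False using kernel_trivial_resolvent[OF R] \<mu> by (simp add: op_spectrum_def)
  qed
qed (use fixed_point_spectrum isoFix_Fix in blast)

lemma level_set_isolated:
  assumes nc: "noncritical_value \<mu>"
  shows "finite {p \<in> Fix. C1_fun w p = \<mu>}"
    and "\<exists>e>0. \<forall>p\<in>Fix. cmod (C1_fun w p - \<mu>) < e \<longrightarrow> C1_fun w p = \<mu>"
proof -
  have FI: "Fix \<subseteq> {0..1}" using Fix_Icc by blast
  have cF: "compact Fix"
    using closed_Fix FI by (meson bounded_closed_interval bounded_subset compact_eq_bounded_closed)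
  have cw: "continuous_on Fix (C1_fun w)" by (rule continuous_on_subset[OF continuous_on_C1_fun FI])
  have "p isolated_in Fix" if "p \<in> {p \<in> Fix. C1_fun w p = \<mu>}" for p
    using w_isoFix[OF nc, of p] that by (simp add: isoFix_def)
  note * = isolated_level_set[OF cF cw this]
  show "finite {p \<in> Fix. C1_fun w p = \<mu>}" by (rule *(1))
  show "\<exists>e>0. \<forall>p\<in>Fix. cmod (C1_fun w p - \<mu>) < e \<longrightarrow> C1_fun w p = \<mu>"
    using *(2) by (simp add: dist_norm)
qed

text \<open>Nearby regular spectral values are also values of \<open>w\<close> at fixed points, and
  these keep a positive distance from \<mu> unless they equal it.\<close>

lemma isolated_spectrum:
  assumes R: "\<mu> \<in> regular_values" and \<mu>: "\<mu> \<in> op_spectrum T"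
  shows "\<mu> isolated_in op_spectrum T"
proof -
  have "noncritical_value \<mu>" using R by (simp add: regular_values_def)
  then obtain e where e: "e > 0" "\<And>p. p \<in> Fix \<Longrightarrow> cmod (C1_fun w p - \<mu>) < e \<Longrightarrow> C1_fun w p = \<mu>"
    using level_set_isolated(2) by blast
  have "\<nu> = \<mu>" if \<nu>: "\<nu> \<in> regular_values \<inter> ball \<mu> e" "\<nu> \<in> op_spectrum T" for \<nu>
  proof -
    obtain p where p: "p \<in> isoFix" "\<nu> = C1_fun w p" using spectrum_in_regular \<nu> by blast
    then show ?thesis using e(2)[of p] isoFix_Fix \<nu> by (auto simp: dist_norm norm_minus_commute)
  qed
  then have "(regular_values \<inter> ball \<mu> e) \<inter> op_spectrum T = {\<mu>}" using R \<mu> e(1) by auto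
  moreover have "open (regular_values \<inter> ball \<mu> e)" by (intro open_Int open_regular open_ball)
  ultimately show ?thesis using \<mu> unfolding isolated_in_def by blast
qed

lemma generalized_kernel_zero:
  assumes R: "\<mu> \<in> regular_values"
  shows "(shifted \<mu> T ^^ n) f = 0 \<Longrightarrow> (\<And>p. p \<in> Fix \<Longrightarrow> C1_fun f p = 0) \<Longrightarrow> f = 0"
proof (induction n arbitrary: f)
  case (Suc n)
  have "shifted \<mu> T f = 0"
  proof (rule Suc.IH)
    show "(shifted \<mu> T ^^ n) (shifted \<mu> T f) = 0" using Suc.prems(1) by (simp add: funpow_swap1)
    show "C1_fun (shifted \<mu> T f) p = 0" if "p \<in> Fix" for p
      using shifted_at_Fix[OF that] Suc.prems(2)[OF that] by simp
  qed
  then show ?case by (rule shifted_kernel_zero[OF R _ Suc.prems(2)])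
qed simp

text \<open>On the generalized eigenspace a power of \<open>\<mu> - w p\<close> kills the value at a
  fixed point \<open>p\<close>. So only the finitely many fixed points with
  \<open>w p = \<mu>\<close> carry information, and evaluation at them is injective.\<close>

lemma finite_multiplicity:
  assumes R: "\<mu> \<in> regular_values"
  shows "multiplicity_eigenvalue T \<mu> < \<infinity>"
proof -
  let ?S = "shifted \<mu> T"
  let ?K = "\<Union>n. op_kernel (?S ^^ n)"
  have S: "bounded_clinear (?S ^^ n)" for n
    by (intro bounded_clinear_funpow bounded_clinear_shifted bounded_clinear_T)
  have up: "x \<in> op_kernel (?S ^^ (m + n))" if "x \<in> op_kernel (?S ^^ n)" for x m n
    using that by (simp add: op_kernel_def funpow_add bounded_clinear_zero[OF S])
  have sub: "csubspace ?K"
  proof (rule complex_vector.subspaceI)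
    show "0 \<in> ?K" by (simp add: op_kernel_def bounded_clinear_zero[OF S])
    fix x y assume "x \<in> ?K" "y \<in> ?K"
    then obtain n m where "x \<in> op_kernel (?S ^^ n)" "y \<in> op_kernel (?S ^^ m)" by blast
    then have "x \<in> op_kernel (?S ^^ (m + n))" "y \<in> op_kernel (?S ^^ (m + n))"
      using up[of x n m] up[of y m n] by (simp_all add: add.commute)
    then have "x + y \<in> op_kernel (?S ^^ (m + n))"
      using bounded_clinear_kernel_subspace[OF S] complex_vector.subspace_add by blast
    then show "x + y \<in> ?K" by blast
  next
    fix c x assume "x \<in> ?K"
    then show "c *\<^sub>C x \<in> ?K"
      using bounded_clinear_kernel_subspace[OF S] complex_vector.subspace_scale by blast
  qed
  have nc: "noncritical_value \<mu>" using R by (simp add: regular_values_def)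
  have "f = 0" if f: "f \<in> ?K" and J: "\<And>p. p \<in> {p \<in> Fix. C1_fun w p = \<mu>} \<Longrightarrow> C1_fun f p = 0" for f
  proof -
    obtain n where n: "(?S ^^ n) f = 0" using f by (auto simp: op_kernel_def)
    have ev: "C1_fun ((?S ^^ n) f) p = (\<mu> - C1_fun w p) ^ n * C1_fun f p" if "p \<in> Fix" for p n
      by (induction n) (simp_all add: shifted_at_Fix[OF that])
    have "C1_fun f p = 0" if p: "p \<in> Fix" for p
      using ev[OF p, of n] n J[of p] p by (cases "C1_fun w p = \<mu>") auto
    then show ?thesis by (rule generalized_kernel_zero[OF R n])
  qed
  then obtain B where "finite B" "?K \<subseteq> cspan B"
    using finite_dimensional_by_evaluations[OF level_set_isolated(1)[OF nc] sub] by blast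
  then show ?thesis by (auto simp: multiplicity_eigenvalue_def cdim_enat_def)
qed

lemma isolated_eigenvalue:
  assumes R: "\<mu> \<in> regular_values" and \<mu>: "\<mu> \<in> op_spectrum T"
  shows "isolated_eigenvalue_finite_mult T \<mu>"
  using isolated_spectrum[OF R \<mu>] finite_multiplicity[OF R] kernel_trivial_resolvent[OF R] \<mu>
  by (auto simp: isolated_eigenvalue_finite_mult_def eigenvalue_def op_spectrum_def)

lemma spectra_T_A:
  "(ess_spectrum1 T = ess_spectrum1 W0.A \<and> ess_spectrum2 T = ess_spectrum2 W0.A \<and>
      ess_spectrum3 T = ess_spectrum3 W0.A \<and> ess_spectrum4 T = ess_spectrum4 W0.A \<and>
      ess_spectrum5 T = ess_spectrum5 W0.A) \<and>
     (ess_spectrum3 T = op_spectrum W0.A \<and> ess_spectrum4 T = op_spectrum W0.A \<and>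
      ess_spectrum5 T = op_spectrum W0.A) \<and>
     (op_spectrum W0.A \<subseteq> op_spectrum T \<and>
      op_spectrum T - op_spectrum W0.A = C1_fun w ` isoFix - op_spectrum W0.A \<and>
      (\<forall>\<mu> \<in> op_spectrum T - op_spectrum W0.A. isolated_eigenvalue_finite_mult T \<mu>))"
proof -
  have sA: "op_spectrum W0.A = - regular_values" by (simp add: op_spectrum_def resolvent_A_eq)
  have "ess_spectrum5 T = - regular_values"
    by (rule ess_spectrum5_eq[OF classification_T(1,2) isolated_spectrum])
  moreover have "ess_spectrum5 W0.A = - regular_values"
    by (rule ess_spectrum5_eq[OF classification_A(1,2)]) (simp_all add: sA)
  moreover have "op_spectrum W0.A \<subseteq> op_spectrum T" unfolding sA using classification_T(1)
    by (auto simp: op_spectrum_def)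
  moreover have "op_spectrum T - op_spectrum W0.A = C1_fun w ` isoFix - op_spectrum W0.A"
    using spectrum_in_regular by (auto simp: sA)
  moreover have "\<forall>\<mu> \<in> op_spectrum T - op_spectrum W0.A. isolated_eigenvalue_finite_mult T \<mu>"
    using isolated_eigenvalue by (auto simp: sA)
  ultimately show ?thesis
    by (simp add: classification_T(2-5) classification_A(2-5)) (simp add: sA)
qed

end

theorem theorem2p1:
  fixes \<phi> :: "real \<Rightarrow> real" and w :: C1_Icc
    and F I :: "real set"
    and T :: "C1_Icc \<Rightarrow> C1_Icc" and A :: "C0_Icc \<Rightarrow> C0_Icc"
  assumes diffeo: "diffeo_Icc \<phi>" and fix0: "\<phi> 0 = 0"
    and inv: "w dvd 1"
    and F_def: "F = {x \<in> {0..1}. \<phi> x = x}"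
    and I_def: "I = {x. x isolated_in F}"
    and T_def: "\<And>f x. x \<in> {0..1} \<Longrightarrow> C1_fun (T f) x = C1_fun w x * C1_fun f (\<phi> x)"
    and A_def: "\<And>g x. x \<in> {0..1} \<Longrightarrow>
      C0_fun (A g) x = C1_fun w x * complex_of_real (deriv_Icc \<phi> x) * C0_fun g (\<phi> x)"
  shows
    "(ess_spectrum1 T = ess_spectrum1 A \<and> ess_spectrum2 T = ess_spectrum2 A \<and>
      ess_spectrum3 T = ess_spectrum3 A \<and> ess_spectrum4 T = ess_spectrum4 A \<and>
      ess_spectrum5 T = ess_spectrum5 A) \<and>
     (ess_spectrum3 T = op_spectrum A \<and> ess_spectrum4 T = op_spectrum A \<and>
      ess_spectrum5 T = op_spectrum A) \<and>
     (op_spectrum A \<subseteq> op_spectrum T \<and>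
      op_spectrum T - op_spectrum A = C1_fun w ` I - op_spectrum A \<and>
      (\<forall>\<mu> \<in> op_spectrum T - op_spectrum A. isolated_eigenvalue_finite_mult T \<mu>))"
proof -
  obtain \<psi> where hom: "homeomorphism {0..1} {0..1} \<phi> \<psi>" and C1: "C1_on_Icc \<phi>" "C1_on_Icc \<psi>"
    using diffeo unfolding diffeo_Icc_def by blast
  note h = hom[unfolded homeomorphism_def]
  have im: "\<phi> x \<in> {0..1}" "\<psi> x \<in> {0..1}" if "x \<in> {0..1}" for x using h that by blast+
  have inj: "inj_on \<phi> {0..1}" using h by (metis inj_on_def)
  have "w dvd 1" by (rule inv)
  then obtain k where k: "1 = w * k" by (rule dvdE)
  have wnz: "C1_fun w x \<noteq> 0" if "x \<in> {0..1}" for x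
  proof
    assume "C1_fun w x = 0"
    then have "C1_fun (w * k) x = 0" by simp
    then show False using that by (simp add: k[symmetric])
  qed
  \<comment> \<open>Continuity and injectivity leave the alternatives increasing and decreasing;
    \<phi> 0 = 0 rules out the second, as \<phi> has no negative values.\<close>
  have mono: "\<phi> x < \<phi> y" if xy: "x \<in> {0..1}" "y \<in> {0..1}" "x < y" for x y
  proof -
    have ne: "\<phi> x \<noteq> \<phi> y" using inj_onD[OF inj _ xy(1,2)] xy(3) by auto
    show ?thesis
    proof (cases "x = 0")
      case True
      then show ?thesis using im(1)[OF xy(2)] ne fix0 by auto
    next
      case False
      have sub: "{0..y} \<subseteq> {0..1}" using xy by auto
      have "\<phi> 0 < \<phi> x \<and> \<phi> x < \<phi> y \<or> \<phi> y < \<phi> x \<and> \<phi> x < \<phi> 0"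
        using False xy by (intro continuous_inj_imp_mono[of 0 x y] continuous_on_subset[OF _ sub] inj_on_subset[OF inj sub])
          (use h in auto)
      then show ?thesis using im(1)[OF xy(1)] fix0 by auto
    qed
  qed
  interpret weighted1 \<phi> \<psi> w
    by unfold_locales (use h im mono C1 wnz in \<open>auto simp del: atLeastAtMost_iff\<close>)
  \<comment> \<open>The values on the unit interval determine an element of either function type,
    because such functions vanish outside it.\<close>
  have T: "T = wcomp1 \<phi> w"
    by (rule ext, rule C1_eqI) (simp add: T_def C1_fun_T del: atLeastAtMost_iff)
  have A: "A = wcomp0 \<phi> (deriv_weight \<phi> w)"
    by (rule ext, rule C0_eqI) (simp add: A_def W0.C0_fun_A deriv_weight_def del: atLeastAtMost_iff)
  have I: "I = isoFix" by (simp add: I_def F_def isoFix_def Fix_def)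
  show ?thesis unfolding T A I by (rule spectra_T_A)
qed

end
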